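(* Let $b$ be a non-extreme function in $H^\infty_1$ with $\|b\|_{H^\infty}=1$, let $a$ be its Pythagorean mate, let $\zeta_1,\ldots,\zeta_N\in\mathbb{T}$ be distinct points and let $\mu=\sum_{j=1}^N\delta_{\zeta_j}$. The following are equivalent: (A) $H(b)\subseteq\mathcal{D}_\mu$ (equivalently, the embedding $H(b)\hookrightarrow\mathcal{D}_\mu$ holds); (B) $\{\zeta_1,\ldots,\zeta_N\}\subseteq\mathbb{T}\setminus\sigma(b)$ and $\sup_{z\in\mathbb{D}}|a(z)|^2V_\mu(z)<\infty$; (C) $\{\zeta_1,\ldots,\zeta_N\}\subseteq\mathbb{T}\setminus\sigma(b)$ and there exists $g\in H^\infty$ such that $a(z)=\Big(\prod_{j=1}^N(z-\zeta_j)\Big)g(z)$ for all $z\in\mathbb{D}$.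
   Context: $\mathbb{D}$ is the open unit disk, $\mathbb{T}$ the unit circle, $m$ the normalized Lebesgue measure on $\mathbb{T}$. $H^2$ is the Hardy space, $H^\infty$ the bounded analytic functions on $\mathbb{D}$, $H^\infty_1$ its closed unit ball. A function $b\in H^\infty_1$ is non-extreme if $\int_{\mathbb{T}}\log(1-|b|)\,dm>-\infty$ (boundary values); then there is a unique outer function $a$ with $a(0)>0$ and $|a|^2+|b|^2=1$ $m$-a.e. on $\mathbb{T}$, called the Pythagorean mate of $b$. For $b$ with $\|b\|_{H^\infty}=1$, the spectrum is $\sigma(b)=\{\zeta\in\mathbb{T}:\liminf_{z\to\zeta,\,z\in\mathbb{D}}|b(z)|<1\}$. The de Branges–Rovnyak space $H(b)$ is $\operatorname{Ran}(I-T_bT_b^* )^{1/2}$ with the range norm $\|(I-T_bT_b^* )^{1/2}f\|_{H(b)}=\|f\|_{H^2}$ ($f\perp\ker$), where $T_b f=bf$ on $H^2$; equivalently the reproducing kernel Hilbert space with kernel $k^b_w(z)=\frac{1-\overline{b(w)}b(z)}{1-\overline{w}z}$. For a finite positive Borel measure $\mu$ on $\mathbb{T}$, $\mathcal{D}_\mu=\{f\in H^2: \mathcal{D}_\mu(f)=\int_{\mathbb{D}}|f'(z)|^2P_\mu(z)\,dA(z)<\infty\}$, where $P_\mu(z)=\int_{\mathbb{T}}\frac{1-|z|^2}{|z-\zeta|^2}d\mu(\zeta)$ and $dA$ is area measure, normed by $\|f\|^2_{H^2}+\mathcal{D}_\mu(f)$. The potential of $\mu$ is $V_\mu(z)=\int_{\mathbb{T}}\frac{d\mu(\lambda)}{|\lambda-z|^2}\in[0,\infty]$;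 for $\mu=\sum_j\delta_{\zeta_j}$, $V_\mu(z)=\sum_{j=1}^N|z-\zeta_j|^{-2}$. *)

theory Defs
  imports "HOL-Analysis.Analysis"
begin

text \<open>Unit disk is ball 0 1, unit circle is sphere 0 1 (as subsets of complex).
  The circle is parametrised by t in [0, 2 pi], t maps to cis t; the normalised
  Lebesgue measure m is lborel on [0, 2 pi] divided by 2 pi.\<close>

definition Hardy2 :: "(complex \<Rightarrow> complex) set" where
  "Hardy2 = {f. f holomorphic_on ball 0 1 \<and>
     (\<exists>M. \<forall>r\<in>{0..<1}. (LBINT t=0..2*pi. (cmod (f (of_real r * cis t)))\<^sup>2) \<le> M)}"

definition Hinf :: "(complex \<Rightarrow> complex) set" where
  "Hinf = {f. f holomorphic_on ball 0 1 \<and> bounded (f ` ball 0 1)}"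

definition Hinf_norm :: "(complex \<Rightarrow> complex) \<Rightarrow> real" where
  "Hinf_norm f = (SUP z\<in>ball 0 1. cmod (f z))"

definition Hinf_ball :: "(complex \<Rightarrow> complex) set" where
  "Hinf_ball = {f. f \<in> Hinf \<and> Hinf_norm f \<le> 1}"

definition bdry :: "(complex \<Rightarrow> complex) \<Rightarrow> real \<Rightarrow> complex" where
  "bdry f t = Lim (at_left 1) (\<lambda>r. f (of_real r * cis t))"

text \<open>Non-extreme: integral of log(1 - |b|) over the circle is > -infinity
  (log 0 read as -infinity).\<close>
definition non_extreme :: "(complex \<Rightarrow> complex) \<Rightarrow> bool" where
  "non_extreme b \<longleftrightarrow> b \<in> Hinf_ball \<and>
     (\<integral>\<^sup>+ t\<in>{0..2*pi}. (if cmod (bdry b t) < 1 then ennreal (- ln (1 - cmod (bdry b t)))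
                         else \<infinity>) \<partial>lborel) < \<infinity>"

definition outer :: "(complex \<Rightarrow> complex) \<Rightarrow> bool" where
  "outer f \<longleftrightarrow> (\<exists>c h. cmod c = 1 \<and> set_integrable lborel {0..2*pi} (h :: real \<Rightarrow> real) \<and>
     (\<forall>z\<in>ball 0 1. f z = c * exp ((1 / (2 * pi)) *
         (LBINT t=0..2*pi. (cis t + z) / (cis t - z) * of_real (h t)))))"

definition pythagorean_mate :: "(complex \<Rightarrow> complex) \<Rightarrow> (complex \<Rightarrow> complex) \<Rightarrow> bool" where
  "pythagorean_mate b a \<longleftrightarrow> outer a \<and> Im (a 0) = 0 \<and> Re (a 0) > 0 \<and>
     (AE t in lborel. t \<in> {0..2*pi} \<longrightarrow> (cmod (bdry a t))\<^sup>2 + (cmod (bdry b t))\<^sup>2 = 1)"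

definition spectrum_b :: "(complex \<Rightarrow> complex) \<Rightarrow> complex set" where
  "spectrum_b b = {\<zeta> \<in> sphere 0 1.
      Liminf (at \<zeta> within ball 0 1) (\<lambda>z. ereal (cmod (b z))) < 1}"

definition kb :: "(complex \<Rightarrow> complex) \<Rightarrow> complex \<Rightarrow> complex \<Rightarrow> complex" where
  "kb b w z = (1 - cnj (b w) * b z) / (1 - cnj w * z)"

text \<open>H(b) as the reproducing kernel Hilbert space with kernel k^b, described as a set
  via Aronszajn's membership criterion: f belongs to the RKHS iff
  |<f, sum c_i k_{w_i}>|^2 <= C ||sum c_i k_{w_i}||^2 for some C.\<close>
definition Hb :: "(complex \<Rightarrow> complex) \<Rightarrow> (complex \<Rightarrow> complex) set" where
  "Hb b = {f. \<exists>C. \<forall>n (w :: nat \<Rightarrow> complex) (c :: nat \<Rightarrow> complex).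
      (\<forall>i<n. w i \<in> ball 0 1) \<longrightarrow>
      (cmod (\<Sum>i<n. cnj (c i) * f (w i)))\<^sup>2
        \<le> C * Re (\<Sum>i<n. \<Sum>j<n. c i * cnj (c j) * kb b (w i) (w j))}"

definition poisson_mu :: "complex measure \<Rightarrow> complex \<Rightarrow> ennreal" where
  "poisson_mu \<mu> z = (\<integral>\<^sup>+ \<zeta>. ennreal ((1 - (cmod z)\<^sup>2) / (cmod (z - \<zeta>))\<^sup>2) \<partial>\<mu>)"

definition potential_mu :: "complex measure \<Rightarrow> complex \<Rightarrow> ennreal" where
  "potential_mu \<mu> z = (\<integral>\<^sup>+ x. ennreal (1 / (cmod (x - z))\<^sup>2) \<partial>\<mu>)"

definition Dmu :: "complex measure \<Rightarrow> (complex \<Rightarrow> complex) set" where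
  "Dmu \<mu> = {f. f \<in> Hardy2 \<and>
     (\<integral>\<^sup>+ z\<in>ball 0 1. ennreal ((cmod (deriv f z))\<^sup>2) * poisson_mu \<mu> z \<partial>lborel) < \<infinity>}"

end

theory Submission
  imports Defs "HOL-Complex_Analysis.Complex_Analysis"
begin

text \<open>
  Conditions (B) and (C) both say that for each \<open>j\<close> there is \<open>M\<close> with \<open>|a(z)| \<le> M |z - \<zeta>\<^sub>j|\<close>, so one
  point \<open>\<zeta> = \<zeta>\<^sub>j\<close> can be treated at a time.  A function \<open>f\<close> has finite local Dirichlet integral at \<open>\<zeta>\<close>
  if and only if, for some \<open>c\<close>, the partial sums of its Taylor series at \<open>\<zeta>\<close> minus \<open>c\<close> are square summable,
  and then \<open>|f(z) - c|\<close> is bounded by a multiple of \<open>|z - \<zeta>| / sqrt (1 - |z|\<^sup>2)\<close>.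

  If \<open>H(b)\<close> embeds, uniform boundedness turns this growth of the individual functions into a growth of the
  kernels: for the kernel of \<open>H(b)\<close> it shows that \<open>\<zeta>\<close> is not in the spectrum, and for the smaller
  kernel \<open>cnj (a(w)) a(z) / (1 - cnj w z)\<close> that \<open>|a(z)| \<le> M |z - \<zeta>|\<close>.

  Conversely, if \<open>|b|\<close> is bounded below near \<open>\<zeta>\<close> and \<open>|a(z)| \<le> M |z - \<zeta>|\<close>, the Gram form of the
  kernel of \<open>H(b)\<close> is bounded by the integral of \<open>|z - \<zeta>|\<^sup>2 |F|\<^sup>2\<close>, where \<open>F\<close> is the corresponding combination
  of Szego kernels.  Hence the pairing of \<open>f \<in> H(b)\<close> with a polynomial \<open>p\<close> is bounded by a multiple of the
  norm of \<open>(z - \<zeta>) p\<close>, which gives the square summability of the partial sums.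
\<close>

section \<open>Integrals over the circle\<close>

text \<open>The embedding is a plain inclusion of sets: \<open>Hb\<close> is described by a bound on
  finite kernel combinations and carries no norm. Boundedness principles are therefore run on
  absolutely convergent series of kernels, which satisfy that bound by construction. Two kernels
  occur because of the constant \<open>c\<close> in the growth bound. The kernel of
  \<open>H(b)\<close> does not see \<open>c\<close> and only gives \<open>sqrt (1 - |b(w)|^2) \<le>
  C (sqrt (1 - |w|^2) + |w - \<zeta>|)\<close>: enough for the spectrum, too weak for
  \<open>a\<close>. Under the embedding, all series of the smaller kernel tend to 0 along the radius
  to \<open>\<zeta>\<close>, so that \<open>c = 0\<close> for them. In the converse the Gram form
  contains \<open>cnj b F\<close>, while only \<open>(z - \<zeta>) F\<close> is controlled. Near
  \<open>\<zeta>\<close> the factor \<open>cnj b\<close> is traded for the analytic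
  \<open>1 / b\<close>, and integration by parts lets the derivative of a cut-off supply the missing
  factor. Boundary values enter the hypotheses through a limit that is an arbitrary value where it
  fails to exist, and \<open>a\<close> is at first only the exponential of a Herglotz integral.
  Hence Fatou's theorem and the boundedness of \<open>a\<close> are needed before anything
  else.\<close>

definition circ :: "real measure" where
  "circ = restrict_space lborel {0..2*pi}"

lemma space_circ [simp]: "space circ = {0..2*pi}"
  by (simp add: circ_def space_restrict_space)

lemma measurable_circ [measurable (raw)]: "f \<in> borel_measurable borel \<Longrightarrow> f \<in> borel_measurable circ"
  by (simp add: circ_def measurable_restrict_space1)

lemma emeasure_circ [simp]: "emeasure circ (space circ) = ennreal (2*pi)"
  unfolding space_circ
  by (simp add: circ_def emeasure_restrict_space)

lemma finite_measure_circ: "finite_measure circ"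
  by (rule finite_measureI) (simp add: emeasure_circ del: space_circ)

interpretation circ: finite_measure circ by (rule finite_measure_circ)

lemma measure_circ [simp]: "measure circ {0..2*pi} = 2*pi"
  using emeasure_circ by (simp add: measure_def)

lemma integrable_circ_bounded:
  fixes f :: "real \<Rightarrow> 'a::{banach, second_countable_topology}"
  assumes "f \<in> borel_measurable circ" "\<And>t. norm (f t) \<le> B"
  shows "integrable circ f"
  using circ.integrable_const_bound[of f B] assms by auto

lemma integrable_circ_continuous:
  fixes f :: "real \<Rightarrow> 'a::euclidean_space"
  assumes "continuous_on {0..2*pi} f"
  shows "integrable circ f"
  using borel_integrable_compact[of "{0..2*pi}" f] assms
  by (simp add: circ_def integrable_restrict_space indicator_scaleR_eq_if if_distrib cong: if_cong)

lemma interval_integral_circ: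
  fixes f :: "real \<Rightarrow> 'a::{banach, second_countable_topology}"
  shows "(LBINT t=0..2*pi. f t) = (LINT t|circ. f t)"
  unfolding zero_ereal_def
  by (subst interval_integral_Icc) (auto simp: circ_def set_lebesgue_integral_def integral_restrict_space)

lemma circ_has_integral:
  fixes f :: "real \<Rightarrow> 'a::euclidean_space"
  assumes "integrable circ f"
  shows "(f has_integral (LINT t|circ. f t)) {0..2*pi}"
proof -
  have "set_integrable lborel {0..2*pi} f"
    using assms by (simp add: circ_def integrable_restrict_space set_integrable_def)
  then show ?thesis
    using set_borel_integral_eq_integral[of "{0..2*pi}" f]
    by (simp add: circ_def integral_restrict_space set_lebesgue_integral_def has_integral_iff)
qed


text \<open>The fundamental theorem of calculus over one period. It serves twice: for the
  orthogonality of the powers of \<open>cis t\<close>, and as integration by parts against the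
  cut-off function.\<close>

lemma circ_integral_periodic_zero:
  fixes f f' :: "real \<Rightarrow> complex"
  assumes "\<And>t. (f has_vector_derivative f' t) (at t)" "f (2*pi) = f 0" "integrable circ f'"
  shows "(LINT t|circ. f' t) = 0"
proof -
  have "(f' has_integral f (2*pi) - f 0) {0..2*pi}"
    by (rule fundamental_theorem_of_calculus) (auto intro: has_vector_derivative_at_within assms)
  moreover have "(f' has_integral (LINT t|circ. f' t)) {0..2*pi}"
    by (rule circ_has_integral) fact
  ultimately have "f (2*pi) - f 0 = (LINT t|circ. f' t)"
    by (rule has_integral_unique)
  with assms(2) show ?thesis by simp
qed

lemma circ_Cauchy:
  fixes g :: "complex \<Rightarrow> complex"
  assumes g: "g holomorphic_on ball 0 R" and \<rho>: "cmod w < \<rho>" "\<rho> < R"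
  shows "(LINT t|circ. g (of_real \<rho> * cis t) * (of_real \<rho> * cis t / (of_real \<rho> * cis t - w))) = 2*pi * g w"
proof -
  have \<rho>0: "\<rho> > 0" using \<rho> by (smt (verit) norm_ge_zero)
  have "g holomorphic_on cball 0 \<rho>"
    using g by (rule holomorphic_on_subset) (use \<rho> in auto)
  then have "((\<lambda>u. g u / (u - w)) has_contour_integral (2 * pi) * \<i> * g w) (circlepath 0 \<rho>)"
    using Cauchy_integral_circlepath_simple[of g 0 \<rho> w] \<rho> by (simp add: mult_ac)
  then have 1: "((\<lambda>t. g (of_real \<rho> * cis t) / (of_real \<rho> * cis t - w) * \<rho> * \<i> * cis t) has_integral (2 * pi) * \<i> * g w) {0..2*pi}"
    by (simp add: circlepath_def has_contour_integral_part_circlepath_iff)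
  have nz: "of_real \<rho> * cis t - w \<noteq> 0" for t
    using \<rho> \<rho>0 by (smt (verit) eq_iff_diff_eq_0 norm_cis norm_mult norm_of_real mult_cancel_left1)
  have c: "continuous_on {0..2*pi} (\<lambda>t. g (of_real \<rho> * cis t) * (of_real \<rho> * cis t / (of_real \<rho> * cis t - w)))"
    using \<rho> \<rho>0 nz
    by (intro continuous_intros continuous_on_compose2[OF holomorphic_on_imp_continuous_on[OF g]])
       (auto simp: norm_mult)
  have "((\<lambda>t. g (of_real \<rho> * cis t) * (of_real \<rho> * cis t / (of_real \<rho> * cis t - w))) has_integral (2 * pi) * g w) {0..2*pi}"
    \<comment> \<open>Along the circle \<open>dz = \<i> z dt\<close>; multiplication by
      \<open>-\<i>\<close> removes the factor that this leaves on both sides.\<close>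
    using has_integral_mult_right[OF 1, of "-\<i>"] by (simp add: mult_ac)
  then show ?thesis
    using circ_has_integral[OF integrable_circ_continuous[OF c]] has_integral_unique by blast
qed

lemma cis_power_integral:
  "(LINT t|circ. cis t ^ n * cnj (cis t) ^ m) = (if n = m then 2*pi else 0)"
proof (cases "n = m")
  case True
  have "cis t ^ m * cnj (cis t) ^ m = 1" for t
    by (simp add: power_mult_distrib[symmetric] complex_norm_square[symmetric])
  then show ?thesis using True by (simp add: scaleR_conv_of_real)
next
  case False
  \<comment> \<open>The frequency is kept real because \<open>n - m\<close> may be negative; that it
    is an integer matters only for periodicity.\<close>
  define k :: real where "k = real n - real m"
  have k: "k \<noteq> 0" using False by (simp add: k_def)
  have e: "cis t ^ n * cnj (cis t) ^ m = cis (k * t)" for t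
    unfolding cis_cnj Complex.DeMoivre cis_mult by (simp add: k_def algebra_simps)
  have "(LINT t|circ. cis (k*t)) = 0"
  proof (rule circ_integral_periodic_zero)
    show "((\<lambda>t. cis (k*t) / (\<i> * k)) has_vector_derivative cis (k*t)) (at t)" for t
      unfolding has_vector_derivative_def using k
      by (auto intro!: derivative_eq_intros simp: fun_eq_iff scaleR_conv_of_real) (simp add: complex_eq_iff)
    have "cis (k * (2*pi)) = 1"
    proof -
      have "k \<in> \<int>" by (simp add: k_def)
      then show ?thesis using cis_multiple_2pi[of k] by (simp add: mult_ac)
    qed
    then show "cis (k * (2 * pi)) / (\<i> * k) = cis (k * 0) / (\<i> * k)" by simp
    show "integrable circ (\<lambda>t. cis (k*t))"
      by (rule integrable_circ_continuous) (intro continuous_intros)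
  qed
  then show ?thesis using False e by simp
qed

lemma measurable_cis [measurable]: "cis \<in> borel_measurable borel"
  by (intro borel_measurable_continuous_onI continuous_intros)

lemma power_series_norm_summable:
  fixes f :: "complex \<Rightarrow> complex" and a :: "nat \<Rightarrow> complex"
  assumes f: "\<And>w. w \<in> ball 0 R \<Longrightarrow> (\<lambda>n. a n * w^n) sums f w" and "cmod z < R"
  shows "summable (\<lambda>n. cmod (a n) * cmod z ^ n)"
proof -
  obtain r where r: "cmod z < r" "r < R" using assms(2) dense by blast
  then have r0: "0 < r" by (smt (verit) norm_ge_zero)
  have "summable (\<lambda>n. a n * (of_real r)^n)"
    using f[of "of_real r"] r r0 by (simp add: sums_iff)
  from powser_insidea[OF this, of z] r r0 show ?thesis
    by (simp add: norm_mult norm_power)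
qed

lemma power_series_holomorphic_ball:
  fixes f :: "complex \<Rightarrow> complex"
  assumes "\<And>w. w \<in> ball 0 R \<Longrightarrow> (\<lambda>n. a n * w^n) sums f w"
  shows "f holomorphic_on ball 0 R"
  using power_series_holomorphic[of 0 R a f] assms by simp

lemma continuous_circ_compose:
  fixes f :: "complex \<Rightarrow> complex"
  assumes "f holomorphic_on ball 0 R" "cmod z < R"
  shows "continuous_on A (\<lambda>t. f (z * cis t))"
  using assms
  by (intro continuous_on_compose2[OF holomorphic_on_imp_continuous_on[OF assms(1)]] continuous_intros)
     (auto simp: norm_mult)

lemma circ_Fourier_coeff:
  fixes f :: "complex \<Rightarrow> complex" and a :: "nat \<Rightarrow> complex"
  assumes f: "\<And>w. w \<in> ball 0 R \<Longrightarrow> (\<lambda>n. a n * w^n) sums f w" and z: "cmod z < R"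
  shows "(LINT t|circ. cnj (cis t) ^ m * f (z * cis t)) = 2*pi * (a m * z^m)"
proof -
  note sm = power_series_norm_summable[OF f z]
  have "(\<lambda>n. LINT t|circ. cnj (cis t) ^ m * (a n * (z * cis t)^n)) sums
        (LINT t|circ. (\<Sum>n. cnj (cis t) ^ m * (a n * (z * cis t)^n)))"
  proof (rule sums_integral)
    show "integrable circ (\<lambda>t. cnj (cis t) ^ m * (a n * (z * cis t) ^ n))" for n
      by (rule integrable_circ_continuous) (intro continuous_intros)
    show "AE t in circ. summable (\<lambda>n. norm (cnj (cis t) ^ m * (a n * (z * cis t) ^ n)))"
      using sm by (simp add: norm_mult norm_power)
    show "summable (\<lambda>n. LINT t|circ. norm (cnj (cis t) ^ m * (a n * (z * cis t) ^ n)))"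
      using summable_mult[OF sm, of "2*pi"] by (simp add: norm_mult norm_power mult.assoc)
  qed
  moreover have "(\<Sum>n. cnj (cis t) ^ m * (a n * (z * cis t)^n)) = cnj (cis t) ^ m * f (z * cis t)" for t
    using sums_mult[OF f[of "z * cis t"], of "cnj (cis t) ^ m"] z by (simp add: sums_iff norm_mult)
  moreover have "(LINT t|circ. cnj (cis t) ^ m * (a n * (z * cis t)^n)) = (if n = m then 2*pi * (a m * z^m) else 0)" for n
  proof -
    have "(LINT t|circ. cnj (cis t) ^ m * (a n * (z * cis t)^n)) = (LINT t|circ. (a n * z^n) * (cis t ^ n * cnj (cis t)^m))"
      by (intro Bochner_Integration.integral_cong) (auto simp: power_mult_distrib)
    also have "\<dots> = (a n * z^n) * (LINT t|circ. (cis t ^ n * cnj (cis t)^m))"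
      by (rule integral_mult_right_zero)
    finally show ?thesis by (simp add: cis_power_integral)
  qed
  ultimately have "(\<lambda>n. if n = m then 2*pi * (a m * z^m) else 0) sums (LINT t|circ. cnj (cis t) ^ m * f (z * cis t))"
    by simp
  moreover have "(\<lambda>n. if n = m then 2*pi * (a m * z^m) else 0) sums (2*pi * (a m * z^m))"
    using sums_single[of m "\<lambda>n. 2*pi * (a m * z^m)"] by simp
  ultimately show ?thesis using sums_unique2 by blast
qed

text \<open>Only the conjugated factor is expanded; the integral of each of its terms against
  \<open>f\<close> is a Fourier coefficient, so no double series occurs. The point \<open>z\<close>
  may be any complex number and not just a radius, which suits the rotation averages of area
  integrals.\<close>

lemma circ_Parseval:
  fixes f :: "complex \<Rightarrow> complex" and a :: "nat \<Rightarrow> complex"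
  assumes f: "\<And>w. w \<in> ball 0 R \<Longrightarrow> (\<lambda>n. a n * w^n) sums f w" and z: "cmod z < R"
  shows "(\<lambda>n. 2*pi * ((cmod (a n))^2 * (cmod z)^(2*n))) sums (LINT t|circ. (cmod (f (z * cis t)))^2)"
proof -
  note sm = power_series_norm_summable[OF f z]
  note cont = continuous_circ_compose[OF power_series_holomorphic_ball[OF f] z]
  have "compact ((\<lambda>t. f (z * cis t)) ` {0..2*pi})"
    by (intro compact_continuous_image cont compact_Icc)
  then obtain B where B: "\<And>t. t \<in> {0..2*pi} \<Longrightarrow> cmod (f (z * cis t)) \<le> B"
    by (metis (no_types, lifting) bounded_iff compact_imp_bounded image_eqI)
  have B0: "B \<ge> 0" using order_trans[OF norm_ge_zero B[of 0]] by simp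
  have "(\<lambda>n. LINT t|circ. cnj (a n * (z * cis t)^n) * f (z * cis t)) sums
        (LINT t|circ. (\<Sum>n. cnj (a n * (z * cis t)^n) * f (z * cis t)))"
  proof (rule sums_integral)
    show "integrable circ (\<lambda>t. cnj (a n * (z * cis t) ^ n) * f (z * cis t))" for n
      by (rule integrable_circ_continuous) (intro continuous_intros cont)
    have "summable (\<lambda>n. cmod (a n) * cmod z ^ n * cmod (f (z * cis t)))" for t
      by (rule summable_mult2[OF sm])
    then show "AE t in circ. summable (\<lambda>n. norm (cnj (a n * (z * cis t) ^ n) * f (z * cis t)))"
      by (simp add: norm_mult norm_power)
    have "norm (LINT t|circ. norm (cnj (a n * (z * cis t) ^ n) * f (z * cis t))) \<le> cmod (a n) * cmod z ^ n * B * (2*pi)" for n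
    proof -
      have "(LINT t|circ. norm (cnj (a n * (z * cis t) ^ n) * f (z * cis t))) \<le> (LINT t|circ. cmod (a n) * cmod z ^ n * B)"
        by (intro integral_mono integrable_circ_continuous continuous_intros cont)
           (auto simp: norm_mult norm_power intro!: mult_left_mono B)
      also have "\<dots> = cmod (a n) * cmod z ^ n * B * (2*pi)" by simp
      finally show ?thesis by simp
    qed
    then show "summable (\<lambda>n. LINT t|circ. norm (cnj (a n * (z * cis t) ^ n) * f (z * cis t)))"
      by (intro summable_comparison_test[OF exI summable_mult2[OF summable_mult2[OF sm]]] allI impI)
  qed
  moreover have "(\<Sum>n. cnj (a n * (z * cis t)^n) * f (z * cis t)) = of_real ((cmod (f (z * cis t)))^2)" for t
  proof -
    have "(\<lambda>n. cnj (a n * (z * cis t)^n) * f (z * cis t)) sums (cnj (f (z * cis t)) * f (z * cis t))"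
      using f[of "z * cis t"] z by (intro sums_mult2) (simp only: sums_cnj, auto simp: norm_mult)
    then show ?thesis by (simp add: sums_iff complex_norm_square mult.commute del: of_real_power)
  qed
  moreover have "(LINT t|circ. cnj (a n * (z * cis t)^n) * f (z * cis t)) = of_real (2*pi * ((cmod (a n))^2 * (cmod z)^(2*n)))" for n
  proof -
    have "(LINT t|circ. cnj (a n * (z * cis t)^n) * f (z * cis t)) = (LINT t|circ. cnj (a n * z^n) * (cnj (cis t)^n * f (z * cis t)))"
      by (intro Bochner_Integration.integral_cong) (auto simp: power_mult_distrib)
    also have "\<dots> = cnj (a n * z^n) * (2*pi * (a n * z^n))"
      by (subst integral_mult_right_zero) (simp only: circ_Fourier_coeff[OF f z])
    also have "\<dots> = 2 * pi * complex_of_real ((cmod (a n * z^n))^2)"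
      unfolding complex_norm_square by (simp add: mult_ac)
    also have "(cmod (a n * z^n))^2 = (cmod (a n))^2 * (cmod z)^(2*n)"
      by (simp add: norm_mult norm_power power_mult_distrib power_mult[symmetric] mult.commute)
    finally show ?thesis by simp
  qed
  ultimately have "(\<lambda>n. complex_of_real (2*pi * ((cmod (a n))^2 * (cmod z)^(2*n)))) sums
      of_real (LINT t|circ. (cmod (f (z * cis t)))^2)"
    by (simp only: integral_complex_of_real)
  then show ?thesis by (simp only: sums_of_real_iff)
qed

lemma circ_finite_Parseval:
  fixes y :: "nat \<Rightarrow> complex"
  shows   "(LINT t|circ. (cmod (\<Sum>n<L. y n * cis t ^ n))^2) = 2*pi * (\<Sum>n<L. (cmod (y n))^2)"
proof -
  have "(LINT t|circ. complex_of_real ((cmod (\<Sum>n<L. y n * cis t ^ n))^2)) =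
        (LINT t|circ. (\<Sum>n<L. \<Sum>m<L. (y n * cnj (y m)) * (cis t ^ n * cnj (cis t) ^ m)))"
    unfolding complex_norm_square cnj_sum sum_product by (simp add: mult_ac)
  also have "\<dots> = (\<Sum>n<L. \<Sum>m<L. (LINT t|circ. (y n * cnj (y m)) * (cis t ^ n * cnj (cis t) ^ m)))"
    by (subst Bochner_Integration.integral_sum, (intro integrable_circ_continuous continuous_intros)[1],
        intro sum.cong refl Bochner_Integration.integral_sum integrable_circ_continuous continuous_intros)
  also have "\<dots> = (\<Sum>n<L. \<Sum>m<L. (y n * cnj (y m)) * (if n = m then 2*pi else 0))"
    by (subst integral_mult_right_zero) (simp only: cis_power_integral)
  also have "\<dots> = (\<Sum>n<L. y n * cnj (y n) * (2*pi))"
    by (simp add: if_distrib sum.delta cong: if_cong)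
  also have "\<dots> = of_real (2*pi * (\<Sum>n<L. (cmod (y n))^2))"
    unfolding of_real_mult of_real_sum complex_norm_square by (simp add: sum_distrib_left mult_ac)
  finally show ?thesis unfolding integral_complex_of_real of_real_eq_iff .
qed

section \<open>Fatou's theorem on radial limits\<close>

text \<open>A function that decreases with the distance from \<open>c\<close> has superlevel sets
  that are intervals centred at \<open>c\<close>, up to their endpoints, and on such intervals the
  integrals of \<open>k\<close> are small by assumption.\<close>

lemma level_set_average_bound:
  fixes P k :: "real \<Rightarrow> real"
  assumes P[measurable]: "P \<in> borel_measurable borel"
    and mono: "\<And>s s'. \<bar>s - c\<bar> \<le> \<bar>s' - c\<bar> \<Longrightarrow> P s' \<le> P s"
    and supp: "\<And>s. \<delta> \<le> \<bar>s - c\<bar> \<Longrightarrow> P s = 0"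
    and k: "integrable lborel k"
    and avg: "\<And>u. 0 < u \<Longrightarrow> u \<le> \<delta> \<Longrightarrow> \<bar>LINT s|lborel. indicator {c-u<..<c+u} s * k s\<bar> \<le> \<epsilon> * (2*u)"
    and y: "0 < y"
  shows "\<bar>LINT s|lborel. indicator {s. y < P s} s * k s\<bar> \<le> \<epsilon> * (LINT s|lborel. indicator {s. y < P s} s)"
proof (cases "\<exists>s. y < P s")
  case False
  then have "indicator {s. y < P s} = (\<lambda>s. 0::real)" by (auto simp: indicator_def fun_eq_iff)
  then show ?thesis by simp
next
  case True
  define A where "A = {s. y < P s}"
  have [measurable]: "k \<in> borel_measurable borel" using borel_measurable_integrable[OF k] by simp
  have [measurable]: "A \<in> sets borel" unfolding A_def by measurable
  have lt: "\<bar>s - c\<bar> < \<delta>" if "s \<in> A" for s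
    using supp[of s] that y by (force simp: A_def)
  define u where "u = (SUP s\<in>A. \<bar>s - c\<bar>)"
  have bdd: "bdd_above ((\<lambda>s. \<bar>s - c\<bar>) ` A)"
    using lt by (intro bdd_aboveI[of _ \<delta>]) (auto intro: less_imp_le)
  have ne: "A \<noteq> {}" using True by (auto simp: A_def)
  have le_u: "\<bar>s - c\<bar> \<le> u" if "s \<in> A" for s
    unfolding u_def using that bdd by (rule cSUP_upper)
  have u0: "0 \<le> u" using ne le_u abs_ge_zero order_trans by blast
  have u\<delta>: "u \<le> \<delta>" unfolding u_def using ne lt by (intro cSUP_least) (auto intro: less_imp_le)
  have inA: "s \<in> A" if "\<bar>s - c\<bar> < u" for s
  proof -
    obtain s' where "s' \<in> A" "\<bar>s - c\<bar> < \<bar>s' - c\<bar>"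
      using less_cSUP_iff[OF ne bdd] \<open>\<bar>s - c\<bar> < u\<close> unfolding u_def by auto
    then show ?thesis using mono[of s s'] by (auto simp: A_def)
  qed
  have ae: "AE s in lborel. indicator A s = (indicator {c-u<..<c+u} s :: real)"
    using AE_lborel_singleton[of "c-u"] AE_lborel_singleton[of "c+u"]
  proof eventually_elim
    case (elim s)
    then show ?case using le_u[of s] inA[of s] by (auto simp: indicator_def abs_if split: if_splits)
  qed
  have "(LINT s|lborel. indicator A s * k s) = (LINT s|lborel. indicator {c-u<..<c+u} s * k s)"
    using ae by (intro integral_cong_AE) auto
  moreover have "(LINT s|lborel. indicator A s) = (LINT s|lborel. indicator {c-u<..<c+u} s :: real)"
    using ae by (intro integral_cong_AE) auto
  moreover have "(LINT s|lborel. indicator {c-u<..<c+u} s :: real) = 2 * u"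
    using u0 by simp
  moreover have "\<bar>LINT s|lborel. indicator {c-u<..<c+u} s * k s\<bar> \<le> \<epsilon> * (2*u)"
    \<comment> \<open>\<open>u = 0\<close> is the case of a level set reduced to its centre, which
      is null.\<close>
    using avg[of u] u0 u\<delta> by (cases "u = 0") auto
  ultimately show ?thesis unfolding A_def by simp
qed

text \<open>For nonnegative \<open>P\<close>, the value \<open>P s\<close> is the length of
  \<open>{0<..<P s}\<close>, so integrability of \<open>P s * k s\<close> is integrability of the
  inner integrals in Fubini's criterion.\<close>

lemma layer_cake_integrable:
  fixes P k :: "real \<Rightarrow> real"
  assumes [measurable]: "P \<in> borel_measurable borel" "k \<in> borel_measurable borel"
    and P0: "\<And>s. 0 \<le> P s" and int: "integrable lborel (\<lambda>s. P s * k s)"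
  shows "integrable (lborel \<Otimes>\<^sub>M lborel) (\<lambda>(s, y). indicator {0<..<P s} y * k s)"
proof (rule lborel_pair.Fubini_integrable)
  have eq: "indicator {0<..<P s} y * k s = (if 0 < y \<and> y < P s then k s else 0)" for s y :: real
    by (simp add: indicator_def)
  show "(\<lambda>(s, y). indicator {0<..<P s} y * k s) \<in> borel_measurable (lborel \<Otimes>\<^sub>M lborel)"
    unfolding eq by measurable
  have "(LINT y|lborel. norm (indicator {0<..<P s} y * k s)) = norm (P s * k s)" for s
    using P0[of s] by (simp add: abs_mult)
  then show "integrable lborel (\<lambda>s. LINT y|lborel. norm (case (s, y) of (s, y) \<Rightarrow> indicator {0<..<P s} y * k s))"
    using int by (simp only: split) simp
  show "AE s in lborel. integrable lborel (\<lambda>y. case (s, y) of (s, y) \<Rightarrow> indicator {0<..<P s} y * k s)"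
    using P0 by (intro AE_I2) (simp add: emeasure_lborel_Ioo)
qed

text \<open>Layer-cake decomposition: \<open>P\<close> is a superposition of the indicators of its
  centred level sets, and Fubini carries the bound over from these to \<open>P\<close>. Only signed
  averages of \<open>k\<close> enter.\<close>

lemma unimodal_average_bound:
  fixes P k :: "real \<Rightarrow> real"
  assumes P[measurable]: "P \<in> borel_measurable borel"
    and P0: "\<And>s. 0 \<le> P s" and PB: "\<And>s. P s \<le> B"
    and mono: "\<And>s s'. \<bar>s - c\<bar> \<le> \<bar>s' - c\<bar> \<Longrightarrow> P s' \<le> P s"
    and supp: "\<And>s. \<delta> \<le> \<bar>s - c\<bar> \<Longrightarrow> P s = 0"
    and k: "integrable lborel k"
    and avg: "\<And>u. 0 < u \<Longrightarrow> u \<le> \<delta> \<Longrightarrow> \<bar>LINT s|lborel. indicator {c-u<..<c+u} s * k s\<bar> \<le> \<epsilon> * (2*u)"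
  shows "\<bar>LINT s|lborel. P s * k s\<bar> \<le> \<epsilon> * (LINT s|lborel. P s)"
proof -
  have km[measurable]: "k \<in> borel_measurable borel" using borel_measurable_integrable[OF k] by simp
  have i1: "integrable lborel (\<lambda>s. P s * k s)"
  proof (rule Bochner_Integration.integrable_bound)
    show "integrable lborel (\<lambda>s. B * k s)" using k by simp
    show "AE s in lborel. norm (P s * k s) \<le> norm (B * k s)"
    proof (intro AE_I2)
      fix s
      have "\<bar>P s\<bar> \<le> \<bar>B\<bar>" using P0[of s] PB[of s] by simp
      then show "norm (P s * k s) \<le> norm (B * k s)" by (simp add: abs_mult mult_right_mono)
    qed
  qed measurable
  have i2: "integrable lborel (\<lambda>s. P s * 1)"
  proof (rule Bochner_Integration.integrable_bound)
    show "integrable lborel (\<lambda>s. B * indicator {c-\<delta>..c+\<delta>} s :: real)"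
      by (intro integrable_mult_right integrable_real_indicator) (auto simp: emeasure_lborel_Icc_eq)
    have "norm (P s * 1) \<le> norm (B * indicator {c-\<delta>..c+\<delta>} s :: real)" for s
      using P0[of s] PB[of s] supp[of s] by (auto simp: indicator_def abs_if split: if_splits)
    then show "AE s in lborel. norm (P s * 1) \<le> norm (B * indicator {c-\<delta>..c+\<delta>} s :: real)" by simp
  qed measurable
  note j1 = layer_cake_integrable[OF P km P0 i1]
  note j2 = layer_cake_integrable[OF P _ P0 i2]
  have c: "(LINT s|lborel. P s * g s) = (LINT y|lborel. (LINT s|lborel. indicator {0<..<P s} y * g s))"
    if "integrable (lborel \<Otimes>\<^sub>M lborel) (\<lambda>(s, y). indicator {0<..<P s} y * g s)" for g :: "real \<Rightarrow> real"
  proof -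
    have "(LINT s|lborel. P s * g s) = (LINT s|lborel. (LINT y|lborel. indicator {0<..<P s} y * g s))"
      using P0 by simp
    then show ?thesis using lborel_pair.Fubini_integral[OF that] by simp
  qed
  have in1: "integrable lborel (\<lambda>y. LINT s|lborel. indicator {0<..<P s} y * k s)"
    using lborel_pair.integrable_snd[OF j1] by simp
  have in2: "integrable lborel (\<lambda>y. LINT s|lborel. indicator {0<..<P s} y * (1::real))"
    using lborel_pair.integrable_snd[OF j2] by simp
  have pt: "\<bar>LINT s|lborel. indicator {0<..<P s} y * k s\<bar> \<le> \<epsilon> * (LINT s|lborel. indicator {0<..<P s} y * 1)" for y
  proof (cases "0 < y")
    case True
    then have "indicator {0<..<P s} y = (indicator {s. y < P s} s :: real)" for s by (simp add: indicator_def)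
    then show ?thesis using level_set_average_bound[OF P mono supp k avg True] by simp
  next
    case False
    then have "indicator {0<..<P s} y = (0::real)" for s by (simp add: indicator_def)
    then show ?thesis by simp
  qed
  have "\<bar>LINT s|lborel. P s * k s\<bar> \<le> (LINT y|lborel. \<bar>LINT s|lborel. indicator {0<..<P s} y * k s\<bar>)"
    unfolding c[OF j1] using integral_abs_bound by blast
  also have "\<dots> \<le> (LINT y|lborel. \<epsilon> * (LINT s|lborel. indicator {0<..<P s} y * 1))"
    by (intro integral_mono integrable_abs in1 integrable_mult_right in2 pt)
  also have "\<dots> = \<epsilon> * (LINT s|lborel. P s * 1)"
    unfolding c[OF j2[OF borel_measurable_const]] by (rule integral_mult_right_zero)
  finally show ?thesis by simp
qed

section \<open>Almost everywhere convergence of symmetric averages\<close>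

lemma AE_circ_iff: "(AE t in circ. Q t) \<longleftrightarrow> (AE t in lborel. t \<in> {0..2*pi} \<longrightarrow> Q t)"
  unfolding circ_def by (subst AE_restrict_space_iff) auto

lemma AE_not_negligible:
  fixes N :: "real set"
  assumes "negligible N" shows "AE t in lborel. t \<notin> N"
  using assms unfolding negligible_iff_null_sets
  by (metis (no_types) AE_completion_iff AE_not_in)

text \<open>The differentiation theorem used next concerns intervals that start at the point; a
  symmetric interval is cut at \<open>t\<close> and its left half is reflected.\<close>

lemma integral_indicator_average:
  fixes H :: "real \<Rightarrow> real"
  assumes H: "integrable lborel H" and u: "0 < u"
  shows "(LINT s|lborel. indicator {t-u<..<t+u} s * (H s - q)) =
    integral {t..t+u} H - q * u + (integral {-t..-t+u} (\<lambda>s. H (-s)) - q * u)"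
proof -
  have i: "H integrable_on {a..b}" for a b
    using H integrable_on_lborel[OF H] integrable_on_subinterval by blast
  have s: "set_integrable lborel {t-u<..<t+u} H"
    unfolding set_integrable_def by (rule integrable_mult_indicator) (use H in auto)
  have "(LINT s|lborel. indicator {t-u<..<t+u} s * (H s - q)) =
      (LINT s|lborel. indicator {t-u<..<t+u} s *\<^sub>R H s - q * indicator {t-u<..<t+u} s)"
    by (simp add: algebra_simps)
  also have "\<dots> = (LINT s|lborel. indicator {t-u<..<t+u} s *\<^sub>R H s) - (LINT s|lborel. q * indicator {t-u<..<t+u} s)"
    by (rule Bochner_Integration.integral_diff) (use s u in \<open>auto simp: set_integrable_def\<close>)
  also have "(LINT s|lborel. q * indicator {t-u<..<t+u} s) = q * (2*u)" using u by simp
  also have "(LINT s|lborel. indicator {t-u<..<t+u} s *\<^sub>R H s) = integral {t-u<..<t+u} H"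
    using set_borel_integral_eq_integral(2)[OF s] by (simp add: set_lebesgue_integral_def)
  also have "\<dots> = integral {t-u..t+u} H"
    using integral_open_interval_real[of "t-u" "t+u" H] by simp
  also have "\<dots> = integral {t-u..t} H + integral {t..t+u} H"
    using u by (intro Henstock_Kurzweil_Integration.integral_combine[symmetric] i) auto
  also have "integral {t-u..t} H = integral {-t..-t+u} (\<lambda>s. H (-s))"
    using Henstock_Kurzweil_Integration.integral_reflect_real[of t "t-u" H] by (simp add: algebra_simps)
  finally show ?thesis by simp
qed

text \<open>Weaker than the Lebesgue point property, since the absolute value stands outside the
  integral. Against symmetric decreasing weights this form is sufficient.\<close>

lemma AE_average_converges:
  fixes h :: "real \<Rightarrow> real"
  assumes h: "integrable lborel h"
  shows "AE t in lborel. \<forall>\<epsilon>>0. \<exists>d>0. \<forall>u. 0 < u \<and> u < d \<longrightarrow>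
      \<bar>LINT s|lborel. indicator {t-u<..<t+u} s * (h s - h t)\<bar> \<le> \<epsilon> * (2*u)"
proof -
  have h': "integrable lborel (\<lambda>s. h (-s))"
    using lborel_integrable_real_affine[OF h, of "-1" 0] by simp
  have i: "h integrable_on cbox a b" for a b
    using integrable_on_lborel[OF h] integrable_on_subcbox by blast
  have i': "(\<lambda>s. h (-s)) integrable_on cbox a b" for a b
    using integrable_on_lborel[OF h'] integrable_on_subcbox by blast
  obtain N1 where N1: "negligible N1"
    "\<And>x e. \<lbrakk>x \<notin> N1; 0 < e\<rbrakk> \<Longrightarrow> \<exists>d>0. \<forall>u. 0 < u \<and> u < d \<longrightarrow>
        norm (integral (cbox x (x + u *\<^sub>R One)) h /\<^sub>R u ^ DIM(real) - h x) < e"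
    using integrable_ccontinuous_explicit[of h, OF i] by metis
  obtain N2 where N2: "negligible N2"
    "\<And>x e. \<lbrakk>x \<notin> N2; 0 < e\<rbrakk> \<Longrightarrow> \<exists>d>0. \<forall>u. 0 < u \<and> u < d \<longrightarrow>
        norm (integral (cbox x (x + u *\<^sub>R One)) (\<lambda>s. h (-s)) /\<^sub>R u ^ DIM(real) - h (-x)) < e"
    using integrable_ccontinuous_explicit[of "\<lambda>s. h (-s)", OF i'] by metis
  \<comment> \<open>The exceptional set of the reflected function has to be reflected back; Lebesgue
    measure is invariant under this.\<close>
  have "AE t in lborel. - t \<notin> N2"
    using AE_distrD[of uminus lborel borel "\<lambda>t. t \<notin> N2"] AE_not_negligible[OF N2(1)]
    unfolding lborel_distr_uminus by simp
  with AE_not_negligible[OF N1(1)] show ?thesis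
  proof eventually_elim
    case (elim t)
    then have t2: "-t \<notin> N2" by simp
    show ?case
    proof (intro allI impI)
      fix \<epsilon> :: real assume e: "\<epsilon> > 0"
      obtain d1 where d1: "d1 > 0" "\<And>u. 0 < u \<and> u < d1 \<Longrightarrow> norm (integral {t..t+u} h / u - h t) < \<epsilon>"
        using N1(2)[OF elim(1) e] by (auto simp: divide_inverse mult.commute)
      obtain d2 where d2: "d2 > 0" "\<And>u. 0 < u \<and> u < d2 \<Longrightarrow> norm (integral {-t..-t+u} (\<lambda>s. h (-s)) / u - h t) < \<epsilon>"
        using N2(2)[OF t2 e] by (auto simp: divide_inverse mult.commute)
      show "\<exists>d>0. \<forall>u. 0 < u \<and> u < d \<longrightarrow>
          \<bar>LINT s|lborel. indicator {t-u<..<t+u} s * (h s - h t)\<bar> \<le> \<epsilon> * (2*u)"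
      proof (intro exI[of _ "min d1 d2"] conjI allI impI)
        fix u :: real assume u: "0 < u \<and> u < min d1 d2"
        have *: "\<bar>I - h t * u\<bar> \<le> \<epsilon> * u" if "norm (I / u - h t) < \<epsilon>" for I
        proof -
          have "\<bar>I - h t * u\<bar> = \<bar>I / u - h t\<bar> * u" using u by (simp add: abs_mult_pos' field_simps abs_mult)
          then show ?thesis using that u by (simp add: mult_right_mono)
        qed
        show "\<bar>LINT s|lborel. indicator {t-u<..<t+u} s * (h s - h t)\<bar> \<le> \<epsilon> * (2*u)"
          using *[OF d1(2)[of u]] *[OF d2(2)[of u]] u
          by (subst integral_indicator_average[OF h]) (auto simp: algebra_simps)
      qed (use d1 d2 in auto)
    qed
  qed
qed


section \<open>The Poisson kernel and the Poisson formula\<close>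

definition poisson :: "complex \<Rightarrow> real \<Rightarrow> real" where
  "poisson z t = (1 - (cmod z)\<^sup>2) / (cmod (cis t - z))\<^sup>2"

lemma cis_ne: "cmod z < 1 \<Longrightarrow> cis t \<noteq> z"
  by (metis less_irrefl norm_cis)

text \<open>The first summand is the Cauchy kernel. The second is analytic as a function of
  \<open>cis t\<close> and vanishes at the origin, so it contributes nothing when integrated against
  an analytic function.\<close>

lemma poisson_eq_Cauchy_kernels:
  assumes "cmod z < 1"
  shows "complex_of_real (poisson z t) = cis t / (cis t - z) + cnj z * cis t / (1 - cnj z * cis t)"
proof -
  define c where "c = cis t"
  have cc: "c * cnj c = 1" by (simp add: c_def flip: complex_norm_square)
  have nz: "c - z \<noteq> 0" using cis_ne[OF assms, of t] by (simp add: c_def)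
  then have nz': "cnj c - cnj z \<noteq> 0" by (metis complex_cnj_diff complex_cnj_zero_iff)
  have c0: "c \<noteq> 0" by (simp add: c_def)
  have "1 - cnj z * c = c * (cnj c - cnj z)" using cc by (simp add: algebra_simps)
  then have "cnj z * c / (1 - cnj z * c) = cnj z / (cnj c - cnj z)" using c0 by simp
  then have "c / (c - z) + cnj z * c / (1 - cnj z * c) = (c * (cnj c - cnj z) + cnj z * (c - z)) / ((c - z) * (cnj c - cnj z))"
    using nz nz' by (simp add: add_frac_eq mult.commute)
  also have "c * (cnj c - cnj z) + cnj z * (c - z) = 1 - z * cnj z" using cc by (simp add: algebra_simps)
  finally show ?thesis
    unfolding poisson_def of_real_divide of_real_diff complex_norm_square c_def[symmetric] by simp
qed

lemma continuous_poisson: "cmod z < 1 \<Longrightarrow> continuous_on A (poisson z)"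
  unfolding poisson_def using cis_ne by (intro continuous_intros) auto

lemma poisson_nonneg: "cmod z \<le> 1 \<Longrightarrow> 0 \<le> poisson z t"
  by (simp add: poisson_def power_le_one)

lemma circ_Cauchy_scaled:
  fixes g :: "complex \<Rightarrow> complex"
  assumes g: "g holomorphic_on ball 0 R" and \<rho>: "0 < \<rho>" "\<rho> < R" and z: "cmod z < 1"
  shows "(LINT t|circ. g (of_real \<rho> * cis t) * (cis t / (cis t - z))) = 2*pi * g (of_real \<rho> * z)"
proof -
  have "cmod (of_real \<rho> * z) < \<rho>" using \<rho> z by (simp add: norm_mult)
  from circ_Cauchy[OF g this \<rho>(2)] show ?thesis
    using \<rho>(1) by (simp flip: right_diff_distrib)
qed

lemma Poisson_formula:
  fixes g :: "complex \<Rightarrow> complex"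
  assumes g: "g holomorphic_on ball 0 R" and \<rho>: "0 < \<rho>" "\<rho> < R" and z: "cmod z < 1"
  shows "(LINT t|circ. of_real (poisson z t) * g (of_real \<rho> * cis t)) = 2*pi * g (of_real \<rho> * z)"
proof -
  have gc: "continuous_on A (\<lambda>t. g (of_real \<rho> * cis t))" for A
    by (rule continuous_circ_compose[OF g]) (use \<rho> in simp)
  \<comment> \<open>The factor \<open>q = 2 / (1 + |z|)\<close> satisfies \<open>1 < q\<close> and
    \<open>|z| q < 1\<close>. Hence the ball of radius \<open>R'\<close> contains the circle of
    radius \<open>\<rho>\<close> but no zero of \<open>of_real \<rho> - cnj z * s\<close>.\<close>
  define R' where "R' = min R (\<rho> * (2 / (1 + cmod z)))"
  have z1: "0 < 1 + cmod z" using norm_ge_zero[of z] by linarith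
  have R': "\<rho> < R'" "R' \<le> R" "cmod z * R' < \<rho>"
  proof -
    have "1 < 2 / (1 + cmod z)" using z z1 by (simp add: field_simps)
    from mult_strict_left_mono[OF this \<rho>(1)] show "\<rho> < R'" using \<rho> by (simp add: R'_def)
    show "R' \<le> R" by (simp add: R'_def)
    have "cmod z * (2 / (1 + cmod z)) < 1" using z z1 by (simp add: field_simps)
    then have "\<rho> * (cmod z * (2 / (1 + cmod z))) < \<rho>" using \<rho>(1) by (simp only: mult_less_cancel_left2)  simp
    moreover have "cmod z * R' \<le> cmod z * (\<rho> * (2 / (1 + cmod z)))"
      by (rule mult_left_mono) (auto simp: R'_def)
    ultimately show "cmod z * R' < \<rho>" by (simp add: mult_ac)
  qed
  have nz: "of_real \<rho> - cnj z * s \<noteq> 0" if "cmod s < R'" for s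
  proof
    assume "of_real \<rho> - cnj z * s = 0"
    then have "cmod (of_real \<rho>) = cmod (cnj z * s)" by simp
    then have "\<rho> = cmod z * cmod s" using \<rho> by (simp add: norm_mult)
    moreover have "cmod z * cmod s \<le> cmod z * R'" using that by (intro mult_left_mono) auto
    ultimately show False using R'(3) by simp
  qed
  define \<phi> where "\<phi> s = g s * (cnj z * s / (of_real \<rho> - cnj z * s))" for s
  have "g holomorphic_on ball 0 R'" using g by (rule holomorphic_on_subset) (use R' in auto)
  then have "\<phi> holomorphic_on ball 0 R'"
    unfolding \<phi>_def using nz by (intro holomorphic_intros) auto
  from circ_Cauchy[OF this, of 0 \<rho>] \<rho> R'
  have c2: "(LINT t|circ. \<phi> (of_real \<rho> * cis t)) = 0" by (simp add: \<phi>_def)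
  note c1 = circ_Cauchy_scaled[OF g \<rho> z]
  have e2: "\<phi> (of_real \<rho> * cis t) = g (of_real \<rho> * cis t) * (cnj z * cis t / (1 - cnj z * cis t))" for t
  proof -
    have "of_real \<rho> - cnj z * (of_real \<rho> * cis t) = of_real \<rho> * (1 - cnj z * cis t)" by (simp add: algebra_simps)
    then show ?thesis using \<rho>(1) by (simp add: \<phi>_def)
  qed
  have nz1: "1 - cnj z * cis t \<noteq> 0" for t
    using nz[of "of_real \<rho> * cis t"] \<rho> R' by (auto simp: norm_mult)
  have i1: "integrable circ (\<lambda>t. g (of_real \<rho> * cis t) * (cis t / (cis t - z)))"
    using cis_ne[OF z] by (intro integrable_circ_continuous continuous_intros gc) auto
  have i2: "integrable circ (\<lambda>t. \<phi> (of_real \<rho> * cis t))"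
    unfolding e2 using nz1 by (intro integrable_circ_continuous continuous_intros gc) auto
  have "(LINT t|circ. of_real (poisson z t) * g (of_real \<rho> * cis t)) =
      (LINT t|circ. g (of_real \<rho> * cis t) * (cis t / (cis t - z)) + \<phi> (of_real \<rho> * cis t))"
    unfolding poisson_eq_Cauchy_kernels[OF z] e2 by (simp add: algebra_simps)
  also have "\<dots> = 2*pi * g (of_real \<rho> * z) + 0"
    by (subst Bochner_Integration.integral_add[OF i1 i2]) (simp only: c1 c2)
  finally show ?thesis by simp
qed

lemma poisson_integral_one:
  assumes "cmod z < 1" shows "(LINT t|circ. poisson z t) = 2*pi"
proof -
  have "complex_of_real (LINT t|circ. poisson z t) = 2*pi"
    using Poisson_formula[of "\<lambda>_. 1" 2 1 z] assms by (simp flip: integral_complex_of_real)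
  then show ?thesis by (metis of_real_eq_iff)
qed

section \<open>The Poisson kernel in polar form and Fatou's theorem\<close>

lemma poisson_polar:
  "poisson (of_real r * cis t) s = (1 - r\<^sup>2) / (1 - 2 * r * cos (s - t) + r\<^sup>2)"
proof -
  have "(cmod (cis s - of_real r * cis t))\<^sup>2 = (cos s - r * cos t)\<^sup>2 + (sin s - r * sin t)\<^sup>2"
    unfolding cmod_power2 by simp
  also have "\<dots> = 1 - 2 * r * cos (s - t) + r\<^sup>2"
    unfolding cos_diff using sin_cos_squared_add2[of s] sin_cos_squared_add2[of t] by algebra
  finally show ?thesis unfolding poisson_def by (simp add: norm_mult)
qed

lemma poisson_denominator_pos:
  fixes r x :: real
  assumes "0 \<le> r" "r < 1" "x \<le> 1"
  shows "0 < 1 - 2 * r * x + r\<^sup>2"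
proof -
  have "2 * r * x \<le> 2 * r" using assms by (simp add: mult_left_le)
  moreover have "0 < (1 - r)\<^sup>2" using assms by simp
  ultimately show ?thesis by (simp add: power2_diff)
qed

text \<open>The kernel depends on the angle through its cosine alone and increases with it. With a
  free upper bound \<open>x\<close> for the cosine, one statement yields the global maximum
  (\<open>x = 1\<close>), the bound far from \<open>t\<close> (\<open>x = cos \<delta>\<close>) and
  monotonicity.\<close>

lemma poisson_polar_mono:
  assumes r: "0 \<le> r" "r < 1" and c: "cos (s' - t) \<le> x" "x \<le> 1"
  shows "poisson (of_real r * cis t) s' \<le> (1 - r\<^sup>2) / (1 - 2 * r * x + r\<^sup>2)"
  unfolding poisson_polar
proof (rule divide_left_mono)
  show "0 \<le> 1 - r\<^sup>2" using r by (simp add: power_le_one)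
  show "1 - 2 * r * x + r\<^sup>2 \<le> 1 - 2 * r * cos (s' - t) + r\<^sup>2"
    using mult_left_mono[OF c(1), of "2*r"] r by simp
  show "0 < (1 - 2 * r * cos (s' - t) + r\<^sup>2) * (1 - 2 * r * x + r\<^sup>2)"
    using poisson_denominator_pos[OF r] c by (intro mult_pos_pos) auto
qed

lemma cos_le_cos_far:
  assumes "0 \<le> \<delta>" "\<delta> \<le> \<bar>x\<bar>" "\<bar>x\<bar> \<le> 2*pi - \<delta>"
  shows "cos x \<le> cos \<delta>"
proof (cases "\<bar>x\<bar> \<le> pi")
  case True
  then show ?thesis using cos_monotone_0_pi_le[of \<delta> "\<bar>x\<bar>"] assms by simp
next
  case False
  then have "cos (2*pi - \<bar>x\<bar>) \<le> cos \<delta>"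
    using assms by (intro cos_monotone_0_pi_le) auto
  then show ?thesis by simp
qed

text \<open>The kernel is cut at distance \<open>\<delta>\<close> from \<open>t\<close>. Its near
  part decreases with the distance, so the averages of \<open>h - h t\<close> control it; its far
  part is bounded by a quantity that tends to 0 with \<open>1 - r\<close>. The point
  \<open>t\<close> is kept off the endpoints so that a full neighbourhood lies in the interval of
  integration.\<close>

theorem Fatou_at_Lebesgue_point:
  fixes h :: "real \<Rightarrow> real"
  assumes H: "integrable lborel H" "\<And>s. H s = indicator {0..2*pi} s * h s" and t: "0 < t" "t < 2*pi"
    and avg: "\<forall>\<epsilon>>0. \<exists>d>0. \<forall>u. 0 < u \<and> u < d \<longrightarrow>
      \<bar>LINT s|lborel. indicator {t-u<..<t+u} s * (H s - H t)\<bar> \<le> \<epsilon> * (2*u)"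
  shows "((\<lambda>r. LINT s|circ. poisson (of_real r * cis t) s * h s) \<longlongrightarrow> 2*pi * h t) (at_left 1)"
proof (rule tendstoI)
  fix e :: real assume e: "e > 0"
  \<comment> \<open>The near part then contributes at most
    \<open>2 * pi * \<epsilon> = e / 2\<close>.\<close>
  define \<epsilon> where "\<epsilon> = e / (4*pi)"
  have "\<epsilon> > 0" using e by (simp add: \<epsilon>_def)
  with avg obtain d where d: "d > 0" "\<And>u. 0 < u \<and> u < d \<Longrightarrow>
      \<bar>LINT s|lborel. indicator {t-u<..<t+u} s * (H s - H t)\<bar> \<le> \<epsilon> * (2*u)" by blast
  \<comment> \<open>Staying within the distances to both endpoints keeps the near interval inside
    the domain, makes the cosine monotone on it, and gives
    \<open>|s - t| \<le> 2 * pi - \<delta>\<close> for all \<open>s\<close> in the domain, as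
    \<open>cos_le_cos_far\<close> requires.\<close>
  define \<delta> where "\<delta> = min (d/2) (min t (2*pi - t))"
  have \<delta>: "0 < \<delta>" "\<delta> < d" "\<delta> \<le> t" "\<delta> \<le> 2*pi - t" "\<delta> \<le> pi" using d t by (auto simp: \<delta>_def)
  define k where "k s = indicator {0..2*pi} s * (h s - h t)" for s :: real
  have k_eq: "k s = H s - h t * indicator {0..2*pi} s" for s
    by (simp add: k_def H(2) algebra_simps)
  have k: "integrable lborel k" unfolding k_eq using H(1) by simp
  have [measurable]: "k \<in> borel_measurable borel" using borel_measurable_integrable[OF k] by simp
  have "H = (\<lambda>s. indicator {0..2*pi} s * h s)" using H(2) by auto
  then have ih: "integrable circ h"
    using H(1) unfolding circ_def by (subst integrable_restrict_space) auto
  define K where "K = (LINT s|lborel. \<bar>k s\<bar>)"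
  \<comment> \<open>The kernel at angular distance \<open>\<delta>\<close>, hence an upper bound for
    it on the far part.\<close>
  define q where "q r = (1 - r\<^sup>2) / (1 - 2 * r * cos \<delta> + r\<^sup>2)" for r :: real
  have cd: "cos \<delta> < 1" using cos_monotone_0_pi[of 0 \<delta>] \<delta> by simp
  have "((\<lambda>r. 2 * \<epsilon> * pi + q r * K) \<longlongrightarrow> 2 * \<epsilon> * pi + (1 - 1\<^sup>2) / (1 - 2 * 1 * cos \<delta> + 1\<^sup>2) * K) (at_left 1)"
    unfolding q_def using cd by (intro tendsto_intros) auto
  then have lim: "((\<lambda>r. 2 * \<epsilon> * pi + q r * K) \<longlongrightarrow> e/2) (at_left 1)" by (simp add: \<epsilon>_def)
  have "eventually (\<lambda>r. 2 * \<epsilon> * pi + q r * K < e) (at_left 1)"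
    using order_tendstoD(2)[OF lim, of e] e by simp
  moreover have "eventually (\<lambda>r::real. r \<in> {0<..<1}) (at_left 1)"
    by (rule eventually_at_leftI[of 0]) auto
  ultimately show "\<forall>\<^sub>F r in at_left 1. dist (LINT s|circ. poisson (of_real r * cis t) s * h s) (2*pi * h t) < e"
  proof eventually_elim
    case (elim r)
    then have r: "0 \<le> r" "r < 1" by auto
    let ?p = "poisson (of_real r * cis t)"
    have z: "cmod (of_real r * cis t) < 1" using r by (simp add: norm_mult)
    have [measurable]: "?p \<in> borel_measurable borel"
      by (rule borel_measurable_continuous_onI[OF continuous_poisson[OF z]])
    have p0: "0 \<le> ?p s" for s using poisson_nonneg z by simp
    define B where "B = (1 - r\<^sup>2) / (1 - 2 * r * 1 + r\<^sup>2)"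
    have pB: "?p s \<le> B" for s unfolding B_def by (rule poisson_polar_mono[OF r]) auto
    have B0: "0 \<le> B" using p0[of 0] pB[of 0] by simp
    have q0: "0 \<le> q r"
      unfolding q_def using poisson_denominator_pos[OF r, of "cos \<delta>"] r by (simp add: power_le_one)
    define Pn where "Pn s = (if \<bar>s - t\<bar> < \<delta> then ?p s else 0)" for s
    define Pf where "Pf s = (if \<bar>s - t\<bar> < \<delta> then 0 else ?p s)" for s
    have [measurable]: "Pn \<in> borel_measurable borel" "Pf \<in> borel_measurable borel"
      unfolding Pn_def Pf_def by measurable
    have bnd: "integrable lborel (\<lambda>s. P s * k s)" if "P \<in> borel_measurable borel" "\<And>s. \<bar>P s\<bar> \<le> B" for P
    proof (rule Bochner_Integration.integrable_bound)
      show "integrable lborel (\<lambda>s. B * k s)" using k by simp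
      show "AE s in lborel. norm (P s * k s) \<le> norm (B * k s)"
        using that(2) B0 by (auto simp: abs_mult intro!: mult_right_mono AE_I2)
    qed (use that in measurable)
    have in1: "integrable lborel (\<lambda>s. Pn s * k s)" "integrable lborel (\<lambda>s. Pf s * k s)"
      using p0 pB B0 by (auto intro!: bnd simp: Pn_def Pf_def)
    have ic: "integrable circ (\<lambda>s. ?p s * g s)" if "integrable circ g" for g :: "real \<Rightarrow> real"
    proof (rule Bochner_Integration.integrable_bound)
      show "integrable circ (\<lambda>s. B * g s)" using that by simp
      show "AE s in circ. norm (?p s * g s) \<le> norm (B * g s)"
        using p0 pB B0 by (auto simp: abs_mult intro!: mult_right_mono AE_I2)
    qed (use that in measurable)
    have "(LINT s|circ. ?p s * h s) - 2*pi * h t = (LINT s|circ. ?p s * h s) - (LINT s|circ. ?p s * h t)"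
      by (subst integral_mult_left_zero) (simp only: poisson_integral_one[OF z])
    also have "\<dots> = (LINT s|circ. ?p s * h s - ?p s * h t)"
      by (rule Bochner_Integration.integral_diff[symmetric]) (intro ic ih circ.integrable_const)+
    also have "\<dots> = (LINT s|lborel. ?p s * k s)"
      unfolding circ_def k_def
      by (subst integral_restrict_space) (auto simp: algebra_simps intro!: Bochner_Integration.integral_cong)
    also have "\<dots> = (LINT s|lborel. Pn s * k s + Pf s * k s)"
      by (rule Bochner_Integration.integral_cong) (auto simp: Pn_def Pf_def)
    also have "\<dots> = (LINT s|lborel. Pn s * k s) + (LINT s|lborel. Pf s * k s)"
      by (rule Bochner_Integration.integral_add[OF in1])
    finally have eq: "(LINT s|circ. ?p s * h s) - 2*pi * h t = (LINT s|lborel. Pn s * k s) + (LINT s|lborel. Pf s * k s)" .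
    have "\<bar>LINT s|lborel. Pn s * k s\<bar> \<le> \<epsilon> * (LINT s|lborel. Pn s)"
    proof (rule unimodal_average_bound[where c=t and \<delta>=\<delta> and B=B])
      show "0 \<le> Pn s" "Pn s \<le> B" for s using p0 pB B0 by (auto simp: Pn_def)
      show "Pn s = 0" if "\<delta> \<le> \<bar>s - t\<bar>" for s using that by (simp add: Pn_def)
      show "Pn s' \<le> Pn s" if "\<bar>s - t\<bar> \<le> \<bar>s' - t\<bar>" for s s'
      proof (cases "\<bar>s' - t\<bar> < \<delta>")
        case True
        have "cos \<bar>s' - t\<bar> \<le> cos \<bar>s - t\<bar>"
          using that True \<delta> by (intro cos_monotone_0_pi_le) auto
        then have "?p s' \<le> ?p s"
          using poisson_polar_mono[OF r, of s' t "cos (s - t)"] by (simp add: poisson_polar)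
        then show ?thesis using True that by (simp add: Pn_def)
      qed (use p0 in \<open>simp add: Pn_def\<close>)
      show "\<bar>LINT s|lborel. indicator {t-u<..<t+u} s * k s\<bar> \<le> \<epsilon> * (2*u)" if "0 < u" "u \<le> \<delta>" for u
      proof -
        have "(LINT s|lborel. indicator {t-u<..<t+u} s * k s) = (LINT s|lborel. indicator {t-u<..<t+u} s * (H s - H t))"
          using that \<delta> t by (intro Bochner_Integration.integral_cong) (auto simp: indicator_def k_def H(2))
        then show ?thesis using d(2)[of u] that \<delta> by simp
      qed
    qed (use k in auto)
    moreover have "(LINT s|lborel. Pn s) \<le> 2*pi"
    proof -
      have "(LINT s|lborel. Pn s) = (LINT s|circ. Pn s)"
        unfolding circ_def using \<delta> t
        by (subst integral_restrict_space) (auto simp: Pn_def indicator_def intro!: Bochner_Integration.integral_cong)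
      also have "\<dots> \<le> (LINT s|circ. ?p s)"
      proof (rule integral_mono)
        show "integrable circ Pn" by (rule integrable_circ_bounded[where B=B]) (use p0 pB B0 in \<open>auto simp: Pn_def\<close>)
        show "integrable circ ?p" using ic[of "\<lambda>_. 1"] by simp
      qed (use p0 in \<open>auto simp: Pn_def\<close>)
      finally show ?thesis using poisson_integral_one[OF z] by simp
    qed
    ultimately have n: "\<bar>LINT s|lborel. Pn s * k s\<bar> \<le> \<epsilon> * (2*pi)"
      using \<open>\<epsilon> > 0\<close> by (smt (verit) mult_left_mono)
    have "\<bar>LINT s|lborel. Pf s * k s\<bar> \<le> (LINT s|lborel. \<bar>Pf s * k s\<bar>)" by (rule integral_abs_bound)
    also have "\<dots> \<le> (LINT s|lborel. q r * \<bar>k s\<bar>)"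
    proof (rule integral_mono)
      show "integrable lborel (\<lambda>s. \<bar>Pf s * k s\<bar>)" using in1 by simp
      show "integrable lborel (\<lambda>s. q r * \<bar>k s\<bar>)" using k by simp
      show "\<bar>Pf s * k s\<bar> \<le> q r * \<bar>k s\<bar>" for s
      proof (cases "s \<in> {0..2*pi} \<and> \<delta> \<le> \<bar>s - t\<bar>")
        case True
        then have "cos (s - t) \<le> cos \<delta>" using \<delta> t by (intro cos_le_cos_far) auto
        then have "?p s \<le> q r" unfolding q_def by (intro poisson_polar_mono[OF r]) auto
        then show ?thesis using p0[of s] True by (auto simp: Pf_def abs_mult intro: mult_right_mono)
      next
        case False
        then show ?thesis using q0 by (auto simp: Pf_def k_def)
      qed
    qed
    also have "\<dots> = q r * K" by (simp add: K_def)
    finally show ?case using n eq elim by (simp add: dist_real_def)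
  qed
qed

theorem Fatou:
  fixes h :: "real \<Rightarrow> real"
  assumes "integrable circ h"
  shows "AE t in circ. ((\<lambda>r. LINT s|circ. poisson (of_real r * cis t) s * h s) \<longlongrightarrow> 2*pi * h t) (at_left 1)"
proof -
  define H where "H s = indicator {0..2*pi} s * h s" for s
  have H: "integrable lborel H"
    using assms unfolding circ_def H_def[abs_def] by (subst (asm) integrable_restrict_space) auto
  show ?thesis
    unfolding AE_circ_iff
    using AE_average_converges[OF H] AE_lborel_singleton[of 0] AE_lborel_singleton[of "2*pi"]
    by eventually_elim (auto intro!: Fatou_at_Lebesgue_point[OF H H_def])
qed

section \<open>Boundary values of bounded analytic functions\<close>

definition taylor :: "(complex \<Rightarrow> complex) \<Rightarrow> nat \<Rightarrow> complex" where
  "taylor f n = (deriv ^^ n) f 0 / fact n"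

lemma taylor_sums:
  assumes "f holomorphic_on ball 0 R" "w \<in> ball 0 R"
  shows "(\<lambda>n. taylor f n * w ^ n) sums f w"
  using holomorphic_power_series[OF assms] by (simp add: taylor_def)

lemma circ_square_mean_bound:
  fixes f :: "complex \<Rightarrow> complex" and a :: "nat \<Rightarrow> complex"
  assumes f: "\<And>w. w \<in> ball 0 1 \<Longrightarrow> (\<lambda>n. a n * w^n) sums f w"
    and C: "\<And>r. 0 \<le> r \<Longrightarrow> r < 1 \<Longrightarrow> (LINT t|circ. (cmod (f (of_real r * cis t)))\<^sup>2) \<le> 2*pi*C"
  shows "summable (\<lambda>n. (cmod (a n))\<^sup>2)" "(\<Sum>n. (cmod (a n))\<^sup>2) \<le> C"
proof -
  have *: "(\<Sum>n<N. (cmod (a n))\<^sup>2) \<le> C" for N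
  proof (rule tendsto_upperbound)
    show "((\<lambda>r. \<Sum>n<N. (cmod (a n))\<^sup>2 * r^(2*n)) \<longlongrightarrow> (\<Sum>n<N. (cmod (a n))\<^sup>2)) (at_left (1::real))"
      by (auto intro!: tendsto_eq_intros)
    have "eventually (\<lambda>r::real. r \<in> {0<..<1}) (at_left 1)"
      by (rule eventually_at_leftI[of 0]) auto
    then show "\<forall>\<^sub>F r::real in at_left 1. (\<Sum>n<N. (cmod (a n))\<^sup>2 * r^(2*n)) \<le> C"
    proof eventually_elim
      case (elim r)
      then have "cmod (of_real r) < 1" by simp
      from circ_Parseval[OF f this] elim
      have s: "(\<lambda>n. 2*pi * ((cmod (a n))\<^sup>2 * r^(2*n))) sums (LINT t|circ. (cmod (f (of_real r * cis t)))\<^sup>2)" by simp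
      have "(\<Sum>n<N. 2*pi * ((cmod (a n))\<^sup>2 * r^(2*n))) \<le> 2*pi*C"
        using sum_le_suminf[OF sums_summable[OF s], of "{..<N}"] C[of r] elim
        unfolding sums_unique[OF s, symmetric] by force
      then show ?case by (simp flip: sum_distrib_left)
    qed
  qed simp
  show 1: "summable (\<lambda>n. (cmod (a n))\<^sup>2)"
    by (rule bounded_imp_summable[where B=C]) (use *[of "Suc _"] in \<open>auto simp: lessThan_Suc_atMost\<close>)
  show "(\<Sum>n. (cmod (a n))\<^sup>2) \<le> C" by (rule suminf_le_const[OF 1 *])
qed

lemma Hinf_bound:
  assumes "f \<in> Hinf"
  obtains B where "0 \<le> B" "\<And>z. z \<in> ball 0 1 \<Longrightarrow> cmod (f z) \<le> B"
proof -
  obtain B where "\<forall>x\<in>f ` ball 0 1. cmod x \<le> B"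
    using assms unfolding Hinf_def bounded_iff by blast
  then have "\<And>z. z \<in> ball 0 1 \<Longrightarrow> cmod (f z) \<le> B" by blast
  then show ?thesis using that[of "\<bar>B\<bar>"] abs_ge_self order_trans by (metis abs_ge_zero)
qed

lemma Hinf_holomorphic: "f \<in> Hinf \<Longrightarrow> f holomorphic_on ball 0 1"
  by (simp add: Hinf_def)

text \<open>For \<open>c n\<close> the squared modulus of the n-th Taylor coefficient, the sum
  measures in mean square how far the dilation by \<open>r\<close> is from the boundary function.
  Each term tends to 0 and is dominated by \<open>c n\<close>.\<close>

lemma summable_dominated_tendsto_zero:
  fixes c :: "nat \<Rightarrow> real"
  assumes c: "summable c" "\<And>n. 0 \<le> c n"
  shows "((\<lambda>r::real. \<Sum>n. c n * (1 - r^n)\<^sup>2) \<longlongrightarrow> 0) (at_left 1)"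
proof -
  have ev: "eventually (\<lambda>r::real. r \<in> {0<..<1}) (at_left 1)"
    by (rule eventually_at_leftI[of 0]) auto
  have "((\<lambda>r::real. \<Sum>n. c n * (1 - r^n)\<^sup>2) \<longlongrightarrow> (\<Sum>n. c n * (1 - 1^n)\<^sup>2)) (at_left 1)"
  proof (rule tannerys_theorem[THEN conjunct2, THEN conjunct2])
    show "((\<lambda>r::real. c n * (1 - r^n)\<^sup>2) \<longlongrightarrow> c n * (1 - 1^n)\<^sup>2) (at_left 1)" for n
      by (intro tendsto_intros)
    have "norm (c n * (1 - r^n)\<^sup>2) \<le> c n" if "r \<in> {0<..<1}" for n and r :: real
    proof -
      have "(1 - r^n)\<^sup>2 \<le> 1" using that by (intro power_le_one) (auto simp: power_le_one)
      then show ?thesis using c(2)[of n] by (simp add: abs_mult mult_left_le)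
    qed
    then show "\<forall>\<^sub>F (n, r) in sequentially \<times>\<^sub>F at_left (1::real). norm (c n * (1 - r^n)\<^sup>2) \<le> c n"
      by (intro eventually_mono[OF eventually_prodI[OF eventually_True ev]]) auto
    show "summable c" by fact
  qed simp
  then show ?thesis by simp
qed

text \<open>The inequality of arithmetic and geometric means, integrated. With \<open>l\<close> of
  the size of the mean-square norm it does the work of Cauchy-Schwarz.\<close>

lemma integral_norm_le_square:
  fixes f :: "real \<Rightarrow> complex"
  assumes f: "continuous_on {0..2*pi} f" and l: "0 < l"
  shows "(LINT t|circ. cmod (f t)) \<le> (2*pi*l + (LINT t|circ. (cmod (f t))\<^sup>2) / l) / 2"
proof -
  have "cmod (f t) \<le> (l + (cmod (f t))\<^sup>2 / l) / 2" for t
  proof -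
    have "2 * l * cmod (f t) \<le> l\<^sup>2 + (cmod (f t))\<^sup>2" using sum_squares_bound[of l "cmod (f t)"] by simp
    then show ?thesis using l by (simp add: field_simps power2_eq_square)
  qed
  then have "(LINT t|circ. cmod (f t)) \<le> (LINT t|circ. (l + (cmod (f t))\<^sup>2 / l) / 2)"
    using l f by (intro integral_mono integrable_circ_continuous continuous_intros) auto
  also have "\<dots> = ((LINT t|circ. l) + (LINT t|circ. (cmod (f t))\<^sup>2 / l)) / 2"
    unfolding integral_divide_zero using l f
    by (subst Bochner_Integration.integral_add) (auto intro!: integrable_circ_continuous continuous_intros)
  finally show ?thesis by simp
qed

text \<open>By monotone convergence the increments are absolutely summable at almost every point,
  and the sequence telescopes.\<close>

lemma AE_convergent_of_summable_L1:
  fixes F :: "nat \<Rightarrow> real \<Rightarrow> complex"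
  assumes F: "\<And>k. continuous_on {0..2*pi} (F k)"
    and s: "summable (\<lambda>k. LINT t|circ. cmod (F (Suc k) t - F k t))"
  shows "AE t in circ. convergent (\<lambda>k. F k t)"
proof -
  define D where "D k t = cmod (F (Suc k) t - F k t)" for k t
  have D: "integrable circ (D k)" for k
    unfolding D_def by (intro integrable_circ_continuous continuous_intros F)
  have [measurable]: "D k \<in> borel_measurable circ" for k using D by (rule borel_measurable_integrable)
  have D0: "0 \<le> D k t" for k t by (simp add: D_def)
  have "(\<integral>\<^sup>+ t. (\<Sum>k. ennreal (D k t)) \<partial>circ) = (\<Sum>k. \<integral>\<^sup>+ t. ennreal (D k t) \<partial>circ)"
    by (rule nn_integral_suminf) simp
  also have "\<dots> = (\<Sum>k. ennreal (LINT t|circ. D k t))"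
    using D D0 by (simp add: nn_integral_eq_integral)
  also have "\<dots> \<noteq> \<infinity>"
    using s D0 unfolding D_def[symmetric] infinity_ennreal_def by (intro ennreal_suminf_neq_top) (auto intro: integral_nonneg_AE)
  finally have "AE t in circ. (\<Sum>k. ennreal (D k t)) \<noteq> \<infinity>"
    by (intro nn_integral_PInf_AE) auto
  then show ?thesis
  proof eventually_elim
    case (elim t)
    then have "summable (\<lambda>k. D k t)" using D0 by (intro summable_suminf_not_top) auto
    then have "summable (\<lambda>k. F (Suc k) t - F k t)" unfolding D_def by (rule summable_norm_cancel)
    then have "convergent (\<lambda>n. \<Sum>k<n. F (Suc k) t - F k t)" by (simp add: summable_iff_convergent)
    then have "convergent (\<lambda>n. (\<Sum>k<n. F (Suc k) t - F k t) + F 0 t)"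
      by (intro convergent_add convergent_const)
    then show ?case using sum_lessThan_telescope[of "\<lambda>k. F k t"] by simp
  qed
qed

lemma circ_square_dilation_difference:
  fixes f :: "complex \<Rightarrow> complex" and a :: "nat \<Rightarrow> complex"
  assumes f: "\<And>w. w \<in> ball 0 1 \<Longrightarrow> (\<lambda>n. a n * w^n) sums f w"
    and sa: "summable (\<lambda>n. (cmod (a n))\<^sup>2)"
    and p: "0 < p" "p < 1" and q: "0 < q" "q < 1"
  shows "(LINT t|circ. (cmod (f (of_real p * cis t) - f (of_real q * cis t)))\<^sup>2)
      \<le> 4*pi*((\<Sum>n. (cmod (a n))\<^sup>2 * (1 - p^n)\<^sup>2) + (\<Sum>n. (cmod (a n))\<^sup>2 * (1 - q^n)\<^sup>2))"
proof -
  \<comment> \<open>The power series of the difference of dilations converges for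
    \<open>|w| < 1 / max p q\<close>, a disk containing the unit circle, so Parseval applies on the
    unit circle itself.\<close>
  define R where "R = 1 / max p q"
  have R: "1 < R" "p * R \<le> 1" "q * R \<le> 1" using p q by (auto simp: R_def field_simps max_def)
  have g: "(\<lambda>n. (a n * (p^n - q^n)) * w^n) sums (f (of_real p * w) - f (of_real q * w))" if "w \<in> ball 0 R" for w
  proof -
    have "p * cmod w < 1" "q * cmod w < 1"
      using that R p q by (auto intro: less_le_trans[OF mult_strict_left_mono])
    then have "(\<lambda>n. a n * (of_real p * w)^n - a n * (of_real q * w)^n) sums (f (of_real p * w) - f (of_real q * w))"
      using p q by (intro sums_diff f) (auto simp: norm_mult)
    then show ?thesis by (simp add: power_mult_distrib algebra_simps)
  qed
  have "cmod 1 < R" using R by simp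
  from circ_Parseval[OF g this]
  have S: "(\<lambda>n. 2*pi * ((cmod (a n))\<^sup>2 * (p^n - q^n)\<^sup>2)) sums
      (LINT t|circ. (cmod (f (of_real p * cis t) - f (of_real q * cis t)))\<^sup>2)"
    by (simp add: norm_mult power_mult_distrib flip: of_real_power of_real_diff)
  have sm: "summable (\<lambda>n. (cmod (a n))\<^sup>2 * (1 - r^n)\<^sup>2)" if "0 < r" "r < 1" for r :: real
  proof (rule summable_comparison_test[OF _ sa])
    have "(1 - r^n)\<^sup>2 \<le> 1" for n using that by (intro power_le_one) (auto simp: power_le_one)
    then show "\<exists>N. \<forall>n\<ge>N. norm ((cmod (a n))\<^sup>2 * (1 - r^n)\<^sup>2) \<le> (cmod (a n))\<^sup>2"
      by (auto simp: mult_left_le)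
  qed
  have T: "(\<lambda>n. 4*pi*((cmod (a n))\<^sup>2 * (1 - p^n)\<^sup>2 + (cmod (a n))\<^sup>2 * (1 - q^n)\<^sup>2)) sums
      (4*pi*((\<Sum>n. (cmod (a n))\<^sup>2 * (1 - p^n)\<^sup>2) + (\<Sum>n. (cmod (a n))\<^sup>2 * (1 - q^n)\<^sup>2)))"
    by (intro sums_mult sums_add summable_sums sm p q)
  show ?thesis
  proof (rule sums_le[OF _ S T])
    fix n
    have "(p^n - q^n)\<^sup>2 \<le> 2 * ((1 - p^n)\<^sup>2 + (1 - q^n)\<^sup>2)"
      using zero_le_power2[of "(1 - p^n) + (1 - q^n)"] by (simp add: power2_eq_square algebra_simps)
    then have "2*pi*(cmod (a n))\<^sup>2 * (p^n - q^n)\<^sup>2 \<le> 2*pi*(cmod (a n))\<^sup>2 * (2 * ((1 - p^n)\<^sup>2 + (1 - q^n)\<^sup>2))"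
      by (intro mult_left_mono) auto
    then show "2*pi * ((cmod (a n))\<^sup>2 * (p^n - q^n)\<^sup>2) \<le> 4*pi*((cmod (a n))\<^sup>2 * (1 - p^n)\<^sup>2 + (cmod (a n))\<^sup>2 * (1 - q^n)\<^sup>2)"
      by (simp add: algebra_simps)
  qed
qed

lemma measurable_dilation:
  assumes "f holomorphic_on ball 0 1" "\<bar>r\<bar> < 1"
  shows "(\<lambda>t. f (of_real r * cis t)) \<in> borel_measurable borel"
  by (intro borel_measurable_continuous_onI continuous_circ_compose[OF assms(1)]) (use assms in simp)

text \<open>Dilations are Cauchy in mean square, so along radii approaching 1 fast enough they
  converge almost everywhere, and the Poisson formula passes to the limit by dominated convergence.
  The function \<open>g\<close> comes from one sequence of radii; radial limits only follow
  afterwards, from Fatou's theorem applied to \<open>g\<close>.\<close>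

lemma Hinf_Poisson_representation:
  fixes f :: "complex \<Rightarrow> complex"
  assumes f: "f \<in> Hinf" and B: "\<And>z. z \<in> ball 0 1 \<Longrightarrow> cmod (f z) \<le> B"
  obtains g :: "real \<Rightarrow> complex" where "g \<in> borel_measurable borel" "\<And>t. cmod (g t) \<le> B"
    "\<And>z. cmod z < 1 \<Longrightarrow> (LINT t|circ. of_real (poisson z t) * g t) = 2*pi * f z"
proof -
  note hol = Hinf_holomorphic[OF f]
  note ts = taylor_sums[OF hol]
  have B0: "0 \<le> B" using order_trans[OF norm_ge_zero B[of 0]] by simp
  have cont: "continuous_on A (\<lambda>t. f (of_real r * cis t))" if "0 < r" "r < 1" for r A
    by (rule continuous_circ_compose[OF hol]) (use that in simp)
  have fb: "cmod (f (of_real r * cis t)) \<le> B" if "0 \<le> r" "r < 1" for r t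
    using that by (intro B) (simp add: norm_mult)
  have sa: "summable (\<lambda>n. (cmod (taylor f n))\<^sup>2)"
  proof (rule circ_square_mean_bound(1)[OF ts])
    fix r :: real assume r: "0 \<le> r" "r < 1"
    have c: "continuous_on {0..2*pi} (\<lambda>t. f (of_real r * cis t))"
      by (rule continuous_circ_compose[OF hol]) (use r in simp)
    have "(LINT t|circ. (cmod (f (of_real r * cis t)))\<^sup>2) \<le> (LINT t|circ. B\<^sup>2)"
      using r by (intro integral_mono integrable_circ_continuous continuous_intros c power_mono fb) auto
    then show "(LINT t|circ. (cmod (f (of_real r * cis t)))\<^sup>2) \<le> 2*pi*B\<^sup>2" by simp
  qed
  define E where "E r = (\<Sum>n. (cmod (taylor f n))\<^sup>2 * (1 - r^n)\<^sup>2)" for r :: real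
  have E: "(E \<longlongrightarrow> 0) (at_left 1)"
    unfolding E_def by (rule summable_dominated_tendsto_zero[OF sa]) simp
  \<comment> \<open>Two demands on the radius: it must tend to 1, and its mean-square error must be
    below \<open>(1/4)^k\<close>, which makes the L1 norms of consecutive differences decay like
    \<open>(1/2)^k\<close>.\<close>
  have "\<exists>r. 1 - inverse (real (Suc k)) < r \<and> 0 < r \<and> r < 1 \<and> E r < (1/4)^k" for k
  proof -
    have "\<forall>\<^sub>F r in at_left 1. E r < (1/4)^k" using order_tendstoD(2)[OF E] by simp
    moreover have "\<forall>\<^sub>F r::real in at_left 1. r \<in> {1 - inverse (real (Suc k))<..<1}"
      by (rule eventually_at_leftI[of "1 - inverse (real (Suc k))"]) (auto simp del: of_nat_Suc)
    moreover have "\<forall>\<^sub>F r::real in at_left 1. r \<in> {0<..<1}"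
      by (rule eventually_at_leftI[of 0]) auto
    ultimately have "\<forall>\<^sub>F r in at_left 1. 1 - inverse (real (Suc k)) < r \<and> 0 < r \<and> r < 1 \<and> E r < (1/4)^k"
      by eventually_elim auto
    then show ?thesis by (rule eventually_happens'[OF trivial_limit_at_left_real])
  qed
  then obtain r where r: "\<And>k. 1 - inverse (real (Suc k)) < r k" "\<And>k. 0 < r k" "\<And>k. r k < 1" "\<And>k. E (r k) < (1/4)^k"
    by metis
  have r1: "r \<longlonglongrightarrow> 1"
  proof (rule real_tendsto_sandwich)
    show "(\<lambda>k. 1 - inverse (real (Suc k))) \<longlonglongrightarrow> 1"
      using tendsto_diff[OF tendsto_const LIMSEQ_inverse_real_of_nat, of 1] by simp
  qed (use r in \<open>auto intro!: always_eventually less_imp_le simp del: of_nat_Suc\<close>)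
  define F where "F k t = f (of_real (r k) * cis t)" for k t
  have Fc: "continuous_on {0..2*pi} (F k)" for k unfolding F_def by (intro cont r)
  have dsq: "(LINT t|circ. (cmod (F (Suc k) t - F k t))\<^sup>2) \<le> 8*pi*(1/4)^k" for k
  proof -
    have "(LINT t|circ. (cmod (F (Suc k) t - F k t))\<^sup>2) \<le> 4*pi*(E (r (Suc k)) + E (r k))"
      unfolding F_def E_def by (rule circ_square_dilation_difference[OF ts sa]) (use r in auto)
    also have "\<dots> \<le> 4*pi*((1/4)^k + (1/4)^k)"
    proof -
      have "E (r (Suc k)) \<le> (1/4)^k"
        using r(4)[of "Suc k"] zero_le_power[of "1/4::real" k] unfolding power_Suc by linarith
      then show ?thesis using r(4)[of k] by (intro mult_left_mono add_mono) auto
    qed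
    finally show ?thesis by simp
  qed
  have d1: "(LINT t|circ. cmod (F (Suc k) t - F k t)) \<le> 5*pi*(1/2)^k" for k
  proof -
    have "(LINT t|circ. cmod (F (Suc k) t - F k t)) \<le> (2*pi*(1/2)^k + (LINT t|circ. (cmod (F (Suc k) t - F k t))\<^sup>2) / (1/2)^k) / 2"
      by (rule integral_norm_le_square) (auto intro!: continuous_intros Fc)
    also have "\<dots> \<le> (2*pi*(1/2)^k + 8*pi*(1/4)^k / (1/2)^k) / 2"
      using dsq[of k] by (intro divide_right_mono add_mono) auto
    also have "(1/4::real)^k / (1/2)^k = (1/2)^k" by (simp flip: power_divide)
    then have "(2*pi*(1/2)^k + 8*pi*(1/4)^k / (1/2)^k) / 2 = 5*pi*(1/2)^k" by (simp flip: times_divide_eq_right)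
    finally show ?thesis .
  qed
  have "summable (\<lambda>k. LINT t|circ. cmod (F (Suc k) t - F k t))"
    by (rule summable_comparison_test[of _ "\<lambda>k. 5*pi*(1/2)^k"])
       (use d1 in \<open>auto intro!: summable_mult summable_geometric simp: integral_nonneg_AE\<close>)
  then have conv: "AE t in circ. convergent (\<lambda>k. F k t)" by (rule AE_convergent_of_summable_L1[OF Fc])
  define X where "X t = lim (\<lambda>k. F k t)" for t
  have [measurable]: "F k \<in> borel_measurable borel" for k
    unfolding F_def by (rule measurable_dilation[OF hol]) (use r(2,3)[of k] in simp)
  have [measurable]: "X \<in> borel_measurable borel" unfolding X_def by measurable
  \<comment> \<open>Replaced by 0 on the null set where \<open>X\<close> is too large, so that the
    bound holds for every \<open>t\<close>.\<close>
  define g where "g t = (if cmod (X t) \<le> B then X t else 0)" for t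
  have lim: "AE t in circ. (\<lambda>k. F k t) \<longlonglongrightarrow> g t"
    using conv
  proof eventually_elim
    case (elim t)
    then have l: "(\<lambda>k. F k t) \<longlonglongrightarrow> X t" by (simp add: X_def convergent_LIMSEQ_iff)
    then have "cmod (X t) \<le> B"
      by (rule Lim_bounded[OF tendsto_norm]) (use fb[OF less_imp_le[OF r(2)] r(3)] in \<open>auto simp: F_def\<close>)
    then show ?case using l by (simp add: g_def)
  qed
  show ?thesis
  proof (rule that)
    show gm[measurable]: "g \<in> borel_measurable borel" unfolding g_def by measurable
    show "cmod (g t) \<le> B" for t using B0 by (simp add: g_def)
    fix z :: complex assume z: "cmod z < 1"
    have [measurable]: "poisson z \<in> borel_measurable borel"
      by (rule borel_measurable_continuous_onI[OF continuous_poisson[OF z]])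
    have "(\<lambda>k. LINT t|circ. of_real (poisson z t) * F k t) \<longlonglongrightarrow> (LINT t|circ. of_real (poisson z t) * g t)"
    proof (rule integral_dominated_convergence[where w="\<lambda>t. poisson z t * B"])
      show "integrable circ (\<lambda>t. poisson z t * B)"
        by (intro integrable_circ_continuous continuous_intros continuous_poisson z)
      show "AE t in circ. (\<lambda>k. of_real (poisson z t) * F k t) \<longlonglongrightarrow> of_real (poisson z t) * g t"
        using lim by eventually_elim (intro tendsto_intros)
      show "AE t in circ. norm (of_real (poisson z t) * F k t) \<le> poisson z t * B" for k
        using fb[OF less_imp_le[OF r(2)] r(3)] poisson_nonneg[of z] z
        by (intro AE_I2) (auto simp: norm_mult F_def intro!: mult_left_mono)
    qed measurable
    moreover have "(LINT t|circ. of_real (poisson z t) * F k t) = 2*pi * f (of_real (r k) * z)" for k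
      unfolding F_def by (rule Poisson_formula[OF hol r(2,3) z])
    moreover have "(\<lambda>k. 2*pi * f (of_real (r k) * z)) \<longlonglongrightarrow> 2*pi * f (of_real 1 * z)"
      using z holomorphic_on_imp_continuous_on[OF hol] r1
      by (intro tendsto_intros isCont_tendsto_compose[of _ f]) (auto simp: continuous_on_eq_continuous_at)
    ultimately show "(LINT t|circ. of_real (poisson z t) * g t) = 2*pi * f z"
      by (simp add: LIMSEQ_unique)
  qed
qed

section \<open>Boundary functions along a fixed sequence of radii\<close>

definition radius :: "nat \<Rightarrow> real" where "radius k = 1 - inverse (real (Suc (Suc k)))"

lemma radius: "0 < radius k" "radius k < 1" "radius \<longlonglongrightarrow> 1"
proof -
  have "1 < real (Suc (Suc k))" by simp
  then show "0 < radius k" "radius k < 1" unfolding radius_def by (auto simp: field_simps)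
  have "(\<lambda>k. 1 - inverse (real (Suc (Suc k)))) \<longlonglongrightarrow> 1 - 0"
    by (intro tendsto_intros LIMSEQ_Suc[OF LIMSEQ_inverse_real_of_nat])
  then show "radius \<longlonglongrightarrow> 1" unfolding radius_def by simp
qed

lemma filterlim_radius: "filterlim radius (at_left 1) sequentially"
  unfolding filterlim_at using radius(2,3) by (auto intro!: always_eventually less_imp_neq)

text \<open>A limit along one fixed sequence of radii is measurable in \<open>t\<close> at once, and
  it agrees with \<open>bdry\<close> wherever the radial limit exists.\<close>

definition bval :: "(complex \<Rightarrow> complex) \<Rightarrow> real \<Rightarrow> complex" where
  "bval f t = lim (\<lambda>k. f (of_real (radius k) * cis t))"

lemma bval_eqI:
  assumes "((\<lambda>r. f (of_real r * cis t)) \<longlongrightarrow> l) (at_left 1)"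
  shows "bval f t = l" "bdry f t = l"
proof -
  show "bval f t = l"
    unfolding bval_def by (rule limI) (rule filterlim_compose[OF assms filterlim_radius])
  show "bdry f t = l" unfolding bdry_def using assms by (simp add: tendsto_Lim)
qed

lemma measurable_bval:
  assumes "f holomorphic_on ball 0 1" shows "bval f \<in> borel_measurable borel"
proof -
  have [measurable]: "(\<lambda>t. f (of_real (radius k) * cis t)) \<in> borel_measurable borel" for k
    by (rule measurable_dilation[OF assms]) (use radius(1,2)[of k] in simp)
  show ?thesis unfolding bval_def by measurable
qed

text \<open>Fatou's theorem for the real and imaginary parts of the function \<open>g\<close> that
  represents \<open>f\<close> as a Poisson integral; this also identifies \<open>g\<close> with
  \<open>bval f\<close> almost everywhere.\<close>

theorem Hinf_radial_limit:
  assumes f: "f \<in> Hinf"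
  shows "AE t in circ. ((\<lambda>r. f (of_real r * cis t)) \<longlongrightarrow> bval f t) (at_left 1)"
proof -
  obtain B where B: "\<And>z. z \<in> ball 0 1 \<Longrightarrow> cmod (f z) \<le> B" using Hinf_bound[OF f] by metis
  obtain g where g[measurable]: "g \<in> borel_measurable borel" and gB: "\<And>t. cmod (g t) \<le> B"
    and gP: "\<And>z. cmod z < 1 \<Longrightarrow> (LINT t|circ. of_real (poisson z t) * g t) = 2*pi * f z"
    using Hinf_Poisson_representation[OF f B] by metis
  have ig: "integrable circ g" by (rule integrable_circ_bounded[OF _ gB]) simp
  have eq: "f z = of_real (LINT s|circ. poisson z s * Re (g s)) / (2*pi)
      + \<i> * of_real (LINT s|circ. poisson z s * Im (g s)) / (2*pi)" if z: "cmod z < 1" for z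
  proof -
    have [measurable]: "poisson z \<in> borel_measurable borel"
      by (rule borel_measurable_continuous_onI[OF continuous_poisson[OF z]])
    have "compact (poisson z ` {0..2*pi})"
      by (intro compact_continuous_image continuous_poisson z compact_Icc)
    then obtain b where b: "\<And>t. t \<in> {0..2*pi} \<Longrightarrow> \<bar>poisson z t\<bar> \<le> b"
      by (metis bounded_iff compact_imp_bounded image_eqI real_norm_def)
    have i: "integrable circ (\<lambda>t. of_real (poisson z t) * g t)"
    proof (rule Bochner_Integration.integrable_bound)
      show "integrable circ (\<lambda>t. b * B)" by simp
      show "AE t in circ. norm (complex_of_real (poisson z t) * g t) \<le> norm (b * B)"
        using b gB by (intro AE_I2) (auto simp: norm_mult abs_mult intro!: mult_mono intro: order_trans[OF _ abs_ge_self])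
    qed measurable
    have "2*pi * f z = (LINT t|circ. of_real (poisson z t) * g t)" using gP[OF z] by simp
    also have "\<dots> = of_real (LINT t|circ. Re (of_real (poisson z t) * g t)) + \<i> * of_real (LINT t|circ. Im (of_real (poisson z t) * g t))"
      unfolding integral_Re[OF i] integral_Im[OF i] by (rule complex_eq)
    finally show ?thesis by (simp add: field_simps)
  qed
  have "AE t in circ. ((\<lambda>r. LINT s|circ. poisson (of_real r * cis t) s * Re (g s)) \<longlongrightarrow> 2*pi * Re (g t)) (at_left 1)"
    "AE t in circ. ((\<lambda>r. LINT s|circ. poisson (of_real r * cis t) s * Im (g s)) \<longlongrightarrow> 2*pi * Im (g t)) (at_left 1)"
    using ig by (auto intro!: Fatou)
  then show ?thesis
  proof eventually_elim
    case (elim t)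
    let ?h = "\<lambda>r. of_real (LINT s|circ. poisson (of_real r * cis t) s * Re (g s)) / (2*pi)
      + \<i> * of_real (LINT s|circ. poisson (of_real r * cis t) s * Im (g s)) / (2*pi)"
    have l1: "(?h \<longlongrightarrow> of_real (2*pi * Re (g t)) / (2*pi) + \<i> * of_real (2*pi * Im (g t)) / (2*pi)) (at_left 1)"
      by (intro tendsto_intros elim) auto
    have l2: "of_real (2*pi * Re (g t)) / (2*pi) + \<i> * of_real (2*pi * Im (g t)) / (2*pi) = g t"
      by (simp add: complex_eq_iff)
    have "\<forall>\<^sub>F r::real in at_left 1. r \<in> {0<..<1}"
      by (rule eventually_at_leftI[of 0]) auto
    then have l3: "\<forall>\<^sub>F r in at_left 1. ?h r = f (of_real r * cis t)"
      by eventually_elim (simp add: eq norm_mult)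
    have l: "((\<lambda>r. f (of_real r * cis t)) \<longlongrightarrow> g t) (at_left 1)"
      using Lim_transform_eventually[OF l1 l3] unfolding l2 .
    show ?case using l bval_eqI(1)[OF l] by simp
  qed
qed

lemma measurable_cnj [measurable (raw)]:
  assumes "f \<in> borel_measurable M" shows "(\<lambda>x. cnj (f x)) \<in> borel_measurable M"
  by (rule measurable_compose[OF assms borel_measurable_continuous_onI]) (intro continuous_intros)

lemma Hinf_bval_limit:
  assumes "f \<in> Hinf"
  shows "AE t in circ. (\<lambda>k. f (of_real (radius k) * cis t)) \<longlonglongrightarrow> bval f t"
  using Hinf_radial_limit[OF assms]
  by eventually_elim (rule filterlim_compose[OF _ filterlim_radius])

lemma Hinf_bdry_eq_bval: "f \<in> Hinf \<Longrightarrow> AE t in circ. bdry f t = bval f t"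
  using Hinf_radial_limit[of f] by (auto elim!: eventually_mono dest: bval_eqI(2))

lemma Hinf_bval_bound:
  assumes "f \<in> Hinf" and "\<And>z. z \<in> ball 0 1 \<Longrightarrow> cmod (f z) \<le> B"
  shows "AE t in circ. cmod (bval f t) \<le> B"
  using Hinf_bval_limit[OF assms(1)]
proof eventually_elim
  case (elim t)
  show ?case
    by (rule Lim_bounded[OF tendsto_norm[OF elim]])
       (use radius(1,2) in \<open>auto intro!: assms(2) simp: norm_mult less_imp_le\<close>)
qed

lemma Hinf_bval_eqI:
  assumes "f \<in> Hinf" "AE t in circ. (\<lambda>k. f (of_real (radius k) * cis t)) \<longlonglongrightarrow> l t"
  shows "AE t in circ. bval f t = l t"
  using Hinf_bval_limit[OF assms(1)] assms(2)
  by eventually_elim (rule LIMSEQ_unique)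

lemma Hinf_measurable_bval: "f \<in> Hinf \<Longrightarrow> bval f \<in> borel_measurable borel"
  by (intro measurable_bval Hinf_holomorphic)

lemma Hinf_bval_integral_limit:
  fixes f :: "complex \<Rightarrow> complex"
  assumes f: "f \<in> Hinf" and q[measurable]: "q \<in> borel_measurable circ" and Q: "\<And>t. cmod (q t) \<le> Q"
  shows "(\<lambda>k. LINT t|circ. q t * f (of_real (radius k) * cis t)) \<longlonglongrightarrow> (LINT t|circ. q t * bval f t)"
    and "integrable circ (\<lambda>t. q t * bval f t)"
proof -
  obtain B where B: "0 \<le> B" "\<And>z. z \<in> ball 0 1 \<Longrightarrow> cmod (f z) \<le> B" using Hinf_bound[OF f] by metis
  have Q0: "0 \<le> Q" using order_trans[OF norm_ge_zero Q[of 0]] .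
  have [measurable]: "(\<lambda>t. f (of_real (radius k) * cis t)) \<in> borel_measurable circ" for k
    by (intro measurable_circ measurable_dilation Hinf_holomorphic f) (use radius(1,2)[of k] in simp)
  have [measurable]: "bval f \<in> borel_measurable circ" by (rule measurable_circ[OF Hinf_measurable_bval[OF f]])
  have 1: "(\<lambda>t. q t * bval f t) \<in> borel_measurable circ" by measurable
  have 2: "(\<lambda>t. q t * f (of_real (radius k) * cis t)) \<in> borel_measurable circ" for k by measurable
  have 3: "integrable circ (\<lambda>t. Q * B)" by simp
  have 4: "AE t in circ. (\<lambda>k. q t * f (of_real (radius k) * cis t)) \<longlonglongrightarrow> q t * bval f t"
    using Hinf_bval_limit[OF f] by eventually_elim (intro tendsto_intros)
  have 5: "AE t in circ. norm (q t * f (of_real (radius k) * cis t)) \<le> Q * B" for k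
  proof (intro AE_I2)
    fix t
    have "cmod (f (of_real (radius k) * cis t)) \<le> B"
      using radius(1,2)[of k] by (intro B(2)) (simp add: norm_mult)
    then show "norm (q t * f (of_real (radius k) * cis t)) \<le> Q * B"
      unfolding norm_mult using Q Q0 by (intro mult_mono) auto
  qed
  show "(\<lambda>k. LINT t|circ. q t * f (of_real (radius k) * cis t)) \<longlonglongrightarrow> (LINT t|circ. q t * bval f t)"
    by (rule integral_dominated_convergence[OF 1 2 3 4 5])
  show "integrable circ (\<lambda>t. q t * bval f t)"
    by (rule integrable_dominated_convergence[OF 1 2 3 4 5])
qed

lemma continuous_Cauchy_kernel:
  assumes "cmod w < 1"
  shows "continuous_on A (\<lambda>t. cis t / (cis t - w))"
  using cis_ne[OF assms] by (intro continuous_intros) auto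

lemma norm_Cauchy_kernel_le:
  assumes "cmod w < 1" shows "cmod (cis t / (cis t - w)) \<le> 1 / (1 - cmod w)"
proof -
  have "1 - cmod w \<le> cmod (cis t - w)" using norm_triangle_ineq2[of "cis t" w] by simp
  then show ?thesis using assms by (simp add: norm_divide frac_le)
qed

lemma bval_Cauchy:
  fixes f :: "complex \<Rightarrow> complex"
  assumes f: "f \<in> Hinf" and w: "cmod w < 1"
  shows "(LINT t|circ. bval f t * (cis t / (cis t - w))) = 2*pi * f w"
proof -
  have "(\<lambda>k. LINT t|circ. (cis t / (cis t - w)) * f (of_real (radius k) * cis t)) \<longlonglongrightarrow> (LINT t|circ. (cis t / (cis t - w)) * bval f t)"
    by (rule Hinf_bval_integral_limit(1)[OF f _ norm_Cauchy_kernel_le[OF w]])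
       (intro measurable_circ borel_measurable_continuous_onI continuous_Cauchy_kernel w)
  moreover have "(LINT t|circ. (cis t / (cis t - w)) * f (of_real (radius k) * cis t)) = 2*pi * f (of_real (radius k) * w)" for k
    using circ_Cauchy_scaled[OF Hinf_holomorphic[OF f] radius(1,2) w, of k] by (simp add: mult.commute)
  moreover have "(\<lambda>k. 2*pi * f (of_real (radius k) * w)) \<longlonglongrightarrow> 2*pi * f (of_real 1 * w)"
    using w holomorphic_on_imp_continuous_on[OF Hinf_holomorphic[OF f]] radius(3)
    by (intro tendsto_intros isCont_tendsto_compose[of _ f]) (auto simp: continuous_on_eq_continuous_at)
  ultimately show ?thesis by (simp add: LIMSEQ_unique mult.commute)
qed

lemma Hinf_mult: "f \<in> Hinf \<Longrightarrow> g \<in> Hinf \<Longrightarrow> (\<lambda>z. f z * g z) \<in> Hinf"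
proof -
  assume f: "f \<in> Hinf" and g: "g \<in> Hinf"
  obtain B where B: "0 \<le> B" "\<And>z. z \<in> ball 0 1 \<Longrightarrow> cmod (f z) \<le> B" using Hinf_bound[OF f] by metis
  obtain C where C: "0 \<le> C" "\<And>z. z \<in> ball 0 1 \<Longrightarrow> cmod (g z) \<le> C" using Hinf_bound[OF g] by metis
  have "cmod (f z * g z) \<le> B * C" if "z \<in> ball 0 1" for z
    unfolding norm_mult using that B C by (intro mult_mono) auto
  then have "bounded ((\<lambda>z. f z * g z) ` ball 0 1)" unfolding bounded_iff by blast
  then show ?thesis using f g by (auto simp: Hinf_def intro: holomorphic_intros)
qed

lemma HinfI:
  assumes "f holomorphic_on ball 0 1" "\<And>z. z \<in> ball 0 1 \<Longrightarrow> cmod (f z) \<le> B"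
  shows "f \<in> Hinf"
  using assms unfolding Hinf_def bounded_iff by blast

lemma Hinf_const [simp]: "(\<lambda>z. c) \<in> Hinf"
  by (rule HinfI[where B="cmod c"]) auto

lemma Hinf_bval_eq_continuous:
  assumes f: "f \<in> Hinf" and c: "\<And>t. isCont f (cis t)"
  shows "AE t in circ. bval f t = f (cis t)"
proof (rule Hinf_bval_eqI[OF f], intro AE_I2)
  fix t
  have "(\<lambda>k. of_real (radius k) * cis t) \<longlonglongrightarrow> of_real 1 * cis t" by (intro tendsto_intros radius)
  then show "(\<lambda>k. f (of_real (radius k) * cis t)) \<longlonglongrightarrow> f (cis t)"
    using isCont_tendsto_compose[OF c[of t]] by simp
qed

lemma Hinf_bval_mult:
  assumes "f \<in> Hinf" "g \<in> Hinf"
  shows "AE t in circ. bval (\<lambda>z. f z * g z) t = bval f t * bval g t"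
  by (rule Hinf_bval_eqI[OF Hinf_mult[OF assms]])
     (use Hinf_bval_limit[OF assms(1)] Hinf_bval_limit[OF assms(2)] in \<open>eventually_elim, intro tendsto_intros\<close>)

section \<open>Combinations of Szego kernels\<close>

text \<open>A linear combination of the reproducing kernels of the Hardy space at the points
  \<open>w i\<close>. Pairing \<open>f\<close> with it gives the sum of
  \<open>cnj (c i) * f (w i)\<close>, the quantity that is bounded in the definition of
  \<open>Hb\<close>.\<close>

definition szego :: "nat \<Rightarrow> (nat \<Rightarrow> complex) \<Rightarrow> (nat \<Rightarrow> complex) \<Rightarrow> complex \<Rightarrow> complex" where
  "szego n c w z = (\<Sum>i<n. c i / (1 - cnj (w i) * z))"

lemma one_minus_cnj_mult_ne:
  assumes "cmod w < 1" "cmod z \<le> 1" shows "1 - cnj w * z \<noteq> 0"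
proof
  assume "1 - cnj w * z = 0"
  then have "cmod (cnj w * z) = 1" by simp
  moreover have "cmod w * cmod z \<le> cmod w" using assms by (simp add: mult_left_le)
  ultimately show False using assms by (simp add: norm_mult)
qed

lemma continuous_szego:
  assumes "\<forall>i<n. w i \<in> ball 0 1" shows "continuous_on (cball 0 1) (szego n c w)"
  unfolding szego_def using assms one_minus_cnj_mult_ne by (intro continuous_intros) auto

lemma isCont_szego:
  assumes "\<forall>i<n. w i \<in> ball 0 1" "cmod z \<le> 1" shows "isCont (szego n c w) z"
  unfolding szego_def using assms one_minus_cnj_mult_ne by (intro continuous_intros) auto

lemma szego_Hinf:
  assumes "\<forall>i<n. w i \<in> ball 0 1" shows "szego n c w \<in> Hinf"
proof -
  have "szego n c w holomorphic_on ball 0 1"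
    unfolding szego_def using assms one_minus_cnj_mult_ne by (intro holomorphic_intros) auto
  moreover have "bounded (szego n c w ` ball 0 1)"
    by (rule bounded_subset[OF compact_imp_bounded[OF compact_continuous_image[OF continuous_szego[OF assms] compact_cball]]]) auto
  ultimately show ?thesis by (simp add: Hinf_def)
qed

lemma continuous_szego_cis:
  assumes "\<forall>i<n. w i \<in> ball 0 1" shows "continuous_on A (\<lambda>t. szego n c w (cis t))"
  by (rule continuous_on_compose2[OF continuous_szego[OF assms]]) (auto intro!: continuous_intros)

lemma szego_cis_bound:
  assumes "\<forall>i<n. w i \<in> ball 0 1"
  obtains B where "0 \<le> B" "\<And>t. cmod (szego n c w (cis t)) \<le> B"
proof -
  have "bounded (szego n c w ` cball 0 1)"
    by (rule compact_imp_bounded[OF compact_continuous_image[OF continuous_szego[OF assms] compact_cball]])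
  then obtain B where "\<forall>x\<in>szego n c w ` cball 0 1. cmod x \<le> B" unfolding bounded_iff by blast
  then have "\<And>t. cmod (szego n c w (cis t)) \<le> B" by auto
  then show ?thesis using that[of B] norm_ge_zero order_trans by blast
qed

lemma measurable_szego_cis [measurable]:
  "(\<lambda>t. szego n c w (cis t)) \<in> borel_measurable borel"
  unfolding szego_def by measurable

text \<open>On the circle \<open>cnj (cis t)\<close> is the inverse of \<open>cis t\<close>, which
  turns the conjugate of a Szego kernel into the Cauchy kernel at the same point. Pairings thereby
  reduce to \<open>bval_Cauchy\<close>.\<close>

lemma cnj_szego_cis:
  assumes "\<forall>i<n. w i \<in> ball 0 1"
  shows "cnj (szego n c w (cis t)) = (\<Sum>i<n. cnj (c i) * (cis t / (cis t - w i)))"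
proof -
  have "cnj (c i / (1 - cnj (w i) * cis t)) = cnj (c i) * (cis t / (cis t - w i))" if "i < n" for i
  proof -
    have "cis t * cnj (cis t) = 1" by (simp flip: complex_norm_square)
    then have "cis t * (1 - w i * cnj (cis t)) = cis t - w i" by (simp add: algebra_simps)
    then have "1 / (1 - w i * cnj (cis t)) = cis t / (cis t - w i)"
      by (metis cis_neq_zero mult_divide_mult_cancel_left mult.right_neutral)
    then show ?thesis by (simp add: divide_inverse)
  qed
  then show ?thesis unfolding szego_def cnj_sum by (intro sum.cong) auto
qed

lemma bval_szego_pairing:
  fixes f :: "complex \<Rightarrow> complex"
  assumes f: "f \<in> Hinf" and w: "\<forall>i<n. w i \<in> ball 0 1"
  shows "(LINT t|circ. bval f t * cnj (szego n c w (cis t))) = 2*pi * (\<Sum>i<n. cnj (c i) * f (w i))"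
proof -
  have i: "integrable circ (\<lambda>t. cnj (c i) * (bval f t * (cis t / (cis t - w i))))" if "i < n" for i
  proof -
    have "cmod (w i) < 1" using w that by auto
    note wi = this
    have "integrable circ (\<lambda>t. (cis t / (cis t - w i)) * bval f t)"
      by (rule Hinf_bval_integral_limit(2)[OF f _ norm_Cauchy_kernel_le[OF wi]])
         (intro measurable_circ borel_measurable_continuous_onI continuous_Cauchy_kernel wi)
    then have "integrable circ (\<lambda>t. cnj (c i) * ((cis t / (cis t - w i)) * bval f t))"
      by (rule integrable_mult_right)
    then show ?thesis by (simp only: mult.commute[of "bval f _"])
  qed
  have "(LINT t|circ. bval f t * cnj (szego n c w (cis t))) = (LINT t|circ. (\<Sum>i<n. cnj (c i) * (bval f t * (cis t / (cis t - w i)))))"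
    unfolding cnj_szego_cis[OF w] by (simp add: sum_distrib_left mult_ac)
  also have "\<dots> = (\<Sum>i<n. LINT t|circ. cnj (c i) * (bval f t * (cis t / (cis t - w i))))"
    by (rule Bochner_Integration.integral_sum) (use i in auto)
  also have "\<dots> = (\<Sum>i<n. cnj (c i) * (2*pi * f (w i)))"
    by (intro sum.cong refl, subst integral_mult_right_zero, subst bval_Cauchy[OF f]) (use w in auto)
  finally show ?thesis by (simp add: sum_distrib_left mult_ac)
qed

lemma szego_szego_pairing:
  fixes f :: "complex \<Rightarrow> complex"
  assumes f: "f \<in> Hinf" and w: "\<forall>i<n. w i \<in> ball 0 1" and v: "\<forall>i<m. v i \<in> ball 0 1"
  shows "(LINT t|circ. bval f t * szego m d v (cis t) * cnj (szego n c w (cis t))) = 2*pi * (\<Sum>i<n. cnj (c i) * (f (w i) * szego m d v (w i)))"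
proof -
  have "AE t in circ. bval (\<lambda>z. f z * szego m d v z) t = bval f t * szego m d v (cis t)"
    using Hinf_bval_mult[OF f szego_Hinf[OF v, of d]] Hinf_bval_eq_continuous[OF szego_Hinf[OF v, of d] isCont_szego[OF v]]
    by (auto elim: eventually_elim2)
  then have ae: "AE t in circ. bval f t * szego m d v (cis t) * cnj (szego n c w (cis t)) =
      bval (\<lambda>z. f z * szego m d v z) t * cnj (szego n c w (cis t))" by auto
  have [measurable]: "bval f \<in> borel_measurable borel" "bval (\<lambda>z. f z * szego m d v z) \<in> borel_measurable borel"
    by (intro Hinf_measurable_bval Hinf_mult f szego_Hinf v)+
  have "(LINT t|circ. bval f t * szego m d v (cis t) * cnj (szego n c w (cis t))) =
      (LINT t|circ. bval (\<lambda>z. f z * szego m d v z) t * cnj (szego n c w (cis t)))"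
    by (rule integral_cong_AE[OF _ _ ae]) (rule measurable_circ, measurable)+
  then show ?thesis using bval_szego_pairing[OF Hinf_mult[OF f szego_Hinf[OF v]] w] by simp
qed

lemma szego_norm_square:
  assumes w: "\<forall>i<n. w i \<in> ball 0 1"
  shows "complex_of_real (LINT t|circ. (cmod (szego n c w (cis t)))\<^sup>2) = 2*pi * (\<Sum>i<n. \<Sum>j<n. c i * cnj (c j) / (1 - cnj (w i) * w j))"
proof -
  have "complex_of_real (LINT t|circ. (cmod (szego n c w (cis t)))\<^sup>2) = (LINT t|circ. bval (\<lambda>_. 1) t * szego n c w (cis t) * cnj (szego n c w (cis t)))"
    unfolding integral_complex_of_real[symmetric] complex_norm_square by (simp add: bval_def lim_const)
  also have "\<dots> = 2*pi * (\<Sum>j<n. cnj (c j) * szego n c w (w j))"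
    using szego_szego_pairing[OF Hinf_const w w, of 1 c c] by simp
  also have "(\<Sum>j<n. cnj (c j) * szego n c w (w j)) = (\<Sum>j<n. \<Sum>i<n. c i * cnj (c j) / (1 - cnj (w i) * w j))"
    unfolding szego_def sum_distrib_left by (simp add: mult.commute)
  also have "\<dots> = (\<Sum>i<n. \<Sum>j<n. c i * cnj (c j) / (1 - cnj (w i) * w j))" by (rule sum.swap)
  finally show ?thesis .
qed

text \<open>The combination with coefficients \<open>c i * cnj (b (w i))\<close> is the image of
  \<open>szego n c w\<close> under the adjoint of multiplication by \<open>b\<close>. So this is the
  quadratic form of the identity minus \<open>T_b\<close> times its adjoint, evaluated at
  \<open>szego n c w\<close>.\<close>

lemma kb_gram:
  assumes w: "\<forall>i<n. w i \<in> ball 0 1"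
  shows "2*pi * Re (\<Sum>i<n. \<Sum>j<n. c i * cnj (c j) * kb b (w i) (w j)) =
    (LINT t|circ. (cmod (szego n c w (cis t)))\<^sup>2) - (LINT t|circ. (cmod (szego n (\<lambda>i. c i * cnj (b (w i))) w (cis t)))\<^sup>2)"
proof -
  have "2*pi * (\<Sum>i<n. \<Sum>j<n. c i * cnj (c j) * kb b (w i) (w j)) =
     2*pi * (\<Sum>i<n. \<Sum>j<n. c i * cnj (c j) / (1 - cnj (w i) * w j)) -
     2*pi * (\<Sum>i<n. \<Sum>j<n. (c i * cnj (b (w i))) * cnj (c j * cnj (b (w j))) / (1 - cnj (w i) * w j))"
    unfolding right_diff_distrib[symmetric] sum_subtractf[symmetric] kb_def
    by (simp add: diff_divide_distrib algebra_simps)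
  also have "\<dots> = complex_of_real ((LINT t|circ. (cmod (szego n c w (cis t)))\<^sup>2) - (LINT t|circ. (cmod (szego n (\<lambda>i. c i * cnj (b (w i))) w (cis t)))\<^sup>2))"
    unfolding of_real_diff szego_norm_square[OF w] ..
  finally have "Re (complex_of_real (2*pi) * (\<Sum>i<n. \<Sum>j<n. c i * cnj (c j) * kb b (w i) (w j))) =
     (LINT t|circ. (cmod (szego n c w (cis t)))\<^sup>2) - (LINT t|circ. (cmod (szego n (\<lambda>i. c i * cnj (b (w i))) w (cis t)))\<^sup>2)"
    by (metis Re_complex_of_real)
  then show ?thesis by simp
qed

text \<open>\<open>G\<close> is the image of \<open>szego n c w\<close> under the adjoint of
  multiplication by \<open>f\<close>; moving the multiplication across the pairing leaves the
  squared norm of \<open>G\<close>.\<close>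

lemma szego_multiplier_pairing:
  fixes f :: "complex \<Rightarrow> complex" and c w :: "nat \<Rightarrow> complex"
  assumes f: "f \<in> Hinf" and w: "\<forall>i<n. w i \<in> ball 0 1"
  defines "G \<equiv> szego n (\<lambda>i. c i * cnj (f (w i))) w"
  shows "(LINT t|circ. bval f t * G (cis t) * cnj (szego n c w (cis t))) = of_real (LINT t|circ. (cmod (G (cis t)))\<^sup>2)"
proof -
  have "complex_of_real (LINT t|circ. (cmod (G (cis t)))\<^sup>2) = (LINT t|circ. bval (\<lambda>_. 1) t * G (cis t) * cnj (G (cis t)))"
    unfolding integral_complex_of_real[symmetric] complex_norm_square by (simp add: bval_def lim_const)
  also have "\<dots> = 2*pi * (\<Sum>j<n. cnj (c j) * (f (w j) * G (w j)))"
    unfolding G_def by (subst szego_szego_pairing[OF Hinf_const w w]) (simp add: mult_ac)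
  also have "\<dots> = (LINT t|circ. bval f t * G (cis t) * cnj (szego n c w (cis t)))"
    unfolding G_def by (subst szego_szego_pairing[OF f w w]) simp
  finally show ?thesis by simp
qed

text \<open>Pythagoras: \<open>G\<close> is the analytic part of \<open>cnj f * F\<close>, and the
  integrand on the left is the squared modulus of the remainder \<open>cnj f * F - G\<close>, up to
  conjugation.\<close>

lemma szego_multiplier_norm:
  fixes f :: "complex \<Rightarrow> complex" and c w :: "nat \<Rightarrow> complex"
  assumes f: "f \<in> Hinf" and w: "\<forall>i<n. w i \<in> ball 0 1"
  defines "G \<equiv> szego n (\<lambda>i. c i * cnj (f (w i))) w" and "F \<equiv> szego n c w"
  shows "(LINT t|circ. (cmod (bval f t * cnj (F (cis t)) - cnj (G (cis t))))\<^sup>2) =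
      (LINT t|circ. (cmod (bval f t))\<^sup>2 * (cmod (F (cis t)))\<^sup>2) - (LINT t|circ. (cmod (G (cis t)))\<^sup>2)"
    and "integrable circ (\<lambda>t. (cmod (bval f t))\<^sup>2 * (cmod (F (cis t)))\<^sup>2)"
    and "integrable circ (\<lambda>t. (cmod (bval f t * cnj (F (cis t)) - cnj (G (cis t))))\<^sup>2)"
proof -
  obtain B where B: "0 \<le> B" "\<And>z. z \<in> ball 0 1 \<Longrightarrow> cmod (f z) \<le> B" using Hinf_bound[OF f] by metis
  obtain BF where BF: "0 \<le> BF" "\<And>t. cmod (F (cis t)) \<le> BF" unfolding F_def using szego_cis_bound[OF w] by metis
  obtain BG where BG: "0 \<le> BG" "\<And>t. cmod (G (cis t)) \<le> BG" unfolding G_def using szego_cis_bound[OF w] by metis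
  have [measurable]: "bval f \<in> borel_measurable borel" by (rule Hinf_measurable_bval[OF f])
  have [measurable]: "(\<lambda>t. F (cis t)) \<in> borel_measurable borel" "(\<lambda>t. G (cis t)) \<in> borel_measurable borel"
    unfolding F_def G_def by measurable
  have bb: "AE t in circ. cmod (bval f t) \<le> B" by (rule Hinf_bval_bound[OF f B(2)])
  have i1: "integrable circ (\<lambda>t. (cmod (bval f t))\<^sup>2 * (cmod (F (cis t)))\<^sup>2)"
  proof (rule circ.integrable_const_bound)
    show "AE t in circ. norm ((cmod (bval f t))\<^sup>2 * (cmod (F (cis t)))\<^sup>2) \<le> B\<^sup>2 * BF\<^sup>2"
      using bb by eventually_elim (use B BF in \<open>auto intro!: mult_mono power_mono\<close>)
  qed (rule measurable_circ, measurable)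
  then show "integrable circ (\<lambda>t. (cmod (bval f t))\<^sup>2 * (cmod (F (cis t)))\<^sup>2)" .
  have i2: "integrable circ (\<lambda>t. (cmod (G (cis t)))\<^sup>2)"
    unfolding G_def by (intro integrable_circ_continuous continuous_intros continuous_szego_cis w)
  have i3: "integrable circ (\<lambda>t. bval f t * G (cis t) * cnj (F (cis t)))"
  proof (rule circ.integrable_const_bound)
    show "AE t in circ. norm (bval f t * G (cis t) * cnj (F (cis t))) \<le> B * BG * BF"
      using bb by eventually_elim (use B BF BG in \<open>auto intro!: mult_mono simp: norm_mult\<close>)
  qed (rule measurable_circ, measurable)
  have pt: "(cmod (bval f t * cnj (F (cis t)) - cnj (G (cis t))))\<^sup>2 =
      (cmod (bval f t))\<^sup>2 * (cmod (F (cis t)))\<^sup>2 + (cmod (G (cis t)))\<^sup>2 - 2 * Re (bval f t * G (cis t) * cnj (F (cis t)))" for t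
  proof -
    have "(cmod (u - cnj v))\<^sup>2 = (cmod u)\<^sup>2 + (cmod v)\<^sup>2 - 2 * Re (u * v)" for u v
      by (simp only: cmod_power2) (simp add: power2_eq_square algebra_simps)
    from this[of "bval f t * cnj (F (cis t))" "G (cis t)"] show ?thesis
      by (simp add: norm_mult power_mult_distrib mult_ac)
  qed
  have i4: "integrable circ (\<lambda>t. 2 * Re (bval f t * G (cis t) * cnj (F (cis t))))"
    using i3 by (intro integrable_mult_right integrable_Re)
  show "integrable circ (\<lambda>t. (cmod (bval f t * cnj (F (cis t)) - cnj (G (cis t))))\<^sup>2)"
    unfolding pt by (intro Bochner_Integration.integrable_diff Bochner_Integration.integrable_add i1 i2 i4)
  have "(LINT t|circ. (cmod (bval f t * cnj (F (cis t)) - cnj (G (cis t))))\<^sup>2) =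
      (LINT t|circ. (cmod (bval f t))\<^sup>2 * (cmod (F (cis t)))\<^sup>2) + (LINT t|circ. (cmod (G (cis t)))\<^sup>2)
      - (LINT t|circ. 2 * Re (bval f t * G (cis t) * cnj (F (cis t))))"
    unfolding pt
    by (subst Bochner_Integration.integral_diff, intro Bochner_Integration.integrable_add i1 i2, rule i4,
        subst Bochner_Integration.integral_add[OF i1 i2]) (rule refl)
  also have "(LINT t|circ. 2 * Re (bval f t * G (cis t) * cnj (F (cis t)))) = 2 * Re (LINT t|circ. bval f t * G (cis t) * cnj (F (cis t)))"
    by (subst integral_mult_right_zero, subst integral_Re[OF i3]) (rule refl)
  also have "\<dots> = 2 * (LINT t|circ. (cmod (G (cis t)))\<^sup>2)"
    unfolding F_def G_def by (subst szego_multiplier_pairing[OF f w]) simp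
  finally show "(LINT t|circ. (cmod (bval f t * cnj (F (cis t)) - cnj (G (cis t))))\<^sup>2) =
      (LINT t|circ. (cmod (bval f t))\<^sup>2 * (cmod (F (cis t)))\<^sup>2) - (LINT t|circ. (cmod (G (cis t)))\<^sup>2)" by simp
qed

section \<open>Outer functions\<close>

definition herglotz :: "(real \<Rightarrow> real) \<Rightarrow> complex \<Rightarrow> complex" where
  "herglotz h z = (LINT t|circ. (cis t + z) / (cis t - z) * of_real (h t))"

text \<open>Geometric expansion of the Cauchy kernel. Its purpose is analyticity of Cauchy
  transforms of integrable functions, which a power series shows at once.\<close>

lemma Cauchy_transform_sums:
  fixes h :: "real \<Rightarrow> complex"
  assumes h: "integrable circ h" and z: "cmod z < 1"
  shows "(\<lambda>n. (LINT t|circ. cnj (cis t) ^ n * h t) * z ^ n) sums (LINT t|circ. cis t / (cis t - z) * h t)"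
proof -
  have [measurable]: "h \<in> borel_measurable circ" using h by (rule borel_measurable_integrable)
  have [measurable]: "(\<lambda>t. cnj (cis t) ^ n) \<in> borel_measurable circ" for n
    by (rule measurable_circ) measurable
  have i: "integrable circ (\<lambda>t. cnj (cis t) ^ n * h t)" for n
    by (rule Bochner_Integration.integrable_bound[OF h]) (auto simp: norm_mult norm_power)
  have g: "(\<lambda>n. cnj (cis t) ^ n * h t * z ^ n) sums (cis t / (cis t - z) * h t)" for t
  proof -
    have "cmod (cnj (cis t) * z) < 1" using z by (simp add: norm_mult)
    then have "(\<lambda>n. (cnj (cis t) * z) ^ n) sums (1 / (1 - cnj (cis t) * z))" by (rule geometric_sums)
    moreover have "1 / (1 - cnj (cis t) * z) = cis t / (cis t - z)"
    proof -
      have "cis t * cnj (cis t) = 1" by (simp flip: complex_norm_square)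
      then have "cis t * (1 - cnj (cis t) * z) = cis t - z"
        by (simp add: right_diff_distrib flip: mult.assoc)
      then show ?thesis by (metis cis_neq_zero mult_divide_mult_cancel_left mult.right_neutral)
    qed
    ultimately have "(\<lambda>n. (cnj (cis t) * z) ^ n * h t) sums (cis t / (cis t - z) * h t)"
      by (simp only: sums_mult2)
    then show ?thesis by (simp add: power_mult_distrib mult_ac)
  qed
  have "(\<lambda>n. LINT t|circ. cnj (cis t) ^ n * h t * z ^ n) sums (LINT t|circ. (\<Sum>n. cnj (cis t) ^ n * h t * z ^ n))"
  proof (rule sums_integral)
    show "integrable circ (\<lambda>t. cnj (cis t) ^ n * h t * z ^ n)" for n
      using i by (rule integrable_mult_left)
    have s: "summable (\<lambda>n. cmod z ^ n)" using z by (simp add: summable_geometric)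
    then show "AE t in circ. summable (\<lambda>n. norm (cnj (cis t) ^ n * h t * z ^ n))"
      by (intro AE_I2) (simp add: norm_mult norm_power summable_mult)
    show "summable (\<lambda>n. LINT t|circ. norm (cnj (cis t) ^ n * h t * z ^ n))"
      using summable_mult[OF s, of "LINT t|circ. cmod (h t)"] by (simp add: norm_mult norm_power)
  qed
  moreover have "(LINT t|circ. cnj (cis t) ^ n * h t * z ^ n) = (LINT t|circ. cnj (cis t) ^ n * h t) * z ^ n" for n
    by (rule integral_mult_left_zero)
  moreover have "(\<Sum>n. cnj (cis t) ^ n * h t * z ^ n) = cis t / (cis t - z) * h t" for t
    using g[of t] by (rule sums_unique[symmetric])
  ultimately show ?thesis by simp
qed

lemma integrable_circ_mult_continuous:
  fixes h :: "real \<Rightarrow> complex"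
  assumes h: "integrable circ h" and q: "continuous_on UNIV q"
  shows "integrable circ (\<lambda>t. q t * h t)"
proof -
  have [measurable]: "h \<in> borel_measurable circ" using h by (rule borel_measurable_integrable)
  have [measurable]: "q \<in> borel_measurable circ" by (intro measurable_circ borel_measurable_continuous_onI q)
  have "compact (q ` {0..2*pi})"
    by (intro compact_continuous_image compact_Icc continuous_on_subset[OF q]) simp
  then obtain B where "\<forall>x\<in>q ` {0..2*pi}. cmod x \<le> B" using compact_imp_bounded bounded_iff by metis
  then have B: "\<And>t. t \<in> {0..2*pi} \<Longrightarrow> cmod (q t) \<le> \<bar>B\<bar>" using abs_ge_self order_trans by blast
  show ?thesis
  proof (rule Bochner_Integration.integrable_bound)
    show "integrable circ (\<lambda>t. of_real B * h t)" using h by simp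
    show "AE t in circ. norm (q t * h t) \<le> norm (of_real B * h t)"
      using B by (intro AE_I2) (auto simp: norm_mult intro!: mult_right_mono)
  qed measurable
qed

lemma continuous_herglotz_kernel:
  assumes "cmod z < 1" shows "continuous_on A (\<lambda>t. (cis t + z) / (cis t - z))"
  using cis_ne[OF assms] by (intro continuous_intros) auto

lemma herglotz_integrable:
  assumes "integrable circ h" "cmod z < 1"
  shows "integrable circ (\<lambda>t. (cis t + z) / (cis t - z) * complex_of_real (h t))"
  using assms by (intro integrable_circ_mult_continuous continuous_herglotz_kernel) auto

text \<open>The Herglotz kernel is twice the Cauchy kernel minus 1.\<close>

lemma herglotz_holomorphic:
  assumes h: "integrable circ h" shows "herglotz h holomorphic_on ball 0 1"
proof -
  have h': "integrable circ (\<lambda>t. complex_of_real (h t))" using h by simp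
  let ?C = "\<lambda>z. LINT t|circ. cis t / (cis t - z) * complex_of_real (h t)"
  have "?C holomorphic_on ball 0 1"
    by (rule power_series_holomorphic_ball[OF Cauchy_transform_sums[OF h']]) simp
  then have "(\<lambda>z. 2 * ?C z - (LINT t|circ. complex_of_real (h t))) holomorphic_on ball 0 1"
    by (intro holomorphic_intros)
  moreover have "2 * ?C z - (LINT t|circ. complex_of_real (h t)) = herglotz h z" if "z \<in> ball 0 1" for z
  proof -
    have z: "cmod z < 1" using that by simp
    have i: "integrable circ (\<lambda>t. cis t / (cis t - z) * complex_of_real (h t))"
      by (rule integrable_circ_mult_continuous[OF h' continuous_Cauchy_kernel[OF z]])
    have "(cis t + z) / (cis t - z) * of_real (h t) = 2 * (cis t / (cis t - z) * of_real (h t)) - of_real (h t)" for t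
    proof -
      have "(cis t + z) / (cis t - z) = 2 * (cis t / (cis t - z)) - 1"
        using cis_ne[OF z, of t] by (simp add: field_simps)
      then show ?thesis by (simp only: left_diff_distrib) simp
    qed
    then have "herglotz h z = (LINT t|circ. 2 * (cis t / (cis t - z) * of_real (h t)) - of_real (h t))"
      unfolding herglotz_def by presburger
    also have "\<dots> = (LINT t|circ. 2 * (cis t / (cis t - z) * complex_of_real (h t))) - (LINT t|circ. complex_of_real (h t))"
      by (rule Bochner_Integration.integral_diff[OF integrable_mult_right[OF i] h'])
    finally show ?thesis by (simp only: integral_mult_right_zero)
  qed
  ultimately show ?thesis by (rule holomorphic_transform)
qed

lemma Re_herglotz_kernel:
  assumes "cmod z < 1" shows "Re ((cis t + z) / (cis t - z)) = poisson z t"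
proof -
  have "(cis t + z) / (cis t - z) = (cis t + z) * cnj (cis t - z) / of_real ((cmod (cis t - z))\<^sup>2)"
    using cis_ne[OF assms, of t] unfolding complex_norm_square by simp
  then have "Re ((cis t + z) / (cis t - z)) = Re ((cis t + z) * cnj (cis t - z)) / (cmod (cis t - z))\<^sup>2"
    by (metis Re_divide_of_real)
  also have "Re ((cis t + z) * cnj (cis t - z)) = (cmod (cis t))\<^sup>2 - (cmod z)\<^sup>2"
    unfolding cmod_power2 by (simp add: power2_eq_square algebra_simps)
  finally show ?thesis by (simp add: poisson_def)
qed

lemma Re_herglotz:
  assumes h: "integrable circ h" and z: "cmod z < 1"
  shows "Re (herglotz h z) = (LINT t|circ. poisson z t * h t)"
proof -
  have "Re ((cis t + z) / (cis t - z) * complex_of_real (h t)) = poisson z t * h t" for t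
    by (simp only: times_complex.sel(1) Re_complex_of_real Im_complex_of_real Re_herglotz_kernel[OF z] mult_zero_right diff_zero)
  then show ?thesis
    unfolding herglotz_def integral_Re[OF herglotz_integrable[OF h z], symmetric] by presburger
qed

text \<open>The real part of the Herglotz integral is the Poisson integral of \<open>h\<close>. It
  is nonnegative in the disk, hence \<open>|A| \<le> 1\<close>, and by Fatou's theorem its radial
  limits are \<open>2 * pi * h t\<close>.\<close>

lemma exp_herglotz_Hinf:
  assumes h: "integrable circ h" and h0: "\<And>t. 0 \<le> h t"
  defines "A \<equiv> \<lambda>z. exp (- (herglotz h z / (2*pi)))"
  shows "A \<in> Hinf" "AE t in circ. cmod (bval A t) = exp (- h t)"
proof -
  have nA: "cmod (A z) = exp (- ((LINT t|circ. poisson z t * h t) / (2*pi)))" if "cmod z < 1" for z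
    unfolding A_def norm_exp_eq_Re using Re_herglotz[OF h that] by simp
  show A: "A \<in> Hinf"
  proof (rule HinfI[where B=1])
    show "A holomorphic_on ball 0 1"
      unfolding A_def by (intro holomorphic_intros herglotz_holomorphic h) auto
    fix z :: complex assume "z \<in> ball 0 1"
    then have z: "cmod z < 1" by simp
    then have "0 \<le> (LINT t|circ. poisson z t * h t)"
      using poisson_nonneg[of z] h0 by (intro integral_nonneg_AE) auto
    then show "cmod (A z) \<le> 1" unfolding nA[OF z] by simp
  qed
  show "AE t in circ. cmod (bval A t) = exp (- h t)"
    using Hinf_radial_limit[OF A] Fatou[OF h]
  proof eventually_elim
    case (elim t)
    have "((\<lambda>r. exp (- ((LINT s|circ. poisson (of_real r * cis t) s * h s) / (2*pi)))) \<longlongrightarrow> exp (- (2*pi * h t / (2*pi)))) (at_left 1)"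
      by (intro tendsto_intros elim) auto
    moreover have "\<forall>\<^sub>F r::real in at_left 1. r \<in> {0<..<1}"
      by (rule eventually_at_leftI[of 0]) auto
    then have "\<forall>\<^sub>F r in at_left 1. exp (- ((LINT s|circ. poisson (of_real r * cis t) s * h s) / (2*pi))) = cmod (A (of_real r * cis t))"
      by eventually_elim (subst nA, auto simp: norm_mult)
    ultimately have "((\<lambda>r. cmod (A (of_real r * cis t))) \<longlongrightarrow> exp (- (2*pi * h t / (2*pi)))) (at_left 1)"
      by (rule Lim_transform_eventually)
    moreover have "((\<lambda>r. cmod (A (of_real r * cis t))) \<longlongrightarrow> cmod (bval A t)) (at_left 1)"
      by (intro tendsto_intros elim)
    ultimately show ?case using tendsto_unique[OF trivial_limit_at_left_real] by fastforce
  qed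
qed

text \<open>The maximum principle for outer functions. Since \<open>bdry\<close> is arbitrary where
  no limit exists, \<open>a\<close> is first written as a quotient of two bounded functions whose
  denominator has nonzero boundary values almost everywhere. So \<open>a\<close> has radial limits
  of modulus \<open>exp (h t)\<close>; the hypothesis then says \<open>h \<le> 0\<close> almost
  everywhere, and the Poisson integral of \<open>h\<close> inherits the sign.\<close>

theorem outer_bounded_of_boundary_bound:
  fixes a :: "complex \<Rightarrow> complex"
  assumes a: "outer a" and b: "AE t in circ. cmod (bdry a t) \<le> 1"
  shows "a \<in> Hinf" "\<And>z. cmod z < 1 \<Longrightarrow> cmod (a z) \<le> 1"
proof -
  obtain c h where c: "cmod c = 1" and h0: "set_integrable lborel {0..2*pi} (h :: real \<Rightarrow> real)"
    and ah: "\<forall>z\<in>ball 0 1. a z = c * exp ((1 / (2 * pi)) *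
         (LBINT t=0..2*pi. (cis t + z) / (cis t - z) * of_real (h t)))"
    using a unfolding outer_def by blast
  have h: "integrable circ h"
    using h0 unfolding circ_def set_integrable_def by (subst integrable_restrict_space) auto
  have az: "a z = c * exp (herglotz h z / (2*pi))" if "cmod z < 1" for z
    using ah that unfolding herglotz_def interval_integral_circ by simp
  define hp where "hp t = max 0 (h t)" for t
  define hm where "hm t = max 0 (- h t)" for t
  have hp: "integrable circ hp" "\<And>t. 0 \<le> hp t" and hm: "integrable circ hm" "\<And>t. 0 \<le> hm t"
    using h by (auto simp: hp_def[abs_def] hm_def[abs_def])
  have hpm: "h t = hp t - hm t" for t by (auto simp: hp_def hm_def)
  define Ap where "Ap = (\<lambda>z. exp (- (herglotz hp z / (2*pi))))"
  define Am where "Am = (\<lambda>z. exp (- (herglotz hm z / (2*pi))))"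
  note P = exp_herglotz_Hinf[OF hp, folded Ap_def] and M = exp_herglotz_Hinf[OF hm, folded Am_def]
  have aA: "a z = c * (Am z / Ap z)" if z: "cmod z < 1" for z
  proof -
    have "herglotz h z = herglotz hp z - herglotz hm z"
      unfolding herglotz_def hpm of_real_diff right_diff_distrib
      by (rule Bochner_Integration.integral_diff[OF herglotz_integrable[OF hp(1) z] herglotz_integrable[OF hm(1) z]])
    then show ?thesis unfolding az[OF z] Ap_def Am_def
      by (simp add: exp_diff[symmetric] diff_divide_distrib)
  qed
  have hle: "AE t in circ. h t \<le> 0"
    using b Hinf_radial_limit[OF P(1)] Hinf_radial_limit[OF M(1)] P(2) M(2)
  proof eventually_elim
    case (elim t)
    have "bval Ap t \<noteq> 0" using elim(4) by auto
    then have "((\<lambda>r. c * (Am (of_real r * cis t) / Ap (of_real r * cis t))) \<longlongrightarrow> c * (bval Am t / bval Ap t)) (at_left 1)"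
      by (intro tendsto_intros elim)
    moreover have "\<forall>\<^sub>F r::real in at_left 1. r \<in> {0<..<1}"
      by (rule eventually_at_leftI[of 0]) auto
    then have "\<forall>\<^sub>F r in at_left 1. c * (Am (of_real r * cis t) / Ap (of_real r * cis t)) = a (of_real r * cis t)"
      by eventually_elim (subst aA, auto simp: norm_mult)
    ultimately have "((\<lambda>r. a (of_real r * cis t)) \<longlongrightarrow> c * (bval Am t / bval Ap t)) (at_left 1)"
      by (rule Lim_transform_eventually)
    from bval_eqI(2)[OF this] have "cmod (bdry a t) = exp (- hm t) / exp (- hp t)"
      using elim c by (simp add: norm_mult norm_divide)
    also have "\<dots> = exp (h t)" by (simp add: hpm exp_minus exp_diff field_simps)
    finally show ?case using elim(1) by simp
  qed
  have le: "(LINT t|circ. poisson z t * h t) \<le> 0" if "cmod z < 1" for z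
  proof -
    have "0 \<le> (LINT t|circ. - (poisson z t * h t))"
      using hle poisson_nonneg[of z] that
      by (intro integral_nonneg_AE) (auto elim!: eventually_mono simp: mult_nonneg_nonpos)
    then show ?thesis by simp
  qed
  show B: "cmod (a z) \<le> 1" if "cmod z < 1" for z
    unfolding az[OF that] using le[OF that] Re_herglotz[OF h that] c by (simp add: norm_mult divide_nonpos_pos)
  show "a \<in> Hinf"
  proof (rule HinfI)
    have "(\<lambda>z. c * exp (herglotz h z / (2*pi))) holomorphic_on ball 0 1"
      by (intro holomorphic_intros herglotz_holomorphic h) auto
    then show "a holomorphic_on ball 0 1" by (rule holomorphic_transform) (simp add: az)
  qed (use B in auto)
qed

section \<open>Area integrals over the disk\<close>

lemma lborel_complex_eq: "lborel = distr (lborel \<Otimes>\<^sub>M lborel) borel (\<lambda>(x, y). Complex x y)"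
proof (rule lborel_eqI)
  have m: "(\<lambda>(x, y). Complex x y) \<in> borel_measurable (lborel \<Otimes>\<^sub>M lborel)"
    by (simp add: Complex_eq split_beta')
  fix l u :: complex
  assume le: "\<And>b. b \<in> Basis \<Longrightarrow> l \<bullet> b \<le> u \<bullet> b"
  then have le': "Re l \<le> Re u" "Im l \<le> Im u" using le[of 1] le[of \<i>] by (auto simp: Basis_complex_def)
  have "emeasure (distr (lborel \<Otimes>\<^sub>M lborel) borel (\<lambda>(x, y). Complex x y)) (box l u) =
      emeasure (lborel \<Otimes>\<^sub>M lborel) ({Re l<..<Re u} \<times> {Im l<..<Im u})"
    by (subst emeasure_distr[OF m])
       (auto intro!: arg_cong[where f="emeasure _"] simp: box_def Basis_complex_def space_pair_measure)
  also have "\<dots> = ennreal (Re u - Re l) * ennreal (Im u - Im l)"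
    using le' by (subst lborel.emeasure_pair_measure_Times) auto
  also have "\<dots> = (\<Prod>b\<in>Basis. (u - l) \<bullet> b)"
    using le' by (simp add: Basis_complex_def ennreal_mult)
  finally show "emeasure (distr (lborel \<Otimes>\<^sub>M lborel) borel (\<lambda>(x, y). Complex x y)) (box l u) = (\<Prod>b\<in>Basis. (u - l) \<bullet> b)" .
qed simp

lemma nn_integral_complex:
  fixes f :: "complex \<Rightarrow> ennreal"
  assumes [measurable]: "f \<in> borel_measurable borel"
  shows "(\<integral>\<^sup>+z. f z \<partial>lborel) = (\<integral>\<^sup>+x. \<integral>\<^sup>+y. f (Complex x y) \<partial>lborel \<partial>lborel)"
proof -
  have m: "(\<lambda>(x, y). Complex x y) \<in> borel_measurable (lborel \<Otimes>\<^sub>M lborel)"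
    by (simp add: Complex_eq split_beta')
  have "(\<integral>\<^sup>+z. f z \<partial>lborel) = (\<integral>\<^sup>+p. f (case p of (x, y) \<Rightarrow> Complex x y) \<partial>(lborel \<Otimes>\<^sub>M lborel))"
    by (subst lborel_complex_eq, subst nn_integral_distr[OF m]) auto
  also have "\<dots> = (\<integral>\<^sup>+x. \<integral>\<^sup>+y. f (Complex x y) \<partial>lborel \<partial>lborel)"
    using lborel.nn_integral_fst[of "\<lambda>p. f (case p of (x, y) \<Rightarrow> Complex x y)" lborel] measurable_compose[OF m assms]
    by simp
  finally show ?thesis .
qed

lemma nn_integral_complex_swap:
  fixes f :: "complex \<Rightarrow> ennreal"
  assumes [measurable]: "f \<in> borel_measurable borel"
  shows "(\<integral>\<^sup>+z. f z \<partial>lborel) = (\<integral>\<^sup>+y. \<integral>\<^sup>+x. f (Complex x y) \<partial>lborel \<partial>lborel)"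
proof -
  have m: "(\<lambda>(x, y). Complex x y) \<in> borel_measurable (lborel \<Otimes>\<^sub>M lborel)"
    by (simp add: Complex_eq split_beta')
  have m2: "(\<lambda>(x, y). f (Complex x y)) \<in> borel_measurable (lborel \<Otimes>\<^sub>M lborel)"
    using measurable_compose[OF m assms] by (simp add: split_beta')
  show ?thesis unfolding nn_integral_complex[OF assms] by (rule lborel_pair.Fubini'[OF m2, symmetric])
qed

lemma nn_integral_real_shift:
  fixes f :: "real \<Rightarrow> ennreal"
  assumes [measurable]: "f \<in> borel_measurable borel"
  shows "(\<integral>\<^sup>+x. f (x + c) \<partial>lborel) = (\<integral>\<^sup>+x. f x \<partial>lborel)"
  using nn_integral_real_affine[OF assms, of 1 c] by (simp add: add.commute)

lemma nn_integral_shear_x: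
  fixes f :: "complex \<Rightarrow> ennreal"
  assumes [measurable]: "f \<in> borel_measurable borel"
  shows "(\<integral>\<^sup>+z. f (Complex (Re z + a * Im z) (Im z)) \<partial>lborel) = (\<integral>\<^sup>+z. f z \<partial>lborel)"
proof -
  have [measurable]: "(\<lambda>z. Complex (Re z + a * Im z) (Im z)) \<in> borel_measurable borel"
    by (simp add: Complex_eq)
  have [measurable]: "(\<lambda>x. Complex x y) \<in> borel_measurable borel" for y by (simp add: Complex_eq)
  have "(\<integral>\<^sup>+z. f (Complex (Re z + a * Im z) (Im z)) \<partial>lborel) = (\<integral>\<^sup>+y. \<integral>\<^sup>+x. f (Complex (x + a * y) y) \<partial>lborel \<partial>lborel)"
    by (subst nn_integral_complex_swap) auto
  also have "\<dots> = (\<integral>\<^sup>+y. \<integral>\<^sup>+x. f (Complex x y) \<partial>lborel \<partial>lborel)"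
    by (subst nn_integral_real_shift) auto
  also have "\<dots> = (\<integral>\<^sup>+z. f z \<partial>lborel)" by (subst nn_integral_complex_swap) auto
  finally show ?thesis .
qed

lemma nn_integral_shear_y:
  fixes f :: "complex \<Rightarrow> ennreal"
  assumes [measurable]: "f \<in> borel_measurable borel"
  shows "(\<integral>\<^sup>+z. f (Complex (Re z) (Im z + a * Re z)) \<partial>lborel) = (\<integral>\<^sup>+z. f z \<partial>lborel)"
proof -
  have [measurable]: "(\<lambda>z. Complex (Re z) (Im z + a * Re z)) \<in> borel_measurable borel"
    by (simp add: Complex_eq)
  have [measurable]: "(\<lambda>y. Complex x y) \<in> borel_measurable borel" for x by (simp add: Complex_eq)
  have "(\<integral>\<^sup>+z. f (Complex (Re z) (Im z + a * Re z)) \<partial>lborel) = (\<integral>\<^sup>+x. \<integral>\<^sup>+y. f (Complex x (y + a * x)) \<partial>lborel \<partial>lborel)"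
    by (subst nn_integral_complex) auto
  also have "\<dots> = (\<integral>\<^sup>+x. \<integral>\<^sup>+y. f (Complex x y) \<partial>lborel \<partial>lborel)"
    by (subst nn_integral_real_shift) auto
  also have "\<dots> = (\<integral>\<^sup>+z. f z \<partial>lborel)" by (subst nn_integral_complex) auto
  finally show ?thesis .
qed

text \<open>A rotation by an angle other than \<open>\<pi>\<close> is a product of three shears.\<close>

lemma nn_integral_rotation:
  fixes f :: "complex \<Rightarrow> ennreal"
  assumes f[measurable]: "f \<in> borel_measurable borel" and c: "cos (t/2) \<noteq> 0"
  shows "(\<integral>\<^sup>+z. f (cis t * z) \<partial>lborel) = (\<integral>\<^sup>+z. f z \<partial>lborel)"
proof -
  define T where "T = - tan (t/2)"
  have s: "sin t = 2 * sin (t/2) * cos (t/2)" using sin_double[of "t/2"] by simp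
  have co: "cos t = (cos (t/2))\<^sup>2 - (sin (t/2))\<^sup>2" using cos_double[of "t/2"] by simp
  have id: "(cos (t/2))\<^sup>2 + (sin (t/2))\<^sup>2 = 1" by simp
  have e1: "1 + T * sin t = cos t"
  proof -
    have "T * sin t = - 2 * (sin (t/2))\<^sup>2" using c by (simp add: T_def tan_def s power2_eq_square)
    then show ?thesis using co id by linarith
  qed
  have e2: "T + T * cos t = - sin t"
  proof -
    have "1 + cos t = 2 * (cos (t/2))\<^sup>2" using co id by linarith
    then have "T * (1 + cos t) = T * (2 * (cos (t/2))\<^sup>2)" by simp
    also have "\<dots> = - sin t" using c by (simp add: T_def tan_def s power2_eq_square)
    finally show ?thesis by (simp add: distrib_left)
  qed
  let ?X = "\<lambda>z. Complex (Re z + T * Im z) (Im z)" and ?Y = "\<lambda>z. Complex (Re z) (Im z + sin t * Re z)"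
  have [measurable]: "?X \<in> borel_measurable borel" "?Y \<in> borel_measurable borel"
    by (simp_all add: Complex_eq)
  have "cis t * z = ?X (?Y (?X z))" for z
  proof (rule complex_eqI)
    have "Re (?X (?Y (?X z))) = (1 + T * sin t) * Re z + (T + T * (1 + T * sin t)) * Im z" by (simp add: algebra_simps)
    also have "\<dots> = cos t * Re z - sin t * Im z" unfolding e1 e2 by simp
    finally show "Re (cis t * z) = Re (?X (?Y (?X z)))" by simp
    have "Im (?X (?Y (?X z))) = sin t * Re z + (1 + T * sin t) * Im z" by (simp add: algebra_simps)
    also have "\<dots> = sin t * Re z + cos t * Im z" unfolding e1 by simp
    finally show "Im (cis t * z) = Im (?X (?Y (?X z)))" by simp
  qed
  then have "(\<integral>\<^sup>+z. f (cis t * z) \<partial>lborel) = (\<integral>\<^sup>+z. f (?X (?Y (?X z))) \<partial>lborel)" by simp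
  also have "\<dots> = (\<integral>\<^sup>+z. f (?X (?Y z)) \<partial>lborel)"
    by (rule nn_integral_shear_x[of "\<lambda>z. f (?X (?Y z))" T]) measurable
  also have "\<dots> = (\<integral>\<^sup>+z. f (?X z) \<partial>lborel)"
    by (rule nn_integral_shear_y[of "\<lambda>z. f (?X z)" "sin t"]) measurable
  also have "\<dots> = (\<integral>\<^sup>+z. f z \<partial>lborel)" by (rule nn_integral_shear_x[OF f])
  finally show ?thesis .
qed

text \<open>Averaging over rotations takes the place of polar coordinates: with the distribution of
  \<open>|z|^2\<close> on the disk it reduces area integrals to means over circles. The angle
  \<open>pi\<close>, excluded from the factorisation into shears, is a null set.\<close>

lemma nn_integral_circ_average:
  fixes f :: "complex \<Rightarrow> ennreal"
  assumes f[measurable]: "f \<in> borel_measurable borel"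
  shows "(\<integral>\<^sup>+z. (\<integral>\<^sup>+t. f (z * cis t) \<partial>circ) \<partial>lborel) = ennreal (2*pi) * (\<integral>\<^sup>+z. f z \<partial>lborel)"
proof -
  interpret P: pair_sigma_finite "lborel :: complex measure" circ
    by (intro pair_sigma_finite.intro lborel.sigma_finite_measure_axioms circ.sigma_finite_measure_axioms)
  have id: "(\<lambda>t. t) \<in> borel_measurable circ" by (rule measurable_circ) simp
  have [measurable]: "(\<lambda>p. cis (snd p)) \<in> borel_measurable ((lborel::complex measure) \<Otimes>\<^sub>M circ)"
    using measurable_compose[OF measurable_snd measurable_circ[OF measurable_cis]] .
  have m: "(\<lambda>(z, t). f (z * cis t)) \<in> borel_measurable (lborel \<Otimes>\<^sub>M circ)"
    unfolding split_beta' by measurable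
  have "(\<integral>\<^sup>+z. (\<integral>\<^sup>+t. f (z * cis t) \<partial>circ) \<partial>lborel) = (\<integral>\<^sup>+t. (\<integral>\<^sup>+z. f (z * cis t) \<partial>lborel) \<partial>circ)"
    by (rule P.Fubini'[OF m, symmetric])
  also have "\<dots> = (\<integral>\<^sup>+t. (\<integral>\<^sup>+z. f z \<partial>lborel) \<partial>circ)"
  proof (rule nn_integral_cong_AE)
    have "cos (t/2) \<noteq> 0" if "t \<in> {0..2*pi}" "t \<noteq> pi" for t
    proof (cases "t < pi")
      case True
      then show ?thesis using cos_gt_zero_pi[of "t/2"] that by auto
    next
      case False
      then have "cos (pi - t/2) > 0" using that by (intro cos_gt_zero_pi) auto
      then show ?thesis by simp
    qed
    then show "AE t in circ. (\<integral>\<^sup>+z. f (z * cis t) \<partial>lborel) = (\<integral>\<^sup>+z. f z \<partial>lborel)"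
      unfolding AE_circ_iff using AE_lborel_singleton[of pi]
      by (auto elim!: eventually_mono simp: mult.commute[of _ "cis _"] intro!: nn_integral_rotation[OF f])
  qed
  also have "\<dots> = ennreal (2*pi) * (\<integral>\<^sup>+z. f z \<partial>lborel)"
    using emeasure_circ by (simp add: mult.commute)
  finally show ?thesis .
qed

section \<open>Radial weights on the disk\<close>

lemma emeasure_ball_complex: "0 \<le> r \<Longrightarrow> emeasure lborel (ball (0::complex) r) = ennreal (pi * r\<^sup>2)"
  and emeasure_cball_complex: "0 \<le> r \<Longrightarrow> emeasure lborel (cball (0::complex) r) = ennreal (pi * r\<^sup>2)"
  by (simp_all add: emeasure_ball emeasure_cball unit_ball_vol_2)

lemma measurable_ident_scale_restrict:
  "(\<lambda>s. s) \<in> borel_measurable (scale_measure r (restrict_space lborel S))"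
  by (subst measurable_cong_sets[OF sets_scale_measure refl], rule measurable_restrict_space1) simp

text \<open>The disk of radius \<open>sqrt s\<close> has area \<open>pi * s\<close>, so
  \<open>|z|^2\<close> is distributed over the unit interval with constant density
  \<open>pi\<close>.\<close>

lemma distr_norm_square_disk:
  "distr (restrict_space lborel (ball (0::complex) 1)) borel (\<lambda>z. (cmod z)\<^sup>2)
    = distr (scale_measure (ennreal pi) (restrict_space lborel {0<..<1::real})) borel (\<lambda>s. s)" (is "?M = ?N")
proof (rule measure_eqI_lessThan)
  have eM: "emeasure ?M {x<..} = (if x < 1 then ennreal (pi * (1 - max 0 x)) else 0)" for x
  proof -
    have m: "(\<lambda>z. (cmod z)\<^sup>2) \<in> borel_measurable (restrict_space lborel (ball (0::complex) 1))"
      by (intro measurable_restrict_space1) measurable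
    have "emeasure ?M {x<..} = emeasure lborel {z\<in>ball (0::complex) 1. x < (cmod z)\<^sup>2}"
      by (subst emeasure_distr[OF m], simp, subst emeasure_restrict_space)
         (auto intro!: arg_cong[where f="emeasure _"] simp: space_restrict_space)
    also have "\<dots> = (if x < 1 then ennreal (pi * (1 - max 0 x)) else 0)"
    proof (cases "0 \<le> x")
      case True
      show ?thesis
      proof (cases "x < 1")
        case x1: True
        have "x < (cmod z)\<^sup>2 \<longleftrightarrow> sqrt x < cmod z" for z :: complex
          using real_sqrt_less_iff[of x "(cmod z)\<^sup>2"] by simp
        then have "{z\<in>ball (0::complex) 1. x < (cmod z)\<^sup>2} = {z\<in>ball 0 1. sqrt x < cmod z}" by (simp only:)
        also have "\<dots> = ball 0 1 - cball 0 (sqrt x)" by auto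
        finally have "{z\<in>ball (0::complex) 1. x < (cmod z)\<^sup>2} = ball 0 1 - cball 0 (sqrt x)" .
        moreover have "emeasure lborel (ball (0::complex) 1 - cball 0 (sqrt x)) = ennreal (pi * 1\<^sup>2) - ennreal (pi * (sqrt x)\<^sup>2)"
          using True x1 real_sqrt_lt_1_iff[of x] emeasure_ball_complex[of 1] emeasure_cball_complex[of "sqrt x"]
          by (subst emeasure_Diff) (auto simp del: real_sqrt_lt_1_iff)
        ultimately show ?thesis using True x1 by (simp add: ennreal_minus algebra_simps)
      next
        case False
        then have "{z\<in>ball (0::complex) 1. x < (cmod z)\<^sup>2} = {}"
        proof -
          have "(cmod z)\<^sup>2 \<le> 1" if "z \<in> ball 0 1" for z :: complex
            using that by (intro power_le_one) auto
          with False show ?thesis by force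
        qed
        with False show ?thesis by (simp only: emeasure_empty if_False)
      qed
    next
      case False
      then have "{z\<in>ball (0::complex) 1. x < (cmod z)\<^sup>2} = ball 0 1"
        by (auto intro: less_le_trans[OF _ zero_le_power2])
      then show ?thesis using False emeasure_ball_complex[of 1] by simp
    qed
    finally show ?thesis .
  qed
  have eN: "emeasure ?N {x<..} = (if x < 1 then ennreal (pi * (1 - max 0 x)) else 0)" for x
  proof -
    have m: "(\<lambda>s. s) \<in> borel_measurable (scale_measure (ennreal pi) (restrict_space lborel {0<..<1::real}))"
      by (rule measurable_ident_scale_restrict)
    have "emeasure ?N {x<..} = ennreal pi * emeasure lborel {s\<in>{0<..<1}. x < s}"
      by (subst emeasure_distr[OF m], simp, simp, subst emeasure_restrict_space)
         (auto intro!: arg_cong[where f="\<lambda>A. ennreal pi * emeasure _ A"] simp: space_restrict_space space_scale_measure)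
    also have "{s\<in>{0<..<1}. x < s} = {max 0 x<..<1}" by auto
    also have "ennreal pi * emeasure lborel {max 0 x<..<1} = (if x < 1 then ennreal (pi * (1 - max 0 x)) else 0)"
      by (auto simp: emeasure_lborel_Ioo ennreal_mult max_def)
    finally show ?thesis .
  qed
  show "emeasure ?M {x<..} = emeasure ?N {x<..}" for x unfolding eM eN ..
  show "emeasure ?M {x<..} < \<infinity>" for x unfolding eM by simp
qed auto

lemma nn_integral_radial:
  fixes g :: "real \<Rightarrow> ennreal"
  assumes g[measurable]: "g \<in> borel_measurable borel"
  shows "(\<integral>\<^sup>+z\<in>ball 0 1. g ((cmod z)\<^sup>2) \<partial>lborel) = ennreal pi * (\<integral>\<^sup>+s\<in>{0<..<1}. g s \<partial>lborel)"
proof -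
  have "(\<integral>\<^sup>+z\<in>ball (0::complex) 1. g ((cmod z)\<^sup>2) \<partial>lborel) = (\<integral>\<^sup>+z. g ((cmod z)\<^sup>2) \<partial>restrict_space lborel (ball (0::complex) 1))"
    by (simp add: nn_integral_restrict_space)
  also have "\<dots> = (\<integral>\<^sup>+s. g s \<partial>distr (restrict_space lborel (ball (0::complex) 1)) borel (\<lambda>z. (cmod z)\<^sup>2))"
    by (subst nn_integral_distr) (auto intro: measurable_restrict_space1)
  also have "\<dots> = (\<integral>\<^sup>+s. g s \<partial>scale_measure (ennreal pi) (restrict_space lborel {0<..<1::real}))"
    unfolding distr_norm_square_disk
    by (subst nn_integral_distr[OF measurable_ident_scale_restrict]) auto
  also have "\<dots> = ennreal pi * (\<integral>\<^sup>+s. g s \<partial>restrict_space lborel {0<..<1::real})"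
    by (rule nn_integral_scale_measure) (simp add: measurable_restrict_space1)
  finally show ?thesis by (simp add: nn_integral_restrict_space)
qed

lemma nn_integral_disk_weight:
  "(\<integral>\<^sup>+z\<in>ball (0::complex) 1. ennreal ((1 - (cmod z)\<^sup>2) * (cmod z)^(2*n)) \<partial>lborel) = ennreal (pi / ((n+1)*(n+2)))"
proof -
  let ?F = "\<lambda>s::real. s^(n+1) / (n+1) - s^(n+2) / (n+2)"
  have "(\<integral>\<^sup>+s\<in>{0<..<1}. ennreal ((1 - s) * s^n) \<partial>lborel) = (\<integral>\<^sup>+s. ennreal ((1 - s) * s^n) * indicator {0..1} s \<partial>lborel)"
    by (rule nn_integral_cong_AE) (use AE_lborel_singleton[of 0] AE_lborel_singleton[of "1::real"] in \<open>eventually_elim, auto simp: indicator_def\<close>)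
  also have "\<dots> = ennreal (?F 1 - ?F 0)"
  proof (rule nn_integral_FTC_Icc)
    fix s :: real assume s: "s \<in> {0..1}"
    have "((\<lambda>s. s^Suc k / Suc k) has_real_derivative s^k) (at s)" for k
      using DERIV_cdivide[OF DERIV_pow[of "Suc k" s], of "real (Suc k)"] by (simp del: of_nat_Suc)
    from DERIV_diff[OF this[of n] this[of "Suc n"]]
    show "(?F has_real_derivative (1 - s) * s^n) (at s)"
      by (simp add: algebra_simps)
    show "0 \<le> (1 - s) * s^n" using s by simp
  qed auto
  also have "?F 1 - ?F 0 = 1 / ((n+1)*(n+2))" by (simp add: field_simps)
  finally have e: "(\<integral>\<^sup>+s\<in>{0<..<1}. ennreal ((1 - s) * s^n) \<partial>lborel) = ennreal (1 / ((n+1)*(n+2)))" .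
  have "(\<integral>\<^sup>+z\<in>ball (0::complex) 1. ennreal ((1 - (cmod z)\<^sup>2) * (cmod z)^(2*n)) \<partial>lborel) =
     (\<integral>\<^sup>+z\<in>ball (0::complex) 1. ennreal ((1 - (cmod z)\<^sup>2) * ((cmod z)\<^sup>2)^n) \<partial>lborel)"
    by (simp add: power_mult)
  also have "\<dots> = ennreal pi * ennreal (1 / ((n+1)*(n+2)))"
    by (subst nn_integral_radial[of "\<lambda>s. ennreal ((1 - s) * s^n)"]) (simp_all only: e, measurable)
  finally show ?thesis by (simp flip: ennreal_mult')
qed

text \<open>By rotation invariance \<open>|q|^2\<close> may be replaced by its means over circles,
  which Parseval turns into a power series in \<open>|z|^2\<close>; the weight is then integrated
  against each power separately.\<close>

lemma nn_integral_disk_power_series: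
  fixes q :: "complex \<Rightarrow> complex" and a :: "nat \<Rightarrow> complex"
  assumes q: "\<And>w. w \<in> ball 0 1 \<Longrightarrow> (\<lambda>n. a n * w^n) sums q w"
  shows "(\<integral>\<^sup>+z\<in>ball 0 1. ennreal ((1 - (cmod z)\<^sup>2) * (cmod (q z))\<^sup>2) \<partial>lborel) =
    (\<Sum>n. ennreal (pi * (cmod (a n))\<^sup>2 / ((n+1)*(n+2))))"
proof -
  note hol = power_series_holomorphic_ball[OF q]
  define f where "f z = ennreal ((1 - (cmod z)\<^sup>2) * (cmod (q z))\<^sup>2) * indicator (ball 0 1) z" for z
  have "(\<lambda>z. indicator (ball 0 1) z *\<^sub>R ((1 - (cmod z)\<^sup>2) * (cmod (q z))\<^sup>2)) \<in> borel_measurable borel"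
    by (intro borel_measurable_continuous_on_indicator continuous_intros holomorphic_on_imp_continuous_on[OF hol]) auto
  then have "(\<lambda>z. ennreal (indicator (ball 0 1) z *\<^sub>R ((1 - (cmod z)\<^sup>2) * (cmod (q z))\<^sup>2))) \<in> borel_measurable borel"
    by measurable
  moreover have "ennreal (indicator (ball 0 1) z *\<^sub>R ((1 - (cmod z)\<^sup>2) * (cmod (q z))\<^sup>2)) = f z" for z
    by (simp add: f_def indicator_def)
  ultimately have f[measurable]: "f \<in> borel_measurable borel" by simp
  have av: "(\<integral>\<^sup>+t. f (z * cis t) \<partial>circ) =
      (\<Sum>n. ennreal (2*pi*(cmod (a n))\<^sup>2) * (ennreal ((1 - (cmod z)\<^sup>2) * (cmod z)^(2*n)) * indicator (ball 0 1) z))" for z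
  proof (cases "z \<in> ball 0 1")
    case True
    then have z: "cmod z < 1" by simp
    have w: "0 \<le> 1 - (cmod z)\<^sup>2" using z by (simp add: power_le_one)
    have c: "continuous_on {0..2*pi} (\<lambda>t. q (z * cis t))" by (rule continuous_circ_compose[OF hol z])
    have S: "(\<lambda>n. (1 - (cmod z)\<^sup>2) * (2*pi * ((cmod (a n))\<^sup>2 * (cmod z)^(2*n)))) sums ((1 - (cmod z)\<^sup>2) * (LINT t|circ. (cmod (q (z * cis t)))\<^sup>2))"
      by (rule sums_mult[OF circ_Parseval[OF q z]])
    have "(\<integral>\<^sup>+t. f (z * cis t) \<partial>circ) = (\<integral>\<^sup>+t. ennreal ((1 - (cmod z)\<^sup>2) * (cmod (q (z * cis t)))\<^sup>2) \<partial>circ)"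
      using True by (simp add: f_def norm_mult)
    also have "\<dots> = ennreal (LINT t|circ. (1 - (cmod z)\<^sup>2) * (cmod (q (z * cis t)))\<^sup>2)"
      using w by (intro nn_integral_eq_integral integrable_circ_continuous continuous_intros c) auto
    also have "(LINT t|circ. (1 - (cmod z)\<^sup>2) * (cmod (q (z * cis t)))\<^sup>2) = (\<Sum>n. (1 - (cmod z)\<^sup>2) * (2*pi * ((cmod (a n))\<^sup>2 * (cmod z)^(2*n))))"
      using sums_unique[OF S] by simp
    also have "ennreal \<dots> = (\<Sum>n. ennreal ((1 - (cmod z)\<^sup>2) * (2*pi * ((cmod (a n))\<^sup>2 * (cmod z)^(2*n)))))"
      using w sums_summable[OF S] by (intro suminf_ennreal2[symmetric]) auto
    also have "\<dots> = (\<Sum>n. ennreal (2*pi*(cmod (a n))\<^sup>2) * (ennreal ((1 - (cmod z)\<^sup>2) * (cmod z)^(2*n)) * indicator (ball 0 1) z))"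
      using True w by (simp add: mult_ac flip: ennreal_mult'')
    finally show ?thesis .
  next
    case False
    then show ?thesis by (simp add: f_def norm_mult)
  qed
  have "ennreal (2*pi) * (\<integral>\<^sup>+z. f z \<partial>lborel) =
     (\<integral>\<^sup>+z. (\<Sum>n. ennreal (2*pi*(cmod (a n))\<^sup>2) * (ennreal ((1 - (cmod z)\<^sup>2) * (cmod z)^(2*n)) * indicator (ball 0 1) z)) \<partial>lborel)"
    unfolding nn_integral_circ_average[OF f, symmetric] av ..
  also have "\<dots> = (\<Sum>n. ennreal (2*pi*(cmod (a n))\<^sup>2) * (\<integral>\<^sup>+z\<in>ball (0::complex) 1. ennreal ((1 - (cmod z)\<^sup>2) * (cmod z)^(2*n)) \<partial>lborel))"
  proof -
    have [measurable]: "ball (0::complex) 1 \<in> sets borel" by simp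
    have [measurable]: "(\<lambda>z::complex. ennreal ((1 - (cmod z)\<^sup>2) * (cmod z)^(2*n)) * indicator (ball 0 1) z) \<in> borel_measurable lborel" for n
      by measurable
    show ?thesis
      by (subst nn_integral_suminf) (auto simp: nn_integral_cmult)
  qed
  also have "\<dots> = (\<Sum>n. ennreal (2*pi) * ennreal (pi * (cmod (a n))\<^sup>2 / ((n+1)*(n+2))))"
    unfolding nn_integral_disk_weight by (simp add: mult_ac flip: ennreal_mult')
  also have "\<dots> = ennreal (2*pi) * (\<Sum>n. ennreal (pi * (cmod (a n))\<^sup>2 / ((n+1)*(n+2))))"
    by (rule ennreal_suminf_cmult)
  finally have "(\<integral>\<^sup>+z. f z \<partial>lborel) = (\<Sum>n. ennreal (pi * (cmod (a n))\<^sup>2 / ((n+1)*(n+2))))"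
    by (subst (asm) ennreal_mult_cancel_left) auto
  then show ?thesis by (simp add: f_def)
qed

section \<open>Local Dirichlet integrals\<close>

lemma taylor_deriv: "taylor (deriv f) n = of_nat (Suc n) * taylor f (Suc n)"
  unfolding taylor_def by (simp add: funpow_Suc_right field_simps del: funpow.simps of_nat_Suc)

lemma norm_cnj_unit_minus:
  assumes "cmod \<zeta> = 1" shows "cmod (1 - cnj \<zeta> * z) = cmod (z - \<zeta>)"
proof -
  have "\<zeta> * cnj \<zeta> = 1" using assms by (simp flip: complex_norm_square)
  then have "\<zeta> * (1 - cnj \<zeta> * z) = \<zeta> - z" by (simp add: right_diff_distrib flip: mult.assoc)
  then show ?thesis using assms by (metis mult_1 norm_minus_commute norm_mult)
qed

text \<open>For \<open>\<phi> k = taylor f k * \<zeta>^k\<close> these are, up to the unimodular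
  factor \<open>\<zeta>^(n+1)\<close>, the Taylor coefficients of
  \<open>deriv f z / (1 - cnj \<zeta> * z)\<close>.\<close>

definition wsum :: "(nat \<Rightarrow> complex) \<Rightarrow> nat \<Rightarrow> complex" where
  "wsum \<phi> n = (\<Sum>k\<le>n. of_nat (Suc k) * \<phi> (Suc k))"

definition psum :: "(nat \<Rightarrow> complex) \<Rightarrow> nat \<Rightarrow> complex" where
  "psum \<phi> n = (\<Sum>k\<le>n. \<phi> k)"

text \<open>For a point mass at \<open>\<zeta>\<close> the integrand is
  \<open>(1 - |z|^2) |q z|^2\<close> with \<open>q z = deriv f z / (1 - cnj \<zeta> * z)\<close>,
  and the Taylor coefficients of \<open>q\<close> come from a Cauchy product with the geometric
  series.\<close>

lemma local_Dirichlet_integral: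
  assumes hol: "f holomorphic_on ball 0 1" and \<zeta>: "cmod \<zeta> = 1"
  defines "\<phi> \<equiv> \<lambda>k. taylor f k * \<zeta>^k"
  shows "(\<integral>\<^sup>+ z\<in>ball 0 1. ennreal ((cmod (deriv f z))\<^sup>2) * ennreal ((1 - (cmod z)\<^sup>2) / (cmod (z - \<zeta>))\<^sup>2) \<partial>lborel)
    = (\<Sum>n. ennreal (pi * (cmod (wsum \<phi> n))\<^sup>2 / ((real n+1)*(real n+2))))"
proof -
  define A where "A k = of_nat (Suc k) * taylor f (Suc k)" for k
  define q where "q z = deriv f z / (1 - cnj \<zeta> * z)" for z
  have hd: "deriv f holomorphic_on ball 0 1" by (rule holomorphic_deriv[OF hol]) simp
  have dS: "(\<lambda>n. A n * w^n) sums deriv f w" if "w \<in> ball 0 1" for w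
    using taylor_sums[OF hd that] by (simp only: taylor_deriv A_def)
  define a where "a n = (\<Sum>i\<le>n. A i * cnj \<zeta> ^ (n - i))" for n
  have qS: "(\<lambda>n. a n * w^n) sums q w" if "w \<in> ball 0 1" for w
  proof -
    have w: "cmod w < 1" using that by simp
    have x: "cmod (cnj \<zeta> * w) < 1" using w \<zeta> by (simp add: norm_mult)
    have "(\<lambda>n. \<Sum>i\<le>n. (A i * w^i) * (cnj \<zeta> * w)^(n - i)) sums ((\<Sum>n. A n * w^n) * (\<Sum>n. (cnj \<zeta> * w)^n))"
    proof (rule Cauchy_product_sums)
      show "summable (\<lambda>k. norm (A k * w^k))"
        using power_series_norm_summable[OF dS w] by (simp add: norm_mult norm_power)
      show "summable (\<lambda>k. norm ((cnj \<zeta> * w)^k))"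
        using x by (simp add: norm_power)
    qed
    moreover have "(\<Sum>n. A n * w^n) = deriv f w" using dS[OF that] by (simp add: sums_iff)
    moreover have "(\<Sum>n. (cnj \<zeta> * w)^n) = 1 / (1 - cnj \<zeta> * w)" using x by (rule suminf_geometric)
    moreover have "(\<Sum>i\<le>n. (A i * w^i) * (cnj \<zeta> * w)^(n - i)) = a n * w^n" for n
      unfolding a_def sum_distrib_right
    proof (intro sum.cong refl)
      fix i assume "i \<in> {..n}"
      then have "w^n = w^i * w^(n-i)" by (simp flip: power_add)
      then show "(A i * w^i) * (cnj \<zeta> * w)^(n - i) = A i * cnj \<zeta> ^ (n - i) * w^n"
        by (simp add: power_mult_distrib)
    qed
    ultimately show ?thesis by (simp add: q_def)
  qed
  have na: "cmod (a n) = cmod (wsum \<phi> n)" for n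
  proof -
    have u: "\<zeta> * cnj \<zeta> = 1" using \<zeta> by (simp flip: complex_norm_square)
    have "\<zeta>^Suc n * a n = wsum \<phi> n"
      unfolding a_def wsum_def \<phi>_def sum_distrib_left A_def
    proof (intro sum.cong refl)
      fix i assume "i \<in> {..n}"
      then have "\<zeta>^Suc n = \<zeta>^Suc i * \<zeta>^(n-i)" by (simp flip: power_add)
      moreover have "\<zeta>^Suc i * \<zeta>^(n-i) * (of_nat (Suc i) * taylor f (Suc i) * cnj \<zeta>^(n-i)) =
         of_nat (Suc i) * (taylor f (Suc i) * \<zeta>^Suc i) * (\<zeta> * cnj \<zeta>)^(n-i)"
        by (simp only: power_mult_distrib mult_ac)
      ultimately have "\<zeta>^Suc n * (of_nat (Suc i) * taylor f (Suc i) * cnj \<zeta>^(n-i)) =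
         of_nat (Suc i) * (taylor f (Suc i) * \<zeta>^Suc i) * (\<zeta> * cnj \<zeta>)^(n-i)"
        by (simp only:)
      then show "\<zeta>^Suc n * (of_nat (Suc i) * taylor f (Suc i) * cnj \<zeta>^(n-i)) = of_nat (Suc i) * (taylor f (Suc i) * \<zeta>^Suc i)"
        unfolding u by simp
    qed
    then have "cmod (\<zeta>^Suc n * a n) = cmod (wsum \<phi> n)" by simp
    then show ?thesis using \<zeta> by (simp add: norm_mult norm_power)
  qed
  have "ennreal ((cmod (deriv f z))\<^sup>2) * ennreal ((1 - (cmod z)\<^sup>2) / (cmod (z - \<zeta>))\<^sup>2) = ennreal ((1 - (cmod z)\<^sup>2) * (cmod (q z))\<^sup>2)" for z
    unfolding q_def norm_divide norm_cnj_unit_minus[OF \<zeta>] power_divide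
    by (simp add: mult.commute flip: ennreal_mult')
  then show ?thesis using nn_integral_disk_power_series[OF qS]
    by (simp only: na of_nat_mult of_nat_add of_nat_1 of_nat_numeral)
qed

text \<open>Summation by parts. The constant \<open>c\<close> is free because its
  \<open>n + 1\<close> copies cancel.\<close>

lemma wsum_eq: "wsum \<phi> n = of_nat (Suc n) * (psum \<phi> (Suc n) - c) - (\<Sum>j\<le>n. psum \<phi> j - c)"
proof (induction n)
  case 0
  then show ?case by (simp add: wsum_def psum_def)
next
  case (Suc n)
  have "wsum \<phi> (Suc n) = wsum \<phi> n + of_nat (Suc (Suc n)) * \<phi> (Suc (Suc n))" by (simp add: wsum_def)
  also have "\<phi> (Suc (Suc n)) = psum \<phi> (Suc (Suc n)) - psum \<phi> (Suc n)" by (simp add: psum_def)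
  finally show ?case unfolding Suc by (simp add: algebra_simps)
qed

text \<open>An exact identity that trades the terms of the local Dirichlet integral for the square
  sum of the centred partial sums. The last term is under control for two choices of
  \<open>c\<close>: the mean of the partial sums up to \<open>M\<close>, for which it vanishes, and
  the limit of these means.\<close>

lemma psum_square_sum_identity:
  "(\<Sum>n\<le>M. (cmod (psum \<phi> n - c))\<^sup>2) =
    (\<Sum>n<M. (cmod (wsum \<phi> n))\<^sup>2 / ((real n+1)*(real n+2))) + (cmod (\<Sum>n\<le>M. psum \<phi> n - c))\<^sup>2 / (real M+1)"
proof (induction M)
  case 0
  then show ?case by simp
next
  case (Suc M)
  define u where "u = psum \<phi> (Suc M) - c"
  define T where "T = (\<Sum>n\<le>M. psum \<phi> n - c)"
  define m where "m = real M + 1"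
  have m: "m > 0" by (simp add: m_def)
  have w: "wsum \<phi> M = of_real m * u - T"
    using wsum_eq[of \<phi> M c] by (simp add: u_def T_def m_def)
  \<comment> \<open>The inductive step is this quadratic identity in \<open>u\<close> and
    \<open>T\<close>; the mixed terms cancel.\<close>
  have K: "(cmod (of_real m * u - T))\<^sup>2 / (m * (m+1)) + (cmod (T + u))\<^sup>2 / (m+1) = (cmod u)\<^sup>2 + (cmod T)\<^sup>2 / m"
  proof -
    have "(cmod (of_real m * u - T))\<^sup>2 + m * (cmod (T + u))\<^sup>2 = (m * (m+1)) * (cmod u)\<^sup>2 + (m+1) * (cmod T)\<^sup>2"
      unfolding cmod_power2 by (simp add: power2_eq_square algebra_simps)
    then have "((cmod (of_real m * u - T))\<^sup>2 + m * (cmod (T + u))\<^sup>2) / (m * (m+1)) = ((m * (m+1)) * (cmod u)\<^sup>2 + (m+1) * (cmod T)\<^sup>2) / (m * (m+1))"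
      by simp
    then show ?thesis using m by (simp add: add_divide_distrib)
  qed
  have r: "real (Suc M) + 1 = m + 1" "real M + 2 = m + 1" by (simp_all add: m_def)
  show ?case
    unfolding sum.atMost_Suc sum.lessThan_Suc Suc.IH r w u_def[symmetric] T_def[symmetric] m_def[symmetric]
    using K by linarith
qed

text \<open>Centring at the mean up to \<open>M\<close> removes the last term of
  \<open>psum_square_sum_identity\<close>, which bounds the partial sums of the series by
  \<open>pi * C\<close>.\<close>

lemma local_Dirichlet_finite:
  assumes C: "\<And>M. (\<Sum>n\<le>M. (cmod (psum \<phi> n - (\<Sum>k\<le>M. psum \<phi> k) / (of_nat M + 1)))\<^sup>2) \<le> C"
  shows "(\<Sum>n. ennreal (pi * (cmod (wsum \<phi> n))\<^sup>2 / ((real n+1)*(real n+2)))) < \<infinity>"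
proof -
  have *: "(\<Sum>n<M. pi * (cmod (wsum \<phi> n))\<^sup>2 / ((real n+1)*(real n+2))) \<le> pi * C" for M
  proof -
    let ?c = "(\<Sum>k\<le>M. psum \<phi> k) / (of_nat M + 1)"
    have "(of_nat M + 1 :: complex) \<noteq> 0" by (metis of_nat_Suc of_nat_eq_0_iff nat.distinct(1) add.commute)
    then have "(\<Sum>n\<le>M. psum \<phi> n - ?c) = 0" by (simp add: sum_subtractf add.commute)
    then have "(\<Sum>n<M. (cmod (wsum \<phi> n))\<^sup>2 / ((real n+1)*(real n+2))) \<le> C"
      using psum_square_sum_identity[where c="?c" and \<phi>=\<phi> and M=M] C[of M] by simp
    then show ?thesis by (simp add: mult_left_mono flip: sum_distrib_left times_divide_eq_right)
  qed
  have s: "summable (\<lambda>n. pi * (cmod (wsum \<phi> n))\<^sup>2 / ((real n+1)*(real n+2)))"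
    by (rule bounded_imp_summable[where B="pi*C"]) (use *[of "Suc _"] in \<open>auto simp: lessThan_Suc_atMost\<close>)
  have "(\<Sum>n. ennreal (pi * (cmod (wsum \<phi> n))\<^sup>2 / ((real n+1)*(real n+2)))) \<noteq> top"
    by (rule ennreal_suminf_neq_top[OF s]) simp
  then show ?thesis by (simp add: less_top)
qed

lemma sum_inverse_consecutive:
  "n \<le> m \<Longrightarrow> (\<Sum>k=n..<m. 1 / ((real k+1)*(real k+2))) = 1 / (real n+1) - 1 / (real m+1)"
proof (induction m rule: dec_induct)
  case (step m)
  have "1 / ((real m+1)*(real m+2)) = 1 / (real m+1) - 1 / (real m+2)" by (simp add: field_simps)
  then show ?case using step by (simp add: add.commute)
qed simp

text \<open>The constant \<open>c\<close> is the limit of the Cesaro means \<open>\<tau>\<close> of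
  the partial sums. Their increments are \<open>wsum \<phi> n\<close> over
  \<open>(n + 1) (n + 2)\<close>, and Cauchy-Schwarz with a telescoping sum gives
  \<open>|\<tau> m - \<tau> n|^2 \<le> E / (n + 1)\<close>: just the rate that bounds the last term
  of \<open>psum_square_sum_identity\<close>.\<close>

lemma local_Dirichlet_square_summable:
  assumes fin: "(\<Sum>n. ennreal (pi * (cmod (wsum \<phi> n))\<^sup>2 / ((real n+1)*(real n+2)))) < \<infinity>"
  obtains c C where "\<And>M. (\<Sum>n\<le>M. (cmod (psum \<phi> n - c))\<^sup>2) \<le> C"
proof -
  define e where "e n = (cmod (wsum \<phi> n))\<^sup>2 / ((real n+1)*(real n+2))" for n
  have e0: "0 \<le> e n" for n by (simp add: e_def)
  have "summable (\<lambda>n. pi * e n)"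
    by (rule summable_suminf_not_top) (use fin in \<open>auto simp: e_def less_top\<close>)
  then have es: "summable e" using summable_mult[of "\<lambda>n. pi * e n" "1/pi"] by simp
  define E where "E = suminf e"
  define \<tau> where "\<tau> n = (\<Sum>j\<le>n. psum \<phi> j) / (of_nat n + 1)" for n
  have n1: "(of_nat n + 1 :: complex) \<noteq> 0" for n by (metis of_nat_Suc of_nat_eq_0_iff nat.distinct(1) add.commute)
  have n2: "(of_nat n + 2 :: complex) \<noteq> 0" for n using n1[of "Suc n"] by (simp add: add.commute)
  have d: "\<tau> (Suc n) - \<tau> n = wsum \<phi> n / ((of_nat n+1)*(of_nat n+2))" for n
  proof -
    have "wsum \<phi> n = (of_nat n + 1) * psum \<phi> (Suc n) - (\<Sum>j\<le>n. psum \<phi> j)"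
      using wsum_eq[of \<phi> n 0] by (simp add: add.commute)
    then show ?thesis using n1[of n] n2[of n]
      by (simp add: \<tau>_def divide_simps add.commute) (simp add: algebra_simps)
  qed
  have dist: "(cmod (\<tau> m - \<tau> n))\<^sup>2 \<le> E / (real n+1)" if "n \<le> m" for n m
  proof -
    have "\<tau> m - \<tau> n = (\<Sum>k=n..<m. wsum \<phi> k / ((of_nat k+1)*(of_nat k+2)))"
      using sum_Suc_diff'[OF that, of \<tau>] by (simp only: d)
    then have "cmod (\<tau> m - \<tau> n) \<le> (\<Sum>k=n..<m. cmod (wsum \<phi> k / ((of_nat k+1)*(of_nat k+2))))"
      by (simp only: norm_sum)
    also have "\<dots> = (\<Sum>k=n..<m. sqrt (e k) * sqrt (1 / ((real k+1)*(real k+2))))"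
    proof (intro sum.cong refl)
      fix k
      have "cmod ((of_nat k+1)*(of_nat k+2)) = (real k+1)*(real k+2)"
        using norm_of_nat[of "k+1", where 'a=complex] norm_of_nat[of "k+2", where 'a=complex]
        unfolding norm_mult of_nat_add of_nat_1 of_nat_numeral by presburger
      moreover have "sqrt (e k) * sqrt (1 / ((real k+1)*(real k+2))) = sqrt ((cmod (wsum \<phi> k) / ((real k+1)*(real k+2)))\<^sup>2)"
        unfolding real_sqrt_mult[symmetric] e_def by (simp add: power2_eq_square)
      ultimately show "cmod (wsum \<phi> k / ((of_nat k+1)*(of_nat k+2))) = sqrt (e k) * sqrt (1 / ((real k+1)*(real k+2)))"
        by (simp add: norm_divide)
    qed
    finally have "(cmod (\<tau> m - \<tau> n))\<^sup>2 \<le> (\<Sum>k=n..<m. sqrt (e k) * sqrt (1 / ((real k+1)*(real k+2))))\<^sup>2"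
      by (rule power_mono) simp
    also have "\<dots> \<le> (\<Sum>k=n..<m. (sqrt (e k))\<^sup>2) * (\<Sum>k=n..<m. (sqrt (1 / ((real k+1)*(real k+2))))\<^sup>2)"
      by (rule Cauchy_Schwarz_ineq_sum)
    also have "\<dots> = (\<Sum>k=n..<m. e k) * (\<Sum>k=n..<m. 1 / ((real k+1)*(real k+2)))"
      using e0 by simp
    also have "\<dots> \<le> E * (1 / (real n+1))"
    proof (rule mult_mono)
      show "(\<Sum>k=n..<m. e k) \<le> E" unfolding E_def by (rule sum_le_suminf[OF es]) (use e0 in auto)
      show "(\<Sum>k=n..<m. 1 / ((real k+1)*(real k+2))) \<le> 1 / (real n+1)"
        unfolding sum_inverse_consecutive[OF that] by simp
      show "0 \<le> E" unfolding E_def by (rule suminf_nonneg[OF es e0])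
      show "0 \<le> (\<Sum>k=n..<m. 1 / ((real k+1)*(real k+2)))" by (intro sum_nonneg) simp
    qed
    finally show ?thesis by simp
  qed
  have "Cauchy \<tau>"
  proof (rule metric_CauchyI)
    fix \<epsilon> :: real assume \<epsilon>: "\<epsilon> > 0"
    obtain N :: nat where N: "E / \<epsilon>\<^sup>2 * 4 < real N" using reals_Archimedean2 by blast
    have half: "cmod (\<tau> m - \<tau> N) < \<epsilon> / 2" if "N \<le> m" for m
    proof -
      have "E * 4 < real N * \<epsilon>\<^sup>2" using N \<epsilon> by (simp add: field_simps)
      also have "\<dots> \<le> (real N + 1) * \<epsilon>\<^sup>2" by (simp add: mult_right_mono)
      finally have "E / (real N + 1) < (\<epsilon>/2)\<^sup>2" by (simp add: field_simps power2_eq_square)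
      then have "(cmod (\<tau> m - \<tau> N))\<^sup>2 < (\<epsilon>/2)\<^sup>2" using dist[OF that] by linarith
      then show ?thesis by (rule power2_less_imp_less) (use \<epsilon> in simp)
    qed
    have "dist (\<tau> m) (\<tau> n) < \<epsilon>" if "N \<le> m" "N \<le> n" for m n
    proof -
      have "dist (\<tau> m) (\<tau> n) \<le> cmod (\<tau> m - \<tau> N) + cmod (\<tau> n - \<tau> N)"
        by (metis dist_norm dist_triangle2)
      then show ?thesis using half[OF that(1)] half[OF that(2)] by simp
    qed
    then show "\<exists>N. \<forall>m\<ge>N. \<forall>n\<ge>N. dist (\<tau> m) (\<tau> n) < \<epsilon>" by blast
  qed
  then obtain c where c: "\<tau> \<longlonglongrightarrow> c" using Cauchy_convergent convergent_def by blast
  have dc: "(cmod (c - \<tau> n))\<^sup>2 \<le> E / (real n+1)" for n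
  proof (rule Lim_bounded)
    show "(\<lambda>m. (cmod (\<tau> m - \<tau> n))\<^sup>2) \<longlonglongrightarrow> (cmod (c - \<tau> n))\<^sup>2" by (intro tendsto_intros c)
    show "\<forall>m\<ge>n. (cmod (\<tau> m - \<tau> n))\<^sup>2 \<le> E / (real n+1)" using dist by blast
  qed
  have "(\<Sum>n\<le>M. (cmod (psum \<phi> n - c))\<^sup>2) \<le> E + E" for M
  proof -
    have "(\<Sum>n\<le>M. psum \<phi> n - c) = (of_nat M + 1) * (\<tau> M - c)"
      using n1[of M] by (simp add: \<tau>_def sum_subtractf right_diff_distrib add.commute)
    moreover have "cmod (of_nat M + 1) = real M + 1" 
      using norm_of_nat[of "Suc M", where 'a=complex] by (simp add: add.commute)
    ultimately have "(cmod (\<Sum>n\<le>M. psum \<phi> n - c))\<^sup>2 / (real M+1) = (real M+1) * (cmod (c - \<tau> M))\<^sup>2"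
      by (simp add: norm_mult power_mult_distrib norm_minus_commute power2_eq_square)
    also have "\<dots> \<le> (real M+1) * (E / (real M+1))" by (intro mult_left_mono dc) simp
    finally have "(cmod (\<Sum>n\<le>M. psum \<phi> n - c))\<^sup>2 / (real M+1) \<le> E" by simp
    moreover have "(\<Sum>n<M. e n) \<le> E" unfolding E_def by (rule sum_le_suminf[OF es]) (use e0 in auto)
    ultimately show ?thesis unfolding psum_square_sum_identity e_def by simp
  qed
  then show ?thesis using that by blast
qed

text \<open>Abel summation writes \<open>f z - c\<close> as \<open>1 - x\<close> times the power
  series of the centred partial sums in \<open>x = cnj \<zeta> * z\<close>. Cauchy-Schwarz against
  the geometric series then produces \<open>1 / sqrt (1 - |z|^2)\<close>.\<close>

lemma power_series_growth_at_boundary_point: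
  fixes f :: "complex \<Rightarrow> complex"
  assumes hol: "f holomorphic_on ball 0 1" and \<zeta>: "cmod \<zeta> = 1"
    and C: "\<And>M. (\<Sum>n\<le>M. (cmod (psum (\<lambda>k. taylor f k * \<zeta>^k) n - c))\<^sup>2) \<le> C"
    and z: "cmod z < 1"
  shows "cmod (f z - c) \<le> sqrt C * (cmod (z - \<zeta>) / sqrt (1 - (cmod z)\<^sup>2))"
proof -
  define \<phi> where "\<phi> k = taylor f k * \<zeta>^k" for k
  define u where "u n = psum \<phi> n - c" for n
  define x where "x = cnj \<zeta> * z"
  have un: "\<zeta> * cnj \<zeta> = 1" using \<zeta> by (simp flip: complex_norm_square)
  have x: "cmod x < 1" "cmod x = cmod z" using z \<zeta> by (simp_all add: x_def norm_mult)
  have C': "(\<Sum>n\<le>M. (cmod (u n))\<^sup>2) \<le> C" for M using C[of M] by (simp add: u_def \<phi>_def[abs_def])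
  have C0: "0 \<le> C" using C'[of 0] by (rule order_trans[rotated]) simp
  have fS: "(\<lambda>n. \<phi> n * x^n) sums f z"
  proof -
    have "\<phi> n * x^n = taylor f n * z^n" for n
    proof -
      have "\<phi> n * x^n = taylor f n * (\<zeta> * cnj \<zeta>)^n * z^n" by (simp add: \<phi>_def x_def power_mult_distrib)
      then show ?thesis unfolding un by simp
    qed
    then show ?thesis using taylor_sums[OF hol, of z] z by simp
  qed
  have abel: "(\<Sum>n\<le>N. \<phi> n * x^n) - c = (1 - x) * (\<Sum>n<N. u n * x^n) + u N * x^N" for N
  proof (induction N)
    case 0
    then show ?case by (simp add: u_def psum_def)
  next
    case (Suc N)
    have us: "u (Suc N) = u N + \<phi> (Suc N)" by (simp add: u_def psum_def)
    show ?case using Suc by (simp add: us algebra_simps)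
  qed
  have geo: "(\<Sum>n<N. (cmod x ^ n)\<^sup>2) \<le> 1 / (1 - (cmod z)\<^sup>2)" for N
  proof -
    have y: "norm ((cmod x)\<^sup>2) < 1" using x by (simp add: abs_square_less_1)
    have "(\<Sum>n<N. (cmod x ^ n)\<^sup>2) = (\<Sum>n<N. ((cmod x)\<^sup>2) ^ n)" by (simp add: power_mult[symmetric] mult.commute)
    also have "\<dots> \<le> (\<Sum>n. ((cmod x)\<^sup>2) ^ n)" by (rule sum_le_suminf) (use y in \<open>auto intro: summable_geometric\<close>)
    also have "\<dots> = 1 / (1 - (cmod z)\<^sup>2)" using suminf_geometric[OF y] x by simp
    finally show ?thesis .
  qed
  have bound: "cmod ((\<Sum>n\<le>N. \<phi> n * x^n) - c) \<le> sqrt C * (cmod (z - \<zeta>) / sqrt (1 - (cmod z)\<^sup>2)) + sqrt C * cmod x ^ N" for N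
  proof -
    have "cmod (\<Sum>n<N. u n * x^n) \<le> (\<Sum>n<N. cmod (u n) * cmod x ^ n)"
      using norm_sum[of "\<lambda>n. u n * x^n" "{..<N}"] by (simp add: norm_mult norm_power)
    also have "\<dots> \<le> sqrt ((\<Sum>n<N. (cmod (u n))\<^sup>2) * (\<Sum>n<N. (cmod x ^ n)\<^sup>2))"
      by (rule real_le_rsqrt[OF Cauchy_Schwarz_ineq_sum])
    also have "\<dots> \<le> sqrt (C * (1 / (1 - (cmod z)\<^sup>2)))"
    proof (intro real_sqrt_le_mono mult_mono geo)
      have "(\<Sum>n<N. (cmod (u n))\<^sup>2) \<le> (\<Sum>n\<le>N. (cmod (u n))\<^sup>2)" by (rule sum_mono2) auto
      then show "(\<Sum>n<N. (cmod (u n))\<^sup>2) \<le> C" using C'[of N] by simp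
    qed (use C0 in \<open>auto intro: sum_nonneg\<close>)
    also have "\<dots> = sqrt C / sqrt (1 - (cmod z)\<^sup>2)" by (simp add: real_sqrt_divide)
    finally have 1: "cmod (\<Sum>n<N. u n * x^n) \<le> sqrt C / sqrt (1 - (cmod z)\<^sup>2)" .
    have "(cmod (u N))\<^sup>2 \<le> (\<Sum>n\<le>N. (cmod (u n))\<^sup>2)" by (rule member_le_sum) auto
    then have 2: "cmod (u N) \<le> sqrt C" using C'[of N] by (intro real_le_rsqrt) simp
    have "cmod ((\<Sum>n\<le>N. \<phi> n * x^n) - c) \<le> cmod (1 - x) * cmod (\<Sum>n<N. u n * x^n) + cmod (u N) * cmod x ^ N"
      unfolding abel by (rule order_trans[OF norm_triangle_ineq]) (simp add: norm_mult norm_power)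
    also have "\<dots> \<le> cmod (z - \<zeta>) * (sqrt C / sqrt (1 - (cmod z)\<^sup>2)) + sqrt C * cmod x ^ N"
      using 1 2 norm_cnj_unit_minus[OF \<zeta>, of z] C0 by (intro add_mono mult_mono) (auto simp: x_def)
    finally show ?thesis by (simp add: mult_ac)
  qed
  have l1: "(\<lambda>N. cmod ((\<Sum>n\<le>N. \<phi> n * x^n) - c)) \<longlonglongrightarrow> cmod (f z - c)"
    using fS unfolding sums_def_le by (intro tendsto_intros) auto
  have l2: "(\<lambda>N. sqrt C * (cmod (z - \<zeta>) / sqrt (1 - (cmod z)\<^sup>2)) + sqrt C * cmod x ^ N)
      \<longlonglongrightarrow> sqrt C * (cmod (z - \<zeta>) / sqrt (1 - (cmod z)\<^sup>2)) + sqrt C * 0"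
    using x by (intro tendsto_intros LIMSEQ_power_zero) auto
  show ?thesis using LIMSEQ_le[OF l1 l2] bound by auto
qed

section \<open>The Dirichlet space of a finite sum of point masses\<close>

lemma poisson_mu_count_space:
  assumes "finite A"
  shows "poisson_mu (count_space A) z = (\<Sum>\<zeta>\<in>A. ennreal ((1 - (cmod z)\<^sup>2) / (cmod (z - \<zeta>))\<^sup>2))"
  using assms unfolding poisson_mu_def by (simp add: nn_integral_count_space_finite)

theorem Dmu_growth:
  assumes f: "f \<in> Dmu (count_space A)" and A: "finite A" "\<zeta> \<in> A" and \<zeta>: "cmod \<zeta> = 1"
  obtains c B where "0 \<le> B" "\<And>z. cmod z < 1 \<Longrightarrow> cmod (f z - c) \<le> B * (cmod (z - \<zeta>) / sqrt (1 - (cmod z)\<^sup>2))"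
proof -
  have hol: "f holomorphic_on ball 0 1"
    and fin: "(\<integral>\<^sup>+ z\<in>ball 0 1. ennreal ((cmod (deriv f z))\<^sup>2) * poisson_mu (count_space A) z \<partial>lborel) < \<infinity>"
    using f by (auto simp: Dmu_def Hardy2_def)
  have "(\<integral>\<^sup>+ z\<in>ball 0 1. ennreal ((cmod (deriv f z))\<^sup>2) * ennreal ((1 - (cmod z)\<^sup>2) / (cmod (z - \<zeta>))\<^sup>2) \<partial>lborel)
     \<le> (\<integral>\<^sup>+ z\<in>ball 0 1. ennreal ((cmod (deriv f z))\<^sup>2) * poisson_mu (count_space A) z \<partial>lborel)"
    unfolding poisson_mu_count_space[OF A(1)]
    using A by (intro nn_integral_mono mult_right_mono mult_left_mono member_le_sum) auto
  then have "(\<Sum>n. ennreal (pi * (cmod (wsum (\<lambda>k. taylor f k * \<zeta>^k) n))\<^sup>2 / ((real n+1)*(real n+2)))) < \<infinity>"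
    using fin unfolding local_Dirichlet_integral[OF hol \<zeta>] by (rule le_less_trans)
  then obtain c C where C: "\<And>M. (\<Sum>n\<le>M. (cmod (psum (\<lambda>k. taylor f k * \<zeta>^k) n - c))\<^sup>2) \<le> C"
    using local_Dirichlet_square_summable by blast
  have "0 \<le> C" using C[of 0] by (rule order_trans[rotated]) simp
  then show ?thesis
    using that[of "sqrt C" c] power_series_growth_at_boundary_point[OF hol \<zeta> C] by auto
qed

lemma Hardy2I:
  assumes hol: "f holomorphic_on ball 0 1" and C: "\<And>N. (\<Sum>n<N. (cmod (taylor f n))\<^sup>2) \<le> C"
  shows "f \<in> Hardy2"
  unfolding Hardy2_def
proof (intro CollectI conjI hol exI ballI)
  fix r :: real assume "r \<in> {0..<1}"
  then have r: "0 \<le> r" "r < 1" by auto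
  then have "cmod (of_real r) < 1" by simp
  from circ_Parseval[OF taylor_sums[OF hol] this] r
  have S: "(\<lambda>n. 2*pi * ((cmod (taylor f n))\<^sup>2 * r^(2*n))) sums (LINT t|circ. (cmod (f (of_real r * cis t)))\<^sup>2)" by simp
  have "(LINT t|circ. (cmod (f (of_real r * cis t)))\<^sup>2) \<le> 2*pi*C"
  proof (rule LIMSEQ_le_const2[OF S[unfolded sums_def]], intro exI allI impI)
    fix N
    have "(\<Sum>n<N. (cmod (taylor f n))\<^sup>2 * r^(2*n)) \<le> (\<Sum>n<N. (cmod (taylor f n))\<^sup>2)"
      using r by (intro sum_mono mult_left_le power_le_one) auto
    then show "(\<Sum>n<N. 2*pi * ((cmod (taylor f n))\<^sup>2 * r^(2*n))) \<le> 2*pi*C"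
      using C[of N] by (simp flip: sum_distrib_left)
  qed
  then show "(LBINT t=0..2*pi. (cmod (f (of_real r * cis t)))\<^sup>2) \<le> 2*pi*C"
    unfolding interval_integral_circ .
qed

text \<open>The subtracted mean depends on \<open>M\<close>, in the form in which the argument with
  test polynomials delivers it; \<open>Dmu_growth\<close>, in the other direction, extracts one
  constant for all \<open>M\<close>.\<close>

theorem DmuI:
  assumes f: "f \<in> Hardy2" and A: "finite A" "\<And>\<zeta>. \<zeta> \<in> A \<Longrightarrow> cmod \<zeta> = 1"
    and C: "\<And>\<zeta>. \<zeta> \<in> A \<Longrightarrow> \<exists>C. \<forall>M. (\<Sum>n\<le>M. (cmod (psum (\<lambda>k. taylor f k * \<zeta>^k) n
        - (\<Sum>k\<le>M. psum (\<lambda>k. taylor f k * \<zeta>^k) k) / (of_nat M + 1)))\<^sup>2) \<le> C"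
  shows "f \<in> Dmu (count_space A)"
proof -
  have hol: "f holomorphic_on ball 0 1" using f by (simp add: Hardy2_def)
  have hd: "deriv f holomorphic_on ball 0 1" by (rule holomorphic_deriv[OF hol]) simp
  define d where "d z = ennreal ((cmod (deriv f z))\<^sup>2) * indicator (ball 0 1) z" for z
  have "(\<lambda>z. indicator (ball 0 1) z *\<^sub>R ((cmod (deriv f z))\<^sup>2)) \<in> borel_measurable borel"
    by (intro borel_measurable_continuous_on_indicator continuous_intros holomorphic_on_imp_continuous_on[OF hd]) auto
  then have "(\<lambda>z. ennreal (indicator (ball 0 1) z *\<^sub>R ((cmod (deriv f z))\<^sup>2))) \<in> borel_measurable borel"
    by measurable
  moreover have "ennreal (indicator (ball 0 1) z *\<^sub>R ((cmod (deriv f z))\<^sup>2)) = d z" for z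
    by (simp add: d_def indicator_def)
  ultimately have d[measurable]: "d \<in> borel_measurable borel" by (simp only:)
  have "(\<integral>\<^sup>+ z\<in>ball 0 1. ennreal ((cmod (deriv f z))\<^sup>2) * poisson_mu (count_space A) z \<partial>lborel) =
     (\<integral>\<^sup>+ z. (\<Sum>\<zeta>\<in>A. d z * ennreal ((1 - (cmod z)\<^sup>2) / (cmod (z - \<zeta>))\<^sup>2)) \<partial>lborel)"
    unfolding poisson_mu_count_space[OF A(1)] d_def by (simp add: sum_distrib_left sum_distrib_right mult_ac)
  also have "\<dots> = (\<Sum>\<zeta>\<in>A. \<integral>\<^sup>+ z. d z * ennreal ((1 - (cmod z)\<^sup>2) / (cmod (z - \<zeta>))\<^sup>2) \<partial>lborel)"
    by (rule nn_integral_sum) measurable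
  also have "\<dots> < \<infinity>"
  proof -
    have "(\<integral>\<^sup>+ z. d z * ennreal ((1 - (cmod z)\<^sup>2) / (cmod (z - \<zeta>))\<^sup>2) \<partial>lborel) < \<infinity>" if "\<zeta> \<in> A" for \<zeta>
    proof -
      have "(\<integral>\<^sup>+ z. d z * ennreal ((1 - (cmod z)\<^sup>2) / (cmod (z - \<zeta>))\<^sup>2) \<partial>lborel) =
         (\<Sum>n. ennreal (pi * (cmod (wsum (\<lambda>k. taylor f k * \<zeta>^k) n))\<^sup>2 / ((real n+1)*(real n+2))))"
        unfolding local_Dirichlet_integral[OF hol A(2)[OF that], symmetric] d_def by (simp add: mult_ac)
      moreover from C[OF that] obtain C' where "\<And>M. (\<Sum>n\<le>M. (cmod (psum (\<lambda>k. taylor f k * \<zeta>^k) n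
        - (\<Sum>k\<le>M. psum (\<lambda>k. taylor f k * \<zeta>^k) k) / (of_nat M + 1)))\<^sup>2) \<le> C'" by blast
      then have "(\<Sum>n. ennreal (pi * (cmod (wsum (\<lambda>k. taylor f k * \<zeta>^k) n))\<^sup>2 / ((real n+1)*(real n+2)))) < \<infinity>"
        by (rule local_Dirichlet_finite)
      ultimately show ?thesis by simp
    qed
    then show ?thesis using A(1) by (auto simp: less_top)
  qed
  finally show ?thesis using f by (simp add: Dmu_def)
qed

section \<open>Kernels and uniform boundedness\<close>

text \<open>The squared norm of the combination of the kernel functions \<open>K (w i)\<close> with
  coefficients \<open>c i\<close>, as a formal expression: the Hilbert space itself is never
  constructed.\<close>

definition gram :: "(complex \<Rightarrow> complex \<Rightarrow> complex) \<Rightarrow> nat \<Rightarrow> (nat \<Rightarrow> complex) \<Rightarrow> (nat \<Rightarrow> complex) \<Rightarrow> real" where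
  "gram K n c w = Re (\<Sum>i<n. \<Sum>j<n. c i * cnj (c j) * K (w i) (w j))"

locale disk_kernel =
  fixes K :: "complex \<Rightarrow> complex \<Rightarrow> complex"
  assumes psd: "(\<And>i. i < n \<Longrightarrow> w i \<in> ball 0 1) \<Longrightarrow> 0 \<le> gram K n c w"
    and herm: "u \<in> ball 0 1 \<Longrightarrow> v \<in> ball 0 1 \<Longrightarrow> K v u = cnj (K u v)"
begin

definition nrm :: "complex \<Rightarrow> real" where "nrm v = sqrt (Re (K v v))"

lemma diag_nonneg: "v \<in> ball 0 1 \<Longrightarrow> 0 \<le> Re (K v v)"
  using psd[of 1 "\<lambda>_. v" "\<lambda>_. 1"] by (simp add: gram_def)

lemma diag_real: "v \<in> ball 0 1 \<Longrightarrow> K v v = of_real (Re (K v v))"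
  using herm[of v v] by (simp add: complex_eq_iff)

lemma nrm_nonneg: "v \<in> ball 0 1 \<Longrightarrow> 0 \<le> nrm v" and nrm_square: "v \<in> ball 0 1 \<Longrightarrow> (nrm v)\<^sup>2 = Re (K v v)"
  using diag_nonneg by (simp_all add: nrm_def)

text \<open>Positivity for the configuration enlarged by the point \<open>v\<close> with coefficient
  \<open>- t * cnj S\<close> gives a quadratic polynomial in the real number \<open>t\<close> that
  is nowhere negative.\<close>

lemma Cauchy_Schwarz:
  assumes v: "v \<in> ball 0 1" and w: "\<And>i. i < n \<Longrightarrow> w i \<in> ball 0 1"
  shows "(cmod (\<Sum>i<n. cnj (c i) * K v (w i)))\<^sup>2 \<le> Re (K v v) * gram K n c w"
proof -
  define S where "S = (\<Sum>i<n. cnj (c i) * K v (w i))"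
  define X where "X = (cmod S)\<^sup>2"
  have XS: "of_real X = S * cnj S" unfolding X_def by (rule complex_norm_square)
  define k where "k = Re (K v v)"
  define G where "G = gram K n c w"
  have q: "0 \<le> G - 2 * t * X + t\<^sup>2 * X * k" for t :: real
  proof -
    define l where "l = - (of_real t * cnj S)"
    define w' where "w' = w(n := v)"
    define c' where "c' = c(n := l)"
    have "0 \<le> gram K (Suc n) c' w'" by (rule psd) (use v w in \<open>auto simp: w'_def less_Suc_eq\<close>)
    also have "gram K (Suc n) c' w' = G + Re (\<Sum>i<n. c i * cnj l * K (w i) v) + Re (\<Sum>j<n. l * cnj (c j) * K v (w j)) + Re (l * cnj l * K v v)"
      by (simp add: gram_def G_def c'_def w'_def sum.distrib)
    also have "(\<Sum>i<n. c i * cnj l * K (w i) v) = cnj (l * S)"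
      unfolding S_def sum_distrib_left cnj_sum
      by (intro sum.cong refl) (use herm[OF v w] in simp)
    also have "(\<Sum>j<n. l * cnj (c j) * K v (w j)) = l * S"
      by (simp add: S_def sum_distrib_left mult_ac)
    also have "l * S = of_real (- t * X)"
      by (simp add: l_def X_def complex_norm_square mult.commute del: of_real_power)
    also have "l * cnj l * K v v = of_real (t\<^sup>2 * X * k)"
    proof -
      have "l * cnj l = of_real (t\<^sup>2 * X)"
        by (simp add: l_def XS power2_eq_square mult_ac)
      then show ?thesis using diag_real[OF v] by (simp add: k_def)
    qed
    finally show ?thesis by (simp add: mult_ac)
  qed
  have k0: "0 \<le> k" using diag_nonneg[OF v] by (simp add: k_def)
  have "X \<le> k * G"
  proof (cases "k = 0")
    case True
    \<comment> \<open>Without quadratic term the polynomial is affine in \<open>t\<close>, and being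
      nonnegative everywhere forces its slope to vanish.\<close>
    have "X = 0"
    proof (rule ccontr)
      assume "X \<noteq> 0"
      then have "X > 0" by (simp add: X_def)
      then show False using q[of "(G + 1) / (2 * X)"] True by simp
    qed
    then show ?thesis using True by simp
  next
    case False
    \<comment> \<open>\<open>t = 1 / k\<close> minimises the polynomial.\<close>
    then show ?thesis using q[of "1 / k"] k0 by (simp add: field_simps power2_eq_square)
  qed
  then show ?thesis by (simp add: X_def S_def k_def G_def)
qed

lemma Cauchy_Schwarz_norm:
  assumes v: "v \<in> ball 0 1" and w: "\<And>i. i < n \<Longrightarrow> w i \<in> ball 0 1"
  shows "cmod (\<Sum>i<n. cnj (c i) * K v (w i)) \<le> nrm v * sqrt (gram K n c w)"
  using Cauchy_Schwarz[OF v w] diag_nonneg[OF v] psd[OF w]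
  unfolding nrm_def real_sqrt_mult[symmetric] by (intro real_le_rsqrt) simp

lemma norm_kernel_le:
  assumes "v \<in> ball 0 1" "z \<in> ball 0 1" shows "cmod (K v z) \<le> nrm v * nrm z"
  using Cauchy_Schwarz_norm[OF assms(1), of 1 "\<lambda>_. z" "\<lambda>_. 1"] assms(2) by (simp add: gram_def nrm_def)

lemma kernel_series_summable:
  assumes v: "\<And>k. v k \<in> ball 0 1" and d: "summable (\<lambda>k. cmod (d k) * nrm (v k))" and z: "z \<in> ball 0 1"
  shows "summable (\<lambda>k. d k * K (v k) z)"
proof (rule summable_comparison_test[OF exI summable_mult2[OF d, of "nrm z"]], intro allI impI)
  fix k
  show "norm (d k * K (v k) z) \<le> cmod (d k) * nrm (v k) * nrm z"
    using mult_left_mono[OF norm_kernel_le[OF v z], of "cmod (d k)" k] by (simp add: norm_mult mult_ac)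
qed

text \<open>The series converges absolutely in norm; its pairing with a finite combination is
  estimated term by term by Cauchy-Schwarz. After squaring this has the shape of the membership
  condition in \<open>Hb\<close>.\<close>

lemma kernel_series_bound:
  assumes v: "\<And>k. v k \<in> ball 0 1" and d: "summable (\<lambda>k. cmod (d k) * nrm (v k))"
    and w: "\<And>i. i < n \<Longrightarrow> w i \<in> ball 0 1"
  shows "cmod (\<Sum>i<n. cnj (c i) * (\<Sum>k. d k * K (v k) (w i))) \<le> (\<Sum>k. cmod (d k) * nrm (v k)) * sqrt (gram K n c w)"
proof -
  have "(\<lambda>k. \<Sum>i<n. cnj (c i) * (d k * K (v k) (w i))) sums (\<Sum>i<n. cnj (c i) * (\<Sum>k. d k * K (v k) (w i)))"
    by (intro sums_sum sums_mult summable_sums kernel_series_summable v d w) auto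
  then have s: "(\<lambda>k. d k * (\<Sum>i<n. cnj (c i) * K (v k) (w i))) sums (\<Sum>i<n. cnj (c i) * (\<Sum>k. d k * K (v k) (w i)))"
    by (simp add: sum_distrib_left mult_ac)
  have b: "norm (d k * (\<Sum>i<n. cnj (c i) * K (v k) (w i))) \<le> cmod (d k) * nrm (v k) * sqrt (gram K n c w)" for k
    using mult_left_mono[OF Cauchy_Schwarz_norm[of "v k" n w c, OF v w], of "cmod (d k)"] by (simp add: norm_mult mult_ac)
  note sm = summable_mult2[OF d, of "sqrt (gram K n c w)"]
  have "cmod (\<Sum>k. d k * (\<Sum>i<n. cnj (c i) * K (v k) (w i))) \<le> (\<Sum>k. cmod (d k) * nrm (v k) * sqrt (gram K n c w))"
    by (rule norm_suminf_le[OF b sm])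
  then show ?thesis unfolding sums_unique[OF s] suminf_mult2[OF d] .
qed

text \<open>Uniform boundedness without completeness: a gliding-hump series with signs chosen one after another
  so that each partial sum is not smaller than its last term.\<close>

lemma uniform_boundedness:
  fixes \<phi> :: "complex \<Rightarrow> real"
  assumes A: "A \<subseteq> ball 0 1" and \<phi>: "\<And>w. w \<in> A \<Longrightarrow> 0 < \<phi> w"
    and pw: "\<And>v d. (\<And>k. v k \<in> A) \<Longrightarrow> summable (\<lambda>k. cmod (d k) * nrm (v k)) \<Longrightarrow>
        \<exists>C. \<forall>w\<in>A. cmod (\<Sum>k. d k * K (v k) w) \<le> C * \<phi> w"
  shows "\<exists>C. \<forall>w\<in>A. nrm w \<le> C * \<phi> w"
proof (rule ccontr)
  assume "\<not> ?thesis"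
  then have "\<exists>w\<in>A. C * \<phi> w < nrm w" for C by (meson not_le)
  \<comment> \<open>The n-th violation has to outweigh the factor \<open>(1/3)^n\<close> of the
    series and still leave \<open>n + 1\<close>.\<close>
  then have "\<exists>w. w \<in> A \<and> (real n + 1) * 3^n * \<phi> w < nrm w" for n by blast
  then obtain w where wA: "\<And>n. w n \<in> A" and wn: "\<And>n. (real n + 1) * 3^n * \<phi> (w n) < nrm (w n)" by metis
  have wb: "w n \<in> ball 0 1" for n using wA A by blast
  define N where "N n = nrm (w n)" for n
  have N0: "0 < N n" for n
  proof -
    have "0 < (real n + 1) * 3^n * \<phi> (w n)" using \<phi>[OF wA] by simp
    then show ?thesis using wn[of n] by (simp add: N_def)
  qed
  define e where "e n z = K (w n) z / of_real (N n)" for n z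
  have en: "e n (w n) = of_real (N n)" for n
  proof -
    have "K (w n) (w n) = of_real ((N n)\<^sup>2)" using diag_real[OF wb] nrm_square[OF wb] by (simp add: N_def)
    then show ?thesis using N0[of n] by (simp add: e_def power2_eq_square)
  qed
  have eb: "cmod (e k z) \<le> nrm z" if "z \<in> ball 0 1" for k z
    using norm_kernel_le[OF wb that, of k] N0[of k] by (simp add: e_def norm_divide N_def field_simps)
  \<comment> \<open>At least one of \<open>|x + h|\<close> and \<open>|x - h|\<close> is not smaller
    than \<open>h = (1/3)^n * N n\<close>; \<open>sg\<close> picks a sign for which this
    holds.\<close>
  define sg where "sg n x = (if (1/3)^n * N n \<le> cmod (x + of_real ((1/3)^n * N n)) then 1 else (-1::complex))" for n x
  \<comment> \<open>Recursive, because the n-th sign depends on the previous partial sum at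
    \<open>w n\<close>.\<close>
  define P where "P = rec_nat (\<lambda>z. 0) (\<lambda>n f z. f z + sg n (f (w n)) * of_real ((1/3)^n) * e n z)"
  have P0: "P 0 z = 0" and PS: "P (Suc n) z = P n z + sg n (P n (w n)) * of_real ((1/3)^n) * e n z" for n z
    by (simp_all add: P_def)
  define d where "d n = sg n (P n (w n)) * of_real ((1/3)^n / N n)" for n
  have nd: "cmod (d n) = (1/3)^n / N n" for n
    using N0[of n] by (simp add: d_def sg_def norm_mult norm_divide norm_power)
  have Psum: "P n z = (\<Sum>k<n. d k * K (w k) z)" for n z
    by (induction n) (simp_all add: P0 PS d_def e_def)
  have ds: "summable (\<lambda>k. cmod (d k) * nrm (w k))"
    using N0 by (simp add: nd N_def[symmetric] less_imp_neq[OF N0, symmetric] summable_geometric)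
  have lower: "(1/3)^n * N n \<le> cmod (P (Suc n) (w n))" for n
  proof -
    define x where "x = P n (w n)"
    define h where "h = (1/3)^n * N n"
    have h0: "0 \<le> h" using N0[of n] by (simp add: h_def)
    have "P (Suc n) (w n) = x + sg n x * of_real h" by (simp add: PS en x_def h_def)
    moreover have "h \<le> cmod (x + sg n x * of_real h)"
    proof (cases "h \<le> cmod (x + of_real h)")
      case True
      then show ?thesis by (simp add: sg_def h_def)
    next
      case False
      then have "h \<le> cmod (x - of_real h)"
      proof -
        have "2 * h = cmod ((x + of_real h) - (x - of_real h))" using h0 by (simp flip: mult_2)
        also have "\<dots> \<le> cmod (x + of_real h) + cmod (x - of_real h)" by (rule norm_triangle_ineq4)
        finally show ?thesis using False by linarith
      qed
      then show ?thesis using False by (simp add: sg_def h_def)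
    qed
    ultimately show ?thesis by (simp add: h_def)
  qed
  obtain C where C: "\<And>z. z \<in> A \<Longrightarrow> cmod (\<Sum>k. d k * K (w k) z) \<le> C * \<phi> z"
    using pw[OF wA ds] by blast
  \<comment> \<open>All terms after the n-th together contribute at most
    \<open>(1/3)^n * N n / 2\<close> at \<open>w n\<close>, half of the lower bound for the partial
    sum.\<close>
  have big: "(1/3)^n * N n / 2 \<le> cmod (\<Sum>k. d k * K (w k) (w n))" for n
  proof -
    note sm = kernel_series_summable[OF wb ds wb, of n]
    have split: "(\<Sum>k. d k * K (w k) (w n)) = (\<Sum>k. d (k + Suc n) * K (w (k + Suc n)) (w n)) + P (Suc n) (w n)"
      unfolding Psum by (rule suminf_split_initial_segment[OF sm])
    have tail: "norm (d (k + Suc n) * K (w (k + Suc n)) (w n)) \<le> (1/3)^Suc n * N n * (1/3)^k" for k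
    proof -
      have "norm (d (k + Suc n) * K (w (k + Suc n)) (w n)) \<le> (1/3)^(k + Suc n) / N (k + Suc n) * (N (k + Suc n) * N n)"
        unfolding norm_mult nd using norm_kernel_le[OF wb wb, of "k + Suc n" n] N0[of "k + Suc n"]
        by (intro mult_left_mono) (auto simp: N_def)
      also have "\<dots> = (1/3)^Suc n * N n * (1/3)^k" using N0[of "k + Suc n"] by (simp add: power_add)
      finally show ?thesis .
    qed
    have "(\<lambda>k. (1/3)^Suc n * N n * (1/3::real)^k) sums ((1/3)^Suc n * N n * (1 / (1 - 1/3)))"
      by (intro sums_mult geometric_sums) simp
    then have g: "summable (\<lambda>k. (1/3)^Suc n * N n * (1/3::real)^k)"
      "(\<Sum>k. (1/3)^Suc n * N n * (1/3::real)^k) = (1/3)^n * N n / 2" by (auto simp: sums_iff)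
    have "cmod (\<Sum>k. d (k + Suc n) * K (w (k + Suc n)) (w n)) \<le> (1/3)^n * N n / 2"
      using norm_suminf_le[OF tail g(1)] g(2) by simp
    then show ?thesis unfolding split
      using lower[of n] norm_diff_ineq[of "P (Suc n) (w n)" "\<Sum>k. d (k + Suc n) * K (w (k + Suc n)) (w n)"]
      by (simp add: add.commute)
  qed
  have "real n + 1 < 2 * C" for n
  proof -
    have "(1/3)^n * N n / 2 \<le> C * \<phi> (w n)" using big[of n] C[OF wA[of n]] by linarith
    then have 1: "N n \<le> 2 * C * 3^n * \<phi> (w n)" by (simp add: power_one_over field_simps)
    have "(real n + 1) * 3^n * \<phi> (w n) < 2 * C * 3^n * \<phi> (w n)" using less_le_trans[OF wn[of n] 1[unfolded N_def]] .
    then show ?thesis using \<phi>[OF wA[of n]] by simp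
  qed
  moreover obtain n :: nat where "2 * C < real n" using reals_Archimedean2 by blast
  ultimately show False by (metis add_increasing2 less_irrefl less_trans not_le zero_le_one)
qed

end

section \<open>Consequences of the embedding\<close>

lemma Hinf_ball_norm_le: "b \<in> Hinf_ball \<Longrightarrow> z \<in> ball 0 1 \<Longrightarrow> cmod (b z) \<le> 1"
proof -
  assume b: "b \<in> Hinf_ball" and z: "z \<in> ball 0 1"
  obtain B where "\<And>z. z \<in> ball 0 1 \<Longrightarrow> cmod (b z) \<le> B"
    using Hinf_bound[of b] b by (auto simp: Hinf_ball_def)
  then have "bdd_above ((\<lambda>z. cmod (b z)) ` ball 0 1)" by (auto intro!: bdd_aboveI[of _ B])
  from cSUP_upper[OF z this] show "cmod (b z) \<le> 1"
    using b by (simp add: Hinf_ball_def Hinf_norm_def)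
qed

lemma Hinf_ball_Hinf: "b \<in> Hinf_ball \<Longrightarrow> b \<in> Hinf"
  by (simp add: Hinf_ball_def)

text \<open>\<open>kb_gram\<close> combined with the Pythagorean identity for the multiplier
  \<open>b\<close>. Both summands are nonnegative, as \<open>|b| \<le> 1\<close> on the circle; this
  makes \<open>kb b\<close> a positive kernel, and each summand alone is a lower bound for the Gram
  form.\<close>

lemma kb_gram_decomposition:
  assumes b: "b \<in> Hinf_ball" and w: "\<forall>i<n. w i \<in> ball 0 1"
  shows "2*pi * gram (kb b) n c w = (LINT t|circ. (1 - (cmod (bval b t))\<^sup>2) * (cmod (szego n c w (cis t)))\<^sup>2)
     + (LINT t|circ. (cmod (bval b t * cnj (szego n c w (cis t)) - cnj (szego n (\<lambda>i. c i * cnj (b (w i))) w (cis t))))\<^sup>2)"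
    and "0 \<le> (LINT t|circ. (1 - (cmod (bval b t))\<^sup>2) * (cmod (szego n c w (cis t)))\<^sup>2)"
proof -
  note bH = Hinf_ball_Hinf[OF b]
  note M = szego_multiplier_norm[OF bH w, of c]
  have iF: "integrable circ (\<lambda>t. (cmod (szego n c w (cis t)))\<^sup>2)"
    by (intro integrable_circ_continuous continuous_intros continuous_szego_cis w)
  have "(LINT t|circ. (1 - (cmod (bval b t))\<^sup>2) * (cmod (szego n c w (cis t)))\<^sup>2) =
     (LINT t|circ. (cmod (szego n c w (cis t)))\<^sup>2 - (cmod (bval b t))\<^sup>2 * (cmod (szego n c w (cis t)))\<^sup>2)"
    by (simp add: left_diff_distrib)
  also have "\<dots> = (LINT t|circ. (cmod (szego n c w (cis t)))\<^sup>2) - (LINT t|circ. (cmod (bval b t))\<^sup>2 * (cmod (szego n c w (cis t)))\<^sup>2)"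
    by (rule Bochner_Integration.integral_diff[OF iF M(2)])
  finally show "2*pi * gram (kb b) n c w = (LINT t|circ. (1 - (cmod (bval b t))\<^sup>2) * (cmod (szego n c w (cis t)))\<^sup>2)
     + (LINT t|circ. (cmod (bval b t * cnj (szego n c w (cis t)) - cnj (szego n (\<lambda>i. c i * cnj (b (w i))) w (cis t))))\<^sup>2)"
    unfolding gram_def kb_gram[OF w] M(1) by simp
  have "AE t in circ. cmod (bval b t) \<le> 1" by (rule Hinf_bval_bound[OF bH Hinf_ball_norm_le[OF b]])
  then show "0 \<le> (LINT t|circ. (1 - (cmod (bval b t))\<^sup>2) * (cmod (szego n c w (cis t)))\<^sup>2)"
    by (intro integral_nonneg_AE) (auto elim!: eventually_mono simp: power_le_one)
qed

lemma kb_disk_kernel: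
  assumes b: "b \<in> Hinf_ball" shows "disk_kernel (kb b)"
proof
  fix n :: nat and w c :: "nat \<Rightarrow> complex" assume "\<And>i. i < n \<Longrightarrow> w i \<in> ball 0 (1::real)"
  then have w: "\<forall>i<n. w i \<in> ball 0 1" by blast
  have "0 \<le> 2*pi * gram (kb b) n c w"
    unfolding kb_gram_decomposition(1)[OF b w]
    by (rule add_nonneg_nonneg[OF kb_gram_decomposition(2)[OF b w]]) (simp add: integral_nonneg_AE)
  then show "0 \<le> gram (kb b) n c w" using pi_gt_zero by (simp add: zero_le_mult_iff)
qed (simp add: kb_def mult.commute)

text \<open>The reproducing kernel of the range of multiplication by \<open>a\<close> on the Hardy
  space, with the range norm.\<close>

definition mate_kernel :: "(complex \<Rightarrow> complex) \<Rightarrow> complex \<Rightarrow> complex \<Rightarrow> complex" where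
  "mate_kernel a w z = cnj (a w) * a z / (1 - cnj w * z)"

lemma mate_kernel_gram:
  assumes w: "\<forall>i<n. w i \<in> ball 0 1"
  shows "2*pi * gram (mate_kernel a) n c w = (LINT t|circ. (cmod (szego n (\<lambda>i. c i * cnj (a (w i))) w (cis t)))\<^sup>2)"
proof -
  have "complex_of_real (LINT t|circ. (cmod (szego n (\<lambda>i. c i * cnj (a (w i))) w (cis t)))\<^sup>2) =
      of_real (2*pi) * (\<Sum>i<n. \<Sum>j<n. c i * cnj (c j) * mate_kernel a (w i) (w j))"
    unfolding szego_norm_square[OF w] mate_kernel_def by (simp add: mult_ac)
  then have "(LINT t|circ. (cmod (szego n (\<lambda>i. c i * cnj (a (w i))) w (cis t)))\<^sup>2) = Re (of_real (2*pi) * (\<Sum>i<n. \<Sum>j<n. c i * cnj (c j) * mate_kernel a (w i) (w j)))"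
    by (metis Re_complex_of_real)
  then show ?thesis by (simp add: gram_def)
qed

lemma mate_kernel_disk_kernel: "disk_kernel (mate_kernel a)"
proof
  fix n :: nat and w c :: "nat \<Rightarrow> complex" assume "\<And>i. i < n \<Longrightarrow> w i \<in> ball 0 (1::real)"
  then have w: "\<forall>i<n. w i \<in> ball 0 1" by blast
  have "0 \<le> 2*pi * gram (mate_kernel a) n c w" unfolding mate_kernel_gram[OF w] by (intro integral_nonneg_AE) auto
  then show "0 \<le> gram (mate_kernel a) n c w" using pi_gt_zero by (simp add: zero_le_mult_iff)
qed (simp add: mate_kernel_def mult.commute)

text \<open>The adjoint of multiplication by \<open>a\<close> maps \<open>F = szego n c w\<close> to
  the analytic part of \<open>cnj a * F\<close>, whose norm is at most that of
  \<open>cnj a * F\<close>. Since \<open>|a|^2 = 1 - |b|^2\<close> on the circle, the square of the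
  latter is the first summand in \<open>kb_gram_decomposition\<close>.\<close>

lemma mate_kernel_le_kb:
  assumes b: "b \<in> Hinf_ball" and a: "a \<in> Hinf"
    and ab: "AE t in circ. (cmod (bval a t))\<^sup>2 + (cmod (bval b t))\<^sup>2 = 1"
    and w: "\<forall>i<n. w i \<in> ball 0 1"
  shows "gram (mate_kernel a) n c w \<le> gram (kb b) n c w"
proof -
  note M = szego_multiplier_norm[OF a w, of c]
  have [measurable]: "bval a \<in> borel_measurable borel" "bval b \<in> borel_measurable borel"
    using a Hinf_ball_Hinf[OF b] by (auto intro: Hinf_measurable_bval)
  have "0 \<le> (LINT t|circ. (cmod (bval a t * cnj (szego n c w (cis t)) - cnj (szego n (\<lambda>i. c i * cnj (a (w i))) w (cis t))))\<^sup>2)"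
    by (intro integral_nonneg_AE) auto
  then have "2*pi * gram (mate_kernel a) n c w \<le> (LINT t|circ. (cmod (bval a t))\<^sup>2 * (cmod (szego n c w (cis t)))\<^sup>2)"
    unfolding mate_kernel_gram[OF w] M(1) by simp
  also have "\<dots> = (LINT t|circ. (1 - (cmod (bval b t))\<^sup>2) * (cmod (szego n c w (cis t)))\<^sup>2)"
  proof (rule integral_cong_AE)
    show "AE t in circ. (cmod (bval a t))\<^sup>2 * (cmod (szego n c w (cis t)))\<^sup>2 = (1 - (cmod (bval b t))\<^sup>2) * (cmod (szego n c w (cis t)))\<^sup>2"
      using ab by eventually_elim (simp add: eq_diff_eq[symmetric])
  qed (rule measurable_circ, measurable)+
  also have "\<dots> \<le> 2*pi * gram (kb b) n c w"
    unfolding kb_gram_decomposition(1)[OF b w] by (simp add: integral_nonneg_AE)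
  finally show ?thesis by simp
qed

text \<open>Stated for any kernel below \<open>kb b\<close>, so that it supplies elements of
  \<open>H(b)\<close> built from \<open>kb b\<close> itself and from
  \<open>mate_kernel a\<close>.\<close>

lemma kernel_series_in_Hb:
  assumes K: "disk_kernel K"
    and le: "\<And>n c w. \<forall>i<n. w i \<in> ball 0 1 \<Longrightarrow> gram K n c w \<le> gram (kb b) n c w"
    and v: "\<And>k. v k \<in> ball 0 1" and d: "summable (\<lambda>k. cmod (d k) * disk_kernel.nrm K (v k))"
  shows "(\<lambda>z. \<Sum>k. d k * K (v k) z) \<in> Hb b"
proof -
  interpret disk_kernel K by fact
  define S where "S = (\<Sum>k. cmod (d k) * nrm (v k))"
  show ?thesis
    unfolding Hb_def gram_def[symmetric]
  proof (intro CollectI exI allI impI)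
    fix n :: nat and w c :: "nat \<Rightarrow> complex" assume w: "\<forall>i<n. w i \<in> ball 0 1"
    have "(cmod (\<Sum>i<n. cnj (c i) * (\<Sum>k. d k * K (v k) (w i))))\<^sup>2 \<le> (S * sqrt (gram K n c w))\<^sup>2"
      unfolding S_def using w by (intro power_mono kernel_series_bound v d) auto
    also have "\<dots> = S\<^sup>2 * gram K n c w" using psd[of n w c] w by (simp add: power_mult_distrib)
    also have "\<dots> \<le> S\<^sup>2 * gram (kb b) n c w" by (intro mult_left_mono le w) simp
    finally show "(cmod (\<Sum>i<n. cnj (c i) * (\<Sum>k. d k * K (v k) (w i))))\<^sup>2 \<le> S\<^sup>2 * gram (kb b) n c w" .
  qed
qed

lemma Re_kb_diag: "cmod w < 1 \<Longrightarrow> Re (kb b w w) = (1 - (cmod (b w))\<^sup>2) / (1 - (cmod w)\<^sup>2)"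
proof -
  have "kb b w w = of_real ((1 - (cmod (b w))\<^sup>2) / (1 - (cmod w)\<^sup>2))"
    unfolding kb_def of_real_divide of_real_diff complex_norm_square by (simp add: mult.commute)
  then show ?thesis by simp
qed

lemma Re_mate_kernel_diag: "cmod w < 1 \<Longrightarrow> Re (mate_kernel a w w) = (cmod (a w))\<^sup>2 / (1 - (cmod w)\<^sup>2)"
proof -
  have "mate_kernel a w w = of_real ((cmod (a w))\<^sup>2 / (1 - (cmod w)\<^sup>2))"
    unfolding mate_kernel_def of_real_divide of_real_diff complex_norm_square by (simp add: mult.commute)
  then show ?thesis by simp
qed

text \<open>The uniform growth of the kernels bounds \<open>sqrt (1 - |b w|^2)\<close> by a multiple
  of \<open>sqrt (1 - |w|^2) + |w - \<zeta>|\<close>, which tends to 0 as \<open>w\<close> tends to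
  \<open>\<zeta>\<close> in any manner. So \<open>|b|\<close> tends to 1 at
  \<open>\<zeta>\<close>.\<close>

lemma not_in_spectrum_of_growth:
  assumes b: "b \<in> Hinf_ball" and \<zeta>: "cmod \<zeta> = 1"
    and gr: "\<And>f. f \<in> Hb b \<Longrightarrow> \<exists>c B. 0 \<le> B \<and> (\<forall>z. cmod z < 1 \<longrightarrow> cmod (f z - c) \<le> B * (cmod (z - \<zeta>) / sqrt (1 - (cmod z)\<^sup>2)))"
  shows "\<zeta> \<notin> spectrum_b b"
proof -
  interpret disk_kernel "kb b" by (rule kb_disk_kernel[OF b])
  \<comment> \<open>The summand 1 absorbs the constants \<open>c\<close>, which vary with the
    function.\<close>
  define \<phi> where "\<phi> w = 1 + cmod (w - \<zeta>) / sqrt (1 - (cmod w)\<^sup>2)" for w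
  have pos: "0 < 1 - (cmod w)\<^sup>2" if "w \<in> ball 0 1" for w :: complex
    using that by (simp add: abs_square_less_1)
  have q0: "0 \<le> cmod (w - \<zeta>) / sqrt (1 - (cmod w)\<^sup>2)" if "w \<in> ball 0 1" for w
    using pos[OF that] by simp
  have "\<exists>C. \<forall>w\<in>ball 0 1. nrm w \<le> C * \<phi> w"
  proof (rule uniform_boundedness[OF subset_refl])
    show "0 < \<phi> w" if "w \<in> ball 0 1" for w using q0[OF that] by (simp add: \<phi>_def)
    fix v :: "nat \<Rightarrow> complex" and d assume v: "\<And>k. v k \<in> ball 0 1" and d: "summable (\<lambda>k. cmod (d k) * nrm (v k))"
    let ?f = "\<lambda>z. \<Sum>k. d k * kb b (v k) z"
    have "?f \<in> Hb b" by (rule kernel_series_in_Hb[OF kb_disk_kernel[OF b] order_refl v d])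
    from gr[OF this] obtain c B where B: "0 \<le> B" "\<And>z. cmod z < 1 \<Longrightarrow> cmod (?f z - c) \<le> B * (cmod (z - \<zeta>) / sqrt (1 - (cmod z)\<^sup>2))" by blast
    show "\<exists>C. \<forall>w\<in>ball 0 1. cmod (?f w) \<le> C * \<phi> w"
    proof (intro exI ballI)
      fix w :: complex assume w: "w \<in> ball 0 1"
      have "cmod (?f w) \<le> cmod c + B * (cmod (w - \<zeta>) / sqrt (1 - (cmod w)\<^sup>2))"
        using B(2)[of w] w norm_triangle_sub[of "?f w" c] by simp
      also have "\<dots> \<le> (cmod c + B) * \<phi> w"
      proof -
        define q where "q = cmod (w - \<zeta>) / sqrt (1 - (cmod w)\<^sup>2)"
        have "0 \<le> q" using q0[OF w] by (simp add: q_def)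
        then have "0 \<le> cmod c * q" by simp
        then show ?thesis using B(1) unfolding \<phi>_def q_def[symmetric] by (simp add: algebra_simps)
      qed
      finally show "cmod (?f w) \<le> (cmod c + B) * \<phi> w" .
    qed
  qed
  then obtain C where C: "\<And>w. w \<in> ball 0 1 \<Longrightarrow> nrm w \<le> C * \<phi> w" by blast
  have up: "sqrt (1 - (cmod (b w))\<^sup>2) \<le> C * (sqrt (1 - (cmod w)\<^sup>2) + cmod (w - \<zeta>))" if w: "w \<in> ball 0 1" for w
  proof -
    have p: "0 < sqrt (1 - (cmod w)\<^sup>2)" using pos[OF w] by simp
    have "sqrt (1 - (cmod (b w))\<^sup>2) = nrm w * sqrt (1 - (cmod w)\<^sup>2)"
      unfolding nrm_def using w pos[OF w] Re_kb_diag[of w b] by (simp add: real_sqrt_divide)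
    also have "\<dots> \<le> C * \<phi> w * sqrt (1 - (cmod w)\<^sup>2)" using C[OF w] p by (intro mult_right_mono) auto
    also have "\<dots> = C * (sqrt (1 - (cmod w)\<^sup>2) + cmod (w - \<zeta>))"
      using p by (simp add: \<phi>_def field_simps)
    finally show ?thesis .
  qed
  have "((\<lambda>w. C * (sqrt (1 - (cmod w)\<^sup>2) + cmod (w - \<zeta>))) \<longlongrightarrow> C * (sqrt (1 - (cmod \<zeta>)\<^sup>2) + cmod (\<zeta> - \<zeta>))) (at \<zeta> within ball 0 1)"
    by (intro tendsto_intros)
  then have lim: "((\<lambda>w. C * (sqrt (1 - (cmod w)\<^sup>2) + cmod (w - \<zeta>))) \<longlongrightarrow> 0) (at \<zeta> within ball 0 1)"
    using \<zeta> by simp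
  have ev: "\<forall>\<^sub>F w in at \<zeta> within ball 0 1. w \<in> ball 0 1"
    by (simp add: eventually_at_filter)
  have "1 \<le> Liminf (at \<zeta> within ball 0 1) (\<lambda>z. ereal (cmod (b z)))"
  proof (rule le_Liminf_iff[THEN iffD2], intro allI impI)
    fix y :: ereal assume y: "y < 1"
    obtain r :: real where r: "y < ereal r" "r < 1" "0 \<le> r"
    proof -
      have "max y 0 < 1" using y by simp
      then obtain q where q: "max y 0 < q" "q < 1" using dense by blast
      then have "y < q" "0 < q" by (auto intro: le_less_trans)
      moreover obtain r where "q = ereal r" using q by (cases q) auto
      ultimately show ?thesis using that[of r] q(2) by simp
    qed
    have "0 < sqrt (1 - r\<^sup>2)" using r by (simp add: abs_square_less_1)
    from order_tendstoD(2)[OF lim this] ev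
    show "\<forall>\<^sub>F z in at \<zeta> within ball 0 1. y < ereal (cmod (b z))"
    proof eventually_elim
      case (elim z)
      have "sqrt (1 - (cmod (b z))\<^sup>2) < sqrt (1 - r\<^sup>2)"
        by (rule le_less_trans[OF up[OF elim(2)] elim(1)])
      then have "r\<^sup>2 < (cmod (b z))\<^sup>2" by simp
      then have "r < cmod (b z)" by (rule power2_less_imp_less) simp
      then show ?case using r(1) less_trans by (metis ereal_less_eq(3) less_ereal.simps(1))
    qed
  qed
  then show ?thesis by (simp add: spectrum_b_def not_less)
qed

text \<open>Uniform boundedness is applied twice. On the radius to \<open>\<zeta>\<close> it bounds
  the norms of the kernels, hence \<open>a\<close> and every kernel series tend to 0 there. This
  identifies the constant \<open>c\<close> of each series as 0, and the second application, over the
  whole disk, can use the weight without an additive 1.\<close>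

lemma mate_vanishes_of_growth:
  assumes b: "b \<in> Hinf_ball" and a: "a \<in> Hinf"
    and ab: "AE t in circ. (cmod (bval a t))\<^sup>2 + (cmod (bval b t))\<^sup>2 = 1"
    and \<zeta>: "cmod \<zeta> = 1"
    and gr: "\<And>f. f \<in> Hb b \<Longrightarrow> \<exists>c B. 0 \<le> B \<and> (\<forall>z. cmod z < 1 \<longrightarrow> cmod (f z - c) \<le> B * (cmod (z - \<zeta>) / sqrt (1 - (cmod z)\<^sup>2)))"
  shows "\<exists>C. \<forall>z\<in>ball 0 1. cmod (a z) \<le> C * cmod (z - \<zeta>)"
proof -
  interpret disk_kernel "mate_kernel a" by (rule mate_kernel_disk_kernel)
  have pos: "0 < 1 - (cmod w)\<^sup>2" if "w \<in> ball 0 1" for w :: complex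
    using that by (simp add: abs_square_less_1)
  have nrm_eq: "nrm w = cmod (a w) / sqrt (1 - (cmod w)\<^sup>2)" if "w \<in> ball 0 1" for w
    unfolding nrm_def using that Re_mate_kernel_diag[of w a] by (simp add: real_sqrt_divide)
  have gs: "\<exists>c B. 0 \<le> B \<and> (\<forall>z. cmod z < 1 \<longrightarrow> cmod ((\<Sum>k. d k * mate_kernel a (v k) z) - c) \<le> B * (cmod (z - \<zeta>) / sqrt (1 - (cmod z)\<^sup>2)))"
    if "\<And>k. v k \<in> ball 0 1" "summable (\<lambda>k. cmod (d k) * nrm (v k))" for v d
    by (rule gr[OF kernel_series_in_Hb[OF mate_kernel_disk_kernel mate_kernel_le_kb[OF b a ab] that]])
  have radial: "cmod (of_real r * \<zeta> - \<zeta>) / sqrt (1 - (cmod (of_real r * \<zeta>))\<^sup>2) \<le> sqrt (1 - r)" "of_real r * \<zeta> \<in> ball 0 1"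
    if r: "0 \<le> r" "r < 1" for r :: real
  proof -
    have "of_real r * \<zeta> - \<zeta> = of_real (r - 1) * \<zeta>" by (simp add: algebra_simps)
    then have 1: "cmod (of_real r * \<zeta> - \<zeta>) = 1 - r" using r \<zeta> by (simp only: norm_mult norm_of_real) simp
    have 2: "cmod (of_real r * \<zeta>) = r" using r \<zeta> by (simp add: norm_mult)
    then show "of_real r * \<zeta> \<in> ball 0 1" using r by simp
    have "1 - r \<le> 1 - r\<^sup>2" using r by (simp add: power2_eq_square mult_left_le)
    then have "(1 - r) / sqrt (1 - r\<^sup>2) \<le> (1 - r) / sqrt (1 - r)" using r by (intro divide_left_mono) auto
    also have "\<dots> = sqrt (1 - r)" using r by (simp add: real_div_sqrt)
    finally show "cmod (of_real r * \<zeta> - \<zeta>) / sqrt (1 - (cmod (of_real r * \<zeta>))\<^sup>2) \<le> sqrt (1 - r)" unfolding 1 2 .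
  qed
  \<comment> \<open>On this radius \<open>|z - \<zeta>| / sqrt (1 - |z|^2) \<le> 1\<close>, so each
    series is bounded there, whatever its constant \<open>c\<close>.\<close>
  define R where "R = (\<lambda>r. of_real r * \<zeta>) ` {0..<1::real}"
  have Rb: "R \<subseteq> ball 0 1" using radial(2) by (auto simp: R_def)
  have "\<exists>C. \<forall>w\<in>R. nrm w \<le> C * 1"
  proof (rule uniform_boundedness[OF Rb])
    fix v :: "nat \<Rightarrow> complex" and d assume v: "\<And>k. v k \<in> R" and d: "summable (\<lambda>k. cmod (d k) * nrm (v k))"
    let ?f = "\<lambda>z. \<Sum>k. d k * mate_kernel a (v k) z"
    obtain c B where B: "0 \<le> B" "\<And>z. cmod z < 1 \<Longrightarrow> cmod (?f z - c) \<le> B * (cmod (z - \<zeta>) / sqrt (1 - (cmod z)\<^sup>2))"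
      using gs[of v d] v Rb d by blast
    have "cmod (?f (of_real r * \<zeta>)) \<le> (cmod c + B) * 1" if r: "0 \<le> r" "r < 1" for r
    proof -
      have "cmod (?f (of_real r * \<zeta>) - c) \<le> B * (cmod (of_real r * \<zeta> - \<zeta>) / sqrt (1 - (cmod (of_real r * \<zeta>))\<^sup>2))"
        using B(2) radial(2)[OF r] by simp
      also have "\<dots> \<le> B * sqrt (1 - r)" using radial(1)[OF r] B(1) by (rule mult_left_mono)
      also have "\<dots> \<le> B * 1" using r B(1) by (intro mult_left_mono) auto
      finally show ?thesis using norm_triangle_sub[of "?f (of_real r * \<zeta>)" c] by simp
    qed
    then show "\<exists>C. \<forall>w\<in>R. cmod (?f w) \<le> C * 1" unfolding R_def by fastforce
  qed simp
  then obtain C1 where C1: "\<And>r. 0 \<le> r \<Longrightarrow> r < 1 \<Longrightarrow> nrm (of_real r * \<zeta>) \<le> C1"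
    unfolding R_def by fastforce
  have C1_0: "0 \<le> C1" using C1[of 0] nrm_nonneg[of 0] by simp
  have pt: "of_real (radius k) * \<zeta> \<in> ball 0 1" for k using radial(2)[of "radius k"] radius(1,2)[of k] by simp
  have sq0: "(\<lambda>k. sqrt (1 - radius k)) \<longlonglongrightarrow> 0"
    using tendsto_real_sqrt[OF tendsto_diff[OF tendsto_const[of 1] radius(3)]] by simp
  have a0: "(\<lambda>k. a (of_real (radius k) * \<zeta>)) \<longlonglongrightarrow> 0"
  proof (rule Lim_null_comparison)
    have "cmod (a (of_real (radius k) * \<zeta>)) \<le> C1 * sqrt (2 * (1 - radius k))" for k
    proof -
      have r: "0 \<le> radius k" "radius k < 1" using radius(1,2)[of k] by auto
      have c: "cmod (of_real (radius k) * \<zeta>) = radius k" using r \<zeta> by (simp add: norm_mult)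
      have s: "0 < sqrt (1 - (radius k)\<^sup>2)" using r by (simp add: abs_square_less_1)
      have "cmod (a (of_real (radius k) * \<zeta>)) \<le> C1 * sqrt (1 - (radius k)\<^sup>2)"
        using C1[OF r] s unfolding nrm_eq[OF pt] c by (simp add: pos_divide_le_eq)
      also have "\<dots> \<le> C1 * sqrt (2 * (1 - radius k))"
      proof (intro mult_left_mono real_sqrt_le_mono C1_0)
        show "1 - (radius k)\<^sup>2 \<le> 2 * (1 - radius k)" using zero_le_power2[of "1 - radius k"] by (simp add: power2_diff)
      qed
      finally show ?thesis .
    qed
    then show "\<forall>\<^sub>F k in sequentially. norm (a (of_real (radius k) * \<zeta>)) \<le> C1 * sqrt (2 * (1 - radius k))" by simp
    have "(\<lambda>k. C1 * sqrt (2 * (1 - radius k))) \<longlonglongrightarrow> C1 * sqrt (2 * (1 - 1))" by (intro tendsto_intros radius)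
    then show "(\<lambda>k. C1 * sqrt (2 * (1 - radius k))) \<longlonglongrightarrow> 0" by simp
  qed
  define \<phi> where "\<phi> w = cmod (w - \<zeta>) / sqrt (1 - (cmod w)\<^sup>2)" for w
  have "\<exists>C. \<forall>w\<in>ball 0 1. nrm w \<le> C * \<phi> w"
  proof (rule uniform_boundedness[OF subset_refl])
    show "0 < \<phi> w" if "w \<in> ball 0 1" for w
      using pos[OF that] that \<zeta> unfolding \<phi>_def by (intro divide_pos_pos) auto
    fix v :: "nat \<Rightarrow> complex" and d assume v: "\<And>k. v k \<in> ball 0 1" and d: "summable (\<lambda>k. cmod (d k) * nrm (v k))"
    let ?f = "\<lambda>z. \<Sum>k. d k * mate_kernel a (v k) z"
    obtain c B where B: "0 \<le> B" "\<And>z. cmod z < 1 \<Longrightarrow> cmod (?f z - c) \<le> B * (cmod (z - \<zeta>) / sqrt (1 - (cmod z)\<^sup>2))"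
      using gs[of v d] v d by blast
    \<comment> \<open>Each term tends to 0 with \<open>a\<close>, and the bound \<open>C1\<close>
      for the kernels along the radius dominates the terms uniformly in \<open>k\<close>.\<close>
    have "(\<lambda>k. ?f (of_real (radius k) * \<zeta>)) \<longlonglongrightarrow> (\<Sum>k. 0)"
    proof (rule tannerys_theorem[THEN conjunct2, THEN conjunct2])
      show "(\<lambda>k. d j * mate_kernel a (v j) (of_real (radius k) * \<zeta>)) \<longlonglongrightarrow> 0" for j
      proof -
        have vz: "1 - cnj (v j) * (of_real 1 * \<zeta>) \<noteq> 0" using v[of j] \<zeta> by (intro one_minus_cnj_mult_ne) auto
        have "(\<lambda>k. d j * (cnj (a (v j)) * a (of_real (radius k) * \<zeta>) / (1 - cnj (v j) * (of_real (radius k) * \<zeta>)))) \<longlonglongrightarrow>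
            d j * (cnj (a (v j)) * 0 / (1 - cnj (v j) * (of_real 1 * \<zeta>)))"
          using vz by (intro tendsto_intros a0 radius)
        then show ?thesis by (simp add: mate_kernel_def)
      qed
      have "norm (d j * mate_kernel a (v j) (of_real (radius k) * \<zeta>)) \<le> cmod (d j) * nrm (v j) * C1" for j k
      proof -
        have "cmod (mate_kernel a (v j) (of_real (radius k) * \<zeta>)) \<le> nrm (v j) * nrm (of_real (radius k) * \<zeta>)"
          by (rule norm_kernel_le[OF v pt])
        also have "\<dots> \<le> nrm (v j) * C1" using C1[of "radius k"] radius(1,2)[of k] nrm_nonneg[OF v] by (intro mult_left_mono) auto
        finally show ?thesis by (simp add: norm_mult mult.assoc mult_left_mono)
      qed
      then show "\<forall>\<^sub>F (j, k) in sequentially \<times>\<^sub>F sequentially. norm (d j * mate_kernel a (v j) (of_real (radius k) * \<zeta>)) \<le> cmod (d j) * nrm (v j) * C1"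
        by (intro always_eventually) auto
      show "summable (\<lambda>j. cmod (d j) * nrm (v j) * C1)" by (rule summable_mult2[OF d])
    qed simp
    then have f0: "(\<lambda>k. ?f (of_real (radius k) * \<zeta>)) \<longlonglongrightarrow> 0" by simp
    have "(\<lambda>k. ?f (of_real (radius k) * \<zeta>) - c) \<longlonglongrightarrow> 0"
    proof (rule Lim_null_comparison)
      have "norm (?f (of_real (radius k) * \<zeta>) - c) \<le> B * sqrt (1 - radius k)" for k
      proof -
        have r: "0 \<le> radius k" "radius k < 1" using radius(1,2)[of k] by auto
        have "norm (?f (of_real (radius k) * \<zeta>) - c) \<le> B * (cmod (of_real (radius k) * \<zeta> - \<zeta>) / sqrt (1 - (cmod (of_real (radius k) * \<zeta>))\<^sup>2))"
          using B(2) pt[of k] by simp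
        also have "\<dots> \<le> B * sqrt (1 - radius k)" using radial(1)[OF r] B(1) by (rule mult_left_mono)
        finally show ?thesis .
      qed
      then show "\<forall>\<^sub>F k in sequentially. norm (?f (of_real (radius k) * \<zeta>) - c) \<le> B * sqrt (1 - radius k)" by simp
      show "(\<lambda>k. B * sqrt (1 - radius k)) \<longlonglongrightarrow> 0" using tendsto_mult[OF tendsto_const[of B] sq0] by simp
    qed
    then have "(\<lambda>k. ?f (of_real (radius k) * \<zeta>)) \<longlonglongrightarrow> c" by (simp add: LIM_zero_iff)
    then have "c = 0" using LIMSEQ_unique[OF _ f0] by blast
    then have "\<forall>w\<in>ball 0 1. cmod (?f w) \<le> B * \<phi> w" using B(2) by (simp add: \<phi>_def)
    then show "\<exists>C. \<forall>w\<in>ball 0 1. cmod (?f w) \<le> C * \<phi> w" ..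
  qed
  then obtain C where C: "\<And>w. w \<in> ball 0 1 \<Longrightarrow> nrm w \<le> C * \<phi> w" by blast
  have "cmod (a w) \<le> C * cmod (w - \<zeta>)" if w: "w \<in> ball 0 1" for w
  proof -
    have p: "0 < sqrt (1 - (cmod w)\<^sup>2)" using pos[OF w] by simp
    have "cmod (a w) / sqrt (1 - (cmod w)\<^sup>2) \<le> (C * cmod (w - \<zeta>)) / sqrt (1 - (cmod w)\<^sup>2)"
      using C[OF w] unfolding nrm_eq[OF w] \<phi>_def by simp
    then show ?thesis using p by (simp add: divide_le_cancel)
  qed
  then show ?thesis by blast
qed

section \<open>The Gram estimate\<close>

lemma circ_Cauchy_Schwarz:
  fixes u v :: "real \<Rightarrow> real"
  assumes u: "integrable circ (\<lambda>t. (u t)\<^sup>2)" and v: "integrable circ (\<lambda>t. (v t)\<^sup>2)" and uv: "integrable circ (\<lambda>t. u t * v t)"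
  shows "(LINT t|circ. u t * v t) \<le> sqrt (LINT t|circ. (u t)\<^sup>2) * sqrt (LINT t|circ. (v t)\<^sup>2)"
proof -
  define P where "P = (LINT t|circ. (u t)\<^sup>2)"
  define Q where "Q = (LINT t|circ. (v t)\<^sup>2)"
  define R where "R = (LINT t|circ. u t * v t)"
  have P0: "0 \<le> P" by (simp add: P_def integral_nonneg_AE)
  have q: "0 \<le> s\<^sup>2 * P - 2 * s * R + Q" for s :: real
  proof -
    have "0 \<le> (LINT t|circ. (s * u t - v t)\<^sup>2)" by (simp add: integral_nonneg_AE)
    also have "\<dots> = (LINT t|circ. s\<^sup>2 * (u t)\<^sup>2 - 2 * s * (u t * v t) + (v t)\<^sup>2)"
      by (intro Bochner_Integration.integral_cong refl) (simp add: power2_diff power_mult_distrib algebra_simps)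
    also have "\<dots> = (LINT t|circ. s\<^sup>2 * (u t)\<^sup>2 - 2 * s * (u t * v t)) + Q"
      unfolding Q_def
      by (rule Bochner_Integration.integral_add[OF Bochner_Integration.integrable_diff[OF integrable_mult_right[OF u] integrable_mult_right[OF uv]] v])
    also have "(LINT t|circ. s\<^sup>2 * (u t)\<^sup>2 - 2 * s * (u t * v t)) = (LINT t|circ. s\<^sup>2 * (u t)\<^sup>2) - (LINT t|circ. 2 * s * (u t * v t))"
      by (rule Bochner_Integration.integral_diff[OF integrable_mult_right[OF u] integrable_mult_right[OF uv]])
    finally show ?thesis by (simp only: P_def R_def integral_mult_right_zero)
  qed
  have "R\<^sup>2 \<le> P * Q"
  proof (cases "P = 0")
    case True
    have "R = 0"
    proof (rule ccontr)
      assume "R \<noteq> 0"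
      then show False using q[of "(Q + 1) / (2 * R)"] True by (simp add: field_simps)
    qed
    then show ?thesis using True by simp
  next
    case False
    then show ?thesis using q[of "R / P"] P0 by (simp add: field_simps power2_eq_square)
  qed
  then show ?thesis unfolding P_def[symmetric] Q_def[symmetric] R_def[symmetric] real_sqrt_mult[symmetric]
    by (rule real_le_rsqrt)
qed

lemma Hinf_norm_integrable:
  assumes y: "y \<in> Hinf" and x: "x \<in> Hinf"
  shows "integrable circ (\<lambda>t. cmod (bval y t) * cmod (bval x t))"
proof -
  obtain B where B: "0 \<le> B" "\<And>z. z \<in> ball 0 1 \<Longrightarrow> cmod (y z) \<le> B" using Hinf_bound[OF y] by metis
  obtain C where C: "0 \<le> C" "\<And>z. z \<in> ball 0 1 \<Longrightarrow> cmod (x z) \<le> C" using Hinf_bound[OF x] by metis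
  have [measurable]: "bval y \<in> borel_measurable borel" "bval x \<in> borel_measurable borel"
    by (intro Hinf_measurable_bval y x)+
  have m: "(\<lambda>t. cmod (bval y t) * cmod (bval x t)) \<in> borel_measurable circ" by (rule measurable_circ) measurable
  have "AE t in circ. cmod (bval y t) \<le> B" by (rule Hinf_bval_bound[OF y B(2)])
  moreover have "AE t in circ. cmod (bval x t) \<le> C" by (rule Hinf_bval_bound[OF x C(2)])
  ultimately have "AE t in circ. norm (cmod (bval y t) * cmod (bval x t)) \<le> B * C"
    by eventually_elim (use B C in \<open>auto intro!: mult_mono\<close>)
  then show ?thesis by (rule circ.integrable_const_bound[OF _ m])
qed

definition boundary_norm :: "(complex \<Rightarrow> complex) \<Rightarrow> real" where
  "boundary_norm f = sqrt (LINT t|circ. (cmod (bval f t))\<^sup>2)"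

lemma boundary_norm_nonneg: "0 \<le> boundary_norm f" by (simp add: boundary_norm_def integral_nonneg_AE)

lemma Hinf_boundary_Cauchy_Schwarz:
  assumes "y \<in> Hinf" "x \<in> Hinf"
  shows "(LINT t|circ. cmod (bval y t) * cmod (bval x t)) \<le> boundary_norm y * boundary_norm x"
  unfolding boundary_norm_def
  by (rule circ_Cauchy_Schwarz)
     (use Hinf_norm_integrable[OF assms(1) assms(1)] Hinf_norm_integrable[OF assms(2) assms(2)] Hinf_norm_integrable[OF assms] in \<open>simp_all add: power2_eq_square\<close>)

text \<open>By Parseval the square means increase with the radius, and along \<open>radius k\<close>
  they tend to the boundary mean by dominated convergence.\<close>

lemma Hinf_circle_norm_le:
  assumes y: "y \<in> Hinf" and r: "0 \<le> r" "r < 1"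
  shows "(LINT t|circ. (cmod (y (of_real r * cis t)))\<^sup>2) \<le> (LINT t|circ. (cmod (bval y t))\<^sup>2)"
proof -
  note hol = Hinf_holomorphic[OF y]
  obtain B where B: "0 \<le> B" "\<And>z. z \<in> ball 0 1 \<Longrightarrow> cmod (y z) \<le> B" using Hinf_bound[OF y] by metis
  have mono: "(LINT t|circ. (cmod (y (of_real r * cis t)))\<^sup>2) \<le> (LINT t|circ. (cmod (y (of_real s * cis t)))\<^sup>2)"
    if s: "r \<le> s" "s < 1" for s
  proof (rule sums_le)
    have "cmod (of_real r) < 1" "cmod (of_real s) < 1" using r s by auto
    then show "(\<lambda>n. 2*pi * ((cmod (taylor y n))\<^sup>2 * (cmod (of_real r))^(2*n))) sums (LINT t|circ. (cmod (y (of_real r * cis t)))\<^sup>2)"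
      "(\<lambda>n. 2*pi * ((cmod (taylor y n))\<^sup>2 * (cmod (of_real s))^(2*n))) sums (LINT t|circ. (cmod (y (of_real s * cis t)))\<^sup>2)"
      by (intro circ_Parseval taylor_sums[OF hol]; simp)+
    show "2*pi * ((cmod (taylor y n))\<^sup>2 * (cmod (of_real r))^(2*n)) \<le> 2*pi * ((cmod (taylor y n))\<^sup>2 * (cmod (of_real s))^(2*n))" for n
      using r s by (intro mult_left_mono power_mono) auto
  qed
  have "(\<lambda>k. LINT t|circ. (cmod (y (of_real (radius k) * cis t)))\<^sup>2) \<longlonglongrightarrow> (LINT t|circ. (cmod (bval y t))\<^sup>2)"
  proof (rule integral_dominated_convergence[where w="\<lambda>_. B\<^sup>2"])
    have [measurable]: "bval y \<in> borel_measurable borel" by (rule Hinf_measurable_bval[OF y])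
    have [measurable]: "(\<lambda>t. y (of_real (radius k) * cis t)) \<in> borel_measurable borel" for k
      by (rule measurable_dilation[OF hol]) (use radius(1,2)[of k] in simp)
    show "(\<lambda>t. (cmod (bval y t))\<^sup>2) \<in> borel_measurable circ" by (rule measurable_circ) measurable
    show "(\<lambda>t. (cmod (y (of_real (radius k) * cis t)))\<^sup>2) \<in> borel_measurable circ" for k by (rule measurable_circ) measurable
    show "AE t in circ. (\<lambda>k. (cmod (y (of_real (radius k) * cis t)))\<^sup>2) \<longlonglongrightarrow> (cmod (bval y t))\<^sup>2"
      using Hinf_bval_limit[OF y] by eventually_elim (intro tendsto_intros)
    show "AE t in circ. norm ((cmod (y (of_real (radius k) * cis t)))\<^sup>2) \<le> B\<^sup>2" for k
      using radius(1,2)[of k] by (intro AE_I2) (simp, intro power_mono B, auto simp: norm_mult)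
  qed simp
  moreover have "\<forall>\<^sub>F k in sequentially. (LINT t|circ. (cmod (y (of_real r * cis t)))\<^sup>2) \<le> (LINT t|circ. (cmod (y (of_real (radius k) * cis t)))\<^sup>2)"
    using order_tendstoD(1)[OF radius(3) r(2)] by eventually_elim (use mono radius(2) in auto)
  ultimately show ?thesis by (rule tendsto_lowerbound) simp
qed

lemma Hinf_circle_Cauchy_Schwarz:
  assumes y: "y \<in> Hinf" and x: "x \<in> Hinf" and r: "0 \<le> r" "r < 1"
  shows "(LINT t|circ. cmod (y (of_real r * cis t)) * cmod (x (of_real r * cis t))) \<le> boundary_norm y * boundary_norm x"
proof -
  have c: "continuous_on {0..2*pi} (\<lambda>t. f (of_real r * cis t))" if "f \<in> Hinf" for f
    by (rule continuous_circ_compose[OF Hinf_holomorphic[OF that]]) (use r in simp)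
  have "(LINT t|circ. cmod (y (of_real r * cis t)) * cmod (x (of_real r * cis t)))
     \<le> sqrt (LINT t|circ. (cmod (y (of_real r * cis t)))\<^sup>2) * sqrt (LINT t|circ. (cmod (x (of_real r * cis t)))\<^sup>2)"
    by (rule circ_Cauchy_Schwarz) (intro integrable_circ_continuous continuous_intros c y x)+
  also have "\<dots> \<le> boundary_norm y * boundary_norm x"
    unfolding boundary_norm_def using r
    by (intro mult_mono real_sqrt_le_mono Hinf_circle_norm_le y x) (auto simp: integral_nonneg_AE)
  finally show ?thesis .
qed

section \<open>A cut-off function on an arc and integration by parts in a sector\<close>

lemma max_zero_square_derivative:
  fixes y :: real shows "((\<lambda>y. (max 0 y)\<^sup>2) has_real_derivative 2 * max 0 y) (at y)"
proof -
  consider "y > 0" | "y < 0" | "y = 0" by linarith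
  then show ?thesis
  proof cases
    case 1
    have "((\<lambda>y. y\<^sup>2) has_real_derivative 2 * max 0 y) (at y)"
      using 1 by (auto intro!: derivative_eq_intros)
    then show ?thesis
      by (rule DERIV_cong_ev[OF refl _ refl, THEN iffD1, rotated])
         (use 1 eventually_nhds_in_open[of "{0<..}" y] in \<open>auto elim!: eventually_mono\<close>)
  next
    case 2
    have "((\<lambda>y. 0) has_real_derivative 2 * max 0 y) (at y)" using 2 by simp
    then show ?thesis
      by (rule DERIV_cong_ev[OF refl _ refl, THEN iffD1, rotated])
         (use 2 eventually_nhds_in_open[of "{..<0}" y] in \<open>auto elim!: eventually_mono\<close>)
  next
    case 3
    have "((\<lambda>h. (max 0 h)\<^sup>2 / h) \<longlongrightarrow> 0) (at (0::real))"
    proof (rule Lim_null_comparison)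
      show "\<forall>\<^sub>F h in at (0::real). norm ((max 0 h)\<^sup>2 / h) \<le> \<bar>h\<bar>"
        by (intro always_eventually) (auto simp: max_def power2_eq_square)
      show "((\<lambda>h. \<bar>h\<bar>) \<longlongrightarrow> 0) (at (0::real))" by (intro tendsto_rabs_zero tendsto_ident_at)
    qed
    then show ?thesis using 3 by (simp add: DERIV_def)
  qed
qed

lemma norm_cis_diff_square:
  assumes "cmod \<zeta> = 1" shows "(cmod (cis t - \<zeta>))\<^sup>2 = 2 * (1 - Re (cis t * cnj \<zeta>))"
proof -
  have "(cmod (cis t - \<zeta>))\<^sup>2 = (cmod (cis t))\<^sup>2 + (cmod \<zeta>)\<^sup>2 - 2 * Re (cis t * cnj \<zeta>)"
    unfolding cmod_power2 by (simp add: power2_eq_square algebra_simps)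
  then show ?thesis using assms by simp
qed

text \<open>A cut-off function near \<open>\<zeta>\<close>, vanishing quadratically at the end of its support,
  so that it is continuously differentiable; both its derivative and its distance from \<open>1\<close> are
  controlled by the distance to \<open>\<zeta>\<close>.\<close>

locale cutoff =
  fixes \<zeta> :: complex and \<epsilon> :: real
  assumes \<zeta>: "cmod \<zeta> = 1" and \<epsilon>: "0 < \<epsilon>"
begin

text \<open>\<open>X t\<close> is the cosine of the angle between \<open>cis t\<close> and
  \<open>\<zeta>\<close>, so \<open>|cis t - \<zeta>|^2 = 2 * (1 - X t)\<close>. The choice of
  \<open>x1\<close> makes this at most \<open>e1^2 / 8\<close> where \<open>X t \<ge> x1\<close>,
  and a radius between \<open>r0\<close> and 1 moves the point by at most \<open>e1 / 4\<close>. The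
  truncated sector over the support of \<open>chi\<close> thus stays within
  \<open>e1 / 2 + e1 / 4 < \<epsilon>\<close> of \<open>\<zeta>\<close>.\<close>

definition e1 :: real where "e1 = min \<epsilon> 1"
definition x1 :: real where "x1 = 1 - e1\<^sup>2 / 16"
definition r0 :: real where "r0 = 1 - e1 / 4"
definition X :: "real \<Rightarrow> real" where "X t = Re (cis t * cnj \<zeta>)"
definition chi :: "real \<Rightarrow> real" where "chi t = (max 0 ((X t - x1) / (1 - x1)))\<^sup>2"
definition dchi :: "real \<Rightarrow> real" where
  "dchi t = 2 * max 0 ((X t - x1) / (1 - x1)) * (Re (\<i> * cis t * cnj \<zeta>) / (1 - x1))"

lemma e1: "0 < e1" "e1 \<le> \<epsilon>" "e1 \<le> 1" using \<epsilon> by (auto simp: e1_def)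
lemma x1: "0 < 1 - x1" using e1 by (simp add: x1_def)
lemma r0: "3/4 \<le> r0" "r0 < 1" using e1 by (auto simp: r0_def)

lemma X_le_1: "X t \<le> 1"
  using norm_cis_diff_square[OF \<zeta>, of t] zero_le_power2[of "cmod (cis t - \<zeta>)"] by (simp add: X_def)

lemma continuous_X: "continuous_on A X" unfolding X_def by (intro continuous_intros)

lemma ramp_zero: "X t \<le> x1 \<Longrightarrow> max 0 ((X t - x1) / (1 - x1)) = 0"
  using x1 by (intro max_absorb1 divide_nonpos_pos) auto

lemma chi_zero: "X t \<le> x1 \<Longrightarrow> chi t = 0" and dchi_zero: "X t \<le> x1 \<Longrightarrow> dchi t = 0"
  by (simp_all only: chi_def dchi_def ramp_zero) simp_all

lemma ramp_bounds: "0 \<le> max 0 ((X t - x1) / (1 - x1))" "max 0 ((X t - x1) / (1 - x1)) \<le> 1"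
  using X_le_1[of t] x1 by (auto simp: divide_le_eq)

lemma chi_bounds: "0 \<le> chi t" "chi t \<le> 1"
  using ramp_bounds[of t] by (auto simp: chi_def power_le_one)

text \<open>\<open>1 - y^2 \<le> 2 * (1 - y)\<close> for the ramp \<open>y\<close>, and
  \<open>1 - X t\<close> is half the squared distance to \<open>\<zeta>\<close>. The deviation is
  even quadratic in the distance; only the linear bound is kept.\<close>

lemma one_minus_chi_le: "1 - chi t \<le> 2 / (1 - x1) * cmod (cis t - \<zeta>)"
proof -
  define y where "y = max 0 ((X t - x1) / (1 - x1))"
  have y: "0 \<le> y" "y \<le> 1" using ramp_bounds[of t] by (auto simp: y_def)
  have "(X t - x1) / (1 - x1) \<le> y" by (simp add: y_def)
  moreover have "(X t - x1) / (1 - x1) = 1 - (1 - X t) / (1 - x1)" using x1 by (simp add: field_simps)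
  ultimately have 1: "1 - y \<le> (1 - X t) / (1 - x1)" by simp
  have "1 - chi t = (1 - y) * (1 + y)" by (simp add: chi_def y_def power2_eq_square algebra_simps)
  also have "\<dots> \<le> (1 - X t) / (1 - x1) * 2" using 1 y by (intro mult_mono) auto
  also have "\<dots> = (cmod (cis t - \<zeta>))\<^sup>2 / (1 - x1)" using norm_cis_diff_square[OF \<zeta>, of t] by (simp add: X_def)
  also have "\<dots> \<le> (2 * cmod (cis t - \<zeta>)) / (1 - x1)"
  proof (rule divide_right_mono)
    have "cmod (cis t - \<zeta>) \<le> 2" using norm_triangle_ineq4[of "cis t" \<zeta>] \<zeta> by simp
    then show "(cmod (cis t - \<zeta>))\<^sup>2 \<le> 2 * cmod (cis t - \<zeta>)" by (simp add: power2_eq_square mult_right_mono)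
  qed (use x1 in simp)
  finally show ?thesis by simp
qed

lemma dchi_le: "\<bar>dchi t\<bar> \<le> 2 / (1 - x1) * cmod (cis t - \<zeta>)"
proof -
  have "\<bar>Re (\<i> * cis t * cnj \<zeta>)\<bar> = \<bar>Im (cis t * cnj \<zeta> - 1)\<bar>" by simp
  also have "\<dots> \<le> cmod (cis t * cnj \<zeta> - 1)" by (rule abs_Im_le_cmod)
  also have "\<dots> = cmod (cis t - \<zeta>)"
    using norm_cnj_unit_minus[OF \<zeta>, of "cis t"] by (simp add: norm_minus_commute mult.commute)
  finally have 1: "\<bar>Re (\<i> * cis t * cnj \<zeta>)\<bar> \<le> cmod (cis t - \<zeta>)" .
  have "\<bar>dchi t\<bar> = 2 * max 0 ((X t - x1) / (1 - x1)) * (\<bar>Re (\<i> * cis t * cnj \<zeta>)\<bar> / (1 - x1))"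
    unfolding dchi_def using ramp_bounds(1)[of t] x1 by (simp only: abs_mult abs_divide) simp
  also have "\<dots> \<le> 2 * 1 * (cmod (cis t - \<zeta>) / (1 - x1))"
    using ramp_bounds[of t] 1 x1 by (intro mult_mono divide_right_mono) auto
  finally show ?thesis by simp
qed

lemma chi_derivative: "(chi has_real_derivative dchi t) (at t)"
proof -
  have "((\<lambda>t. cis t * cnj \<zeta>) has_vector_derivative (\<i> * cis t * cnj \<zeta>)) (at t)"
    unfolding has_vector_derivative_def
    by (auto intro!: derivative_eq_intros simp: fun_eq_iff scaleR_conv_of_real)
  then have "(X has_real_derivative Re (\<i> * cis t * cnj \<zeta>)) (at t)"
    unfolding X_def[abs_def] has_real_derivative_iff_has_vector_derivative
    by (rule bounded_linear.has_vector_derivative[OF bounded_linear_Re])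
  then have "((\<lambda>t. (X t - x1) / (1 - x1)) has_real_derivative Re (\<i> * cis t * cnj \<zeta>) / (1 - x1)) (at t)"
    using DERIV_cdivide[OF DERIV_diff[OF _ DERIV_const]] by fastforce
  from DERIV_chain2[OF max_zero_square_derivative this]
  show ?thesis unfolding chi_def[abs_def] dchi_def by simp
qed

lemma continuous_chi: "continuous_on A chi" and continuous_dchi: "continuous_on A dchi"
  unfolding chi_def dchi_def using x1 by (intro continuous_intros continuous_X; simp)+

lemma sector:
  assumes "x1 \<le> X t" "r0 \<le> r" "r \<le> 1"
  shows "of_real r * cis t \<in> ball \<zeta> \<epsilon>"
proof -
  have "(cmod (cis t - \<zeta>))\<^sup>2 \<le> 2 * (1 - x1)"
    using norm_cis_diff_square[OF \<zeta>, of t] assms(1) by (simp add: X_def)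
  also have "\<dots> < (e1 / 2)\<^sup>2" using e1 by (simp add: x1_def power2_eq_square)
  finally have 1: "cmod (cis t - \<zeta>) < e1 / 2" by (rule power2_less_imp_less) (use e1 in simp)
  have "of_real r * cis t - \<zeta> = (cis t - \<zeta>) - of_real (1 - r) * cis t" by (simp add: algebra_simps)
  then have "cmod (of_real r * cis t - \<zeta>) \<le> cmod (cis t - \<zeta>) + cmod (of_real (1 - r) * cis t)"
    by (simp only: norm_triangle_ineq4)
  also have "cmod (of_real (1 - r) * cis t) = 1 - r" using assms(3) by (simp only: norm_mult norm_of_real norm_cis) simp
  also have "\<dots> \<le> e1 / 4" using assms(2) by (simp add: r0_def)
  finally show ?thesis using 1 e1 by (simp add: dist_norm norm_minus_commute)
qed

text \<open>\<open>G\<close> is regular only inside the sector while the integrals run over the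
  whole circle; where \<open>X t \<le> x1\<close> the vanishing of \<open>q\<close> takes over.
  Joint continuity is what differentiation under the integral sign asks for.\<close>

lemma cutoff_continuous:
  fixes G :: "complex \<Rightarrow> complex" and q :: "real \<Rightarrow> complex"
  assumes G: "continuous_on (ball 0 1 \<inter> ball \<zeta> \<epsilon>) G" and q: "continuous_on UNIV q"
    and q0: "\<And>t. X t \<le> x1 \<Longrightarrow> q t = 0" and \<rho>: "\<rho> < 1"
  shows "continuous_on ({r0..\<rho>} \<times> T) (\<lambda>(r, t). q t * G (of_real r * cis t))"
proof -
  have "continuous_on ({r0..\<rho>} \<times> T) (\<lambda>p. if X (snd p) \<le> x1 then 0 else q (snd p) * G (of_real (fst p) * cis (snd p)))"
  proof (rule continuous_on_cases_le)
    have "of_real (fst p) * cis (snd p) \<in> ball 0 1 \<inter> ball \<zeta> \<epsilon>" if "p \<in> {p \<in> {r0..\<rho>} \<times> T. x1 \<le> X (snd p)}" for p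
      using that \<rho> r0 sector[of "snd p" "fst p"] by (auto simp: norm_mult)
    then show "continuous_on {p \<in> {r0..\<rho>} \<times> T. x1 \<le> X (snd p)} (\<lambda>p. q (snd p) * G (of_real (fst p) * cis (snd p)))"
      by (intro continuous_intros continuous_on_compose2[OF q] continuous_on_compose2[OF G]) auto
    show "continuous_on ({r0..\<rho>} \<times> T) (\<lambda>p. X (snd p))"
      by (rule continuous_on_compose2[OF continuous_X[of UNIV]]) (auto intro!: continuous_intros)
  qed (auto simp: q0)
  then show ?thesis
    by (rule continuous_on_eq) (auto simp: q0 split_beta')
qed

lemma cutoff_continuous_slice:
  fixes G :: "complex \<Rightarrow> complex" and q :: "real \<Rightarrow> complex"
  assumes G: "continuous_on (ball 0 1 \<inter> ball \<zeta> \<epsilon>) G" and q: "continuous_on UNIV q"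
    and q0: "\<And>t. X t \<le> x1 \<Longrightarrow> q t = 0" and r: "r0 \<le> r" "r < 1"
  shows "continuous_on {0..2*pi} (\<lambda>t. q t * G (of_real r * cis t))"
proof -
  have "continuous_on {0..2*pi} (\<lambda>t. case (r, t) of (r, t) \<Rightarrow> q t * G (of_real r * cis t))"
    by (rule continuous_on_compose2[OF cutoff_continuous[OF G q q0 r(2), of "{0..2*pi}"]])
       (use r in \<open>auto intro!: continuous_intros\<close>)
  then show ?thesis by simp
qed

lemma cutoff_radial_derivative:
  assumes H: "H holomorphic_on (ball 0 1 \<inter> ball \<zeta> \<epsilon>)" and r: "r0 \<le> r" "r < 1"
  shows "((\<lambda>r. of_real (chi t) * H (of_real r * cis t)) has_vector_derivative
     of_real (chi t) * cis t * deriv H (of_real r * cis t)) (at r within A)"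
proof (cases "X t \<le> x1")
  case True
  then show ?thesis by (simp add: chi_zero)
next
  case False
  then have "of_real r * cis t \<in> ball 0 1 \<inter> ball \<zeta> \<epsilon>"
    using sector[of t r] r r0 by (auto simp: norm_mult)
  then have "(H has_field_derivative deriv H (of_real r * cis t)) (at (of_real r * cis t))"
    by (intro holomorphic_derivI[OF H]) auto
  moreover have "((\<lambda>r. of_real r * cis t) has_vector_derivative cis t) (at r)"
    unfolding has_vector_derivative_def by (auto intro!: derivative_eq_intros simp: fun_eq_iff scaleR_conv_of_real)
  ultimately have "(H \<circ> (\<lambda>r. of_real r * cis t) has_vector_derivative cis t * deriv H (of_real r * cis t)) (at r)"
    by (intro field_vector_diff_chain_at)
  then have "((\<lambda>r. of_real (chi t) * H (of_real r * cis t)) has_vector_derivative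
     of_real (chi t) * (cis t * deriv H (of_real r * cis t))) (at r)"
    unfolding o_def by (rule has_vector_derivative_mult_right)
  then show ?thesis by (simp add: mult.assoc has_vector_derivative_at_within)
qed

lemma cutoff_angular_derivative:
  assumes H: "H holomorphic_on (ball 0 1 \<inter> ball \<zeta> \<epsilon>)" and r: "r0 \<le> r" "r < 1"
  shows "((\<lambda>t. of_real (chi t) * H (of_real r * cis t)) has_vector_derivative
     of_real (dchi t) * H (of_real r * cis t) + \<i> * of_real r * (of_real (chi t) * cis t * deriv H (of_real r * cis t))) (at t)"
\<comment> \<open>Strict inequality, so that the first case is an open set of angles on which the
  product vanishes identically. Angles with \<open>X t = x1\<close> fall into the second case, where
  the point still lies in the sector.\<close>
proof (cases "X t < x1")
  case True
  have o: "open {t. X t < x1}"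
    by (intro open_Collect_less continuous_X continuous_on_const)
  have z: "((\<lambda>t. 0) has_vector_derivative of_real (dchi t) * H (of_real r * cis t) + \<i> * of_real r * (of_real (chi t) * cis t * deriv H (of_real r * cis t))) (at t)"
    using True by (simp add: chi_zero dchi_zero)
  show ?thesis
    by (rule has_vector_derivative_transform_within_open[OF z o]) (use True in \<open>auto simp: chi_zero\<close>)
next
  case False
  then have "of_real r * cis t \<in> ball 0 1 \<inter> ball \<zeta> \<epsilon>"
    using sector[of t r] r r0 by (auto simp: norm_mult)
  then have "(H has_field_derivative deriv H (of_real r * cis t)) (at (of_real r * cis t))"
    by (intro holomorphic_derivI[OF H]) auto
  moreover have "((\<lambda>t. of_real r * cis t) has_vector_derivative \<i> * of_real r * cis t) (at t)"
    unfolding has_vector_derivative_def by (auto intro!: derivative_eq_intros simp: fun_eq_iff scaleR_conv_of_real)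
  ultimately have "(H \<circ> (\<lambda>t. of_real r * cis t) has_vector_derivative \<i> * of_real r * cis t * deriv H (of_real r * cis t)) (at t)"
    by (intro field_vector_diff_chain_at)
  moreover have "((\<lambda>t. complex_of_real (chi t)) has_vector_derivative of_real (dchi t)) (at t)"
    using chi_derivative has_vector_derivative_of_real has_real_derivative_iff_has_vector_derivative by blast
  ultimately have "((\<lambda>t. of_real (chi t) * H (of_real r * cis t)) has_vector_derivative
     of_real (chi t) * (\<i> * of_real r * cis t * deriv H (of_real r * cis t)) + of_real (dchi t) * H (of_real r * cis t)) (at t)"
    unfolding o_def by (intro has_vector_derivative_mult)
  then show ?thesis by (simp add: algebra_simps)
qed

text \<open>Since the derivative of \<open>H (of_real r * cis t)\<close> in \<open>t\<close> is
  \<open>\<i> * r * cis t\<close> times \<open>deriv H\<close>, the radial derivative of the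
  integral can be moved from \<open>H\<close> to the cut-off.\<close>

lemma cutoff_integration_by_parts:
  assumes H: "H holomorphic_on (ball 0 1 \<inter> ball \<zeta> \<epsilon>)" and r: "r0 \<le> r" "r < 1"
  shows "\<i> * of_real r * (LINT t|circ. of_real (chi t) * cis t * deriv H (of_real r * cis t)) = - (LINT t|circ. of_real (dchi t) * H (of_real r * cis t))"
proof -
  have cH: "continuous_on (ball 0 1 \<inter> ball \<zeta> \<epsilon>) H" "continuous_on (ball 0 1 \<inter> ball \<zeta> \<epsilon>) (deriv H)"
    using H by (auto intro!: holomorphic_on_imp_continuous_on holomorphic_deriv)
  have i1: "integrable circ (\<lambda>t. of_real (dchi t) * H (of_real r * cis t))"
    by (intro integrable_circ_continuous cutoff_continuous_slice cH r) (auto intro!: continuous_intros continuous_dchi simp: dchi_zero)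
  have i2: "integrable circ (\<lambda>t. of_real (chi t) * cis t * deriv H (of_real r * cis t))"
    by (intro integrable_circ_continuous cutoff_continuous_slice cH r) (auto intro!: continuous_intros continuous_chi simp: chi_zero)
  have "(LINT t|circ. of_real (dchi t) * H (of_real r * cis t) + \<i> * of_real r * (of_real (chi t) * cis t * deriv H (of_real r * cis t))) = 0"
  proof (rule circ_integral_periodic_zero)
    show "of_real (chi (2*pi)) * H (of_real r * cis (2*pi)) = of_real (chi 0) * H (of_real r * cis 0)"
      by (simp add: chi_def X_def)
    show "integrable circ (\<lambda>t. of_real (dchi t) * H (of_real r * cis t) + \<i> * of_real r * (of_real (chi t) * cis t * deriv H (of_real r * cis t)))"
      by (intro Bochner_Integration.integrable_add i1 integrable_mult_right i2)
  qed (rule cutoff_angular_derivative[OF H r])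
  then have "(LINT t|circ. of_real (dchi t) * H (of_real r * cis t)) + (LINT t|circ. \<i> * of_real r * (of_real (chi t) * cis t * deriv H (of_real r * cis t))) = 0"
    by (subst (asm) Bochner_Integration.integral_add[OF i1 integrable_mult_right[OF i2]])
  then show ?thesis by (subst (asm) integral_mult_right_zero) (simp add: eq_neg_iff_add_eq_0 add.commute)
qed

text \<open>The radial derivative is estimated after integration by parts; the factor 2 covers
  \<open>1 / r\<close> for \<open>r \<ge> r0\<close>, and the radii range over an interval of length
  at most 1. The bound is independent of \<open>\<rho>\<close>, so it survives the passage to the
  boundary.\<close>

lemma cutoff_integral_growth:
  assumes H: "H holomorphic_on (ball 0 1 \<inter> ball \<zeta> \<epsilon>)" and \<rho>: "r0 \<le> \<rho>" "\<rho> < 1"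
    and B: "\<And>r. r0 \<le> r \<Longrightarrow> r < 1 \<Longrightarrow> (LINT t|circ. \<bar>dchi t\<bar> * cmod (H (of_real r * cis t))) \<le> B"
  shows "cmod ((LINT t|circ. of_real (chi t) * H (of_real \<rho> * cis t)) - (LINT t|circ. of_real (chi t) * H (of_real r0 * cis t))) \<le> 2 * B"
proof -
  have cH: "continuous_on (ball 0 1 \<inter> ball \<zeta> \<epsilon>) H" "continuous_on (ball 0 1 \<inter> ball \<zeta> \<epsilon>) (deriv H)"
    using H by (auto intro!: holomorphic_on_imp_continuous_on holomorphic_deriv)
  define I where "I r = integral (cbox 0 (2*pi)) (\<lambda>t. of_real (chi t) * H (of_real r * cis t))" for r
  define I' where "I' r = integral (cbox 0 (2*pi)) (\<lambda>t. of_real (chi t) * cis t * deriv H (of_real r * cis t))" for r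
  have c1: "continuous_on {0..2*pi} (\<lambda>t. of_real (chi t) * H (of_real r * cis t))" if "r0 \<le> r" "r < 1" for r
    by (intro cutoff_continuous_slice cH that) (auto intro!: continuous_intros continuous_chi simp: chi_zero)
  have c2: "continuous_on {0..2*pi} (\<lambda>t. of_real (chi t) * cis t * deriv H (of_real r * cis t))" if "r0 \<le> r" "r < 1" for r
    by (intro cutoff_continuous_slice cH that) (auto intro!: continuous_intros continuous_chi simp: chi_zero)
  have c3: "continuous_on {0..2*pi} (\<lambda>t. of_real (dchi t) * H (of_real r * cis t))" if "r0 \<le> r" "r < 1" for r
    by (intro cutoff_continuous_slice cH that) (auto intro!: continuous_intros continuous_dchi simp: dchi_zero)
  have I_eq: "I r = (LINT t|circ. of_real (chi t) * H (of_real r * cis t))" if "r0 \<le> r" "r < 1" for r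
    using circ_has_integral[OF integrable_circ_continuous[OF c1[OF that]]] by (simp add: I_def integral_unique)
  have I'_eq: "I' r = (LINT t|circ. of_real (chi t) * cis t * deriv H (of_real r * cis t))" if "r0 \<le> r" "r < 1" for r
    using circ_has_integral[OF integrable_circ_continuous[OF c2[OF that]]] by (simp add: I'_def integral_unique)
  have dI: "(I has_vector_derivative I' r) (at r within {r0..\<rho>})" if "r \<in> {r0..\<rho>}" for r
    unfolding I_def I'_def
  proof (rule leibniz_rule_vector_derivative)
    show "((\<lambda>r. of_real (chi t) * H (of_real r * cis t)) has_vector_derivative of_real (chi t) * cis t * deriv H (of_real r * cis t)) (at r within {r0..\<rho>})"
      if "r \<in> {r0..\<rho>}" for r t
      by (rule cutoff_radial_derivative[OF H]) (use that \<rho> in auto)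
    show "(\<lambda>t. of_real (chi t) * H (of_real r * cis t)) integrable_on cbox 0 (2*pi)" if "r \<in> {r0..\<rho>}" for r
      unfolding cbox_interval by (intro integrable_continuous_interval c1) (use that \<rho> in auto)
    show "continuous_on ({r0..\<rho>} \<times> cbox 0 (2*pi)) (\<lambda>(r, t). of_real (chi t) * cis t * deriv H (of_real r * cis t))"
      by (rule cutoff_continuous[OF cH(2) _ _ \<rho>(2)]) (auto intro!: continuous_intros continuous_chi simp: chi_zero)
  qed (use that in auto)
  have B0: "0 \<le> B"
    using order_trans[OF _ B[of r0]] r0 by (simp add: integral_nonneg_AE)
  have bI': "norm (I' r) \<le> 2 * B" if "r \<in> {r0..\<rho>}" for r
  proof -
    have r: "r0 \<le> r" "r < 1" using that \<rho> by auto
    have "\<i> * of_real r * I' r = - (LINT t|circ. of_real (dchi t) * H (of_real r * cis t))"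
      unfolding I'_eq[OF r] by (rule cutoff_integration_by_parts[OF H r])
    then have "cmod (\<i> * of_real r * I' r) = cmod (LINT t|circ. of_real (dchi t) * H (of_real r * cis t))" by simp
    also have "\<dots> \<le> (LINT t|circ. cmod (of_real (dchi t) * H (of_real r * cis t)))" by (rule integral_norm_bound)
    also have "\<dots> \<le> B" using B[OF r] by (simp add: norm_mult)
    finally have "r * cmod (I' r) \<le> B" using r r0 by (simp add: norm_mult)
    moreover have "(1/2) * cmod (I' r) \<le> r * cmod (I' r)" using r r0 by (intro mult_right_mono) auto
    ultimately show ?thesis by simp
  qed
  have "(I' has_integral I \<rho> - I r0) {r0..\<rho>}"
    by (rule fundamental_theorem_of_calculus[OF \<rho>(1) dI])
  then have "norm (I \<rho> - I r0) \<le> 2 * B * measure lborel (cbox r0 \<rho>)"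
    by (intro has_integral_bound[where f=I']) (use bI' B0 in auto)
  also have "\<dots> \<le> 2 * B * 1" using \<rho> r0 B0 by (intro mult_left_mono) auto
  finally show ?thesis using I_eq[of \<rho>] I_eq[of r0] \<rho> r0 by simp
qed

end

section \<open>Difference quotients and the estimate on the arc\<close>

lemma Hinf_sum: "(\<And>i. i \<in> I \<Longrightarrow> f i \<in> Hinf) \<Longrightarrow> (\<lambda>z. \<Sum>i\<in>I. f i z) \<in> Hinf"
proof (induction I rule: infinite_finite_induct)
  case (insert i I)
  obtain B where B: "\<And>z. z \<in> ball 0 1 \<Longrightarrow> cmod (f i z) \<le> B" using Hinf_bound[OF insert.prems[OF insertI1]] by metis
  have IH: "(\<lambda>z. \<Sum>i\<in>I. f i z) \<in> Hinf" using insert by blast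
  obtain C where C: "\<And>z. z \<in> ball 0 1 \<Longrightarrow> cmod (\<Sum>i\<in>I. f i z) \<le> C" using Hinf_bound[OF IH] by metis
  have "(\<lambda>z. f i z + (\<Sum>i\<in>I. f i z)) \<in> Hinf"
  proof (rule HinfI)
    show "(\<lambda>z. f i z + (\<Sum>i\<in>I. f i z)) holomorphic_on ball 0 1"
      using Hinf_holomorphic[OF IH] Hinf_holomorphic[of "f i"] insert.prems by (intro holomorphic_on_add) auto
    show "cmod (f i z + (\<Sum>i\<in>I. f i z)) \<le> B + C" if "z \<in> ball 0 1" for z
      using norm_triangle_mono[OF B[OF that] C[OF that]] .
  qed
  then show ?case using insert.hyps by simp
qed simp_all

lemma Hinf_linear_factor: "(\<lambda>z. z - \<zeta>) \<in> Hinf"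
  by (rule HinfI[where B="1 + cmod \<zeta>"])
     (auto intro!: holomorphic_intros order_trans[OF norm_triangle_ineq4])

text \<open>The singularity at \<open>w\<close> is removable. Compactness bounds the quotient on a
  disk of radius \<open>s > |w|\<close>, and outside it the denominator is at least
  \<open>s - |w|\<close>.\<close>

lemma Hinf_difference_quotient:
  assumes b: "b \<in> Hinf" and w: "w \<in> ball 0 1"
  shows "(\<lambda>z. if z = w then deriv b w else (b z - b w) / (z - w)) \<in> Hinf" (is "?D \<in> Hinf")
proof -
  obtain B where B: "0 \<le> B" "\<And>z. z \<in> ball 0 1 \<Longrightarrow> cmod (b z) \<le> B" using Hinf_bound[OF b] by metis
  have hol: "?D holomorphic_on ball 0 1"
    by (rule pole_lemma_open[OF Hinf_holomorphic[OF b]]) simp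
  obtain s where s: "cmod w < s" "s < 1" using w dense[of "cmod w" 1] by auto
  have "compact (?D ` cball 0 s)"
    by (intro compact_continuous_image compact_cball continuous_on_subset[OF holomorphic_on_imp_continuous_on[OF hol]])
       (use s in auto)
  then obtain C where C: "\<forall>y\<in>?D ` cball 0 s. cmod y \<le> C" using compact_imp_bounded bounded_iff by metis
  show ?thesis
  proof (rule HinfI[OF hol])
    fix z :: complex assume z: "z \<in> ball 0 1"
    show "cmod (?D z) \<le> max C (2 * B / (s - cmod w))"
    proof (cases "cmod z \<le> s")
      case True
      then have "cmod (?D z) \<le> C" using C by (auto simp del: if_split)
      then show ?thesis by simp
    next
      case False
      then have ne: "z \<noteq> w" and d: "s - cmod w \<le> cmod (z - w)"
        using s norm_triangle_ineq2[of z w] by auto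
      have "cmod (b z - b w) \<le> 2 * B"
        using norm_triangle_ineq4[of "b z" "b w"] B(2)[OF z] B(2)[OF w] by simp
      then have "cmod ((b z - b w) / (z - w)) \<le> 2 * B / (s - cmod w)"
        unfolding norm_divide using d s B(1) by (intro frac_le) auto
      then show ?thesis using ne by simp
    qed
  qed
qed

text \<open>Passing from the boundary point to its dilation costs \<open>1 - r\<close>, which is
  itself at most the distance of the dilated point from \<open>\<zeta>\<close>.\<close>

lemma norm_cis_le_dilation:
  assumes "cmod \<zeta> = 1" "0 \<le> r" "r \<le> 1"
  shows "cmod (cis t - \<zeta>) \<le> 2 * cmod (of_real r * cis t - \<zeta>)"
    and "1 - r \<le> cmod (of_real r * cis t - \<zeta>)"
proof -
  show 1: "1 - r \<le> cmod (of_real r * cis t - \<zeta>)"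
    using norm_triangle_ineq2[of \<zeta> "of_real r * cis t"] assms by (simp add: norm_mult norm_minus_commute)
  have "cis t - \<zeta> = of_real (1 - r) * cis t + (of_real r * cis t - \<zeta>)" by (simp add: algebra_simps)
  then have "cmod (cis t - \<zeta>) \<le> cmod (of_real (1 - r) * cis t) + cmod (of_real r * cis t - \<zeta>)"
    by (metis norm_triangle_ineq)
  also have "cmod (of_real (1 - r) * cis t) = 1 - r" using assms by (simp only: norm_mult norm_of_real norm_cis) simp
  finally show "cmod (cis t - \<zeta>) \<le> 2 * cmod (of_real r * cis t - \<zeta>)" using 1 by simp
qed

context cutoff
begin

text \<open>The first summand bounds the integral at the initial radius \<open>r0\<close>, the
  second its variation from there to the boundary.\<close>

definition arc_const :: real where "arc_const = 2 / (1 - r0) + 2 * (8 / (1 - x1))"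

lemma boundary_lower_bound:
  assumes b: "b \<in> Hinf" and bU: "\<And>z. z \<in> ball 0 1 \<inter> ball \<zeta> \<epsilon> \<Longrightarrow> 1/2 < cmod (b z)"
  shows "AE t in circ. x1 < X t \<longrightarrow> 1/2 \<le> cmod (bval b t)"
  using Hinf_bval_limit[OF b]
proof eventually_elim
  case (elim t)
  show ?case
  proof
    assume X: "x1 < X t"
    have "\<forall>\<^sub>F k in sequentially. 1/2 \<le> cmod (b (of_real (radius k) * cis t))"
      using order_tendstoD(1)[OF radius(3) r0(2)]
    proof eventually_elim
      case (elim k)
      then have "of_real (radius k) * cis t \<in> ball 0 1 \<inter> ball \<zeta> \<epsilon>"
        using sector[of t "radius k"] X radius(1,2)[of k] by (auto simp: norm_mult)
      then show ?case using bU by (simp add: less_imp_le)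
    qed
    then show "1/2 \<le> cmod (bval b t)"
      by (intro tendsto_lowerbound[OF tendsto_norm[OF elim]]) auto
  qed
qed

text \<open>Only \<open>(z - \<zeta>) * F\<close> is controlled, so a factor
  \<open>|z - \<zeta>|\<close> has to be gained. As \<open>F * x / b\<close> is analytic in the
  sector, the boundary integral is compared with the one at radius \<open>r0\<close>, where
  \<open>|z - \<zeta>| \<ge> 1 - r0\<close>; in between, the derivative of the cut-off contributes
  \<open>|cis t - \<zeta>|\<close>.\<close>

lemma arc_estimate:
  assumes b: "b \<in> Hinf" and bU: "\<And>z. z \<in> ball 0 1 \<inter> ball \<zeta> \<epsilon> \<Longrightarrow> 1/2 < cmod (b z)"
    and F: "F \<in> Hinf" and x: "x \<in> Hinf"
  shows "cmod (LINT t|circ. of_real (chi t) * (bval F t * bval x t / bval b t)) \<le> arc_const * (boundary_norm (\<lambda>z. (z - \<zeta>) * F z) * boundary_norm x)"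
proof -
  define E where "E = (\<lambda>z. (z - \<zeta>) * F z)"
  define S where "S = boundary_norm E * boundary_norm x"
  have E: "E \<in> Hinf" unfolding E_def by (rule Hinf_mult[OF Hinf_linear_factor F])
  define U where "U = ball 0 1 \<inter> ball \<zeta> \<epsilon>"
  define H where "H z = F z * x z / b z" for z
  have sub: "U \<subseteq> ball 0 1" by (auto simp: U_def)
  have bn: "b z \<noteq> 0" if "z \<in> U" for z using bU[of z] that by (auto simp: U_def)
  have H: "H holomorphic_on U"
    unfolding H_def using bn Hinf_holomorphic[OF F] Hinf_holomorphic[OF x] Hinf_holomorphic[OF b]
    by (intro holomorphic_intros) (auto intro: holomorphic_on_subset[OF _ sub])
  have cH: "continuous_on (ball 0 1 \<inter> ball \<zeta> \<epsilon>) H" using H unfolding U_def by (rule holomorphic_on_imp_continuous_on)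
  have HU: "cmod (H z) \<le> 2 * (cmod (F z) * cmod (x z))" if "z \<in> U" for z
  proof -
    have "1/2 < cmod (b z)" using bU that by (simp add: U_def)
    then have "cmod (F z) * cmod (x z) / cmod (b z) \<le> cmod (F z) * cmod (x z) / (1/2)" by (intro divide_left_mono) auto
    then show ?thesis by (simp add: H_def norm_mult norm_divide)
  qed
  have inU: "of_real r * cis t \<in> U" if "x1 \<le> X t" "r0 \<le> r" "r < 1" for r t
    using sector[of t r] that r0 by (auto simp: U_def norm_mult)
  have blb: "AE t in circ. x1 < X t \<longrightarrow> 1/2 \<le> cmod (bval b t)" by (rule boundary_lower_bound[OF b bU])
  have cc: "continuous_on {0..2*pi} (\<lambda>t. of_real (chi t) * H (of_real r * cis t))"
    and cd: "continuous_on {0..2*pi} (\<lambda>t. of_real (dchi t) * H (of_real r * cis t))" if "r0 \<le> r" "r < 1" for r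
    by (intro cutoff_continuous_slice cH that; auto intro!: continuous_intros continuous_chi continuous_dchi simp: chi_zero dchi_zero)+
  have iEx: "integrable circ (\<lambda>t. cmod (E (of_real r * cis t)) * cmod (x (of_real r * cis t)))" if "r0 \<le> r" "r < 1" for r
    using that r0
    by (intro integrable_circ_continuous continuous_intros continuous_circ_compose[OF Hinf_holomorphic[OF E]] continuous_circ_compose[OF Hinf_holomorphic[OF x]]) auto
  have Ex: "(LINT t|circ. cmod (E (of_real r * cis t)) * cmod (x (of_real r * cis t))) \<le> S" if "r0 \<le> r" "r < 1" for r
    unfolding S_def using that r0 by (intro Hinf_circle_Cauchy_Schwarz E x) auto
  \<comment> \<open>The constant is \<open>8 = 2 * 2 * 2\<close>: from \<open>dchi_le\<close>, from
    replacing \<open>cis t\<close> by its dilation, and from \<open>1 / |b| < 2\<close>.\<close>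
  have dB: "(LINT t|circ. \<bar>dchi t\<bar> * cmod (H (of_real r * cis t))) \<le> 8 / (1 - x1) * S" if r: "r0 \<le> r" "r < 1" for r
  proof -
    have "(LINT t|circ. \<bar>dchi t\<bar> * cmod (H (of_real r * cis t))) \<le> (LINT t|circ. 8 / (1 - x1) * (cmod (E (of_real r * cis t)) * cmod (x (of_real r * cis t))))"
    proof (rule integral_mono)
      have "continuous_on {0..2*pi} (\<lambda>t. cmod (of_real (dchi t) * H (of_real r * cis t)))" by (intro continuous_on_norm cd r)
      then show "integrable circ (\<lambda>t. \<bar>dchi t\<bar> * cmod (H (of_real r * cis t)))"
        by (intro integrable_circ_continuous) (simp add: norm_mult)
      show "integrable circ (\<lambda>t. 8 / (1 - x1) * (cmod (E (of_real r * cis t)) * cmod (x (of_real r * cis t))))"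
        by (intro integrable_mult_right iEx r)
      fix t
      let ?z = "of_real r * cis t"
      show "\<bar>dchi t\<bar> * cmod (H ?z) \<le> 8 / (1 - x1) * (cmod (E ?z) * cmod (x ?z))"
      proof (cases "X t \<le> x1")
        case True
        then show ?thesis using x1 by (simp add: dchi_zero)
      next
        case False
        have "\<bar>dchi t\<bar> \<le> 2 / (1 - x1) * (2 * cmod (?z - \<zeta>))"
          using dchi_le[of t] norm_cis_le_dilation(1)[OF \<zeta>, of r t] r r0 x1
          by (intro order_trans[OF dchi_le] mult_left_mono) auto
        then have "\<bar>dchi t\<bar> * cmod (H ?z) \<le> 2 / (1 - x1) * (2 * cmod (?z - \<zeta>)) * (2 * (cmod (F ?z) * cmod (x ?z)))"
          using HU[OF inU[of t r]] False r x1 by (intro mult_mono) auto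
        then show ?thesis by (simp add: E_def norm_mult mult_ac)
      qed
    qed
    also have "\<dots> = 8 / (1 - x1) * (LINT t|circ. cmod (E (of_real r * cis t)) * cmod (x (of_real r * cis t)))"
      by (rule integral_mult_right_zero)
    also have "\<dots> \<le> 8 / (1 - x1) * S" using Ex[OF r] x1 by (intro mult_left_mono) auto
    finally show ?thesis .
  qed
  have start: "cmod (LINT t|circ. of_real (chi t) * H (of_real r0 * cis t)) \<le> 2 / (1 - r0) * S"
  proof -
    have "cmod (LINT t|circ. of_real (chi t) * H (of_real r0 * cis t)) \<le> (LINT t|circ. cmod (of_real (chi t) * H (of_real r0 * cis t)))"
      by (rule integral_norm_bound)
    also have "\<dots> \<le> (LINT t|circ. 2 / (1 - r0) * (cmod (E (of_real r0 * cis t)) * cmod (x (of_real r0 * cis t))))"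
    proof (rule integral_mono)
      show "integrable circ (\<lambda>t. cmod (of_real (chi t) * H (of_real r0 * cis t)))"
        using r0 by (intro integrable_norm integrable_circ_continuous cc) auto
      show "integrable circ (\<lambda>t. 2 / (1 - r0) * (cmod (E (of_real r0 * cis t)) * cmod (x (of_real r0 * cis t))))"
        using r0 by (intro integrable_mult_right iEx) auto
      fix t
      let ?z = "of_real r0 * cis t"
      show "cmod (of_real (chi t) * H ?z) \<le> 2 / (1 - r0) * (cmod (E ?z) * cmod (x ?z))"
      proof (cases "X t \<le> x1")
        case True
        then show ?thesis using r0 by (simp add: chi_zero)
      next
        case False
        have "cmod (of_real (chi t) * H ?z) \<le> 1 * (2 * (cmod (F ?z) * cmod (x ?z)))"
          unfolding norm_mult using HU[OF inU[of t r0]] False r0 chi_bounds[of t] by (intro mult_mono) auto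
        also have "\<dots> \<le> cmod (?z - \<zeta>) / (1 - r0) * (2 * (cmod (F ?z) * cmod (x ?z)))"
          using norm_cis_le_dilation(2)[OF \<zeta>, of r0 t] r0 by (intro mult_right_mono) auto
        also have "\<dots> = 2 / (1 - r0) * (cmod (E ?z) * cmod (x ?z))" by (simp add: E_def norm_mult)
        finally show ?thesis .
      qed
    qed
    also have "\<dots> = 2 / (1 - r0) * (LINT t|circ. cmod (E (of_real r0 * cis t)) * cmod (x (of_real r0 * cis t)))"
      by (rule integral_mult_right_zero)
    also have "\<dots> \<le> 2 / (1 - r0) * S" using Ex[of r0] r0 by (intro mult_left_mono) auto
    finally show ?thesis .
  qed
  have bound: "cmod (LINT t|circ. of_real (chi t) * H (of_real \<rho> * cis t)) \<le> arc_const * S" if \<rho>: "r0 \<le> \<rho>" "\<rho> < 1" for \<rho>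
  proof -
    have "cmod ((LINT t|circ. of_real (chi t) * H (of_real \<rho> * cis t)) - (LINT t|circ. of_real (chi t) * H (of_real r0 * cis t))) \<le> 2 * (8 / (1 - x1) * S)"
      by (rule cutoff_integral_growth[OF H[unfolded U_def] \<rho> dB])
    then have "cmod (LINT t|circ. of_real (chi t) * H (of_real \<rho> * cis t)) \<le> 2 / (1 - r0) * S + 2 * (8 / (1 - x1) * S)"
      using start norm_triangle_sub by (smt (verit, best))
    then show ?thesis by (simp add: arc_const_def distrib_right)
  qed
  obtain BF where BF: "0 \<le> BF" "\<And>z. z \<in> ball 0 1 \<Longrightarrow> cmod (F z) \<le> BF" using Hinf_bound[OF F] by metis
  obtain Bx where Bx: "0 \<le> Bx" "\<And>z. z \<in> ball 0 1 \<Longrightarrow> cmod (x z) \<le> Bx" using Hinf_bound[OF x] by metis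
  \<comment> \<open>The sector begins at \<open>r0\<close>, so the sequence of radii is shifted
    until all of them exceed it.\<close>
  obtain k0 where k0: "\<And>k. k0 \<le> k \<Longrightarrow> r0 < radius k"
    using order_tendstoD(1)[OF radius(3) r0(2)] unfolding eventually_sequentially by blast
  have k1: "r0 \<le> radius (k + k0)" "radius (k + k0) < 1" for k using k0[of "k + k0"] radius(2) by (auto intro: less_imp_le)
  have "(\<lambda>k. LINT t|circ. of_real (chi t) * H (of_real (radius (k + k0)) * cis t)) \<longlonglongrightarrow>
     (LINT t|circ. of_real (chi t) * (bval F t * bval x t / bval b t))"
  proof (rule integral_dominated_convergence[where w="\<lambda>_. 2 * (BF * Bx)"])
    have [measurable]: "bval F \<in> borel_measurable borel" "bval x \<in> borel_measurable borel" "bval b \<in> borel_measurable borel"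
      by (intro Hinf_measurable_bval F x b)+
    have [measurable]: "chi \<in> borel_measurable borel" by (rule borel_measurable_continuous_onI[OF continuous_chi])
    show "(\<lambda>t. of_real (chi t) * (bval F t * bval x t / bval b t)) \<in> borel_measurable circ"
      by (rule measurable_circ) measurable
    show "(\<lambda>t. of_real (chi t) * H (of_real (radius (k + k0)) * cis t)) \<in> borel_measurable circ" for k
      by (rule borel_measurable_integrable[OF integrable_circ_continuous[OF cc[OF k1]]])
    show "AE t in circ. (\<lambda>k. of_real (chi t) * H (of_real (radius (k + k0)) * cis t)) \<longlonglongrightarrow> of_real (chi t) * (bval F t * bval x t / bval b t)"
      using blb Hinf_bval_limit[OF F] Hinf_bval_limit[OF x] Hinf_bval_limit[OF b]
    proof eventually_elim
      case (elim t)
      show ?case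
      proof (cases "X t \<le> x1")
        case True
        then show ?thesis by (simp add: chi_zero)
      next
        case False
        then have "bval b t \<noteq> 0" using elim(1) by auto
        then show ?thesis unfolding H_def
          by (intro tendsto_intros LIMSEQ_ignore_initial_segment[OF elim(2)] LIMSEQ_ignore_initial_segment[OF elim(3)] LIMSEQ_ignore_initial_segment[OF elim(4)])
      qed
    qed
    show "AE t in circ. norm (of_real (chi t) * H (of_real (radius (k + k0)) * cis t)) \<le> 2 * (BF * Bx)" for k
    proof (intro AE_I2)
      fix t
      let ?z = "of_real (radius (k + k0)) * cis t"
      show "norm (of_real (chi t) * H ?z) \<le> 2 * (BF * Bx)"
      proof (cases "X t \<le> x1")
        case True
        then show ?thesis using BF Bx by (simp add: chi_zero)
      next
        case False
        then have z: "?z \<in> U" using inU[of t "radius (k + k0)"] k1 by auto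
        then have z': "?z \<in> ball 0 1" using sub by blast
        have "norm (of_real (chi t) * H ?z) \<le> 1 * (2 * (cmod (F ?z) * cmod (x ?z)))"
          unfolding norm_mult using HU[OF z] chi_bounds[of t] by (intro mult_mono) auto
        also have "\<dots> \<le> 1 * (2 * (BF * Bx))" using BF(2)[OF z'] Bx(2)[OF z'] BF(1) by (intro mult_left_mono mult_mono) auto
        finally show ?thesis by simp
      qed
    qed
  qed simp
  from tendsto_norm[OF this] show ?thesis
    unfolding E_def[symmetric] S_def[symmetric]
    by (rule Lim_bounded) (use bound k1 in auto)
qed

end

text \<open>With \<open>F\<close> the Szego combination, \<open>x(z) = z (\<Sum>\<^sub>i cnj (c\<^sub>i) (b(z) - b(w\<^sub>i)) / (z - w\<^sub>i))\<close>
  is analytic, vanishes at \<open>0\<close>, and the Gram form is the sum of the integrals of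
  \<open>(1 - |b|\<^sup>2) |F|\<^sup>2 = |a|\<^sup>2 |F|\<^sup>2\<close> and of \<open>|x|\<^sup>2\<close>, the latter being equal to that of \<open>cnj b F x\<close>.
  On an arc around \<open>\<zeta>\<close>, \<open>cnj b = 1 / b - |a|\<^sup>2 / b\<close>: the first part is analytic in a sector, where
  one integrates by parts against a cut-off function; the second is small because \<open>a\<close> vanishes at \<open>\<zeta>\<close>.\<close>

theorem gram_estimate:
  assumes b: "b \<in> Hinf_ball" and a: "a \<in> Hinf"
    and ab: "AE t in circ. (cmod (bval a t))\<^sup>2 + (cmod (bval b t))\<^sup>2 = 1"
    and \<zeta>: "cmod \<zeta> = 1" and aM: "\<And>z. z \<in> ball 0 1 \<Longrightarrow> cmod (a z) \<le> M * cmod (z - \<zeta>)"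
    and spec: "\<zeta> \<notin> spectrum_b b"
  shows "\<exists>C. \<forall>n c w. (\<forall>i<n. w i \<in> ball 0 1) \<longrightarrow>
     gram (kb b) n c w \<le> C * (LINT t|circ. (cmod (cis t - \<zeta>))\<^sup>2 * (cmod (szego n c w (cis t)))\<^sup>2)"
proof -
  note bH = Hinf_ball_Hinf[OF b]
  have "1 \<le> Liminf (at \<zeta> within ball 0 1) (\<lambda>z. ereal (cmod (b z)))" using spec \<zeta> by (simp add: spectrum_b_def not_less)
  \<comment> \<open>Any level strictly between 0 and 1 would serve; with \<open>1/2\<close> the
    bound for \<open>1 / |b|\<close> near \<open>\<zeta>\<close> is 2.\<close>
  then have "ereal (1/2) < 1 \<longrightarrow> (\<forall>\<^sub>F z in at \<zeta> within ball 0 1. ereal (1/2) < ereal (cmod (b z)))"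
    unfolding le_Liminf_iff by blast
  then have "\<forall>\<^sub>F z in at \<zeta> within ball 0 1. 1/2 < cmod (b z)"
    by (simp only: one_ereal_def ereal_less_eq less_ereal.simps)
  then obtain \<epsilon> where \<epsilon>: "0 < \<epsilon>" and \<epsilon>b: "\<And>z. z \<in> ball 0 1 \<Longrightarrow> z \<noteq> \<zeta> \<Longrightarrow> dist z \<zeta> < \<epsilon> \<Longrightarrow> 1/2 < cmod (b z)"
    unfolding eventually_at by auto
  have bU: "1/2 < cmod (b z)" if "z \<in> ball 0 1 \<inter> ball \<zeta> \<epsilon>" for z
  proof -
    have "z \<noteq> \<zeta>" using that \<zeta> by auto
    then show ?thesis using \<epsilon>b[of z] that by (simp add: dist_commute)
  qed
  interpret cutoff \<zeta> \<epsilon> by unfold_locales fact+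
  have M0: "0 \<le> M"
  proof -
    have "0 \<le> M * cmod (0 - \<zeta>)" by (rule order_trans[OF norm_ge_zero aM]) simp
    then show ?thesis using \<zeta> by simp
  qed
  have bb: "AE t in circ. cmod (bval b t) \<le> 1" by (rule Hinf_bval_bound[OF bH Hinf_ball_norm_le[OF b]])
  have aa: "AE t in circ. cmod (bval a t) \<le> M * cmod (cis t - \<zeta>)"
    using Hinf_bval_limit[OF a]
  proof eventually_elim
    case (elim t)
    have "(\<lambda>k. M * cmod (of_real (radius k) * cis t - \<zeta>)) \<longlonglongrightarrow> M * cmod (of_real 1 * cis t - \<zeta>)"
      by (intro tendsto_intros radius)
    moreover have "cmod (a (of_real (radius k) * cis t)) \<le> M * cmod (of_real (radius k) * cis t - \<zeta>)" for k
      using radius(1,2)[of k] by (intro aM) (simp add: norm_mult)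
    ultimately show ?case using LIMSEQ_le[OF tendsto_norm[OF elim]] by simp
  qed
  have blb: "AE t in circ. x1 < X t \<longrightarrow> 1/2 \<le> cmod (bval b t)" by (rule boundary_lower_bound[OF bH bU])
  define C1 where "C1 = 2 / (1 - x1) + 2 * M"
  have C1: "0 \<le> C1" using x1 M0 by (simp add: C1_def)
  define C2 where "C2 = C1 + arc_const"
  have C2: "0 \<le> C2" using C1 x1 r0 by (simp add: C2_def arc_const_def)
  \<comment> \<open>Two errors, both of the order of \<open>|cis t - \<zeta>|\<close>: the part
    \<open>(1 - chi) * cnj b\<close>, where \<open>|b| \<le> 1\<close> and \<open>1 - chi\<close> is
    small at \<open>\<zeta>\<close>; and \<open>chi * (cnj b - 1 / b)\<close>, of modulus
    \<open>chi * |a|^2 / |b|\<close>, where \<open>|a|^2 \<le> |a|\<close> and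
    \<open>1 / |b| \<le> 2\<close>. They account for the two summands of \<open>C1\<close>.\<close>
  have key: "AE t in circ. cmod (cnj (bval b t) - of_real (chi t) / bval b t) \<le> C1 * cmod (cis t - \<zeta>)"
    using bb aa ab blb
  proof eventually_elim
    case (elim t)
    define \<beta> where "\<beta> = bval b t"
    have d0: "0 \<le> cmod (cis t - \<zeta>)" by simp
    have 1: "cmod (of_real (1 - chi t) * cnj \<beta>) \<le> 2 / (1 - x1) * cmod (cis t - \<zeta>)"
    proof -
      have "cmod (of_real (1 - chi t) * cnj \<beta>) = (1 - chi t) * cmod \<beta>"
        using chi_bounds[of t] by (simp only: norm_mult norm_of_real) simp
      also have "\<dots> \<le> (1 - chi t) * 1" using elim(1) chi_bounds[of t] by (intro mult_left_mono) (auto simp: \<beta>_def)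
      finally show ?thesis using one_minus_chi_le[of t] by simp
    qed
    have 2: "cmod (of_real (chi t) * (cnj \<beta> - 1 / \<beta>)) \<le> 2 * M * cmod (cis t - \<zeta>)"
    proof (cases "X t \<le> x1")
      case True
      then show ?thesis using M0 by (simp add: chi_zero)
    next
      case False
      then have l: "1/2 \<le> cmod \<beta>" using elim(4) by (simp add: \<beta>_def)
      then have nz: "\<beta> \<noteq> 0" by auto
      have a1: "cmod (bval a t) \<le> 1"
      proof -
        have "(cmod (bval a t))\<^sup>2 \<le> 1" using elim(3) zero_le_power2[of "cmod (bval b t)"] by linarith
        then show ?thesis by (simp add: abs_square_le_1)
      qed
      have "cnj \<beta> - 1 / \<beta> = - of_real (1 - (cmod \<beta>)\<^sup>2) / \<beta>"
        unfolding of_real_diff complex_norm_square using nz by (simp add: field_simps)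
      also have "1 - (cmod \<beta>)\<^sup>2 = (cmod (bval a t))\<^sup>2" using elim(3) by (simp add: \<beta>_def)
      finally have "cmod (cnj \<beta> - 1 / \<beta>) = (cmod (bval a t))\<^sup>2 / cmod \<beta>" by (simp add: norm_divide norm_power)
      also have "\<dots> \<le> cmod (bval a t) / (1/2)"
        using l a1 by (intro frac_le) (auto simp: power2_eq_square mult_left_le)
      finally have "cmod (cnj \<beta> - 1 / \<beta>) \<le> 2 * M * cmod (cis t - \<zeta>)" using elim(2) by simp
      then have "chi t * cmod (cnj \<beta> - 1 / \<beta>) \<le> 1 * (2 * M * cmod (cis t - \<zeta>))"
        using chi_bounds[of t] by (intro mult_mono) auto
      then show ?thesis using chi_bounds[of t] by (simp add: norm_mult)
    qed
    have "cnj \<beta> - of_real (chi t) / \<beta> = of_real (1 - chi t) * cnj \<beta> + of_real (chi t) * (cnj \<beta> - 1 / \<beta>)"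
      by (simp add: algebra_simps)
    then have "cmod (cnj \<beta> - of_real (chi t) / \<beta>) \<le> 2 / (1 - x1) * cmod (cis t - \<zeta>) + 2 * M * cmod (cis t - \<zeta>)"
      using norm_triangle_mono[OF 1 2] by simp
    then show ?case by (simp add: C1_def \<beta>_def distrib_right)
  qed
  show ?thesis
  proof (intro exI allI impI)
    fix n :: nat and c w :: "nat \<Rightarrow> complex" assume w: "\<forall>i<n. w i \<in> ball 0 1"
    define F where "F = szego n c w"
    define G where "G = szego n (\<lambda>i. c i * cnj (b (w i))) w"
    have F: "F \<in> Hinf" unfolding F_def by (rule szego_Hinf[OF w])
    have Fb: "AE t in circ. bval F t = F (cis t)"
      unfolding F_def by (rule Hinf_bval_eq_continuous[OF szego_Hinf[OF w] isCont_szego[OF w]]) simp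
    define x where "x = (\<lambda>z. \<Sum>i<n. cnj (c i) * (z * (if z = w i then deriv b (w i) else (b z - b (w i)) / (z - w i))))"
    have x: "x \<in> Hinf"
      unfolding x_def
    proof (intro Hinf_sum Hinf_mult Hinf_const)
      show "(\<lambda>z. z) \<in> Hinf" using Hinf_linear_factor[of 0] by simp
    qed (use w in \<open>auto intro!: Hinf_difference_quotient[OF bH]\<close>)
    have xb: "AE t in circ. bval x t = bval b t * cnj (F (cis t)) - cnj (G (cis t))"
    proof (rule Hinf_bval_eqI[OF x])
      show "AE t in circ. (\<lambda>k. x (of_real (radius k) * cis t)) \<longlonglongrightarrow> bval b t * cnj (F (cis t)) - cnj (G (cis t))"
        using Hinf_bval_limit[OF bH]
      proof eventually_elim
        case (elim t)
        have lz: "(\<lambda>k. of_real (radius k) * cis t) \<longlonglongrightarrow> cis t"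
          using tendsto_mult[OF tendsto_of_real[OF radius(3)] tendsto_const[of "cis t"]] by simp
        have ne: "cis t \<noteq> w i" if "i < n" for i using w that cis_ne[of "w i" t] by auto
        have D: "(\<lambda>k. if of_real (radius k) * cis t = w i then deriv b (w i) else (b (of_real (radius k) * cis t) - b (w i)) / (of_real (radius k) * cis t - w i))
            \<longlonglongrightarrow> (bval b t - b (w i)) / (cis t - w i)" if "i < n" for i
        proof (rule Lim_transform_eventually)
          show "(\<lambda>k. (b (of_real (radius k) * cis t) - b (w i)) / (of_real (radius k) * cis t - w i)) \<longlonglongrightarrow> (bval b t - b (w i)) / (cis t - w i)"
            using ne[OF that] by (intro tendsto_intros elim lz) auto
          show "\<forall>\<^sub>F k in sequentially. (b (of_real (radius k) * cis t) - b (w i)) / (of_real (radius k) * cis t - w i) =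
             (if of_real (radius k) * cis t = w i then deriv b (w i) else (b (of_real (radius k) * cis t) - b (w i)) / (of_real (radius k) * cis t - w i))"
            using tendsto_imp_eventually_ne[OF lz ne[OF that]] by eventually_elim simp
        qed
        have "(\<lambda>k. x (of_real (radius k) * cis t)) \<longlonglongrightarrow> (\<Sum>i<n. cnj (c i) * (cis t * ((bval b t - b (w i)) / (cis t - w i))))"
          unfolding x_def by (intro tendsto_intros lz D) auto
        also have "(\<Sum>i<n. cnj (c i) * (cis t * ((bval b t - b (w i)) / (cis t - w i)))) = bval b t * cnj (F (cis t)) - cnj (G (cis t))"
          unfolding F_def G_def cnj_szego_cis[OF w] sum_distrib_left sum_subtractf[symmetric]
          by (intro sum.cong refl) (simp add: algebra_simps diff_divide_distrib)
        finally show ?case .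
      qed
    qed
    define W where "W = (LINT t|circ. (cmod (cis t - \<zeta>))\<^sup>2 * (cmod (F (cis t)))\<^sup>2)"
    define E where "E = (\<lambda>z. (z - \<zeta>) * F z)"
    have E: "E \<in> Hinf" unfolding E_def by (rule Hinf_mult[OF Hinf_linear_factor F])
    have Eb: "AE t in circ. bval E t = (cis t - \<zeta>) * bval F t"
      using Hinf_bval_mult[OF Hinf_linear_factor F, of \<zeta>] Hinf_bval_eq_continuous[OF Hinf_linear_factor, of \<zeta>]
      unfolding E_def by (auto elim: eventually_elim2)
    have [measurable]: "bval F \<in> borel_measurable borel" "bval x \<in> borel_measurable borel" "bval b \<in> borel_measurable borel"
       "bval a \<in> borel_measurable borel" "bval E \<in> borel_measurable borel"
      by (intro Hinf_measurable_bval F x bH a E)+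
    have [measurable]: "(\<lambda>t. F (cis t)) \<in> borel_measurable borel" "(\<lambda>t. G (cis t)) \<in> borel_measurable borel" unfolding F_def G_def by measurable
    have [measurable]: "chi \<in> borel_measurable borel" by (rule borel_measurable_continuous_onI[OF continuous_chi])
    have cF: "continuous_on A (\<lambda>t. F (cis t))" for A unfolding F_def by (rule continuous_szego_cis[OF w])
    have EW: "boundary_norm E = sqrt W"
    proof -
      have "(LINT t|circ. (cmod (bval E t))\<^sup>2) = W" unfolding W_def
      proof (rule integral_cong_AE)
        show "AE t in circ. (cmod (bval E t))\<^sup>2 = (cmod (cis t - \<zeta>))\<^sup>2 * (cmod (F (cis t)))\<^sup>2"
          using Eb Fb by eventually_elim (simp add: norm_mult power_mult_distrib)
      qed (rule measurable_circ, measurable)+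
      then show ?thesis by (simp add: boundary_norm_def)
    qed
    have W0: "0 \<le> W" by (simp add: W_def integral_nonneg_AE)
    have x2: "(boundary_norm x)\<^sup>2 = (LINT t|circ. (cmod (bval b t * cnj (F (cis t)) - cnj (G (cis t))))\<^sup>2)"
    proof -
      have "(boundary_norm x)\<^sup>2 = (LINT t|circ. (cmod (bval x t))\<^sup>2)" by (simp add: boundary_norm_def integral_nonneg_AE)
      also have "\<dots> = (LINT t|circ. (cmod (bval b t * cnj (F (cis t)) - cnj (G (cis t))))\<^sup>2)"
      proof (rule integral_cong_AE)
        show "AE t in circ. (cmod (bval x t))\<^sup>2 = (cmod (bval b t * cnj (F (cis t)) - cnj (G (cis t))))\<^sup>2"
          using xb by eventually_elim simp
      qed (rule measurable_circ, measurable)+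
      finally show ?thesis .
    qed
    obtain BF where BF: "0 \<le> BF" "\<And>t. cmod (F (cis t)) \<le> BF" unfolding F_def using szego_cis_bound[OF w] by metis
    obtain BG where BG: "0 \<le> BG" "\<And>t. cmod (G (cis t)) \<le> BG" unfolding G_def using szego_cis_bound[OF w] by metis
    obtain Bx where Bx: "0 \<le> Bx" "\<And>z. z \<in> ball 0 1 \<Longrightarrow> cmod (x z) \<le> Bx" using Hinf_bound[OF x] by metis
    have xbd: "AE t in circ. cmod (bval x t) \<le> Bx" by (rule Hinf_bval_bound[OF x Bx(2)])
    have iG: "integrable circ (\<lambda>t. bval x t * G (cis t))"
    proof (rule circ.integrable_const_bound)
      show "AE t in circ. norm (bval x t * G (cis t)) \<le> Bx * BG"
        using xbd by eventually_elim (use Bx BG in \<open>auto simp: norm_mult intro!: mult_mono\<close>)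
    qed (rule measurable_circ, measurable)
    have iF: "integrable circ (\<lambda>t. cnj (bval b t) * F (cis t) * bval x t)"
    proof (rule circ.integrable_const_bound)
      show "AE t in circ. norm (cnj (bval b t) * F (cis t) * bval x t) \<le> 1 * BF * Bx"
        using xbd bb
        by eventually_elim (unfold norm_mult complex_mod_cnj, intro mult_mono, use Bx BF in auto)
    qed (rule measurable_circ, measurable)
    \<comment> \<open>An integral of an analytic function that vanishes at 0; in terms of pairings
      it is \<open>szego_multiplier_pairing\<close> for \<open>b\<close>.\<close>
    have xG: "(LINT t|circ. bval x t * G (cis t)) = 0"
    proof -
      have i1: "integrable circ (\<lambda>t. bval b t * G (cis t) * cnj (F (cis t)))"
      proof (rule circ.integrable_const_bound)
        show "AE t in circ. norm (bval b t * G (cis t) * cnj (F (cis t))) \<le> 1 * BG * BF"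
          using bb
          by eventually_elim (unfold norm_mult complex_mod_cnj, intro mult_mono, use BG BF in auto)
      qed (rule measurable_circ, measurable)
      have i2: "integrable circ (\<lambda>t. complex_of_real ((cmod (G (cis t)))\<^sup>2))"
        unfolding G_def by (intro integrable_circ_continuous continuous_intros continuous_szego_cis w)
      have "(LINT t|circ. bval x t * G (cis t)) = (LINT t|circ. bval b t * G (cis t) * cnj (F (cis t)) - of_real ((cmod (G (cis t)))\<^sup>2))"
      proof (rule integral_cong_AE)
        show "AE t in circ. bval x t * G (cis t) = bval b t * G (cis t) * cnj (F (cis t)) - of_real ((cmod (G (cis t)))\<^sup>2)"
          using xb
        proof eventually_elim
          case (elim t)
          show ?case unfolding elim complex_norm_square by (simp add: algebra_simps)
        qed
      qed (rule measurable_circ, measurable)+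
      also have "\<dots> = (LINT t|circ. bval b t * G (cis t) * cnj (F (cis t))) - (LINT t|circ. complex_of_real ((cmod (G (cis t)))\<^sup>2))"
        by (rule Bochner_Integration.integral_diff[OF i1 i2])
      also have "\<dots> = 0"
        unfolding integral_complex_of_real F_def G_def szego_multiplier_pairing[OF bH w] by simp
      finally show ?thesis .
    qed
    \<comment> \<open>On the circle \<open>cnj x = cnj b * F - G\<close>, and \<open>G\<close> drops
      out by \<open>xG\<close>. The squared norm of \<open>x\<close> becomes an integral in which
      \<open>cnj b\<close> is the only factor that is not analytic.\<close>
    have xx: "of_real ((boundary_norm x)\<^sup>2) = (LINT t|circ. cnj (bval b t) * F (cis t) * bval x t)"
    proof -
      have "complex_of_real ((boundary_norm x)\<^sup>2) = (LINT t|circ. of_real ((cmod (bval x t))\<^sup>2))"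
        unfolding integral_complex_of_real by (simp add: boundary_norm_def integral_nonneg_AE)
      also have "\<dots> = (LINT t|circ. cnj (bval b t) * F (cis t) * bval x t - bval x t * G (cis t))"
      proof (rule integral_cong_AE)
        show "AE t in circ. complex_of_real ((cmod (bval x t))\<^sup>2) = cnj (bval b t) * F (cis t) * bval x t - bval x t * G (cis t)"
          using xb
        proof eventually_elim
          case (elim t)
          have "cnj (bval x t) = cnj (bval b t) * F (cis t) - G (cis t)" by (simp add: elim)
          from arg_cong[OF this, of "\<lambda>y. bval x t * y"] show ?case
            unfolding complex_norm_square by (simp add: algebra_simps)
        qed
      qed (rule measurable_circ, measurable)+
      also have "\<dots> = (LINT t|circ. cnj (bval b t) * F (cis t) * bval x t) - (LINT t|circ. bval x t * G (cis t))"
        by (rule Bochner_Integration.integral_diff[OF iF iG])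
      finally show ?thesis using xG by simp
    qed
    have i3: "integrable circ (\<lambda>t. of_real (chi t) * (bval F t * bval x t / bval b t))"
    proof (rule circ.integrable_const_bound)
      show "AE t in circ. norm (of_real (chi t) * (bval F t * bval x t / bval b t)) \<le> 2 * (BF * Bx)"
        using xbd Fb blb
      proof eventually_elim
        case (elim t)
        show ?case
        proof (cases "X t \<le> x1")
          case True
          then show ?thesis using BF Bx by (simp add: chi_zero)
        next
          case False
          have "cmod (bval F t) * cmod (bval x t) / cmod (bval b t) \<le> BF * Bx / (1/2)"
            using elim False BF(2)[of t] BF(1) Bx(1) by (intro frac_le mult_mono) auto
          then have "chi t * (cmod (bval F t) * cmod (bval x t) / cmod (bval b t)) \<le> 1 * (BF * Bx / (1/2))"
            using chi_bounds[of t] by (intro mult_mono) auto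
          then show ?thesis using chi_bounds[of t] by (simp add: norm_mult norm_divide)
        qed
      qed
    qed (rule measurable_circ, measurable)
    have diff: "cmod (LINT t|circ. cnj (bval b t) * F (cis t) * bval x t - of_real (chi t) * (bval F t * bval x t / bval b t))
       \<le> C1 * (sqrt W * boundary_norm x)"
    proof -
      have "cmod (LINT t|circ. cnj (bval b t) * F (cis t) * bval x t - of_real (chi t) * (bval F t * bval x t / bval b t))
         \<le> (LINT t|circ. cmod (cnj (bval b t) * F (cis t) * bval x t - of_real (chi t) * (bval F t * bval x t / bval b t)))"
        by (rule integral_norm_bound)
      also have "\<dots> \<le> (LINT t|circ. C1 * (cmod (bval E t) * cmod (bval x t)))"
      proof (rule integral_mono_AE)
        show "integrable circ (\<lambda>t. cmod (cnj (bval b t) * F (cis t) * bval x t - of_real (chi t) * (bval F t * bval x t / bval b t)))"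
          by (intro integrable_norm Bochner_Integration.integrable_diff iF i3)
        show "integrable circ (\<lambda>t. C1 * (cmod (bval E t) * cmod (bval x t)))"
          by (intro integrable_mult_right Hinf_norm_integrable E x)
        show "AE t in circ. cmod (cnj (bval b t) * F (cis t) * bval x t - of_real (chi t) * (bval F t * bval x t / bval b t))
           \<le> C1 * (cmod (bval E t) * cmod (bval x t))"
          using key Eb Fb
        proof eventually_elim
          case (elim t)
          have "cnj (bval b t) * F (cis t) * bval x t - of_real (chi t) * (bval F t * bval x t / bval b t) =
             (cnj (bval b t) - of_real (chi t) / bval b t) * (bval F t * bval x t)"
            using elim(3) by (simp add: algebra_simps)
          then have "cmod (cnj (bval b t) * F (cis t) * bval x t - of_real (chi t) * (bval F t * bval x t / bval b t)) =
             cmod (cnj (bval b t) - of_real (chi t) / bval b t) * (cmod (bval F t) * cmod (bval x t))"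
            by (simp only: norm_mult)
          also have "\<dots> \<le> C1 * cmod (cis t - \<zeta>) * (cmod (bval F t) * cmod (bval x t))"
            using elim(1) by (rule mult_right_mono) simp
          finally show ?case using elim(2) by (simp add: norm_mult mult_ac)
        qed
      qed
      also have "\<dots> = C1 * (LINT t|circ. cmod (bval E t) * cmod (bval x t))" by (rule integral_mult_right_zero)
      also have "\<dots> \<le> C1 * (sqrt W * boundary_norm x)"
        using Hinf_boundary_Cauchy_Schwarz[OF E x] C1 unfolding EW by (rule mult_left_mono)
      finally show ?thesis .
    qed
    have arc: "cmod (LINT t|circ. of_real (chi t) * (bval F t * bval x t / bval b t)) \<le> arc_const * (sqrt W * boundary_norm x)"
      using arc_estimate[OF bH bU F x] unfolding E_def[symmetric] EW .
    have "(boundary_norm x)\<^sup>2 \<le> C2 * (sqrt W * boundary_norm x)"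
    proof -
      have "(boundary_norm x)\<^sup>2 = cmod (complex_of_real ((boundary_norm x)\<^sup>2))" by (simp add: norm_power)
      also have "complex_of_real ((boundary_norm x)\<^sup>2) =
          (LINT t|circ. cnj (bval b t) * F (cis t) * bval x t - of_real (chi t) * (bval F t * bval x t / bval b t))
          + (LINT t|circ. of_real (chi t) * (bval F t * bval x t / bval b t))"
        unfolding xx by (subst Bochner_Integration.integral_diff[OF iF i3]) simp
      also have "cmod \<dots> \<le> C1 * (sqrt W * boundary_norm x) + arc_const * (sqrt W * boundary_norm x)"
        by (rule norm_triangle_mono[OF diff arc])
      finally show ?thesis by (simp add: C2_def distrib_right)
    qed
    then have "boundary_norm x * boundary_norm x \<le> (C2 * sqrt W) * boundary_norm x" by (simp add: power2_eq_square mult_ac)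
    \<comment> \<open>The norm of \<open>x\<close> also occurs on the right to the first power;
      dividing by it closes the estimate.\<close>
    then have "boundary_norm x \<le> C2 * sqrt W"
      using boundary_norm_nonneg[of x] C2 W0 by (cases "boundary_norm x = 0") auto
    then have "(boundary_norm x)\<^sup>2 \<le> (C2 * sqrt W)\<^sup>2" using boundary_norm_nonneg[of x] by (rule power_mono)
    then have X2: "(boundary_norm x)\<^sup>2 \<le> C2\<^sup>2 * W" using W0 by (simp add: power_mult_distrib)
    have "(LINT t|circ. (1 - (cmod (bval b t))\<^sup>2) * (cmod (F (cis t)))\<^sup>2) \<le> (LINT t|circ. M\<^sup>2 * ((cmod (cis t - \<zeta>))\<^sup>2 * (cmod (F (cis t)))\<^sup>2))"
    proof (rule integral_mono_AE)
      show "integrable circ (\<lambda>t. (1 - (cmod (bval b t))\<^sup>2) * (cmod (F (cis t)))\<^sup>2)"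
      proof (rule circ.integrable_const_bound)
        show "AE t in circ. norm ((1 - (cmod (bval b t))\<^sup>2) * (cmod (F (cis t)))\<^sup>2) \<le> 1 * BF\<^sup>2"
          using bb
        proof eventually_elim
          case (elim t)
          then have "\<bar>1 - (cmod (bval b t))\<^sup>2\<bar> \<le> 1" by (simp add: power_le_one)
          moreover have "(cmod (F (cis t)))\<^sup>2 \<le> BF\<^sup>2" using BF by (intro power_mono) auto
          ultimately have "\<bar>1 - (cmod (bval b t))\<^sup>2\<bar> * (cmod (F (cis t)))\<^sup>2 \<le> 1 * BF\<^sup>2" by (intro mult_mono) auto
          then show ?case by (simp only: real_norm_def abs_mult abs_power2)
        qed
      qed (rule measurable_circ, measurable)
      show "integrable circ (\<lambda>t. M\<^sup>2 * ((cmod (cis t - \<zeta>))\<^sup>2 * (cmod (F (cis t)))\<^sup>2))"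
        by (intro integrable_circ_continuous continuous_intros cF)
      show "AE t in circ. (1 - (cmod (bval b t))\<^sup>2) * (cmod (F (cis t)))\<^sup>2 \<le> M\<^sup>2 * ((cmod (cis t - \<zeta>))\<^sup>2 * (cmod (F (cis t)))\<^sup>2)"
        using aa ab
      proof eventually_elim
        case (elim t)
        have "1 - (cmod (bval b t))\<^sup>2 = (cmod (bval a t))\<^sup>2" using elim(2) by simp
        also have "\<dots> \<le> (M * cmod (cis t - \<zeta>))\<^sup>2" by (rule power_mono[OF elim(1)]) simp
        finally have "(1 - (cmod (bval b t))\<^sup>2) * (cmod (F (cis t)))\<^sup>2 \<le> (M * cmod (cis t - \<zeta>))\<^sup>2 * (cmod (F (cis t)))\<^sup>2"
          by (rule mult_right_mono) simp
        then show ?case by (simp add: power_mult_distrib mult.assoc)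
      qed
    qed
    also have "\<dots> = M\<^sup>2 * W" unfolding W_def by (rule integral_mult_right_zero)
    finally have "2*pi * gram (kb b) n c w \<le> (M\<^sup>2 + C2\<^sup>2) * W"
      unfolding kb_gram_decomposition(1)[OF b w] F_def[symmetric] G_def[symmetric] x2[symmetric]
      using X2 by (simp add: distrib_right)
    then show "gram (kb b) n c w \<le> ((M\<^sup>2 + C2\<^sup>2) / (2*pi)) * (LINT t|circ. (cmod (cis t - \<zeta>))\<^sup>2 * (cmod (szego n c w (cis t)))\<^sup>2)"
      unfolding F_def[symmetric] W_def[symmetric] by (simp add: field_simps)
  qed
qed

section \<open>From the Gram estimate to the embedding\<close>

lemma cauchy_difference_quotient_limit:
  fixes Q :: "complex \<Rightarrow> complex"
  assumes \<delta>: "0 < \<delta>" and Q: "\<And>h k. h \<noteq> 0 \<Longrightarrow> k \<noteq> 0 \<Longrightarrow> cmod h < \<delta> \<Longrightarrow> cmod k < \<delta> \<Longrightarrow> cmod (Q h - Q k) \<le> C * cmod (h - k)"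
  shows "\<exists>L. (Q \<longlongrightarrow> L) (at 0)"
proof -
  define s :: "nat \<Rightarrow> complex" where "s n = of_real (\<delta> * inverse (real (Suc (Suc n))))" for n :: nat
  have s: "s n \<noteq> 0" "cmod (s n) < \<delta>" for n
  proof -
    show "s n \<noteq> 0" using \<delta> by (simp add: s_def del: of_nat_Suc)
    have "inverse (real (Suc (Suc n))) < 1" by (simp add: inverse_less_1_iff)
    then show "cmod (s n) < \<delta>" using \<delta> mult_strict_left_mono[of "inverse (real (Suc (Suc n)))" 1 \<delta>] by (simp only: s_def norm_of_real) simp
  qed
  have "(\<lambda>n. \<delta> * inverse (real (Suc (Suc n)))) \<longlonglongrightarrow> \<delta> * 0"
    by (intro tendsto_intros LIMSEQ_Suc[OF LIMSEQ_inverse_real_of_nat])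
  from tendsto_of_real[OF this, where 'a=complex] have s0: "s \<longlonglongrightarrow> 0" by (simp add: s_def[abs_def])
  have C0: "0 \<le> C"
  proof -
    have "0 \<le> C * cmod (s 0 - s 1)" by (rule order_trans[OF norm_ge_zero Q[OF s(1) s(1) s(2) s(2)]])
    moreover have "s 0 \<noteq> s 1" using \<delta> by (simp add: s_def)
    ultimately show ?thesis by (simp add: zero_le_mult_iff)
  qed
  have "Cauchy (\<lambda>n. Q (s n))"
  proof (rule metric_CauchyI)
    fix e :: real assume e: "0 < e"
    then have "0 < e / (C + 1)" using C0 by simp
    then obtain N where N: "\<And>m n. N \<le> m \<Longrightarrow> N \<le> n \<Longrightarrow> dist (s m) (s n) < e / (C + 1)"
      using metric_CauchyD[OF LIMSEQ_imp_Cauchy[OF s0]] by blast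
    have "dist (Q (s m)) (Q (s n)) < e" if "N \<le> m" "N \<le> n" for m n
    proof -
      have "dist (Q (s m)) (Q (s n)) \<le> C * dist (s m) (s n)" using Q[OF s(1) s(1) s(2) s(2)] by (simp add: dist_norm)
      also have "\<dots> \<le> (C + 1) * dist (s m) (s n)" by (simp add: mult_right_mono)
      also have "\<dots> < e" using N[OF that] C0 by (simp add: field_simps)
      finally show ?thesis .
    qed
    then show "\<exists>M. \<forall>m\<ge>M. \<forall>n\<ge>M. dist (Q (s m)) (Q (s n)) < e" by blast
  qed
  then obtain L where L: "(\<lambda>n. Q (s n)) \<longlonglongrightarrow> L" using Cauchy_convergent convergent_def by blast
  have b: "cmod (Q h - L) \<le> C * cmod h" if h: "h \<noteq> 0" "cmod h < \<delta>" for h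
  proof (rule LIMSEQ_le)
    show "(\<lambda>n. cmod (Q h - Q (s n))) \<longlonglongrightarrow> cmod (Q h - L)" by (intro tendsto_intros L)
    have "(\<lambda>n. C * cmod (h - s n)) \<longlonglongrightarrow> C * cmod (h - 0)" by (intro tendsto_intros s0)
    then show "(\<lambda>n. C * cmod (h - s n)) \<longlonglongrightarrow> C * cmod h" by simp
    show "\<exists>N. \<forall>n\<ge>N. cmod (Q h - Q (s n)) \<le> C * cmod (h - s n)" using Q[OF h(1) s(1) h(2) s(2)] by blast
  qed
  have "((\<lambda>h. Q h - L) \<longlongrightarrow> 0) (at 0)"
  proof (rule Lim_null_comparison)
    show "\<forall>\<^sub>F h in at 0. norm (Q h - L) \<le> C * cmod h"
      unfolding eventually_at using \<delta> b by (auto intro!: exI[of _ \<delta>])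
    show "((\<lambda>h. C * cmod h) \<longlongrightarrow> 0) (at (0::complex))" by (intro tendsto_eq_intros) auto
  qed
  then show ?thesis using LIM_zero_cancel by blast
qed

text \<open>The pairing of \<open>f\<close> with Szego combinations is bounded in the weighted norm
  with weight \<open>W\<close>. Weight 1 leads to the Hardy space, weight
  \<open>|cis t - \<zeta>|^2\<close> to the local Dirichlet condition at
  \<open>\<zeta>\<close>.\<close>

definition szego_bounded :: "(real \<Rightarrow> real) \<Rightarrow> real \<Rightarrow> (complex \<Rightarrow> complex) \<Rightarrow> bool" where
  "szego_bounded W C f \<longleftrightarrow> (\<forall>n c w. (\<forall>i<n. w i \<in> ball 0 1) \<longrightarrow>
     (cmod (\<Sum>i<n. cnj (c i) * f (w i)))\<^sup>2 \<le> C * (LINT t|circ. W t * (cmod (szego n c w (cis t)))\<^sup>2))"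

text \<open>The difference of two difference quotients of the Szego kernel is proportional to the
  distance of their increments; dually, difference quotients of \<open>f\<close> become Lipschitz
  functions of the increment.\<close>

lemma szego_second_difference:
  fixes u v w z :: complex
  assumes nz: "1 - cnj u * z \<noteq> 0" "1 - cnj v * z \<noteq> 0" "1 - cnj w * z \<noteq> 0" and uw: "u \<noteq> w" and vw: "v \<noteq> w"
  shows "(1 / (1 - cnj u * z) - 1 / (1 - cnj w * z)) / cnj (u - w) - (1 / (1 - cnj v * z) - 1 / (1 - cnj w * z)) / cnj (v - w)
    = cnj (u - v) * z\<^sup>2 / ((1 - cnj u * z) * (1 - cnj v * z) * (1 - cnj w * z))"
proof -
  have *: "(1 / (1 - cnj u * z) - 1 / (1 - cnj w * z)) / cnj (u - w) = z / ((1 - cnj u * z) * (1 - cnj w * z))"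
    if "1 - cnj u * z \<noteq> 0" "u \<noteq> w" for u
  proof -
    have c: "cnj (u - w) \<noteq> 0" using that(2) by simp
    have "1 / (1 - cnj u * z) - 1 / (1 - cnj w * z) = cnj (u - w) * z / ((1 - cnj u * z) * (1 - cnj w * z))"
      using that(1) nz(3) by (simp add: diff_frac_eq) (simp add: algebra_simps)
    then show ?thesis using c by simp
  qed
  have "z / ((1 - cnj u * z) * (1 - cnj w * z)) - z / ((1 - cnj v * z) * (1 - cnj w * z)) =
     (z * (1 - cnj v * z) - z * (1 - cnj u * z)) / ((1 - cnj u * z) * (1 - cnj v * z) * (1 - cnj w * z))"
    using nz by (simp add: divide_simps)
  also have "z * (1 - cnj v * z) - z * (1 - cnj u * z) = cnj (u - v) * z\<^sup>2"
    by (simp add: algebra_simps power2_eq_square)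
  finally show ?thesis unfolding *[OF nz(1) uw] *[OF nz(2) vw] .
qed

text \<open>Membership in \<open>Hb\<close> presupposes no regularity of \<open>f\<close>, so even
  differentiability must come from the bound. Three kernels, at \<open>w + h\<close>,
  \<open>w + k\<close> and \<open>w\<close>, reproduce the difference of two difference quotients of
  \<open>f\<close>, and \<open>szego_second_difference\<close> makes it of the order of
  \<open>h - k\<close>.\<close>

lemma szego_bounded_holomorphic:
  assumes f: "szego_bounded W C f" and W: "\<And>t. 0 \<le> W t" "\<And>t. W t \<le> 4" and Wc: "continuous_on {0..2*pi} W" and C: "0 \<le> C"
  shows "f holomorphic_on ball 0 1"
proof -
  have "f field_differentiable at w" if w: "w \<in> ball 0 1" for w
  proof -
    \<comment> \<open>Half the distance to the circle, so that the three denominators are all at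
      least \<open>\<delta>\<close>, whence the cube below.\<close>
    define \<delta> where "\<delta> = (1 - cmod w) / 2"
    have \<delta>: "0 < \<delta>" using w by (simp add: \<delta>_def)
    have inb: "w + h \<in> ball 0 1" "\<delta> \<le> cmod (1 - cnj (w + h) * cis t)" if "cmod h < \<delta>" for h t
    proof -
      have "2 * \<delta> = 1 - cmod w" by (simp add: \<delta>_def)
      then have n: "cmod (w + h) \<le> 1 - \<delta>" using norm_triangle_ineq[of w h] that by linarith
      then show "w + h \<in> ball 0 1" using \<delta> by simp
      have "cmod (cnj (w + h) * cis t) = cmod (w + h)" by (simp add: norm_mult del: complex_cnj_add)
      then show "\<delta> \<le> cmod (1 - cnj (w + h) * cis t)" using n norm_triangle_ineq2[of 1 "cnj (w + h) * cis t"] by simp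
    qed
    define Q where "Q h = (f (w + h) - f w) / h" for h
    \<comment> \<open>\<open>8 * pi\<close> is the bound 4 for \<open>W\<close> times the total mass
      \<open>2 * pi\<close>.\<close>
    have Qb: "cmod (Q h - Q k) \<le> sqrt (C * (8*pi)) / \<delta>^3 * cmod (h - k)"
      if h: "h \<noteq> 0" "cmod h < \<delta>" and k: "k \<noteq> 0" "cmod k < \<delta>" for h k
    proof -
      define v where "v = (\<lambda>i::nat. if i = 0 then w + h else if i = 1 then w + k else w)"
      define c where "c = (\<lambda>i::nat. cnj (if i = 0 then 1 / h else if i = 1 then - 1 / k else 1 / k - 1 / h))"
      have vb: "\<forall>i<3. v i \<in> ball 0 1" using inb(1)[OF h(2)] inb(1)[OF k(2)] w by (auto simp: v_def)
      have 3: "{..<3::nat} = {0, 1, 2}" by auto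
      have s: "(\<Sum>i<3. cnj (c i) * f (v i)) = Q h - Q k"
        unfolding 3 by (simp add: c_def v_def Q_def) (simp add: divide_inverse algebra_simps)
      have szv: "szego 3 c v (cis t) = cnj (h - k) * (cis t)\<^sup>2 / ((1 - cnj (w + h) * cis t) * (1 - cnj (w + k) * cis t) * (1 - cnj w * cis t))" for t
      proof -
        have nz: "1 - cnj (w + h) * cis t \<noteq> 0" "1 - cnj (w + k) * cis t \<noteq> 0" "1 - cnj w * cis t \<noteq> 0"
          using inb[OF h(2)] inb[OF k(2)] w by (intro one_minus_cnj_mult_ne; simp)+
        have split: "szego 3 c v (cis t) = c 0 / (1 - cnj (v 0) * cis t) + c 1 / (1 - cnj (v 1) * cis t) + c 2 / (1 - cnj (v 2) * cis t)"
          unfolding szego_def 3 by (simp add: add.assoc)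
        have vs: "v 0 = w + h" "v 1 = w + k" "v 2 = w" by (simp_all add: v_def)
        have cs: "c 0 = inverse (cnj h)" "c 1 = - inverse (cnj k)" "c 2 = inverse (cnj k) - inverse (cnj h)"
          by (simp_all add: c_def divide_inverse)
        have alg: "p / A + (- q) / B + (q - p) / D = (1 / A - 1 / D) * p - (1 / B - 1 / D) * q" for p q A B D :: complex
          by (simp add: divide_inverse algebra_simps)
        have "szego 3 c v (cis t) = (1 / (1 - cnj (w + h) * cis t) - 1 / (1 - cnj w * cis t)) / cnj (w + h - w)
           - (1 / (1 - cnj (w + k) * cis t) - 1 / (1 - cnj w * cis t)) / cnj (w + k - w)"
          unfolding split vs cs alg by (simp only: add_diff_cancel_left' divide_inverse)
        also have "\<dots> = cnj (w + h - (w + k)) * (cis t)\<^sup>2 / ((1 - cnj (w + h) * cis t) * (1 - cnj (w + k) * cis t) * (1 - cnj w * cis t))"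
          by (rule szego_second_difference[OF nz]) (use h k in auto)
        finally show ?thesis by simp
      qed
      have szb: "cmod (szego 3 c v (cis t)) \<le> cmod (h - k) / \<delta>^3" for t
      proof -
        have d: "\<delta> \<le> cmod (1 - cnj w * cis t)" using inb(2)[of 0 t] \<delta> by simp
        have "\<delta> * \<delta> * \<delta> \<le> cmod (1 - cnj (w + h) * cis t) * cmod (1 - cnj (w + k) * cis t) * cmod (1 - cnj w * cis t)"
          using inb(2)[OF h(2), of t] inb(2)[OF k(2), of t] d \<delta> by (intro mult_mono) auto
        moreover have "cmod (szego 3 c v (cis t)) = cmod (h - k) / (cmod (1 - cnj (w + h) * cis t) * cmod (1 - cnj (w + k) * cis t) * cmod (1 - cnj w * cis t))"
          unfolding szv norm_divide norm_mult norm_power by (simp del: complex_cnj_add complex_cnj_diff)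
        ultimately show ?thesis using \<delta> by (simp add: power3_eq_cube frac_le)
      qed
      have "(cmod (Q h - Q k))\<^sup>2 \<le> C * (LINT t|circ. W t * (cmod (szego 3 c v (cis t)))\<^sup>2)"
        unfolding s[symmetric]
        using f[unfolded szego_bounded_def, THEN spec[of _ 3], THEN spec[of _ c], THEN spec[of _ v]] vb by blast
      also have "\<dots> \<le> C * (LINT t|circ. 4 * (cmod (h - k) / \<delta>^3)\<^sup>2)"
        using C W szb \<delta>
        by (intro mult_left_mono integral_mono integrable_circ_continuous continuous_intros continuous_szego_cis vb Wc mult_mono power_mono) auto
      also have "\<dots> = (C * (8*pi)) * (cmod (h - k) / \<delta>^3)\<^sup>2" by simp
      finally have "cmod (Q h - Q k) \<le> sqrt ((C * (8*pi)) * (cmod (h - k) / \<delta>^3)\<^sup>2)" by (rule real_le_rsqrt)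
      also have "\<dots> = sqrt (C * (8*pi)) * (cmod (h - k) / \<delta>^3)" using \<delta> by (simp only: real_sqrt_mult real_sqrt_abs) simp
      finally show ?thesis by simp
    qed
    obtain L where "(Q \<longlongrightarrow> L) (at 0)"
      using cauchy_difference_quotient_limit[OF \<delta>, of Q "sqrt (C * (8*pi)) / \<delta>^3"] Qb by blast
    then have "(f has_field_derivative L) (at w)" unfolding Q_def DERIV_def .
    then show ?thesis by (auto simp: field_differentiable_def)
  qed
  then show ?thesis by (simp add: holomorphic_on_def field_differentiable_at_within)
qed

text \<open>Polynomials are limits of combinations of Szego kernels at the points of a regular polygon of radius \<open>1/2\<close>.\<close>

definition unity_root :: "nat \<Rightarrow> complex" where "unity_root R = cis (2 * pi / real R)"

lemma power_swap: "(a ^ i) ^ k = (a ^ k) ^ i" for a :: "'a::monoid_mult"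
  by (metis mult.commute power_mult)

lemma unity_root_power: "0 < R \<Longrightarrow> unity_root R ^ R = 1"
  by (simp add: unity_root_def Complex.DeMoivre)

lemma unity_root_power_ne:
  assumes "0 < k" "k < R" shows "unity_root R ^ k \<noteq> 1"
proof
  assume "unity_root R ^ k = 1"
  then have "cis (2 * pi * (real k / real R)) = 1" by (simp add: unity_root_def Complex.DeMoivre mult_ac)
  then have "cos (2 * pi * (real k / real R)) = 1" by (metis cis.simps(1) one_complex.simps(1))
  then obtain m :: int where "2 * pi * (real k / real R) = of_int m * 2 * pi" using cos_one_2pi_int by blast
  then have "2 * pi * (real k / real R) = 2 * pi * of_int m" by (simp only: mult_ac)
  then have "real k / real R = of_int m" using pi_neq_zero by (simp only: mult_cancel_left) simp
  moreover have "0 < real k / real R" "real k / real R < 1" using assms by auto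
  ultimately show False by (metis of_int_0_less_iff of_int_less_1_iff zless_imp_add1_zle add_0 not_less)
qed

lemma norm_unity_root [simp]: "cmod (unity_root R) = 1" by (simp add: unity_root_def)

lemma unity_root_cnj: "unity_root R * cnj (unity_root R) = 1"
  by (simp flip: complex_norm_square)

lemma unity_root_orthogonality:
  assumes "n < R" "k < R"
  shows "(\<Sum>i<R. (unity_root R ^ n * cnj (unity_root R) ^ k) ^ i) = (if n = k then of_nat R else 0)"
proof (cases "n = k")
  case True
  have "unity_root R ^ k * cnj (unity_root R) ^ k = 1" using unity_root_cnj by (simp flip: power_mult_distrib)
  then show ?thesis using True by simp
next
  case False
  define x where "x = unity_root R ^ n * cnj (unity_root R) ^ k"
  have R0: "0 < R" using assms by simp
  have xR: "x ^ R = 1"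
  proof -
    have "x ^ R = (unity_root R ^ R) ^ n * cnj (unity_root R ^ R) ^ k" by (simp add: x_def power_mult_distrib power_swap[of _ _ R])
    then show ?thesis using unity_root_power[OF R0] by simp
  qed
  have "x \<noteq> 1"
  proof
    assume "x = 1"
    then have "x * unity_root R ^ k = unity_root R ^ k" by simp
    moreover have "x * unity_root R ^ k = unity_root R ^ n * (unity_root R * cnj (unity_root R)) ^ k" by (simp add: x_def power_mult_distrib mult_ac)
    ultimately have eq: "unity_root R ^ n = unity_root R ^ k" unfolding unity_root_cnj by simp
    have nz: "unity_root R \<noteq> 0" by (metis norm_unity_root norm_zero zero_neq_one)
    show False
    proof (cases "n < k")
      case True
      then have "unity_root R ^ k = unity_root R ^ n * unity_root R ^ (k - n)" by (simp flip: power_add)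
      then have "unity_root R ^ (k - n) = 1" using eq nz by simp
      then show False using unity_root_power_ne[of "k - n" R] True assms by simp
    next
      case F: False
      then have "unity_root R ^ n = unity_root R ^ k * unity_root R ^ (n - k)" by (simp flip: power_add)
      then have "unity_root R ^ (n - k) = 1" using eq nz by simp
      then show False using unity_root_power_ne[of "n - k" R] F False assms by simp
    qed
  qed
  then have "(\<Sum>i<R. x ^ i) = 0" using xR by (simp add: sum_gp_strict)
  then show ?thesis using False by (simp add: x_def)
qed

text \<open>The weights \<open>2^n\<close> compensate for the radius \<open>1/2\<close>. By the
  orthogonality of roots of unity the power \<open>z^n\<close> survives together with its aliases of
  exponent \<open>n + R\<close>, \<open>n + 2 * R\<close> and so on, which the denominator
  collects.\<close>

lemma polygon_kernel_sum:
  assumes L: "L \<le> R" "0 < R" and z: "cmod z \<le> 1"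
  shows "szego R (\<lambda>i. (\<Sum>n<L. y n * 2^n * (unity_root R ^ n) ^ i) / of_nat R) (\<lambda>i. unity_root R ^ i / 2) z
     = (\<Sum>n<L. y n * z^n) / (1 - (z/2)^R)"
proof -
  define \<omega> where "\<omega> = unity_root R"
  define c where "c i = (\<Sum>n<L. y n * 2^n * (\<omega> ^ n) ^ i) / of_nat R" for i
  have sm: "cmod ((z/2)^R) < 1"
  proof -
    have "cmod (z/2) < 1" using z by (simp add: norm_divide)
    then show ?thesis using L(2) by (simp add: norm_power power_less_one_iff)
  qed
  then have nz: "1 - (z/2)^R \<noteq> 0" by auto
  have trm: "c i / (1 - cnj (\<omega>^i / 2) * z) * (1 - (z/2)^R) = (\<Sum>k<R. c i * (cnj \<omega> ^ k) ^ i * (z/2)^k)" for i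
  proof -
    define x where "x = cnj (\<omega>^i / 2) * z"
    have x: "x = cnj \<omega> ^ i * (z/2)" by (simp add: x_def)
    have "cmod x < 1" using z by (simp add: x \<omega>_def norm_mult norm_power norm_divide)
    then have x1: "1 - x \<noteq> 0" by auto
    have xk: "x ^ k = (cnj \<omega> ^ k) ^ i * (z/2)^k" for k
      by (simp only: x power_mult_distrib power_swap[of _ i k])
    have "x ^ R = (cnj \<omega> ^ R) ^ i * (z/2)^R" by (rule xk)
    also have "cnj \<omega> ^ R = 1" using unity_root_power[OF L(2)] unfolding \<omega>_def by (metis complex_cnj_one complex_cnj_power)
    finally have "(z/2)^R = x^R" by simp
    then have "c i / (1 - x) * (1 - (z/2)^R) = c i * (\<Sum>k<R. x^k)"
      using x1 by (simp add: sum_gp_strict)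
    also have "\<dots> = (\<Sum>k<R. c i * (cnj \<omega> ^ k) ^ i * (z/2)^k)"
      by (simp add: sum_distrib_left xk mult.assoc)
    finally show ?thesis by (simp add: x_def)
  qed
  have "szego R c (\<lambda>i. \<omega> ^ i / 2) z * (1 - (z/2)^R) = (\<Sum>i<R. \<Sum>k<R. c i * (cnj \<omega> ^ k) ^ i * (z/2)^k)"
    unfolding szego_def sum_distrib_right trm ..
  also have "\<dots> = (\<Sum>i<R. \<Sum>k<R. \<Sum>n<L. (\<omega> ^ n * cnj \<omega> ^ k) ^ i * (y n * 2^n * (z/2)^k / of_nat R))"
    by (intro sum.cong refl) (simp add: c_def sum_distrib_left sum_distrib_right sum_divide_distrib power_mult_distrib mult_ac)
  also have "\<dots> = (\<Sum>k<R. \<Sum>n<L. \<Sum>i<R. (\<omega> ^ n * cnj \<omega> ^ k) ^ i * (y n * 2^n * (z/2)^k / of_nat R))"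
    by (subst sum.swap) (intro sum.cong refl sum.swap)
  also have "\<dots> = (\<Sum>k<R. \<Sum>n<L. (if n = k then of_nat R else 0) * (y n * 2^n * (z/2)^k / of_nat R))"
    unfolding sum_distrib_right[symmetric] \<omega>_def using L
    by (intro sum.cong refl arg_cong2[where f="(*)"] unity_root_orthogonality) auto
  also have "\<dots> = (\<Sum>n<L. \<Sum>k<R. (if n = k then of_nat R else 0) * (y n * 2^n * (z/2)^k / of_nat R))"
    by (rule sum.swap)
  also have "\<dots> = (\<Sum>n<L. y n * z^n)"
  proof (intro sum.cong refl)
    fix n assume "n \<in> {..<L}"
    then have n: "n < R" using L by simp
    have "(\<Sum>k<R. (if n = k then of_nat R else 0) * (y n * 2^n * (z/2)^k / of_nat R)) = (\<Sum>k<R. if n = k then y n * 2^n * (z/2)^k else 0)"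
      using L by (intro sum.cong refl) auto
    also have "\<dots> = y n * 2^n * (z/2)^n" using n by simp
    finally show "(\<Sum>k<R. (if n = k then of_nat R else 0) * (y n * 2^n * (z/2)^k / of_nat R)) = y n * z^n"
      by (simp add: power_divide)
  qed
  finally show ?thesis using nz unfolding c_def[abs_def] \<omega>_def by (simp add: eq_divide_eq)
qed

text \<open>The average reproduces the n-th coefficient up to aliasing from coefficients of index at
  least \<open>R\<close>, and these form a tail of an absolutely convergent series.\<close>

lemma polygon_average_limit:
  assumes f: "f holomorphic_on ball 0 1"
  shows "(\<lambda>R. (\<Sum>i<R. (cnj (unity_root R) ^ n) ^ i * f (unity_root R ^ i / 2)) / of_nat R) \<longlonglongrightarrow> taylor f n / 2^n"
proof -
  define a where "a k = taylor f k / 2^k" for k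
  have "cmod (1/2 :: complex) < 1" by simp
  from power_series_norm_summable[OF taylor_sums[OF f] this]
  have sm: "summable (\<lambda>k. cmod (a k))" by (simp add: a_def norm_divide norm_power power_one_over)
  define T where "T R = (\<Sum>k. cmod (a (k + R)))" for R
  have T0: "T \<longlonglongrightarrow> 0" unfolding T_def by (rule suminf_exist_split2[OF sm])
  have err: "cmod ((\<Sum>i<R. (cnj (unity_root R) ^ n) ^ i * f (unity_root R ^ i / 2)) / of_nat R - a n) \<le> T R" if R: "n < R" for R
  proof -
    define \<omega> where "\<omega> = unity_root R"
    have R0: "0 < R" using R by simp
    define \<tau> where "\<tau> i = (\<Sum>k. a (k + R) * (\<omega>^i)^(k + R))" for i
    have fs: "f (\<omega>^i / 2) = \<tau> i + (\<Sum>k<R. a k * (\<omega>^i)^k)" for i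
    proof -
      have "cmod (\<omega>^i / 2) < 1" by (simp add: \<omega>_def norm_divide norm_power)
      then have "(\<lambda>k. taylor f k * (\<omega>^i / 2)^k) sums f (\<omega>^i / 2)" by (intro taylor_sums[OF f]) simp
      then have S: "(\<lambda>k. a k * (\<omega>^i)^k) sums f (\<omega>^i / 2)" by (simp add: a_def power_divide)
      show ?thesis unfolding \<tau>_def sums_unique[OF S] by (rule suminf_split_initial_segment[OF sums_summable[OF S]])
    qed
    have smR: "summable (\<lambda>k. cmod (a (k + R)))" using sm by (rule summable_ignore_initial_segment)
    have \<tau>: "cmod (\<tau> i) \<le> T R" for i
      unfolding \<tau>_def T_def
      by (rule norm_suminf_le) (use smR in \<open>simp_all add: norm_mult norm_power \<omega>_def\<close>)
    have main: "(\<Sum>i<R. (cnj \<omega> ^ n) ^ i * (\<Sum>k<R. a k * (\<omega>^i)^k)) = of_nat R * a n"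
    proof -
      have "(\<Sum>i<R. (cnj \<omega> ^ n) ^ i * (\<Sum>k<R. a k * (\<omega>^i)^k)) = (\<Sum>i<R. \<Sum>k<R. (\<omega>^k * cnj \<omega>^n)^i * a k)"
        by (intro sum.cong refl) (simp add: sum_distrib_left power_mult_distrib power_swap[of \<omega>] mult_ac)
      also have "\<dots> = (\<Sum>k<R. \<Sum>i<R. (\<omega>^k * cnj \<omega>^n)^i * a k)" by (rule sum.swap)
      also have "\<dots> = (\<Sum>k<R. (if k = n then of_nat R else 0) * a k)"
        unfolding sum_distrib_right[symmetric] \<omega>_def using R
        by (intro sum.cong refl arg_cong2[where f="(*)"] unity_root_orthogonality) auto
      also have "\<dots> = (\<Sum>k<R. if n = k then of_nat R * a k else 0)" by (intro sum.cong refl) auto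
      also have "\<dots> = of_nat R * a n" using R by simp
      finally show ?thesis .
    qed
    have "(\<Sum>i<R. (cnj \<omega> ^ n) ^ i * f (\<omega>^i / 2)) = (\<Sum>i<R. (cnj \<omega> ^ n) ^ i * \<tau> i) + of_nat R * a n"
      unfolding fs main[symmetric] by (simp add: distrib_left sum.distrib)
    then have "(\<Sum>i<R. (cnj \<omega> ^ n) ^ i * f (\<omega>^i / 2)) / of_nat R - a n = (\<Sum>i<R. (cnj \<omega> ^ n) ^ i * \<tau> i) / of_nat R"
      using R0 by (simp add: add_divide_distrib)
    also have "cmod \<dots> \<le> (\<Sum>i<R. T R) / real R"
    proof -
      have "cmod (\<Sum>i<R. (cnj \<omega> ^ n) ^ i * \<tau> i) \<le> (\<Sum>i<R. T R)"
        using \<tau> by (intro sum_norm_le) (simp add: norm_mult norm_power \<omega>_def)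
      then show ?thesis unfolding norm_divide norm_of_nat by (rule divide_right_mono) simp
    qed
    also have "\<dots> = T R" using R0 by simp
    finally show ?thesis by (simp add: \<omega>_def)
  qed
  have "(\<lambda>R. (\<Sum>i<R. (cnj (unity_root R) ^ n) ^ i * f (unity_root R ^ i / 2)) / of_nat R - a n) \<longlonglongrightarrow> 0"
    by (rule Lim_null_comparison[OF eventually_mono[OF eventually_gt_at_top[of n] err] T0])
  then show ?thesis by (simp add: LIM_zero_iff a_def)
qed

text \<open>The combination over the regular polygon differs from the polynomial only by the factor
  \<open>1 / (1 - (z/2)^R)\<close>, which is uniformly close to 1 on the circle, so the bound
  survives the limit of large \<open>R\<close>.\<close>

lemma szego_bounded_polynomials:
  assumes f: "szego_bounded W C f" and hol: "f holomorphic_on ball 0 1"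
    and W: "\<And>t. 0 \<le> W t" and Wc: "continuous_on {0..2*pi} W" and C: "0 \<le> C"
  shows "(cmod (\<Sum>n<L. cnj (y n) * taylor f n))\<^sup>2 \<le> C * (LINT t|circ. W t * (cmod (\<Sum>n<L. y n * cis t ^ n))\<^sup>2)"
proof -
  define Y where "Y t = (\<Sum>n<L. y n * cis t ^ n)" for t
  define J where "J = (LINT t|circ. W t * (cmod (Y t))\<^sup>2)"
  define S where "S R = (\<Sum>i<R. cnj ((\<Sum>n<L. y n * 2^n * (unity_root R ^ n) ^ i) / of_nat R) * f (unity_root R ^ i / 2))" for R
  have Yc: "continuous_on {0..2*pi} Y" unfolding Y_def by (intro continuous_intros)
  have J0: "0 \<le> J" unfolding J_def using W by (intro integral_nonneg_AE) auto
  have SR: "(cmod (S R))\<^sup>2 \<le> C * (J / (1 - (1/2)^R)\<^sup>2)" if R: "L \<le> R" "0 < R" for R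
  proof -
    let ?c = "\<lambda>i. (\<Sum>n<L. y n * 2^n * (unity_root R ^ n) ^ i) / of_nat R" and ?w = "\<lambda>i. unity_root R ^ i / 2"
    have w: "\<forall>i<R. ?w i \<in> ball 0 1" by (simp add: norm_divide norm_power)
    have p: "0 < 1 - (1/2::real)^R" using R by (simp add: power_less_one_iff)
    have "(cmod (S R))\<^sup>2 \<le> C * (LINT t|circ. W t * (cmod (szego R ?c ?w (cis t)))\<^sup>2)"
      unfolding S_def
      using f[unfolded szego_bounded_def, THEN spec[of _ R], THEN spec[of _ ?c], THEN spec[of _ ?w]] w by blast
    also have "\<dots> \<le> C * (LINT t|circ. W t * (cmod (Y t))\<^sup>2 / (1 - (1/2)^R)\<^sup>2)"
    proof (intro mult_left_mono integral_mono C)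
      show "integrable circ (\<lambda>t. W t * (cmod (szego R ?c ?w (cis t)))\<^sup>2)"
        by (intro integrable_circ_continuous continuous_intros continuous_szego_cis w Wc)
      show "integrable circ (\<lambda>t. W t * (cmod (Y t))\<^sup>2 / (1 - (1/2)^R)\<^sup>2)"
        using p by (intro integrable_circ_continuous continuous_intros Yc Wc) auto
      fix t
      have "1 - (1/2)^R \<le> cmod (1 - (cis t / 2)^R)"
        using norm_triangle_ineq2[of 1 "(cis t / 2)^R"] by (simp add: norm_power norm_divide power_one_over)
      then have "cmod (szego R ?c ?w (cis t)) \<le> cmod (Y t) / (1 - (1/2)^R)"
        using p unfolding polygon_kernel_sum[OF R, of "cis t" y, simplified] Y_def norm_divide
        by (intro divide_left_mono mult_pos_pos) auto
      then have "(cmod (szego R ?c ?w (cis t)))\<^sup>2 \<le> (cmod (Y t) / (1 - (1/2)^R))\<^sup>2" by (rule power_mono) simp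
      then have "W t * (cmod (szego R ?c ?w (cis t)))\<^sup>2 \<le> W t * (cmod (Y t) / (1 - (1/2)^R))\<^sup>2" using W by (rule mult_left_mono)
      then show "W t * (cmod (szego R ?c ?w (cis t)))\<^sup>2 \<le> W t * (cmod (Y t))\<^sup>2 / (1 - (1/2)^R)\<^sup>2" by (simp add: power_divide)
    qed
    also have "(LINT t|circ. W t * (cmod (Y t))\<^sup>2 / (1 - (1/2)^R)\<^sup>2) = J / (1 - (1/2)^R)\<^sup>2"
      unfolding J_def by (rule integral_divide_zero)
    finally show ?thesis .
  qed
  have Slim: "S \<longlonglongrightarrow> (\<Sum>n<L. cnj (y n) * taylor f n)"
  proof -
    have e: "S R = (\<Sum>n<L. cnj (y n) * 2^n * ((\<Sum>i<R. (cnj (unity_root R) ^ n) ^ i * f (unity_root R ^ i / 2)) / of_nat R))" for R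
    proof -
      have "S R = (\<Sum>i<R. \<Sum>n<L. cnj (y n) * 2^n * ((cnj (unity_root R) ^ n) ^ i * f (unity_root R ^ i / 2)) / of_nat R)"
        unfolding S_def by (intro sum.cong refl) (simp add: sum_distrib_left sum_distrib_right sum_divide_distrib mult_ac)
      also have "\<dots> = (\<Sum>n<L. \<Sum>i<R. cnj (y n) * 2^n * ((cnj (unity_root R) ^ n) ^ i * f (unity_root R ^ i / 2)) / of_nat R)" by (rule sum.swap)
      finally show ?thesis by (simp add: sum_distrib_left sum_divide_distrib)
    qed
    have l: "(\<lambda>R. \<Sum>n<L. cnj (y n) * 2^n * ((\<Sum>i<R. (cnj (unity_root R) ^ n) ^ i * f (unity_root R ^ i / 2)) / of_nat R))
        \<longlonglongrightarrow> (\<Sum>n<L. cnj (y n) * 2^n * (taylor f n / 2^n))"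
      by (intro tendsto_intros polygon_average_limit hol)
    have "(\<Sum>n<L. cnj (y n) * 2^n * (taylor f n / 2^n)) = (\<Sum>n<L. cnj (y n) * taylor f n)" by simp
    with l show ?thesis using ext[of S, OF e] by (simp only:)
  qed
  have "(\<lambda>R. C * (J / (1 - (1/2)^R)\<^sup>2)) \<longlonglongrightarrow> C * (J / (1 - 0)\<^sup>2)"
    by (intro tendsto_intros LIMSEQ_power_zero) auto
  then have u: "(\<lambda>R. C * (J / (1 - (1/2)^R)\<^sup>2)) \<longlonglongrightarrow> C * J" by simp
  have l: "(\<lambda>R. (cmod (S R))\<^sup>2) \<longlonglongrightarrow> (cmod (\<Sum>n<L. cnj (y n) * taylor f n))\<^sup>2" by (intro tendsto_intros Slim)
  show ?thesis
    unfolding J_def[symmetric] Y_def[symmetric] by (rule LIMSEQ_le[OF l u]) (use SR in \<open>auto intro!: exI[of _ "Suc L"]\<close>)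
qed

text \<open>Testing against the Taylor polynomial of \<open>f\<close> itself gives
  \<open>s^2 \<le> 2 * pi * C * s\<close> for the partial square sum \<open>s\<close>, a bound that
  does not depend on the degree.\<close>

lemma szego_bounded_Hardy2:
  assumes f: "szego_bounded (\<lambda>_. 1) C f" and C: "0 \<le> C"
  shows "f \<in> Hardy2"
proof -
  have hol: "f holomorphic_on ball 0 1" by (rule szego_bounded_holomorphic[OF f _ _ _ C]) auto
  show ?thesis
  proof (rule Hardy2I[OF hol])
    fix N
    define s where "s = (\<Sum>n<N. (cmod (taylor f n))\<^sup>2)"
    have s0: "0 \<le> s" by (simp add: s_def sum_nonneg)
    have "(\<Sum>n<N. cnj (taylor f n) * taylor f n) = of_real s"
      unfolding s_def of_real_sum complex_norm_square by (simp add: mult.commute)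
    then have sq: "s\<^sup>2 \<le> C * (2*pi * s)"
      using szego_bounded_polynomials[OF f hol _ _ C, of "taylor f" N] s0
      by (simp add: circ_finite_Parseval s_def[symmetric] norm_power)
    have "s \<le> 2*pi * C" using s0 C
  proof (cases "s = 0")
    case False
    then have "0 < s" using s0 by simp
    moreover have "s * s \<le> (2*pi * C) * s" using \<open>s\<^sup>2 \<le> C * (2*pi * s)\<close> by (simp add: power2_eq_square mult_ac)
    ultimately show ?thesis by (simp only: mult_le_cancel_right_pos)
  qed simp
    then show "(\<Sum>n<N. (cmod (taylor f n))\<^sup>2) \<le> 2*pi * C" by (simp only: s_def)
  qed
qed

text \<open>The polynomial with coefficients \<open>y n * cnj \<zeta> ^ n\<close> vanishes at
  \<open>\<zeta>\<close>, because the mean \<open>m\<close> has been subtracted, and so it is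
  divisible by \<open>z - \<zeta>\<close>; the tail sums \<open>\<xi>\<close> give the coefficients
  of the quotient, up to a factor of modulus 1 on the circle. Summation by parts turns the pairing
  of \<open>f\<close> with this quotient into \<open>s\<close>, and its weighted square norm is
  \<open>2 * pi * s\<close>; hence \<open>s^2 \<le> 2 * pi * C * s\<close>.\<close>

lemma szego_bounded_local_Dirichlet:
  assumes \<zeta>: "cmod \<zeta> = 1" and f: "szego_bounded (\<lambda>t. (cmod (cis t - \<zeta>))\<^sup>2) C f" and C: "0 \<le> C"
    and hol: "f holomorphic_on ball 0 1"
  defines "\<phi> \<equiv> \<lambda>k. taylor f k * \<zeta>^k"
  shows "(\<Sum>n\<le>M. (cmod (psum \<phi> n - (\<Sum>k\<le>M. psum \<phi> k) / (of_nat M + 1)))\<^sup>2) \<le> 2*pi * C"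
proof -
  define m where "m = (\<Sum>k\<le>M. psum \<phi> k) / (of_nat M + 1)"
  define y where "y j = psum \<phi> j - m" for j
  define s where "s = (\<Sum>j\<le>M. (cmod (y j))\<^sup>2)"
  have M1: "(of_nat M + 1 :: complex) \<noteq> 0" by (metis of_nat_Suc of_nat_eq_0_iff nat.distinct(1) add.commute)
  have ysum: "(\<Sum>j\<le>M. y j) = 0" using M1 by (simp add: y_def m_def sum_subtractf add.commute)
  define \<xi> where "\<xi> n = (\<Sum>j=n..M. y j)" for n
  have \<xi>0: "\<xi> 0 = 0" using ysum by (simp add: \<xi>_def atMost_atLeast0)
  have \<xi>M: "\<xi> (Suc M) = 0" by (simp add: \<xi>_def)
  have \<xi>S: "\<xi> n = y n + \<xi> (Suc n)" if "n \<le> M" for n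
    unfolding \<xi>_def using that by (rule sum.atLeast_Suc_atMost)
  have un: "cnj \<zeta> * \<zeta> = 1" using \<zeta> by (simp add: mult.commute flip: complex_norm_square)
  have s0: "0 \<le> s" by (simp add: s_def sum_nonneg)
  have lhs: "(\<Sum>n<Suc M. cnj (\<xi> n * cnj \<zeta> ^ n) * taylor f n) = of_real s"
  proof -
    \<comment> \<open>Summation by parts; the boundary term vanishes at \<open>k = M\<close> since
      \<open>\<xi> (Suc M) = 0\<close>.\<close>
    have ab: "(\<Sum>n\<le>k. cnj (\<xi> n) * \<phi> n) = (\<Sum>j\<le>k. psum \<phi> j * cnj (y j)) + psum \<phi> k * cnj (\<xi> (Suc k))" if "k \<le> M" for k
      using that
    proof (induction k)
      case 0
      then show ?case using \<xi>S[of 0] by (simp add: psum_def algebra_simps)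
    next
      case (Suc k)
      have p: "psum \<phi> (Suc k) = psum \<phi> k + \<phi> (Suc k)" by (simp add: psum_def)
      have "\<xi> (Suc k) = y (Suc k) + \<xi> (Suc (Suc k))" by (rule \<xi>S[OF Suc.prems])
      then show ?case using Suc by (simp add: p algebra_simps)
    qed
    have "(\<Sum>n<Suc M. cnj (\<xi> n * cnj \<zeta> ^ n) * taylor f n) = (\<Sum>n\<le>M. cnj (\<xi> n) * \<phi> n)"
      by (simp add: \<phi>_def mult_ac lessThan_Suc_atMost)
    also have "\<dots> = (\<Sum>j\<le>M. psum \<phi> j * cnj (y j))" using ab[of M] by (simp add: \<xi>M)
    also have "\<dots> = (\<Sum>j\<le>M. y j * cnj (y j)) + m * cnj (\<Sum>j\<le>M. y j)"
      by (simp add: y_def sum_distrib_left algebra_simps flip: sum.distrib)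
    also have "\<dots> = of_real s" unfolding ysum s_def of_real_sum complex_norm_square by simp
    finally show ?thesis .
  qed
  have rhs: "(LINT t|circ. (cmod (cis t - \<zeta>))\<^sup>2 * (cmod (\<Sum>n<Suc M. \<xi> n * cnj \<zeta> ^ n * cis t ^ n))\<^sup>2) = 2*pi * s"
  proof -
    have "(cmod (cis t - \<zeta>))\<^sup>2 * (cmod (\<Sum>n<Suc M. \<xi> n * cnj \<zeta> ^ n * cis t ^ n))\<^sup>2 = (cmod (\<Sum>n<Suc M. (y n * cnj \<zeta> ^ n) * cis t ^ n))\<^sup>2" for t
    proof -
      define u where "u = cnj \<zeta> * cis t"
      have nu: "cmod u = 1" using \<zeta> by (simp add: u_def norm_mult)
      have tel: "(u - 1) * (\<Sum>n<k. \<xi> n * u^n) = u * (\<Sum>n<k. y n * u^n) + \<xi> k * u^k" if "k \<le> Suc M" for k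
        using that
      proof (induction k)
        case 0
        then show ?case by (simp add: \<xi>0)
      next
        case (Suc k)
        have "\<xi> k = y k + \<xi> (Suc k)" using Suc.prems by (intro \<xi>S) simp
        then show ?case using Suc by (simp add: algebra_simps)
      qed
      have "cmod (cis t - \<zeta>) * cmod (\<Sum>n<Suc M. \<xi> n * u^n) = cmod ((u - 1) * (\<Sum>n<Suc M. \<xi> n * u^n))"
        using norm_cnj_unit_minus[OF \<zeta>, of "cis t"] by (simp add: norm_mult u_def norm_minus_commute)
      also have "\<dots> = cmod (\<Sum>n<Suc M. y n * u^n)" using tel[of "Suc M"] nu by (simp add: \<xi>M norm_mult del: sum.lessThan_Suc)
      finally have "(cmod (cis t - \<zeta>) * cmod (\<Sum>n<Suc M. \<xi> n * u^n))\<^sup>2 = (cmod (\<Sum>n<Suc M. y n * u^n))\<^sup>2" by simp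
      then show ?thesis by (simp add: u_def power_mult_distrib mult.assoc del: sum.lessThan_Suc)
    qed
    then have "(LINT t|circ. (cmod (cis t - \<zeta>))\<^sup>2 * (cmod (\<Sum>n<Suc M. \<xi> n * cnj \<zeta> ^ n * cis t ^ n))\<^sup>2) = 2*pi * (\<Sum>n<Suc M. (cmod (y n * cnj \<zeta> ^ n))\<^sup>2)"
      by (simp only: circ_finite_Parseval)
    also have "(\<Sum>n<Suc M. (cmod (y n * cnj \<zeta> ^ n))\<^sup>2) = s"
      using \<zeta> by (simp add: s_def norm_mult norm_power lessThan_Suc_atMost del: sum.lessThan_Suc)
    finally show ?thesis .
  qed
  have "(cmod (\<Sum>n<Suc M. cnj (\<xi> n * cnj \<zeta> ^ n) * taylor f n))\<^sup>2 \<le> C * (LINT t|circ. (cmod (cis t - \<zeta>))\<^sup>2 * (cmod (\<Sum>n<Suc M. \<xi> n * cnj \<zeta> ^ n * cis t ^ n))\<^sup>2)"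
    by (rule szego_bounded_polynomials[OF f hol _ _ C]) (auto intro!: continuous_intros)
  then have sq: "s\<^sup>2 \<le> C * (2*pi * s)" unfolding lhs rhs using s0 by (simp add: norm_power)
  have "s \<le> 2*pi * C" using s0 C
  proof (cases "s = 0")
    case False
    then have "0 < s" using s0 by simp
    moreover have "s * s \<le> (2*pi * C) * s" using \<open>s\<^sup>2 \<le> C * (2*pi * s)\<close> by (simp add: power2_eq_square mult_ac)
    ultimately show ?thesis by (simp only: mult_le_cancel_right_pos)
  qed simp
  then show ?thesis by (simp add: s_def y_def m_def)
qed

section \<open>Membership in the Hardy space and in the Dirichlet space\<close>

lemma Hb_gram_bound:
  assumes f: "f \<in> Hb b" and b: "b \<in> Hinf_ball"
  obtains C where "0 \<le> C" "\<And>n c w. \<forall>i<n. w i \<in> ball 0 1 \<Longrightarrow> (cmod (\<Sum>i<n. cnj (c i) * f (w i)))\<^sup>2 \<le> C * gram (kb b) n c w"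
proof -
  obtain C where C: "\<And>n w c. \<forall>i<n. w i \<in> ball 0 1 \<Longrightarrow> (cmod (\<Sum>i<n. cnj (c i) * f (w i)))\<^sup>2 \<le> C * gram (kb b) n c w"
    using f unfolding Hb_def gram_def[symmetric] by blast
  interpret disk_kernel "kb b" by (rule kb_disk_kernel[OF b])
  show ?thesis
  \<comment> \<open>The sign of the constant in \<open>Hb\<close> is not prescribed; as the Gram
    form is nonnegative, the absolute value may replace it.\<close>
  proof (rule that[of "\<bar>C\<bar>"])
    fix n :: nat and c w :: "nat \<Rightarrow> complex" assume w: "\<forall>i<n. w i \<in> ball 0 1"
    have "C * gram (kb b) n c w \<le> \<bar>C\<bar> * gram (kb b) n c w" using psd[of n w c] w by (intro mult_right_mono) auto
    then show "(cmod (\<Sum>i<n. cnj (c i) * f (w i)))\<^sup>2 \<le> \<bar>C\<bar> * gram (kb b) n c w" using C[OF w, of c] by linarith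
  qed simp
qed

text \<open>By \<open>kb_gram\<close> the Gram form is at most the normalised squared norm of the
  Szego combination, that is, \<open>H(b)\<close> sits contractively in the Hardy space.\<close>

theorem Hb_subset_Hardy2:
  assumes b: "b \<in> Hinf_ball" shows "Hb b \<subseteq> Hardy2"
proof
  fix f assume "f \<in> Hb b"
  then obtain C where C: "0 \<le> C" "\<And>n c w. \<forall>i<n. w i \<in> ball 0 1 \<Longrightarrow> (cmod (\<Sum>i<n. cnj (c i) * f (w i)))\<^sup>2 \<le> C * gram (kb b) n c w"
    using Hb_gram_bound[OF _ b] by metis
  have "szego_bounded (\<lambda>_. 1) (C / (2*pi)) f"
    unfolding szego_bounded_def
  proof (intro allI impI)
    fix n :: nat and c w :: "nat \<Rightarrow> complex" assume w: "\<forall>i<n. w i \<in> ball 0 1"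
    have "2*pi * gram (kb b) n c w \<le> (LINT t|circ. (cmod (szego n c w (cis t)))\<^sup>2)"
      unfolding gram_def kb_gram[OF w] by (simp add: integral_nonneg_AE)
    then have "gram (kb b) n c w \<le> (LINT t|circ. (cmod (szego n c w (cis t)))\<^sup>2) / (2*pi)" by (simp add: field_simps)
    then have "C * gram (kb b) n c w \<le> C * ((LINT t|circ. (cmod (szego n c w (cis t)))\<^sup>2) / (2*pi))" using C(1) by (rule mult_left_mono)
    then show "(cmod (\<Sum>i<n. cnj (c i) * f (w i)))\<^sup>2 \<le> C / (2*pi) * (LINT t|circ. 1 * (cmod (szego n c w (cis t)))\<^sup>2)"
      using C(2)[OF w, of c] by simp
  qed
  then show "f \<in> Hardy2" by (rule szego_bounded_Hardy2) (use C(1) in simp)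
qed

text \<open>The bound that defines \<open>Hb\<close> and the Gram estimate are combined at each
  point separately. The constants may differ from point to point, since the Dirichlet integral is
  additive over the finitely many atoms.\<close>

theorem Hb_subset_Dmu:
  assumes b: "b \<in> Hinf_ball" and a: "a \<in> Hinf"
    and ab: "AE t in circ. (cmod (bval a t))\<^sup>2 + (cmod (bval b t))\<^sup>2 = 1"
    and A: "finite A" "\<And>\<zeta>. \<zeta> \<in> A \<Longrightarrow> cmod \<zeta> = 1"
    and aM: "\<And>\<zeta>. \<zeta> \<in> A \<Longrightarrow> \<exists>M. \<forall>z\<in>ball 0 1. cmod (a z) \<le> M * cmod (z - \<zeta>)"
    and spec: "\<And>\<zeta>. \<zeta> \<in> A \<Longrightarrow> \<zeta> \<notin> spectrum_b b"
  shows "Hb b \<subseteq> Dmu (count_space A)"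
proof
  fix f assume f: "f \<in> Hb b"
  then have H2: "f \<in> Hardy2" using Hb_subset_Hardy2[OF b] by blast
  then have hol: "f holomorphic_on ball 0 1" by (simp add: Hardy2_def)
  obtain C where C: "0 \<le> C" "\<And>n c w. \<forall>i<n. w i \<in> ball 0 1 \<Longrightarrow> (cmod (\<Sum>i<n. cnj (c i) * f (w i)))\<^sup>2 \<le> C * gram (kb b) n c w"
    using Hb_gram_bound[OF f b] by metis
  show "f \<in> Dmu (count_space A)"
  proof (rule DmuI[OF H2 A])
    fix \<zeta> assume \<zeta>A: "\<zeta> \<in> A"
    note \<zeta> = A(2)[OF \<zeta>A]
    obtain M where M: "\<And>z. z \<in> ball 0 1 \<Longrightarrow> cmod (a z) \<le> M * cmod (z - \<zeta>)" using aM[OF \<zeta>A] by blast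
    obtain D where D: "\<And>n c w. \<forall>i<n. w i \<in> ball 0 1 \<Longrightarrow>
        gram (kb b) n c w \<le> D * (LINT t|circ. (cmod (cis t - \<zeta>))\<^sup>2 * (cmod (szego n c w (cis t)))\<^sup>2)"
      using gram_estimate[OF b a ab \<zeta> M spec[OF \<zeta>A]] by blast
    have "szego_bounded (\<lambda>t. (cmod (cis t - \<zeta>))\<^sup>2) (C * \<bar>D\<bar>) f"
      unfolding szego_bounded_def
    proof (intro allI impI)
      fix n :: nat and c w :: "nat \<Rightarrow> complex" assume w: "\<forall>i<n. w i \<in> ball 0 1"
      define I where "I = (LINT t|circ. (cmod (cis t - \<zeta>))\<^sup>2 * (cmod (szego n c w (cis t)))\<^sup>2)"
      have I0: "0 \<le> I" by (simp add: I_def integral_nonneg_AE)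
      have "gram (kb b) n c w \<le> \<bar>D\<bar> * I"
        using D[OF w, of c] mult_right_mono[OF abs_ge_self[of D] I0] unfolding I_def[symmetric] by linarith
      then have "C * gram (kb b) n c w \<le> C * (\<bar>D\<bar> * I)" using C(1) by (rule mult_left_mono)
      then show "(cmod (\<Sum>i<n. cnj (c i) * f (w i)))\<^sup>2 \<le> C * \<bar>D\<bar> * (LINT t|circ. (cmod (cis t - \<zeta>))\<^sup>2 * (cmod (szego n c w (cis t)))\<^sup>2)"
        unfolding I_def[symmetric] using C(2)[OF w, of c] by (simp add: mult.assoc)
    qed
    from szego_bounded_local_Dirichlet[OF \<zeta> this _ hol] C(1)
    show "\<exists>C. \<forall>M. (\<Sum>n\<le>M. (cmod (psum (\<lambda>k. taylor f k * \<zeta>^k) n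
        - (\<Sum>k\<le>M. psum (\<lambda>k. taylor f k * \<zeta>^k) k) / (of_nat M + 1)))\<^sup>2) \<le> C" by auto
  qed
qed

section \<open>Equivalence of the conditions\<close>

lemma potential_mu_count_space:
  "finite A \<Longrightarrow> potential_mu (count_space A) z = (\<Sum>x\<in>A. ennreal (1 / (cmod (x - z))\<^sup>2))"
  unfolding potential_mu_def by (simp add: nn_integral_count_space_finite)

lemma potential_bound_iff:
  assumes A: "finite A" "\<And>x. x \<in> A \<Longrightarrow> cmod x = 1"
  shows "(SUP z\<in>ball 0 1. ennreal ((cmod (a z))\<^sup>2) * potential_mu (count_space A) z) < \<infinity>
    \<longleftrightarrow> (\<forall>x\<in>A. \<exists>M. \<forall>z\<in>ball 0 1. cmod (a z) \<le> M * cmod (z - x))" (is "?S < \<infinity> \<longleftrightarrow> ?R")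
proof
  assume fin: "?S < \<infinity>"
  then obtain K where K: "0 \<le> K" "?S = ennreal K" by (cases ?S) auto
  show ?R
  proof
    fix x assume x: "x \<in> A"
    have "cmod (a z) \<le> sqrt K * cmod (z - x)" if z: "z \<in> ball 0 1" for z
    proof -
      have pos: "0 < cmod (z - x)" using A(2)[OF x] z by auto
      have "ennreal ((cmod (a z))\<^sup>2 * (1 / (cmod (x - z))\<^sup>2)) = ennreal ((cmod (a z))\<^sup>2) * ennreal (1 / (cmod (x - z))\<^sup>2)"
        by (rule ennreal_mult) auto
      also have "\<dots> \<le> ennreal ((cmod (a z))\<^sup>2) * potential_mu (count_space A) z"
        unfolding potential_mu_count_space[OF A(1)] using A(1) x by (intro mult_left_mono member_le_sum) auto
      also have "\<dots> \<le> ?S" using z by (rule SUP_upper)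
      finally have "(cmod (a z))\<^sup>2 * (1 / (cmod (x - z))\<^sup>2) \<le> K" using K by (simp add: ennreal_le_iff)
      then have "(cmod (a z))\<^sup>2 \<le> K * (cmod (z - x))\<^sup>2" using pos by (simp add: field_simps norm_minus_commute)
      then have "cmod (a z) \<le> sqrt (K * (cmod (z - x))\<^sup>2)" by (rule real_le_rsqrt)
      then show ?thesis by (simp add: real_sqrt_mult)
    qed
    then show "\<exists>M. \<forall>z\<in>ball 0 1. cmod (a z) \<le> M * cmod (z - x)" by blast
  qed
next
  assume ?R
  then obtain M where M: "\<And>x z. x \<in> A \<Longrightarrow> z \<in> ball 0 1 \<Longrightarrow> cmod (a z) \<le> M x * cmod (z - x)" by metis
  have "?S \<le> (\<Sum>x\<in>A. ennreal ((M x)\<^sup>2))"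
  proof (rule SUP_least)
    fix z :: complex assume z: "z \<in> ball 0 1"
    show "ennreal ((cmod (a z))\<^sup>2) * potential_mu (count_space A) z \<le> (\<Sum>x\<in>A. ennreal ((M x)\<^sup>2))"
      unfolding potential_mu_count_space[OF A(1)] sum_distrib_left
    proof (rule sum_mono)
      fix x assume x: "x \<in> A"
      have pos: "0 < cmod (z - x)" using A(2)[OF x] z by auto
      have "(cmod (a z))\<^sup>2 \<le> (M x * cmod (z - x))\<^sup>2" by (rule power_mono[OF M[OF x z]]) simp
      then have "(cmod (a z))\<^sup>2 * (1 / (cmod (x - z))\<^sup>2) \<le> (M x)\<^sup>2"
        using pos by (simp add: power_mult_distrib field_simps norm_minus_commute)
      then show "ennreal ((cmod (a z))\<^sup>2) * ennreal (1 / (cmod (x - z))\<^sup>2) \<le> ennreal ((M x)\<^sup>2)"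
        by (simp add: ennreal_leI flip: ennreal_mult)
    qed
  qed
  also have "\<dots> < \<infinity>" by (simp add: less_top[symmetric])
  finally show "?S < \<infinity>" .
qed

text \<open>Induction over the points. Near the new point \<open>x\<close> the other factors stay
  away from 0, as the points are distinct, and the bound at \<open>x\<close> applies; elsewhere
  \<open>|z - x| \<ge> \<epsilon>\<close>, and the bound for the other points applies.\<close>

lemma bound_by_product:
  assumes "finite A" and a: "\<And>z. z \<in> ball 0 1 \<Longrightarrow> cmod (a z) \<le> B"
    and M: "\<And>x. x \<in> A \<Longrightarrow> \<exists>M. \<forall>z\<in>ball 0 1. cmod (a z) \<le> M * cmod (z - x)"
  shows "\<exists>C\<ge>0. \<forall>z\<in>ball 0 1. cmod (a z) \<le> C * (\<Prod>x\<in>A. cmod (z - x))"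
  using assms(1) M
proof (induction A)
  case empty
  have "0 \<le> B" by (rule order_trans[OF norm_ge_zero a[of 0]]) simp
  then show ?case using a by auto
next
  case (insert x A)
  obtain C where C: "0 \<le> C" "\<And>z. z \<in> ball 0 1 \<Longrightarrow> cmod (a z) \<le> C * (\<Prod>y\<in>A. cmod (z - y))" using insert by auto
  obtain M where M: "\<And>z. z \<in> ball 0 1 \<Longrightarrow> cmod (a z) \<le> M * cmod (z - x)" using insert.prems by blast
  define p where "p z = (\<Prod>y\<in>A. cmod (z - y))" for z
  have p0: "0 \<le> p z" for z by (simp add: p_def prod_nonneg)
  have px: "0 < p x" using insert.hyps by (auto simp: p_def intro!: prod_pos)
  have "isCont p x" unfolding p_def by (intro continuous_intros)
  then have "(p \<longlongrightarrow> p x) (nhds x)" by (simp add: continuous_at tendsto_at_iff_tendsto_nhds)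
  then have "\<forall>\<^sub>F z in nhds x. p x / 2 < p z" by (rule order_tendstoD(1)) (use px in simp)
  then obtain \<epsilon> where \<epsilon>: "0 < \<epsilon>" "\<And>z. dist z x < \<epsilon> \<Longrightarrow> p x / 2 < p z" unfolding eventually_nhds_metric by blast
  define C' where "C' = max (\<bar>M\<bar> / (p x / 2)) (C / \<epsilon>)"
  have "cmod (a z) \<le> C' * (cmod (z - x) * p z)" if z: "z \<in> ball 0 1" for z
  proof (cases "dist z x < \<epsilon>")
    case True
    have "cmod (a z) \<le> \<bar>M\<bar> * cmod (z - x)" using M[OF z] mult_right_mono[OF abs_ge_self[of M], of "cmod (z - x)"] by simp
    also have "\<dots> = \<bar>M\<bar> / (p x / 2) * (cmod (z - x) * (p x / 2))" using px by simp
    also have "\<dots> \<le> C' * (cmod (z - x) * p z)"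
      using \<epsilon>(2)[OF True] px by (intro mult_mono) (auto simp: C'_def le_max_iff_disj)
    finally show ?thesis .
  next
    case False
    have "cmod (a z) \<le> C * p z" using C(2)[OF z] by (simp add: p_def)
    also have "\<dots> = C / \<epsilon> * (\<epsilon> * p z)" using \<epsilon>(1) by simp
    also have "\<dots> \<le> C' * (cmod (z - x) * p z)"
      using False \<epsilon>(1) C(1) p0[of z] by (intro mult_mono) (auto simp: C'_def dist_norm le_max_iff_disj)
    finally show ?thesis .
  qed
  moreover have "0 \<le> C'" using C(1) \<epsilon>(1) by (simp add: C'_def le_max_iff_disj)
  ultimately show ?case using insert.hyps by (auto simp: p_def intro!: exI[of _ C'])
qed

text \<open>The only candidate for \<open>g\<close> is the quotient, since the product has no zero
  in the disk, and \<open>bound_by_product\<close> bounds it. Conversely, all factors except the one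
  at the given point are at most 2.\<close>

lemma product_factor_iff:
  fixes \<zeta> :: "nat \<Rightarrow> complex"
  assumes inj: "inj_on \<zeta> {..<N}" and \<zeta>: "\<And>j. j < N \<Longrightarrow> cmod (\<zeta> j) = 1" and a: "a \<in> Hinf"
  shows "(\<exists>g\<in>Hinf. \<forall>z\<in>ball 0 1. a z = (\<Prod>j<N. z - \<zeta> j) * g z)
    \<longleftrightarrow> (\<forall>x\<in>\<zeta> ` {..<N}. \<exists>M. \<forall>z\<in>ball 0 1. cmod (a z) \<le> M * cmod (z - x))" (is "?L \<longleftrightarrow> ?R")
proof
  assume ?L
  then obtain g where g: "g \<in> Hinf" "\<And>z. z \<in> ball 0 1 \<Longrightarrow> a z = (\<Prod>j<N. z - \<zeta> j) * g z" by blast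
  obtain B where B: "0 \<le> B" "\<And>z. z \<in> ball 0 1 \<Longrightarrow> cmod (g z) \<le> B" using Hinf_bound[OF g(1)] by metis
  show ?R
  proof
    fix x assume "x \<in> \<zeta> ` {..<N}"
    then obtain j where j: "j < N" "x = \<zeta> j" by auto
    have "cmod (a z) \<le> (2^N * B) * cmod (z - x)" if z: "z \<in> ball 0 1" for z
    proof -
      have "(\<Prod>i\<in>{..<N} - {j}. cmod (z - \<zeta> i)) \<le> (\<Prod>i\<in>{..<N} - {j}. 2)"
      proof (rule prod_mono, intro conjI)
        fix i assume "i \<in> {..<N} - {j}"
        then show "cmod (z - \<zeta> i) \<le> 2" using norm_triangle_ineq4[of z "\<zeta> i"] \<zeta>[of i] z by simp
      qed simp
      also have "\<dots> \<le> 2^N" using j by simp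
      finally have p: "(\<Prod>i\<in>{..<N} - {j}. cmod (z - \<zeta> i)) \<le> 2^N" .
      have "cmod (a z) = cmod (z - x) * (\<Prod>i\<in>{..<N} - {j}. cmod (z - \<zeta> i)) * cmod (g z)"
        using g(2)[OF z] j by (simp add: norm_mult prod_norm prod.remove[of "{..<N}" j])
      also have "\<dots> \<le> cmod (z - x) * 2^N * B"
        using p B(2)[OF z] by (intro mult_mono) (auto intro: prod_nonneg)
      finally show ?thesis by (simp add: mult_ac)
    qed
    then show "\<exists>M. \<forall>z\<in>ball 0 1. cmod (a z) \<le> M * cmod (z - x)" by blast
  qed
next
  assume R: ?R
  obtain B where "\<And>z. z \<in> ball 0 1 \<Longrightarrow> cmod (a z) \<le> B" using Hinf_bound[OF a] by metis
  then have "\<exists>C\<ge>0. \<forall>z\<in>ball 0 1. cmod (a z) \<le> C * (\<Prod>x\<in>\<zeta> ` {..<N}. cmod (z - x))"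
    by (rule bound_by_product[rotated]) (simp_all only: R[rule_format] finite_imageI finite_lessThan)
  then obtain C where C: "\<And>z. z \<in> ball 0 1 \<Longrightarrow> cmod (a z) \<le> C * (\<Prod>x\<in>\<zeta> ` {..<N}. cmod (z - x))" by metis
  have pr: "(\<Prod>x\<in>\<zeta> ` {..<N}. cmod (z - x)) = cmod (\<Prod>j<N. z - \<zeta> j)" for z
    using prod.reindex[OF inj, of "\<lambda>x. cmod (z - x)"] by (simp add: prod_norm)
  have nz: "(\<Prod>j<N. z - \<zeta> j) \<noteq> 0" if "z \<in> ball 0 1" for z
    unfolding prod_zero_iff[OF finite_lessThan] using \<zeta> that by fastforce
  show ?L
  proof (intro bexI[where x="\<lambda>z. a z / (\<Prod>j<N. z - \<zeta> j)"] ballI)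
    show "(\<lambda>z. a z / (\<Prod>j<N. z - \<zeta> j)) \<in> Hinf"
    proof (rule HinfI)
      show "(\<lambda>z. a z / (\<Prod>j<N. z - \<zeta> j)) holomorphic_on ball 0 1"
        using nz by (intro holomorphic_intros Hinf_holomorphic[OF a]) auto
      show "cmod (a z / (\<Prod>j<N. z - \<zeta> j)) \<le> C" if "z \<in> ball 0 1" for z
        using C[OF that] nz[OF that] unfolding pr norm_divide by (simp add: pos_divide_le_eq)
    qed
  qed (use nz in auto)
qed

theorem theoremA:
  fixes b a :: "complex \<Rightarrow> complex" and \<zeta> :: "nat \<Rightarrow> complex" and N :: nat
  assumes "non_extreme b"
    and "Hinf_norm b = 1"
    and "pythagorean_mate b a"
    and "inj_on \<zeta> {..<N}"
    and "\<forall>j<N. \<zeta> j \<in> sphere 0 1"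
  defines "\<mu> \<equiv> count_space (\<zeta> ` {..<N})"
  shows "(Hb b \<subseteq> Dmu \<mu>
          \<longleftrightarrow> ((\<forall>j<N. \<zeta> j \<notin> spectrum_b b) \<and>
               (SUP z\<in>ball 0 1. ennreal ((cmod (a z))\<^sup>2) * potential_mu \<mu> z) < \<infinity>))
       \<and> (Hb b \<subseteq> Dmu \<mu>
          \<longleftrightarrow> ((\<forall>j<N. \<zeta> j \<notin> spectrum_b b) \<and>
               (\<exists>g\<in>Hinf. \<forall>z\<in>ball 0 1. a z = (\<Prod>j<N. z - \<zeta> j) * g z)))"
proof -
  define A where "A = \<zeta> ` {..<N}"
  have A: "finite A" "\<And>x. x \<in> A \<Longrightarrow> cmod x = 1" using assms(5) by (auto simp: A_def)
  have b: "b \<in> Hinf_ball" using assms(1) by (simp add: non_extreme_def)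
  have oa: "outer a" and ab0: "AE t in circ. (cmod (bdry a t))\<^sup>2 + (cmod (bdry b t))\<^sup>2 = 1"
    using assms(3) unfolding pythagorean_mate_def AE_circ_iff by auto
  have "AE t in circ. cmod (bdry a t) \<le> 1"
    using ab0
  proof eventually_elim
    case (elim t)
    have "(cmod (bdry a t))\<^sup>2 \<le> 1" using elim zero_le_power2[of "cmod (bdry b t)"] by linarith
    then show ?case by (simp add: abs_square_le_1)
  qed
  \<comment> \<open>The mate is given with boundary values of modulus at most 1 only; this is where
    outerness makes it bounded in the disk.\<close>
  from outer_bounded_of_boundary_bound(1)[OF oa this] have a: "a \<in> Hinf" .
  have ab: "AE t in circ. (cmod (bval a t))\<^sup>2 + (cmod (bval b t))\<^sup>2 = 1"
    using ab0 Hinf_bdry_eq_bval[OF a] Hinf_bdry_eq_bval[OF Hinf_ball_Hinf[OF b]] by eventually_elim simp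
  have spec: "(\<forall>j<N. \<zeta> j \<notin> spectrum_b b) \<longleftrightarrow> (\<forall>x\<in>A. x \<notin> spectrum_b b)" by (auto simp: A_def)
  have main: "Hb b \<subseteq> Dmu \<mu> \<longleftrightarrow> (\<forall>x\<in>A. x \<notin> spectrum_b b) \<and> (\<forall>x\<in>A. \<exists>M. \<forall>z\<in>ball 0 1. cmod (a z) \<le> M * cmod (z - x))"
  proof
    assume sub: "Hb b \<subseteq> Dmu \<mu>"
    have gr: "\<exists>c B. 0 \<le> B \<and> (\<forall>z. cmod z < 1 \<longrightarrow> cmod (f z - c) \<le> B * (cmod (z - x) / sqrt (1 - (cmod z)\<^sup>2)))"
      if "x \<in> A" "f \<in> Hb b" for x f
    proof -
      have "f \<in> Dmu (count_space A)" using sub that(2) unfolding \<mu>_def A_def by blast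
      from Dmu_growth[OF this A(1) that(1) A(2)[OF that(1)]] show ?thesis by metis
    qed
    show "(\<forall>x\<in>A. x \<notin> spectrum_b b) \<and> (\<forall>x\<in>A. \<exists>M. \<forall>z\<in>ball 0 1. cmod (a z) \<le> M * cmod (z - x))"
      using not_in_spectrum_of_growth[OF b A(2) gr] mate_vanishes_of_growth[OF b a ab A(2) gr] by blast
  next
    assume "(\<forall>x\<in>A. x \<notin> spectrum_b b) \<and> (\<forall>x\<in>A. \<exists>M. \<forall>z\<in>ball 0 1. cmod (a z) \<le> M * cmod (z - x))"
    then show "Hb b \<subseteq> Dmu \<mu>"
      unfolding \<mu>_def A_def[symmetric] by (intro Hb_subset_Dmu[OF b a ab A]) auto
  qed
  have B: "(SUP z\<in>ball 0 1. ennreal ((cmod (a z))\<^sup>2) * potential_mu \<mu> z) < \<infinity>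
      \<longleftrightarrow> (\<forall>x\<in>A. \<exists>M. \<forall>z\<in>ball 0 1. cmod (a z) \<le> M * cmod (z - x))"
    unfolding \<mu>_def A_def[symmetric] by (rule potential_bound_iff[OF A])
  have C: "(\<exists>g\<in>Hinf. \<forall>z\<in>ball 0 1. a z = (\<Prod>j<N. z - \<zeta> j) * g z)
      \<longleftrightarrow> (\<forall>x\<in>A. \<exists>M. \<forall>z\<in>ball 0 1. cmod (a z) \<le> M * cmod (z - x))"
    unfolding A_def using assms(5) by (intro product_factor_iff[OF assms(4) _ a]) auto
  show ?thesis unfolding main B C spec by blast
qed

end
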